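(* Let $(X,\mathcal{X},\mu,T)$ be an ergodic nilsystem and $f\in L^\infty(\mu)$. Then the following properties are equivalent: (i) $|||f|||_2=0$, or equivalently, $\mathbb{E}(f|\mathcal{Z}_1)=0$. (ii) For every strictly increasing sequence $a\colon\mathbb{N}\to\mathbb{N}$, we have $$\lim_{N\to\infty}\Big\|\frac1N\sum_{n=1}^NT^{a(n)}f\Big\|_{L^2(\mu)}=0.$$ (iii) For every $g\in L^\infty(\mu)$, we have $$\lim_{n\to\infty}\int g\cdot T^nf\,d\mu=0.$$
   Context: $T^nf:=f\circ T^n$. An $s$-step nilmanifold is a compact homogeneous space $X=G/\Gamma$, where $G$ is an $s$-step nilpotent Lie group and $\Gamma$ is a discrete cocompact subgroup. For $b\in G$, the system $(X,\mathcal{X},\mu,T)$, where $\mathcal X$ is the Borel $\sigma$-algebra, $\mu=m_X$ is the projection to $X$ of the Haar measure of $G$ (a probability measure) and $Tx:=bx$, is an $s$-step nilsystem; a nilsystem is an $s$-step nilsystem for some $s\in\mathbb{N}$. Gowers-Host-Kra seminorms: for $f\in L^\infty(\mu)$, $|||f|||_0:=\int f\,d\mu$ and for $s\ge 0$, $|||f|||_{s+1}^{2^{s+1}}:=\lim_{H\to\infty}\frac1H\sum_{h=1}^H|||\Delta_hf|||_s^{2^s}$, where $\Delta_hf:=f\cdot T^h\overline f$ (the limits exist). $\mathcal{Z}_1$ is the Host-Kra factor of degree $1$ of the system, i.e. the $T$-invariant sub-$\sigma$-algebra of $\mathcal X$ characterized by: $|||f|||_2=0$ if and only if $\mathbb{E}(f|\mathcal{Z}_1)=0$,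 for $f\in L^\infty(\mu)$ (for ergodic systems it is the Kronecker factor). *)

theory Defs
  imports "HOL-Probability.Probability" "HOL-Algebra.Left_Coset" "HOL-Algebra.Generated_Groups"
begin

section \<open>Smooth manifolds and Lie groups\<close>

text \<open>
  The model space is the library's Euclidean space of dimension \<open>n\<close>, consisting of the sequences
  that vanish from index \<open>n\<close> on. Unlike the type \<open>real ^ 'n\<close> it allows dimension \<open>0\<close>, and hence
  discrete groups. \<open>C_k_on k n W f\<close> says that \<open>f\<close> has continuous partial derivatives up to order
  \<open>k\<close>; it is meant for \<open>W\<close> open in \<open>Euclidean_space n\<close>, and then does not depend on the values
  of \<open>f\<close> outside \<open>W\<close>.
\<close>

primrec C_k_on :: "nat \<Rightarrow> nat \<Rightarrow> (nat \<Rightarrow> real) set \<Rightarrow> ((nat \<Rightarrow> real) \<Rightarrow> real) \<Rightarrow> bool" where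
  "C_k_on 0 n W f \<longleftrightarrow> continuous_map (subtopology (Euclidean_space n) W) euclideanreal f"
| "C_k_on (Suc k) n W f \<longleftrightarrow>
     continuous_map (subtopology (Euclidean_space n) W) euclideanreal f \<and>
     (\<forall>i<n. (\<forall>x\<in>W. (\<lambda>t. f (x(i := t))) field_differentiable at (x i)) \<and>
            C_k_on k n W (\<lambda>x. deriv (\<lambda>t. f (x(i := t))) (x i)))"

definition smooth_on :: "nat \<Rightarrow> (nat \<Rightarrow> real) set \<Rightarrow> ((nat \<Rightarrow> real) \<Rightarrow> real) \<Rightarrow> bool" where
  "smooth_on n W f \<longleftrightarrow> (\<forall>k. C_k_on k n W f)"

type_synonym 'a chart = "'a set \<times> ('a \<Rightarrow> nat \<Rightarrow> real)"

definition is_chart :: "nat \<Rightarrow> 'a topology \<Rightarrow> 'a chart \<Rightarrow> bool" where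
  "is_chart n X c \<longleftrightarrow> (case c of (U, \<phi>) \<Rightarrow>
     openin X U \<and> openin (Euclidean_space n) (\<phi> ` U) \<and>
     homeomorphic_map (subtopology X U) (subtopology (Euclidean_space n) (\<phi> ` U)) \<phi>)"

definition smooth_in_charts ::
  "nat \<Rightarrow> 'a chart set \<Rightarrow> nat \<Rightarrow> 'b chart set \<Rightarrow> ('a \<Rightarrow> 'b) \<Rightarrow> bool" where
  "smooth_in_charts n A m B f \<longleftrightarrow>
     (\<forall>(U, \<phi>)\<in>A. \<forall>(V, \<psi>)\<in>B. \<forall>j<m.
        smooth_on n (\<phi> ` (U \<inter> f -` V)) (\<lambda>u. \<psi> (f (inv_into U \<phi> u)) j))"

text \<open>For \<open>f = id\<close>, \<^const>\<open>smooth_in_charts\<close> is smoothness of the transition maps.\<close>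

definition smooth_atlas :: "nat \<Rightarrow> 'a topology \<Rightarrow> 'a chart set \<Rightarrow> bool" where
  "smooth_atlas n X A \<longleftrightarrow>
     (\<forall>c\<in>A. is_chart n X c) \<and> \<Union>(fst ` A) = topspace X \<and> smooth_in_charts n A n A id"

definition smooth_map ::
  "nat \<Rightarrow> 'a topology \<Rightarrow> 'a chart set \<Rightarrow> nat \<Rightarrow> 'b topology \<Rightarrow> 'b chart set \<Rightarrow> ('a \<Rightarrow> 'b) \<Rightarrow> bool" where
  "smooth_map n X A m Y B f \<longleftrightarrow> continuous_map X Y f \<and> smooth_in_charts n A m B f"

definition prod_atlas :: "nat \<Rightarrow> 'a chart set \<Rightarrow> 'b chart set \<Rightarrow> ('a \<times> 'b) chart set" where
  "prod_atlas n A B =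
     (\<lambda>((U, \<phi>), (V, \<psi>)). (U \<times> V, \<lambda>(x, y) i. if i < n then \<phi> x i else \<psi> y (i - n))) ` (A \<times> B)"

text \<open>
  No connectedness is required. The smooth structure enters only through its existence.
\<close>

definition lie_group :: "('g, 'r) monoid_scheme \<Rightarrow> 'g topology \<Rightarrow> bool" where
  "lie_group G \<tau> \<longleftrightarrow>
     group G \<and> topspace \<tau> = carrier G \<and> Hausdorff_space \<tau> \<and> second_countable \<tau> \<and>
     (\<exists>n A. smooth_atlas n \<tau> A \<and>
        smooth_map (n + n) (prod_topology \<tau> \<tau>) (prod_atlas n A A) n \<tau> A (\<lambda>(x, y). x \<otimes>\<^bsub>G\<^esub> y) \<and>
        smooth_map n \<tau> A n \<tau> A (\<lambda>x. inv\<^bsub>G\<^esub> x))"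


section \<open>Nilmanifolds\<close>

text \<open>With the usual indexing \<open>G\<^sub>1 = G\<close>, \<open>G\<^sub>k\<^sub>+\<^sub>1 = [G\<^sub>k, G]\<close>, \<open>lower_central G k\<close> is \<open>G\<^sub>k\<^sub>+\<^sub>1\<close>.\<close>

primrec lower_central :: "('g, 'r) monoid_scheme \<Rightarrow> nat \<Rightarrow> 'g set" where
  "lower_central G 0 = carrier G"
| "lower_central G (Suc k) = generate G
     {x \<otimes>\<^bsub>G\<^esub> y \<otimes>\<^bsub>G\<^esub> inv\<^bsub>G\<^esub> x \<otimes>\<^bsub>G\<^esub> inv\<^bsub>G\<^esub> y | x y. x \<in> lower_central G k \<and> y \<in> carrier G}"

definition nilpotent_group :: "nat \<Rightarrow> ('g, 'r) monoid_scheme \<Rightarrow> bool" where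
  "nilpotent_group s G \<longleftrightarrow> group G \<and> lower_central G s = {\<one>\<^bsub>G\<^esub>}"

text \<open>The quotient topology on the space of left cosets.\<close>

definition coset_topology :: "('g, 'r) monoid_scheme \<Rightarrow> 'g topology \<Rightarrow> 'g set \<Rightarrow> 'g set topology" where
  "coset_topology G \<tau> \<Gamma> = topology (\<lambda>U. U \<subseteq> lcosets\<^bsub>G\<^esub> \<Gamma> \<and> openin \<tau> {g \<in> topspace \<tau>. g <#\<^bsub>G\<^esub> \<Gamma> \<in> U})"

lemma openin_coset_topology:
  "openin (coset_topology G \<tau> \<Gamma>) U \<longleftrightarrow>
     U \<subseteq> lcosets\<^bsub>G\<^esub> \<Gamma> \<and> openin \<tau> {g \<in> topspace \<tau>. g <#\<^bsub>G\<^esub> \<Gamma> \<in> U}"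
proof -
  let ?P = "\<lambda>U. {g \<in> topspace \<tau>. g <#\<^bsub>G\<^esub> \<Gamma> \<in> U}"
  have "istopology (\<lambda>U. U \<subseteq> lcosets\<^bsub>G\<^esub> \<Gamma> \<and> openin \<tau> (?P U))"
    unfolding istopology_def
  proof (intro conjI allI impI)
    fix S T assume "S \<subseteq> lcosets\<^bsub>G\<^esub> \<Gamma> \<and> openin \<tau> (?P S)" "T \<subseteq> lcosets\<^bsub>G\<^esub> \<Gamma> \<and> openin \<tau> (?P T)"
    moreover have "?P (S \<inter> T) = ?P S \<inter> ?P T" by auto
    ultimately show "S \<inter> T \<subseteq> lcosets\<^bsub>G\<^esub> \<Gamma>" "openin \<tau> (?P (S \<inter> T))" by (auto intro: openin_Int)
  next
    fix K assume K: "\<forall>S\<in>K. S \<subseteq> lcosets\<^bsub>G\<^esub> \<Gamma> \<and> openin \<tau> (?P S)"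
    then show "\<Union>K \<subseteq> lcosets\<^bsub>G\<^esub> \<Gamma>" by blast
    have "?P (\<Union>K) = (\<Union>S\<in>K. ?P S)" by auto
    with K show "openin \<tau> (?P (\<Union>K))" by auto
  qed
  then show ?thesis
    by (simp add: coset_topology_def topology_inverse')
qed

lemma topspace_coset_topology:
  assumes "topspace \<tau> = carrier G"
  shows "topspace (coset_topology G \<tau> \<Gamma>) = lcosets\<^bsub>G\<^esub> \<Gamma>"
proof -
  have "{g \<in> topspace \<tau>. g <#\<^bsub>G\<^esub> \<Gamma> \<in> lcosets\<^bsub>G\<^esub> \<Gamma>} = topspace \<tau>"
    using assms by (auto simp: LCOSETS_def)
  then have "openin (coset_topology G \<tau> \<Gamma>) (lcosets\<^bsub>G\<^esub> \<Gamma>)"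
    by (simp add: openin_coset_topology)
  then show ?thesis
    by (metis openin_coset_topology openin_subset openin_topspace subset_antisym)
qed

definition nilmanifold :: "nat \<Rightarrow> ('g, 'r) monoid_scheme \<Rightarrow> 'g topology \<Rightarrow> 'g set \<Rightarrow> bool" where
  "nilmanifold s G \<tau> \<Gamma> \<longleftrightarrow>
     lie_group G \<tau> \<and> nilpotent_group s G \<and>
     subgroup \<Gamma> G \<and> subtopology \<tau> \<Gamma> = discrete_topology \<Gamma> \<and>
     compact_space (coset_topology G \<tau> \<Gamma>)"


section \<open>Haar measure and nilsystems\<close>

definition borel_of :: "'a topology \<Rightarrow> 'a measure" where
  "borel_of X = sigma (topspace X) {U. openin X U}"

text \<open>
  Regularity is automatic, since the groups considered are locally compact and second countable.
\<close>

definition haar_measure :: "('g, 'r) monoid_scheme \<Rightarrow> 'g topology \<Rightarrow> 'g measure \<Rightarrow> bool" where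
  "haar_measure G \<tau> m \<longleftrightarrow>
     sets m = sets (borel_of \<tau>) \<and> emeasure m (space m) \<noteq> 0 \<and>
     (\<forall>K. compactin \<tau> K \<and> K \<in> sets m \<longrightarrow> emeasure m K < \<infinity>) \<and>
     (\<forall>g\<in>carrier G. \<forall>A\<in>sets m. emeasure m (g <#\<^bsub>G\<^esub> A) = emeasure m A)"

definition fundamental_domain ::
  "('g, 'r) monoid_scheme \<Rightarrow> 'g topology \<Rightarrow> 'g set \<Rightarrow> 'g set \<Rightarrow> bool" where
  "fundamental_domain G \<tau> \<Gamma> F \<longleftrightarrow>
     F \<in> sets (borel_of \<tau>) \<and> bij_betw (\<lambda>g. g <#\<^bsub>G\<^esub> \<Gamma>) F (lcosets\<^bsub>G\<^esub> \<Gamma>)"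

text \<open>
  The measure \<open>m\<^sub>X\<close> on \<open>X = G/\<Gamma>\<close>: restrict a Haar measure of \<open>G\<close> to a Borel fundamental domain
  and push it forward under the projection. On a nilmanifold Borel fundamental domains exist and
  the result does not depend on which one is used; requiring a probability measure fixes the
  normalisation of the Haar measure.
\<close>

definition haar_projection ::
  "('g, 'r) monoid_scheme \<Rightarrow> 'g topology \<Rightarrow> 'g set \<Rightarrow> 'g set measure \<Rightarrow> bool" where
  "haar_projection G \<tau> \<Gamma> M \<longleftrightarrow>
     sets M = sets (borel_of (coset_topology G \<tau> \<Gamma>)) \<and> prob_space M \<and>
     (\<exists>m. haar_measure G \<tau> m \<and>
        (\<forall>F. fundamental_domain G \<tau> \<Gamma> F \<longrightarrow>
           M = distr (restrict_space m F) (borel_of (coset_topology G \<tau> \<Gamma>)) (\<lambda>g. g <#\<^bsub>G\<^esub> \<Gamma>)))"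

definition nilsystem ::
  "nat \<Rightarrow> ('g, 'r) monoid_scheme \<Rightarrow> 'g topology \<Rightarrow> 'g set \<Rightarrow> 'g \<Rightarrow> 'g set measure \<Rightarrow> ('g set \<Rightarrow> 'g set) \<Rightarrow> bool"
  where
  "nilsystem s G \<tau> \<Gamma> b M T \<longleftrightarrow>
     nilmanifold s G \<tau> \<Gamma> \<and> haar_projection G \<tau> \<Gamma> M \<and>
     b \<in> carrier G \<and> T = (\<lambda>x. b <#\<^bsub>G\<^esub> x)"


section \<open>Ergodicity, seminorms and the Host-Kra factor of degree one\<close>

definition ergodic :: "'a measure \<Rightarrow> ('a \<Rightarrow> 'a) \<Rightarrow> bool" where
  "ergodic M T \<longleftrightarrow> (\<forall>A\<in>sets M. T -` A \<inter> space M = A \<longrightarrow> measure M A = 0 \<or> measure M A = 1)"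

definition Linfty :: "'a measure \<Rightarrow> ('a \<Rightarrow> complex) set" where
  "Linfty M = {f. f \<in> borel_measurable M \<and> (\<exists>C. AE x in M. norm (f x) \<le> C)}"

definition L2norm :: "'a measure \<Rightarrow> ('a \<Rightarrow> complex) \<Rightarrow> real" where
  "L2norm M f = sqrt (\<integral>x. (norm (f x))\<^sup>2 \<partial>M)"

definition mult_diff :: "('a \<Rightarrow> 'a) \<Rightarrow> nat \<Rightarrow> ('a \<Rightarrow> complex) \<Rightarrow> 'a \<Rightarrow> complex" where
  "mult_diff T h f = (\<lambda>x. f x * cnj (f ((T ^^ h) x)))"

text \<open>
  The values are complex because \<open>|||f|||\<^sub>0\<close> is the integral of \<open>f\<close>. For \<open>s \<ge> 1\<close> the limit is a
  nonnegative real number, and \<open>|||f|||\<^sub>s\<close> is its nonnegative \<open>2\<^sup>s\<close>-th root.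
\<close>

primrec ghk_seminorm :: "'a measure \<Rightarrow> ('a \<Rightarrow> 'a) \<Rightarrow> nat \<Rightarrow> ('a \<Rightarrow> complex) \<Rightarrow> complex" where
  "ghk_seminorm M T 0 f = (\<integral>x. f x \<partial>M)"
| "ghk_seminorm M T (Suc s) f = complex_of_real (root (2 ^ Suc s)
     (Re (lim (\<lambda>H. (\<Sum>h=1..H. ghk_seminorm M T s (mult_diff T h f) ^ (2 ^ s)) / of_nat H))))"

definition complex_cond_exp :: "'a measure \<Rightarrow> 'a measure \<Rightarrow> ('a \<Rightarrow> complex) \<Rightarrow> 'a \<Rightarrow> complex" where
  "complex_cond_exp M Z f = (\<lambda>x. Complex (real_cond_exp M Z (\<lambda>y. Re (f y)) x)
                                          (real_cond_exp M Z (\<lambda>y. Im (f y)) x))"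

text \<open>
  The characterising property determines the factor up to null sets, so that whether
  \<open>E(f | Z\<^sub>1) = 0\<close> holds almost everywhere does not depend on the choice made below.
\<close>

definition is_hk_factor_1 :: "'a measure \<Rightarrow> ('a \<Rightarrow> 'a) \<Rightarrow> 'a measure \<Rightarrow> bool" where
  "is_hk_factor_1 M T Z \<longleftrightarrow>
     subalgebra M Z \<and> {T -` A \<inter> space M | A. A \<in> sets Z} = sets Z \<and>
     (\<forall>f\<in>Linfty M. ghk_seminorm M T 2 f = 0 \<longleftrightarrow> (AE x in M. complex_cond_exp M Z f x = 0))"

definition hk_factor_1 :: "'a measure \<Rightarrow> ('a \<Rightarrow> 'a) \<Rightarrow> 'a measure" where
  "hk_factor_1 M T = (SOME Z. is_hk_factor_1 M T Z)"

end

theory Submission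
  imports Defs
begin

text \<open>
  A system \<open>G/\<Gamma>\<close> with \<open>T x = b x\<close> is treated without the structure theory of nilpotent Lie groups and
  without spectral theory. Let \<open>N\<close> be the open subgroup generated by a small neighbourhood \<open>B\<close> of the
  identity and \<open>H\<close> the group generated by \<open>N\<close> and \<open>b\<close>; by ergodicity \<open>H\<close> acts transitively. For the
  commutator series \<open>L 0 = N\<close>, \<open>L (k + 1) = [L k, H]\<close> of \<open>H\<close>, the main point is that for \<open>k \<ge> 1\<close>
  and \<open>L (k + 1)\<close>-invariant continuous \<open>g\<close>, translating \<open>g\<close> by an element of \<open>L k\<close> does not change
  the asymptotics of \<open>\<integral> f(b\<^sup>n x) g(x)\<close>. The elements with this property form a closed subgroup \<open>R k\<close>; it contains
  the commutators with \<open>b\<close>, by a Mautner type argument, and those which fix a point, and multilinearity of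
  iterated commutators together with approximate roots of the elements of \<open>B\<close> yields all of \<open>L k\<close>.
  Averaging \<open>g\<close> over \<open>L k\<close> and descending in \<open>k\<close> replaces any continuous \<open>g\<close> by an \<open>L 1\<close>-invariant one.

  Since \<open>L 1\<close>-invariant functions have totally bounded orbits, \<open>|||f|||\<^sub>2 = 0\<close> makes \<open>f\<close> orthogonal to them,
  by van der Corput, and so (iii) follows; the converse is Cesaro summation of \<open>\<integral> f \<cdot> T\<^sup>n f\<close>.
  The \<open>L 1\<close>-invariant continuous functions generate the factor of degree one. Finally (ii) and (iii) are
  equivalent in every measure preserving system: if (iii) fails, the times at which a fixed correlation
  stays away from \<open>0\<close> contain a sequence contradicting (ii), and (iii) makes the correlations of \<open>T\<^sup>m f\<close> and
  \<open>T\<^sup>n f\<close> small for distant \<open>m\<close> and \<open>n\<close>.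
\<close>

section \<open>Commutator series\<close>

text \<open>Behind the Mautner step: a small \<open>h\<close> may be moved past
  \<open>b [^] n\<close> at little cost, and this inserts the commutator of \<open>h\<close> with
  \<open>b [^] n\<close>, which modulo the next term of the series is the \<open>n\<close>-th power
  of \<open>commutator G h b\<close>. If \<open>h\<close> is roughly an \<open>n\<close>-th root of
  a fixed element, that power keeps its size although \<open>h\<close> tends to the identity, so
  every commutator with \<open>b\<close> is reached. The obstacle is the passage from
  \<open>b\<close> to other last entries, because ergodicity is a statement about \<open>X\<close>
  and not about the group. It can be exploited directly only for commutators whose entries other
  than the last fix the base point, as these descend to the space. Compactness of \<open>X\<close>
  then allows an entry from the stabiliser to be replaced by an arbitrary one, at the price of
  taking roots in the first entry. Roots exist only near the identity, whence first entries are kept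
  in \<open>N\<close>; and since the group need not be connected, \<open>b\<close> has to be added
  to \<open>N\<close> as a further generator.\<close>

definition commutator :: "('g, 'r) monoid_scheme \<Rightarrow> 'g \<Rightarrow> 'g \<Rightarrow> 'g" where
  "commutator G x y = x \<otimes>\<^bsub>G\<^esub> y \<otimes>\<^bsub>G\<^esub> inv\<^bsub>G\<^esub> x \<otimes>\<^bsub>G\<^esub> inv\<^bsub>G\<^esub> y"

text \<open>In contrast to \<open>lower_central\<close> the series starts at a subgroup
  \<open>N\<close>, while the second entries of the commutators range over the whole group. The
  first entry of an iterated commutator thus stays where approximate roots are available.\<close>

primrec comm_series :: "('g, 'r) monoid_scheme \<Rightarrow> 'g set \<Rightarrow> nat \<Rightarrow> 'g set" where
  "comm_series G N 0 = N"
| "comm_series G N (Suc k) =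
     generate G {commutator G x y | x y. x \<in> comm_series G N k \<and> y \<in> carrier G}"

declare comm_series.simps(2) [simp del]

context group
begin

lemma cancel_inv_left [simp]: "x \<in> carrier G \<Longrightarrow> y \<in> carrier G \<Longrightarrow> inv x \<otimes> (x \<otimes> y) = y"
  by (metis inv_closed l_inv l_one m_assoc)

lemma cancel_inv_right [simp]: "x \<in> carrier G \<Longrightarrow> y \<in> carrier G \<Longrightarrow> x \<otimes> (inv x \<otimes> y) = y"
  by (metis inv_closed r_inv l_one m_assoc)

lemma commutator_closed [simp]:
  "x \<in> carrier G \<Longrightarrow> y \<in> carrier G \<Longrightarrow> commutator G x y \<in> carrier G"
  by (simp add: commutator_def)

lemma commutator_mult_left:
  "u \<in> carrier G \<Longrightarrow> v \<in> carrier G \<Longrightarrow> y \<in> carrier G \<Longrightarrow>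
    commutator G (u \<otimes> v) y = u \<otimes> commutator G v y \<otimes> inv u \<otimes> commutator G u y"
  by (simp add: commutator_def m_assoc inv_mult_group)

lemma commutator_mult_right:
  "x \<in> carrier G \<Longrightarrow> y \<in> carrier G \<Longrightarrow> z \<in> carrier G \<Longrightarrow>
    commutator G x (y \<otimes> z) = commutator G x y \<otimes> (y \<otimes> commutator G x z \<otimes> inv y)"
  by (simp add: commutator_def m_assoc inv_mult_group)

end

locale filtered_group = group G for G (structure) +
  fixes N :: "'a set"
  assumes N_normal: "N \<lhd> G"
begin

abbreviation L :: "nat \<Rightarrow> 'a set" where "L \<equiv> comm_series G N"

lemma L_normal: "L k \<lhd> G"
proof (induction k)
  case 0 show ?case by (simp add: N_normal)
next
  case (Suc k)
  then interpret k: normal "L k" G .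
  let ?S = "{commutator G x y | x y. x \<in> L k \<and> y \<in> carrier G}"
  have "?S \<subseteq> carrier G" using k.subset by auto
  moreover have "g \<otimes> h \<otimes> inv g \<in> ?S" if h: "h \<in> ?S" and g: "g \<in> carrier G" for h g
  proof -
    from h obtain x y where xy: "h = commutator G x y" "x \<in> L k" "y \<in> carrier G" by auto
    have x: "x \<in> carrier G" using xy k.subset by auto
    have "g \<otimes> h \<otimes> inv g = commutator G (g \<otimes> x \<otimes> inv g) (g \<otimes> y \<otimes> inv g)"
      using x xy g by (simp add: commutator_def m_assoc inv_mult_group)
    moreover have "g \<otimes> x \<otimes> inv g \<in> L k" using k.inv_op_closed2[OF g xy(2)] .
    ultimately show ?thesis using xy g by blast
  qed
  ultimately have "generate G ?S \<lhd> G" by (intro normal_generateI) auto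
  then show ?case by (simp add: comm_series.simps(2))
qed

lemma L_subgroup: "subgroup (L k) G"
  using L_normal normal_imp_subgroup by blast

lemma L_carrier: "x \<in> L k \<Longrightarrow> x \<in> carrier G"
  using L_subgroup subgroup.mem_carrier by metis

lemma L_one [simp]: "\<one> \<in> L k" using L_subgroup by (rule subgroup.one_closed)
lemma L_mult: "x \<in> L k \<Longrightarrow> y \<in> L k \<Longrightarrow> x \<otimes> y \<in> L k" using L_subgroup by (rule subgroup.m_closed)
lemma L_inv: "x \<in> L k \<Longrightarrow> inv x \<in> L k" using L_subgroup by (rule subgroup.m_inv_closed)

lemma L_conj: "x \<in> L k \<Longrightarrow> y \<in> carrier G \<Longrightarrow> y \<otimes> x \<otimes> inv y \<in> L k"
  using L_normal normal.inv_op_closed2 by metis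

lemma L_conj': "x \<in> L k \<Longrightarrow> y \<in> carrier G \<Longrightarrow> inv y \<otimes> x \<otimes> y \<in> L k"
  using L_normal normal.inv_op_closed1 by metis

lemma commutator_in_L: "x \<in> L k \<Longrightarrow> y \<in> carrier G \<Longrightarrow> commutator G x y \<in> L (Suc k)"
  by (auto simp: comm_series.simps(2) intro: generate.incl)

lemma L_Suc_subset: "L (Suc k) \<subseteq> L k"
proof -
  have "commutator G x y \<in> L k" if "x \<in> L k" "y \<in> carrier G" for x y
  proof -
    have "x \<otimes> (y \<otimes> inv x \<otimes> inv y) \<in> L k" using that L_mult L_conj L_inv by blast
    then show ?thesis using that L_carrier by (simp add: commutator_def m_assoc)
  qed
  then show ?thesis
    unfolding comm_series.simps(2) by (intro generate_subgroup_incl L_subgroup) auto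
qed

lemma L_mono: "j \<le> k \<Longrightarrow> L k \<subseteq> L j"
  by (induction k rule: dec_induct) (use L_Suc_subset in auto)

section \<open>Congruences modulo the terms of the series\<close>

definition lcong :: "nat \<Rightarrow> 'a \<Rightarrow> 'a \<Rightarrow> bool" where
  "lcong k x y \<longleftrightarrow> x \<in> carrier G \<and> y \<in> carrier G \<and> x \<otimes> inv y \<in> L k"

lemma lcong_refl: "x \<in> carrier G \<Longrightarrow> lcong k x x" by (simp add: lcong_def)

lemma lcong_sym: assumes "lcong k x y" shows "lcong k y x"
  using assms L_inv[of "x \<otimes> inv y" k] by (auto simp: lcong_def inv_mult_group)

lemma lcong_trans [trans]: assumes "lcong k x y" "lcong k y z" shows "lcong k x z"
  using assms L_mult[of "x \<otimes> inv y" k "y \<otimes> inv z"] by (auto simp: lcong_def m_assoc)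

lemma lcong_mult: assumes "lcong k x y" "lcong k x' y'" shows "lcong k (x \<otimes> x') (y \<otimes> y')"
proof -
  have c: "x \<in> carrier G" "y \<in> carrier G" "x' \<in> carrier G" "y' \<in> carrier G"
    using assms by (auto simp: lcong_def)
  have "(x \<otimes> inv y) \<otimes> (y \<otimes> (x' \<otimes> inv y') \<otimes> inv y) \<in> L k"
    using assms by (intro L_mult[of "x \<otimes> inv y"] L_conj[of "x' \<otimes> inv y'"]) (auto simp: lcong_def)
  then show ?thesis using c by (simp add: lcong_def m_assoc inv_mult_group)
qed

lemma lcong_inv: assumes "lcong k x y" shows "lcong k (inv x) (inv y)"
proof -
  have c: "x \<in> carrier G" "y \<in> carrier G" using assms by (auto simp: lcong_def)
  have "inv (x \<otimes> inv y) \<in> L k" using assms L_inv by (auto simp: lcong_def)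
  then have "inv x \<otimes> inv (x \<otimes> inv y) \<otimes> x \<in> L k" using c L_conj' by blast
  then have "inv x \<otimes> y \<in> L k" using c by (simp add: m_assoc inv_mult_group)
  then show ?thesis using c by (simp add: lcong_def)
qed

lemma lcong_pow: "lcong k x y \<Longrightarrow> lcong k (x [^] (n::nat)) (y [^] n)"
  by (induction n) (auto simp: lcong_refl intro: lcong_mult)

lemma lcong_one: "x \<in> L k \<Longrightarrow> lcong k x \<one>" using L_carrier by (auto simp: lcong_def)

text \<open>The quotient of the two sides is the commutator of \<open>u\<close> and
  \<open>y\<close>. In other words, \<open>L k\<close> is central modulo \<open>L (Suc k)\<close>;
  in particular the quotients of successive terms are abelian.\<close>

lemma lcong_commute: "u \<in> L k \<Longrightarrow> y \<in> carrier G \<Longrightarrow> lcong (Suc k) (u \<otimes> y) (y \<otimes> u)"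
  using commutator_in_L[of u k y] L_carrier[of u k]
  by (simp add: lcong_def commutator_def m_assoc inv_mult_group)

lemma lcong_conj: "u \<in> L k \<Longrightarrow> y \<in> carrier G \<Longrightarrow> lcong (Suc k) (y \<otimes> u \<otimes> inv y) u"
  using lcong_mult[OF lcong_sym[OF lcong_commute[of u k y]] lcong_refl[of "inv y"]] L_carrier[of u k]
  by (simp add: m_assoc)

text \<open>In the exact identity \<open>commutator_mult_left\<close> one factor is conjugated by
  \<open>u\<close> and the order is reversed. Neither matters here, since both factors lie in
  \<open>L (Suc k)\<close>, which is central modulo \<open>L (Suc (Suc k))\<close>.\<close>

lemma commutator_lcong_mult_left:
  assumes "u \<in> L k" "v \<in> L k" "y \<in> carrier G"
  shows "lcong (Suc (Suc k)) (commutator G (u \<otimes> v) y) (commutator G u y \<otimes> commutator G v y)"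
proof -
  have c: "u \<in> carrier G" "v \<in> carrier G" using assms L_carrier by auto
  have 1: "commutator G u y \<in> L (Suc k)" "commutator G v y \<in> L (Suc k)"
    using assms commutator_in_L by auto
  have "lcong (Suc (Suc k)) (u \<otimes> commutator G v y \<otimes> inv u \<otimes> commutator G u y)
     (commutator G v y \<otimes> commutator G u y)"
    using 1 c assms by (intro lcong_mult lcong_conj lcong_refl) auto
  also have "lcong (Suc (Suc k)) \<dots> (commutator G u y \<otimes> commutator G v y)"
    using 1 c assms by (intro lcong_commute) auto
  finally show ?thesis using c assms by (simp add: commutator_mult_left)
qed

lemma commutator_lcong_mult_right:
  assumes "u \<in> L k" "y \<in> carrier G" "z \<in> carrier G"
  shows "lcong (Suc (Suc k)) (commutator G u (y \<otimes> z)) (commutator G u y \<otimes> commutator G u z)"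
proof -
  have c: "u \<in> carrier G" using assms L_carrier by auto
  show ?thesis unfolding commutator_mult_right[OF c assms(2,3)]
    using c assms commutator_in_L by (intro lcong_mult lcong_conj lcong_refl) auto
qed

lemma commutator_lcong_left:
  assumes "lcong (Suc k) u v" "v \<in> L k" "y \<in> carrier G"
  shows "lcong (Suc (Suc k)) (commutator G u y) (commutator G v y)"
proof -
  have c: "u \<in> carrier G" "v \<in> carrier G" using assms by (auto simp: lcong_def)
  define n where "n = u \<otimes> inv v"
  have n: "n \<in> L (Suc k)" using assms by (auto simp: lcong_def n_def)
  have u: "u = n \<otimes> v" using c by (simp add: n_def m_assoc)
  have nk: "n \<in> L k" using n L_Suc_subset by blast
  have nc: "n \<in> carrier G" using n L_carrier by blast
  have "lcong (Suc (Suc k)) (commutator G u y) (commutator G n y \<otimes> commutator G v y)"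
    unfolding u using commutator_lcong_mult_left[OF nk assms(2,3)] .
  also have "lcong (Suc (Suc k)) \<dots> (\<one> \<otimes> commutator G v y)"
    using c assms n commutator_in_L by (intro lcong_mult lcong_one lcong_refl) auto
  finally show ?thesis using c assms by simp
qed

section \<open>Left-normed iterated commutators and their multilinearity\<close>

definition lc :: "'a \<Rightarrow> 'a list \<Rightarrow> 'a" where "lc x ys = foldl (commutator G) x ys"

lemma lc_Nil [simp]: "lc x [] = x" and lc_Cons [simp]: "lc x (y # ys) = lc (commutator G x y) ys"
  and lc_append [simp]: "lc x (ys @ zs) = lc (lc x ys) zs"
  by (simp_all add: lc_def)

lemma lc_in_L:
  "u \<in> L k \<Longrightarrow> set ys \<subseteq> carrier G \<Longrightarrow> lc u ys \<in> L (k + length ys)"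
proof (induction ys arbitrary: u k)
  case (Cons y ys)
  have "lc (commutator G u y) ys \<in> L (Suc k + length ys)"
    using Cons.prems by (intro Cons.IH commutator_in_L) auto
  then show ?case by simp
qed simp

text \<open>One commutator is additive only up to the next term of the series, so the induction has
  to carry an element \<open>w\<close> that is merely congruent to the product. Every further entry
  raises the level of the elements and of the error by one.\<close>

lemma lc_lcong_mult:
  assumes "u \<in> L k" "v \<in> L k" "lcong (Suc k) w (u \<otimes> v)" "set ys \<subseteq> carrier G"
  shows "lcong (Suc (k + length ys)) (lc w ys) (lc u ys \<otimes> lc v ys)"
  using assms
proof (induction ys arbitrary: u v w k)
  case (Cons y ys)
  have y: "y \<in> carrier G" using Cons.prems by simp
  have "lcong (Suc (Suc k)) (commutator G w y) (commutator G (u \<otimes> v) y)"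
    using Cons.prems y L_mult by (intro commutator_lcong_left) auto
  also have "lcong (Suc (Suc k)) \<dots> (commutator G u y \<otimes> commutator G v y)"
    using Cons.prems y by (intro commutator_lcong_mult_left) auto
  finally have "lcong (Suc (Suc k + length ys)) (lc (commutator G w y) ys)
     (lc (commutator G u y) ys \<otimes> lc (commutator G v y) ys)"
    using Cons.prems y by (intro Cons.IH commutator_in_L) auto
  then show ?case by simp
qed simp

lemma lc_mult_head:
  assumes "x \<in> N" "x' \<in> N" "set ys \<subseteq> carrier G"
  shows "lcong (Suc (length ys)) (lc (x \<otimes> x') ys) (lc x ys \<otimes> lc x' ys)"
  using lc_lcong_mult[of x 0 x' "x \<otimes> x'" ys] assms L_carrier[of _ 0] by (auto intro: lcong_refl)

text \<open>With the entries \<open>ps\<close> absorbed into \<open>u\<close>, additivity of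
  \<open>commutator G u\<close> supplies exactly the congruence from which
  \<open>lc_lcong_mult\<close> treats the remaining entries \<open>qs\<close>.\<close>

lemma lc_mult_slot:
  assumes "x \<in> N" "set ps \<subseteq> carrier G" "y \<in> carrier G" "y' \<in> carrier G" "set qs \<subseteq> carrier G"
  shows "lcong (Suc (length ps + length qs + 1)) (lc x (ps @ (y \<otimes> y') # qs))
           (lc x (ps @ y # qs) \<otimes> lc x (ps @ y' # qs))"
proof -
  define u where "u = lc x ps"
  have u: "u \<in> L (length ps)" unfolding u_def using lc_in_L[of x 0 ps] assms by simp
  have "lcong (Suc (Suc (length ps) + length qs)) (lc (commutator G u (y \<otimes> y')) qs)
     (lc (commutator G u y) qs \<otimes> lc (commutator G u y') qs)"
    using u assms by (intro lc_lcong_mult commutator_in_L commutator_lcong_mult_right) auto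
  then show ?thesis by (simp add: u_def)
qed

lemma lc_carrier: "x \<in> carrier G \<Longrightarrow> set ys \<subseteq> carrier G \<Longrightarrow> lc x ys \<in> carrier G"
  by (induction ys arbitrary: x) auto

lemma lc_one: "set ys \<subseteq> carrier G \<Longrightarrow> lc \<one> ys = \<one>"
  by (induction ys) (auto simp: commutator_def)

lemma lc_slot_one:
  "x \<in> carrier G \<Longrightarrow> set ps \<subseteq> carrier G \<Longrightarrow> set qs \<subseteq> carrier G \<Longrightarrow> lc x (ps @ \<one> # qs) = \<one>"
  using lc_carrier[of x ps] by (simp add: commutator_def lc_one)

text \<open>Modulo \<open>L (Suc k)\<close>, left-normed commutators generate \<open>L k\<close>.
  The induction replaces \<open>S\<close> by the set \<open>S'\<close> of those elements of
  \<open>L k\<close> all of whose commutators lie in \<open>S\<close>; this is a subgroup because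
  commutators are additive modulo \<open>L (Suc (Suc k))\<close>, which is contained in
  \<open>S\<close>.\<close>

lemma L_subset_subgroup:
  assumes "subgroup S G" "L (Suc k) \<subseteq> S"
    and "\<And>x ys. x \<in> N \<Longrightarrow> set ys \<subseteq> carrier G \<Longrightarrow> length ys = k \<Longrightarrow> lc x ys \<in> S"
  shows "L k \<subseteq> S"
  using assms
proof (induction k arbitrary: S)
  case 0 then show ?case using 0(3)[of _ "[]"] by auto
next
  case (Suc k)
  interpret S: subgroup S G by fact
  have Scong: "x \<in> S" if "lcong (Suc (Suc k)) x y" "y \<in> S" for x y
  proof -
    have "x \<otimes> inv y \<otimes> y \<in> S" using that Suc.prems(2) by (auto simp: lcong_def)
    then show ?thesis using that by (simp add: lcong_def m_assoc)
  qed
  define S' where "S' = {v \<in> L k. \<forall>y\<in>carrier G. commutator G v y \<in> S}"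
  have "subgroup S' G"
  proof (rule subgroupI)
    show "S' \<subseteq> carrier G" using L_carrier by (auto simp: S'_def)
    have "commutator G \<one> y \<in> S" if "y \<in> carrier G" for y using that by (simp add: commutator_def)
    then have "\<one> \<in> S'" by (simp add: S'_def)
    then show "S' \<noteq> {}" by blast
  next
    fix a b assume ab: "a \<in> S'" "b \<in> S'"
    then show "a \<otimes> b \<in> S'"
      using commutator_lcong_mult_left[of a k b] Scong L_mult by (fastforce simp: S'_def)
  next
    fix a assume a: "a \<in> S'"
    have ai: "inv a \<in> L k" using a L_inv by (auto simp: S'_def)
    have ac: "a \<in> carrier G" using a L_carrier by (auto simp: S'_def)
    have "commutator G (inv a) y \<in> S" if y: "y \<in> carrier G" for y
    proof -
      have aS: "commutator G a y \<in> S" using a y by (auto simp: S'_def)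
      have "lcong (Suc (Suc k)) (commutator G (inv a \<otimes> a) y) (commutator G (inv a) y \<otimes> commutator G a y)"
        using a ai y by (intro commutator_lcong_mult_left) (auto simp: S'_def)
      then have "lcong (Suc (Suc k)) \<one> (commutator G (inv a) y \<otimes> commutator G a y)"
        using ac y by (simp add: commutator_def)
      then have "lcong (Suc (Suc k)) (commutator G (inv a) y \<otimes> commutator G a y) \<one>" by (rule lcong_sym)
      then have "commutator G (inv a) y \<otimes> commutator G a y \<in> S" using Scong S.one_closed by blast
      then have "commutator G (inv a) y \<otimes> commutator G a y \<otimes> inv (commutator G a y) \<in> S"
        using aS by auto
      then show ?thesis using ac y by (simp add: m_assoc)
    qed
    then show "inv a \<in> S'" using ai by (simp add: S'_def)
  qed
  moreover have "L (Suc k) \<subseteq> S'"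
    using L_Suc_subset[of k] commutator_in_L[of _ "Suc k"] Suc.prems(2) unfolding S'_def by blast
  moreover have "lc x ys \<in> S'" if "x \<in> N" "set ys \<subseteq> carrier G" "length ys = k" for x ys
  proof -
    have "lc x (ys @ [y]) \<in> S" if "y \<in> carrier G" for y
      using that \<open>x \<in> N\<close> \<open>set ys \<subseteq> carrier G\<close> \<open>length ys = k\<close> by (intro Suc.prems(3)) auto
    moreover have "lc x ys \<in> L k" using lc_in_L[of x 0 ys] that by simp
    ultimately show ?thesis by (simp add: S'_def)
  qed
  ultimately have "L k \<subseteq> S'" by (intro Suc.IH) auto
  then show ?case
    unfolding comm_series.simps(2) by (intro generate_subgroup_incl Suc.prems(1)) (auto simp: S'_def)
qed

end

section \<open>Transitive actions of topological groups\<close>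

locale topological_group = group G for G (structure) +
  fixes \<tau> :: "'a topology"
  assumes topspace_group: "topspace \<tau> = carrier G"
    and continuous_mult: "continuous_map (prod_topology \<tau> \<tau>) \<tau> (\<lambda>(x, y). x \<otimes> y)"
    and continuous_inv: "continuous_map \<tau> \<tau> (\<lambda>x. inv x)"
begin

lemma continuous_map_group_mult:
  "continuous_map Z \<tau> f \<Longrightarrow> continuous_map Z \<tau> g \<Longrightarrow> continuous_map Z \<tau> (\<lambda>z. f z \<otimes> g z)"
  using continuous_map_compose[OF continuous_map_pairedI continuous_mult] by (simp add: o_def)

lemma continuous_map_group_inv: "continuous_map Z \<tau> f \<Longrightarrow> continuous_map Z \<tau> (\<lambda>z. inv (f z))"
  using continuous_map_compose[OF _ continuous_inv] by (simp add: o_def)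

lemma continuous_map_group_const: "c \<in> carrier G \<Longrightarrow> continuous_map Z \<tau> (\<lambda>z. c)"
  by (simp add: topspace_group)

lemmas group_continuous_intros =
  continuous_map_group_mult continuous_map_group_inv continuous_map_group_const

lemma continuous_map_commutator:
  "continuous_map Z \<tau> f \<Longrightarrow> continuous_map Z \<tau> g \<Longrightarrow>
    continuous_map Z \<tau> (\<lambda>z. commutator G (f z) (g z))"
  unfolding commutator_def by (intro group_continuous_intros)

section \<open>Neighbourhoods of the identity\<close>

definition nbhd :: "'a set \<Rightarrow> bool" where "nbhd W \<longleftrightarrow> openin \<tau> W \<and> \<one> \<in> W"

lemma nbhd_carrier: "nbhd W \<Longrightarrow> w \<in> W \<Longrightarrow> w \<in> carrier G"
  using openin_subset topspace_group by (fastforce simp: nbhd_def)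

lemma nbhd_Int: "nbhd V \<Longrightarrow> nbhd W \<Longrightarrow> nbhd (V \<inter> W)" by (auto simp: nbhd_def)

lemma nbhd_preimage:
  assumes "continuous_map \<tau> \<tau> f" "f \<one> = \<one>" "nbhd V"
  obtains W where "nbhd W" "\<And>w. w \<in> W \<Longrightarrow> f w \<in> V"
proof
  show "nbhd {w \<in> topspace \<tau>. f w \<in> V}"
    using assms openin_continuous_map_preimage[OF assms(1)] by (auto simp: nbhd_def topspace_group)
qed auto

lemma nbhd_quotient:
  assumes "nbhd W"
  obtains V where "nbhd V" "\<And>v w. v \<in> V \<Longrightarrow> w \<in> V \<Longrightarrow> inv v \<otimes> w \<in> W" "\<And>v w. v \<in> V \<Longrightarrow> w \<in> V \<Longrightarrow> v \<otimes> inv w \<in> W"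
proof -
  have ex: "\<exists>V. nbhd V \<and> (\<forall>v\<in>V. \<forall>w\<in>V. f (v, w) \<in> W)"
    if f: "continuous_map (prod_topology \<tau> \<tau>) \<tau> f" "f (\<one>, \<one>) = \<one>" for f
  proof -
    have "openin (prod_topology \<tau> \<tau>) {p \<in> topspace (prod_topology \<tau> \<tau>). f p \<in> W}"
      using assms f openin_continuous_map_preimage by (fastforce simp: nbhd_def)
    moreover have "(\<one>, \<one>) \<in> {p \<in> topspace (prod_topology \<tau> \<tau>). f p \<in> W}"
      using assms f by (auto simp: topspace_group nbhd_def)
    ultimately obtain A C where "openin \<tau> A" "openin \<tau> C" "\<one> \<in> A" "\<one> \<in> C"
      "A \<times> C \<subseteq> {p \<in> topspace (prod_topology \<tau> \<tau>). f p \<in> W}"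
      unfolding openin_prod_topology_alt by meson
    then show ?thesis by (intro exI[of _ "A \<inter> C"]) (auto simp: nbhd_def)
  qed
  obtain V1 where V1: "nbhd V1" "\<forall>v\<in>V1. \<forall>w\<in>V1. inv v \<otimes> w \<in> W"
    using ex[of "\<lambda>p. inv (fst p) \<otimes> snd p"]
      continuous_map_group_mult[OF continuous_map_group_inv[OF continuous_map_fst] continuous_map_snd]
    by auto
  obtain V2 where V2: "nbhd V2" "\<forall>v\<in>V2. \<forall>w\<in>V2. v \<otimes> inv w \<in> W"
    using ex[of "\<lambda>p. fst p \<otimes> inv (snd p)"]
      continuous_map_group_mult[OF continuous_map_fst continuous_map_group_inv[OF continuous_map_snd]]
    by auto
  show thesis using V1 V2 by (intro that[of "V1 \<inter> V2"]) (auto intro: nbhd_Int)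
qed

lemma openin_right_translate:
  assumes "openin \<tau> W" "g \<in> carrier G"
  shows "openin \<tau> ((\<lambda>w. w \<otimes> g) ` W)"
proof -
  have W: "W \<subseteq> carrier G" using assms openin_subset topspace_group by fastforce
  have "(\<lambda>w. w \<otimes> g) ` W = {x \<in> topspace \<tau>. x \<otimes> inv g \<in> W}"
  proof (rule equalityI; rule subsetI)
    fix x assume "x \<in> {x \<in> topspace \<tau>. x \<otimes> inv g \<in> W}"
    then have "x = (x \<otimes> inv g) \<otimes> g" "x \<otimes> inv g \<in> W" using assms by (auto simp: topspace_group m_assoc)
    then show "x \<in> (\<lambda>w. w \<otimes> g) ` W" by blast
  qed (use W assms in \<open>auto simp: topspace_group m_assoc\<close>)
  moreover have "continuous_map \<tau> \<tau> (\<lambda>x. x \<otimes> inv g)"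
    using assms by (intro group_continuous_intros) auto
  ultimately show ?thesis using assms openin_continuous_map_preimage by fastforce
qed

lemma openin_left_translate:
  assumes "openin \<tau> W" "g \<in> carrier G"
  shows "openin \<tau> ((\<lambda>w. g \<otimes> w) ` W)"
proof -
  have W: "W \<subseteq> carrier G" using assms openin_subset topspace_group by fastforce
  have "(\<lambda>w. g \<otimes> w) ` W = {x \<in> topspace \<tau>. inv g \<otimes> x \<in> W}"
  proof (rule equalityI; rule subsetI)
    fix x assume "x \<in> {x \<in> topspace \<tau>. inv g \<otimes> x \<in> W}"
    then have "x = g \<otimes> (inv g \<otimes> x)" "inv g \<otimes> x \<in> W" using assms by (auto simp: topspace_group)
    then show "x \<in> (\<lambda>w. g \<otimes> w) ` W" by blast
  qed (use W assms in \<open>auto simp: topspace_group\<close>)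
  moreover have "continuous_map \<tau> \<tau> (\<lambda>x. inv g \<otimes> x)"
    using assms by (intro group_continuous_intros) auto
  ultimately show ?thesis using assms openin_continuous_map_preimage by fastforce
qed

end

text \<open>An abstraction of the coset space, so that the same facts serve the given Lie group and
  the open subgroup to which it is reduced later. By \<open>orbit_open\<close> and transitivity,
  \<open>X\<close> carries the quotient topology of the orbit map of \<open>x0\<close>.\<close>

locale transitive_action = topological_group G \<tau> for G (structure) and \<tau> +
  fixes X :: "'x topology" and act :: "'a \<Rightarrow> 'x \<Rightarrow> 'x" and M :: "'x measure" and x0 :: 'x
  assumes act_one: "x \<in> topspace X \<Longrightarrow> act \<one> x = x"
    and act_mult: "g \<in> carrier G \<Longrightarrow> h \<in> carrier G \<Longrightarrow> x \<in> topspace X \<Longrightarrow> act (g \<otimes> h) x = act g (act h x)"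
    and continuous_act: "continuous_map (prod_topology \<tau> X) X (\<lambda>(g, x). act g x)"
    and x0: "x0 \<in> topspace X"
    and transitive: "x \<in> topspace X \<Longrightarrow> \<exists>g\<in>carrier G. x = act g x0"
    and orbit_open: "openin \<tau> U \<Longrightarrow> openin X ((\<lambda>g. act g x0) ` U)"
    and compact: "compact_space X"
    and sets_M: "sets M = sets (borel_of X)"
    and prob: "prob_space M"
    and invariant: "g \<in> carrier G \<Longrightarrow> distr M M (act g) = M"
begin

sublocale prob_space M by (rule prob)

lemma space_M: "space M = topspace X"
  using sets_eq_imp_space_eq[OF sets_M] by (simp add: borel_of_def space_measure_of_conv)

lemma act_in [simp]: "g \<in> carrier G \<Longrightarrow> x \<in> topspace X \<Longrightarrow> act g x \<in> topspace X"
  using continuous_map_image_subset_topspace[OF continuous_act]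
  by (fastforce simp: topspace_group image_subset_iff)

lemma act_inv [simp]:
  "g \<in> carrier G \<Longrightarrow> x \<in> topspace X \<Longrightarrow> act g (act (inv g) x) = x"
  "g \<in> carrier G \<Longrightarrow> x \<in> topspace X \<Longrightarrow> act (inv g) (act g x) = x"
  by (simp_all add: act_one flip: act_mult)

lemma continuous_map_act:
  "continuous_map Z \<tau> f \<Longrightarrow> continuous_map Z X g \<Longrightarrow> continuous_map Z X (\<lambda>z. act (f z) (g z))"
  using continuous_map_compose[OF continuous_map_pairedI continuous_act] by (simp add: o_def)

lemma continuous_act1: "g \<in> carrier G \<Longrightarrow> continuous_map X X (act g)"
  using continuous_map_act[OF continuous_map_group_const continuous_map_id] by simp

lemma open_sets: "openin X U \<Longrightarrow> U \<in> sets M"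
  unfolding sets_M borel_of_def using openin_subset by (subst sets_measure_of) auto

lemma continuous_measurable:
  assumes "continuous_map X euclideanreal \<phi>"
  shows "\<phi> \<in> borel_measurable M"
proof (rule borel_measurableI)
  fix S :: "real set" assume "open S"
  then have "openin X {x \<in> topspace X. \<phi> x \<in> S}"
    using assms openin_continuous_map_preimage by fastforce
  then show "\<phi> -` S \<inter> space M \<in> sets M" using open_sets
    by (simp add: space_M vimage_def Collect_conj_eq Int_commute)
qed

lemma act_measurable [measurable]:
  assumes "g \<in> carrier G"
  shows "act g \<in> measurable M M"
proof -
  have "act g \<in> measurable M (sigma (topspace X) {U. openin X U})"
  proof (rule measurable_measure_of)
    show "{U. openin X U} \<subseteq> Pow (topspace X)" using openin_subset by auto
    show "act g \<in> space M \<rightarrow> topspace X" using assms by (simp add: space_M)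
    fix U assume "U \<in> {U. openin X U}"
    then have "openin X {x \<in> topspace X. act g x \<in> U}"
      using continuous_act1[OF assms] openin_continuous_map_preimage by fastforce
    then show "act g -` U \<inter> space M \<in> sets M" using open_sets
      by (simp add: space_M vimage_def Collect_conj_eq Int_commute)
  qed
  then show ?thesis
    using measurable_cong_sets[OF refl sets_M] unfolding borel_of_def by blast
qed

section \<open>Continuous functions on the space\<close>

definition Cont :: "('x \<Rightarrow> real) set" where "Cont = {\<phi>. continuous_map X euclideanreal \<phi>}"

lemma Cont_measurable [measurable_dest]: "\<phi> \<in> Cont \<Longrightarrow> \<phi> \<in> borel_measurable M"
  using continuous_measurable by (auto simp: Cont_def)

lemma Cont_bounded:
  assumes "\<phi> \<in> Cont"
  obtains C where "C > 0" "\<And>x. x \<in> topspace X \<Longrightarrow> \<bar>\<phi> x\<bar> \<le> C"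
proof -
  have "compactin euclideanreal (\<phi> ` topspace X)"
    using assms compact image_compactin by (fastforce simp: compact_space_def Cont_def)
  then have "bounded (\<phi> ` topspace X)" using compact_imp_bounded by auto
  then obtain C where "\<forall>x\<in>topspace X. \<bar>\<phi> x\<bar> \<le> C" by (auto simp: bounded_iff)
  then have "\<And>x. x \<in> topspace X \<Longrightarrow> \<bar>\<phi> x\<bar> \<le> max C 1" by fastforce
  then show thesis by (intro that[of "max C 1"]) auto
qed

lemma Cont_integrable: assumes "\<phi> \<in> Cont" shows "integrable M \<phi>"
proof -
  obtain C where C: "\<And>x. x \<in> topspace X \<Longrightarrow> \<bar>\<phi> x\<bar> \<le> C" using Cont_bounded[OF assms] by metis
  show ?thesis
    by (rule integrable_const_bound[where B = C])
      (use C assms Cont_measurable in \<open>auto intro!: AE_I2 simp: space_M\<close>)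
qed

lemma Cont_intros:
  "\<phi> \<in> Cont \<Longrightarrow> \<psi> \<in> Cont \<Longrightarrow> (\<lambda>x. \<phi> x + \<psi> x) \<in> Cont"
  "\<phi> \<in> Cont \<Longrightarrow> \<psi> \<in> Cont \<Longrightarrow> (\<lambda>x. \<phi> x - \<psi> x) \<in> Cont"
  "\<phi> \<in> Cont \<Longrightarrow> \<psi> \<in> Cont \<Longrightarrow> (\<lambda>x. \<phi> x * \<psi> x) \<in> Cont"
  "\<phi> \<in> Cont \<Longrightarrow> (\<lambda>x. \<bar>\<phi> x\<bar>) \<in> Cont"
  "\<phi> \<in> Cont \<Longrightarrow> (\<lambda>x. (\<phi> x)\<^sup>2) \<in> Cont"
  "\<phi> \<in> Cont \<Longrightarrow> \<psi> \<in> Cont \<Longrightarrow> (\<lambda>x. min (\<phi> x) (\<psi> x)) \<in> Cont"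
  "\<phi> \<in> Cont \<Longrightarrow> \<psi> \<in> Cont \<Longrightarrow> (\<lambda>x. max (\<phi> x) (\<psi> x)) \<in> Cont"
  "(\<lambda>x. c) \<in> Cont"
  by (auto simp: Cont_def intro: continuous_intros)

lemma Cont_act: "\<phi> \<in> Cont \<Longrightarrow> g \<in> carrier G \<Longrightarrow> (\<lambda>x. \<phi> (act g x)) \<in> Cont"
  using continuous_map_compose[OF continuous_act1, of g euclideanreal \<phi>] by (auto simp: Cont_def o_def)

lemma integral_act:
  fixes \<phi> :: "'x \<Rightarrow> 'd :: {banach, second_countable_topology}"
  assumes "\<phi> \<in> borel_measurable M" "g \<in> carrier G"
  shows "(\<integral>x. \<phi> (act g x) \<partial>M) = (\<integral>x. \<phi> x \<partial>M)"
  using integral_distr[of "act g" M M \<phi>] assms invariant[of g] act_measurable[of g] by simp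

lemma integral_Cont_bound:
  assumes "f \<in> Cont" "g \<in> Cont" "\<And>x. x \<in> topspace X \<Longrightarrow> \<bar>f x\<bar> \<le> C" "\<And>x. x \<in> topspace X \<Longrightarrow> \<bar>g x\<bar> \<le> e"
  shows "\<bar>\<integral>x. f x * g x \<partial>M\<bar> \<le> C * e"
proof -
  have i: "integrable M (\<lambda>x. f x * g x)" using assms by (intro Cont_integrable Cont_intros)
  have "\<bar>\<integral>x. f x * g x \<partial>M\<bar> \<le> (\<integral>x. \<bar>f x * g x\<bar> \<partial>M)" by (rule integral_abs_bound)
  also have "\<dots> \<le> (\<integral>x. C * e \<partial>M)"
  proof (rule integral_mono)
    fix x assume "x \<in> space M"
    then have "\<bar>f x\<bar> * \<bar>g x\<bar> \<le> C * e" using assms(3,4)[of x]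
      by (intro mult_mono) (auto simp: space_M)
    then show "\<bar>f x * g x\<bar> \<le> C * e" by (simp add: abs_mult)
  qed (use i in auto)
  also have "\<dots> = C * e" by (simp add: prob_space)
  finally show ?thesis .
qed

text \<open>Tube lemma: the open set of pairs \<open>(w, x)\<close> at which \<open>\<phi>\<close>
  changes by less than \<open>e\<close> contains the compact slice over the identity, hence a whole
  strip \<open>U\<close> times \<open>X\<close>.\<close>

lemma uniform_continuity:
  assumes "\<phi> \<in> Cont" "e > 0"
  obtains W where "nbhd W" "\<And>w x. w \<in> W \<Longrightarrow> x \<in> topspace X \<Longrightarrow> \<bar>\<phi> (act w x) - \<phi> x\<bar> < e"
proof -
  let ?F = "\<lambda>p. \<phi> (act (fst p) (snd p)) - \<phi> (snd p)"
  have 1: "continuous_map (prod_topology \<tau> X) euclideanreal ?F"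
  proof (rule continuous_map_diff)
    show "continuous_map (prod_topology \<tau> X) euclideanreal (\<lambda>p. \<phi> (act (fst p) (snd p)))"
      using continuous_map_compose[OF continuous_map_act[OF continuous_map_fst continuous_map_snd], of euclideanreal \<phi>]
        assms by (simp add: o_def Cont_def)
    show "continuous_map (prod_topology \<tau> X) euclideanreal (\<lambda>p. \<phi> (snd p))"
      using continuous_map_compose[OF continuous_map_snd, of X euclideanreal \<phi>] assms by (simp add: o_def Cont_def)
  qed
  define O1 where "O1 = {p \<in> topspace (prod_topology \<tau> X). ?F p \<in> {-e<..<e}}"
  have "openin (prod_topology \<tau> X) O1"
    unfolding O1_def by (rule openin_continuous_map_preimage[OF 1]) auto
  moreover have "{\<one>} \<times> topspace X \<subseteq> O1" using assms by (auto simp: O1_def act_one topspace_group)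
  ultimately obtain U V where UV: "openin \<tau> U" "\<one> \<in> U" "topspace X \<subseteq> V" "U \<times> V \<subseteq> O1"
    using tube_lemma_right[of \<tau> X O1 "topspace X" "\<one>"] compact
    by (auto simp: compact_space_def topspace_group)
  show thesis
  proof (rule that[of U])
    show "nbhd U" using UV by (simp add: nbhd_def)
    fix w x assume "w \<in> U" "x \<in> topspace X"
    then have "(w, x) \<in> O1" using UV by auto
    then show "\<bar>\<phi> (act w x) - \<phi> x\<bar> < e" by (auto simp: O1_def)
  qed
qed

section \<open>Orbits of open sets and their measure\<close>

lemma open_orbit:
  assumes "openin \<tau> W" "x \<in> topspace X"
  shows "openin X ((\<lambda>w. act w x) ` W)"
proof -
  obtain g where g: "g \<in> carrier G" "x = act g x0" using transitive[OF assms(2)] by auto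
  have W: "W \<subseteq> carrier G" using assms openin_subset topspace_group by fastforce
  have "(\<lambda>w. act w x) ` W = (\<lambda>g. act g x0) ` (\<lambda>w. w \<otimes> g) ` W"
    unfolding image_image using g W x0 by (intro image_cong) (auto simp: act_mult)
  then show ?thesis using orbit_open openin_right_translate[OF assms(1) g(1)] by simp
qed

lemma act_image_eq: "g \<in> carrier G \<Longrightarrow> U \<subseteq> topspace X \<Longrightarrow> act g ` U = act (inv g) -` U \<inter> topspace X"
  by (force intro: image_eqI[of _ _ "act (inv g) _"])

lemma openin_act_image: "g \<in> carrier G \<Longrightarrow> openin X U \<Longrightarrow> openin X (act g ` U)"
  using openin_continuous_map_preimage[OF continuous_act1[of "inv g"], of U] openin_subset[of X U]
  by (simp add: act_image_eq vimage_def Collect_conj_eq Int_commute)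

lemma measure_act_image:
  assumes "g \<in> carrier G" "U \<in> sets M"
  shows "act g ` U \<in> sets M" "measure M (act g ` U) = measure M U"
proof -
  have U: "U \<subseteq> topspace X" using sets.sets_into_space[OF assms(2)] by (simp add: space_M)
  have m: "act (inv g) \<in> measurable M M" using assms by simp
  have eq: "act g ` U = act (inv g) -` U \<inter> space M" using act_image_eq[OF assms(1) U] by (simp add: space_M)
  show "act g ` U \<in> sets M" unfolding eq using m assms(2) by (rule measurable_sets)
  have "measure M U = measure (distr M M (act (inv g))) U" using invariant[of "inv g"] assms by simp
  also have "\<dots> = measure M (act g ` U)" unfolding eq using m assms(2) by (rule measure_distr)
  finally show "measure M (act g ` U) = measure M U" by simp
qed

text \<open>By transitivity the translates of a nonempty open set cover \<open>X\<close>, by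
  compactness finitely many suffice, and all have the same measure; a null set cannot exhaust a
  probability space in this way.\<close>

lemma open_positive:
  assumes "openin X U" "U \<noteq> {}"
  shows "measure M U > 0"
proof (rule ccontr)
  assume "\<not> measure M U > 0"
  then have 0: "measure M U = 0" by (simp add: zero_less_measure_iff)
  have cov: "topspace X \<subseteq> \<Union>((\<lambda>g. act g ` U) ` carrier G)"
  proof
    fix x assume x: "x \<in> topspace X"
    obtain u where u: "u \<in> U" "u \<in> topspace X" using assms openin_subset by fastforce
    obtain g h where gh: "g \<in> carrier G" "x = act g x0" "h \<in> carrier G" "u = act h x0"
      using transitive x u by metis
    then have "x = act (g \<otimes> inv h) u" using x0 by (simp add: act_mult)
    then show "x \<in> \<Union>((\<lambda>g. act g ` U) ` carrier G)" using gh u by blast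
  qed
  obtain F where F: "finite F" "F \<subseteq> (\<lambda>g. act g ` U) ` carrier G" "topspace X \<subseteq> \<Union>F"
    using compactinD[OF compact[unfolded compact_space_def], of "(\<lambda>g. act g ` U) ` carrier G"] cov
      openin_act_image assms(1) by blast
  have z: "V \<in> sets M \<and> measure M V = 0" if "V \<in> F" for V
    using that F(2) measure_act_image[OF _ open_sets[OF assms(1)]] 0 by auto
  have "measure M (\<Union>V\<in>F. V) \<le> (\<Sum>V\<in>F. measure M V)"
    using z F by (intro finite_measure_subadditive_finite) auto
  also have "\<dots> = 0" using z by simp
  finally have "measure M (\<Union>V\<in>F. V) \<le> 0" .
  moreover have "(\<Union>V\<in>F. V) = space M"
    using F(3) z sets.sets_into_space by (fastforce simp: space_M)
  ultimately show False by (simp add: prob_space)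
qed

text \<open>Finitely many sets \<open>V y\<close> cover \<open>X\<close>, and \<open>d\<close> is
  the least of their measures. If \<open>x = v y\<close> with \<open>v\<close> in \<open>V\<close>,
  then every \<open>u y\<close> equals \<open>u v^-1 x\<close>, so the whole of \<open>V y\<close>
  lies in the \<open>W\<close>-orbit of \<open>x\<close>.\<close>

lemma orbit_measure_lower_bound:
  assumes "nbhd W"
  obtains d where "d > 0" "\<And>x. x \<in> topspace X \<Longrightarrow> d \<le> measure M ((\<lambda>w. act w x) ` W)"
proof -
  obtain V where V: "nbhd V" "\<And>v w. v \<in> V \<Longrightarrow> w \<in> V \<Longrightarrow> v \<otimes> inv w \<in> W"
    using nbhd_quotient[OF assms] by metis
  let ?O = "\<lambda>x. (\<lambda>w. act w x) ` V"
  have op: "openin X (?O x)" if "x \<in> topspace X" for x using V that by (intro open_orbit) (auto simp: nbhd_def)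
  have self: "x \<in> ?O x" if "x \<in> topspace X" for x
    using V act_one[OF that] by (auto simp: nbhd_def intro: rev_image_eqI[of "\<one>"])
  have "topspace X \<subseteq> \<Union>(?O ` topspace X)" using self by blast
  then obtain F where F: "finite F" "F \<subseteq> ?O ` topspace X" "topspace X \<subseteq> \<Union>F"
    using compactinD[OF compact[unfolded compact_space_def], of "?O ` topspace X"] op by blast
  define d where "d = Min (measure M ` F)"
  have "F \<noteq> {}" using F x0 by auto
  have pos: "measure M A > 0" if "A \<in> F" for A
    using that F op self open_positive by blast
  have "d > 0" unfolding d_def using pos F(1) \<open>F \<noteq> {}\<close> by (subst Min_gr_iff) auto
  moreover have "d \<le> measure M ((\<lambda>w. act w x) ` W)" if x: "x \<in> topspace X" for x
  proof -
    obtain y where y: "y \<in> topspace X" "x \<in> ?O y" "?O y \<in> F" using F x by blast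
    then obtain v where v: "v \<in> V" "x = act v y" by auto
    have vc: "v \<in> carrier G" using V v nbhd_carrier by auto
    have "?O y \<subseteq> (\<lambda>w. act w x) ` W"
    proof
      fix z assume "z \<in> ?O y"
      then obtain u where u: "u \<in> V" "z = act u y" by auto
      have uc: "u \<in> carrier G" using V u nbhd_carrier by auto
      have "z = act (u \<otimes> inv v) x" using u v vc uc y by (simp add: act_mult)
      then show "z \<in> (\<lambda>w. act w x) ` W" using V(2)[OF u(1) v(1)] by blast
    qed
    then have "measure M (?O y) \<le> measure M ((\<lambda>w. act w x) ` W)"
      using x assms by (intro finite_measure_mono open_sets open_orbit) (auto simp: nbhd_def)
    moreover have "d \<le> measure M (?O y)" unfolding d_def using y F(1) by (intro Min_le) auto
    ultimately show ?thesis by simp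
  qed
  ultimately show thesis by (rule that)
qed

text \<open>Equicontinuity converts smallness in \<open>L\<^sup>2\<close> into uniform smallness.\<close>

lemma equicontinuous_sup_bound:
  assumes "nbhd W"
  obtains d where "d > 0"
    "\<And>\<psi> e x. \<psi> \<in> Cont \<Longrightarrow> (\<And>w x. w \<in> W \<Longrightarrow> x \<in> topspace X \<Longrightarrow> \<bar>\<psi> (act w x) - \<psi> x\<bar> \<le> e) \<Longrightarrow>
       (\<integral>x. (\<psi> x)\<^sup>2 \<partial>M) \<le> d * e\<^sup>2 \<Longrightarrow> x \<in> topspace X \<Longrightarrow> \<bar>\<psi> x\<bar> \<le> 2 * e"
proof -
  obtain d where d: "d > 0" "\<And>x. x \<in> topspace X \<Longrightarrow> d \<le> measure M ((\<lambda>w. act w x) ` W)"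
    using orbit_measure_lower_bound[OF assms] by metis
  show thesis
  proof (rule that[of d])
    fix \<psi> e x assume \<psi>: "\<psi> \<in> Cont" and osc: "\<And>w x. w \<in> W \<Longrightarrow> x \<in> topspace X \<Longrightarrow> \<bar>\<psi> (act w x) - \<psi> x\<bar> \<le> e"
      and int: "(\<integral>x. (\<psi> x)\<^sup>2 \<partial>M) \<le> d * e\<^sup>2" and x: "x \<in> topspace X"
    have e: "e \<ge> 0" using osc[of "\<one>" x] x assms by (auto simp: nbhd_def)
    show "\<bar>\<psi> x\<bar> \<le> 2 * e"
    proof (rule ccontr)
      assume gt: "\<not> \<bar>\<psi> x\<bar> \<le> 2 * e"
      \<comment> \<open>On the \<open>W\<close>-orbit of \<open>x\<close> the oscillation bound
        keeps \<open>\<bar>\<psi>\<bar>\<close> above \<open>c\<close>. That orbit has measure at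
        least \<open>d\<close>, so \<open>c > e\<close> would push the integral beyond
        \<open>d * e\<^sup>2\<close>.\<close>
      define c where "c = \<bar>\<psi> x\<bar> - e"
      have c: "c > e" using gt by (simp add: c_def)
      let ?A = "(\<lambda>w. act w x) ` W"
      have A: "?A \<in> sets M" using x assms by (intro open_sets open_orbit) (auto simp: nbhd_def)
      have "c\<^sup>2 * measure M ?A = (\<integral>y. indicator ?A y * c\<^sup>2 \<partial>M)" using A by simp
      also have "\<dots> \<le> (\<integral>y. (\<psi> y)\<^sup>2 \<partial>M)"
      proof (rule integral_mono)
        fix y assume "y \<in> space M"
        show "indicator ?A y * c\<^sup>2 \<le> (\<psi> y)\<^sup>2"
        proof (cases "y \<in> ?A")
          case True
          then have "c \<le> \<bar>\<psi> y\<bar>" using osc[OF _ x] by (fastforce simp: c_def)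
          then have "c\<^sup>2 \<le> \<bar>\<psi> y\<bar>\<^sup>2" using c e by (intro power_mono) auto
          then show ?thesis using True by simp
        qed simp
      qed (use A \<psi> in \<open>auto intro!: Cont_integrable Cont_intros simp: less_top[symmetric]\<close>)
      finally have "c\<^sup>2 * measure M ?A \<le> d * e\<^sup>2" using int by simp
      moreover have "c\<^sup>2 * d \<le> c\<^sup>2 * measure M ?A" using d(2)[OF x] by (intro mult_left_mono) auto
      moreover have "e\<^sup>2 < c\<^sup>2" using c e by (intro power_strict_mono) auto
      ultimately show False using d(1) by (smt (verit) mult.commute mult_less_cancel_left_pos)
    qed
  qed fact
qed

end

section \<open>Actions of nilpotent groups\<close>

text \<open>Stands for \<open>z = y1^n ... ym^n w\<close> together with
  \<open>P = y1 ... ym\<close>, where all \<open>yi\<close> and \<open>w\<close> belong to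
  \<open>W\<close>. The factors themselves are not recorded: a homomorphism into an abelian group
  sends \<open>z\<close> to the \<open>n\<close>-th power of the image of \<open>P\<close> times the
  image of \<open>w\<close>.\<close>

inductive root_product :: "('g, 'r) monoid_scheme \<Rightarrow> 'g set \<Rightarrow> nat \<Rightarrow> 'g \<Rightarrow> 'g \<Rightarrow> 'g \<Rightarrow> bool"
  for G (structure) and W n where
  base: "w \<in> W \<Longrightarrow> root_product G W n w \<one> w"
| step: "root_product G W n z P w \<Longrightarrow> y \<in> W \<Longrightarrow> root_product G W n (y [^] n \<otimes> z) (y \<otimes> P) w"

context filtered_group
begin

text \<open>A homomorphism from \<open>D\<close> into the abelian group \<open>L k\<close> modulo
  \<open>L (Suc k)\<close>, represented by a lift with values in the group itself so that quotient
  groups need not be formed.\<close>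

definition quasi_hom :: "nat \<Rightarrow> 'a set \<Rightarrow> ('a \<Rightarrow> 'a) \<Rightarrow> bool" where
  "quasi_hom k D \<theta> \<longleftrightarrow> subgroup D G \<and> (\<forall>x\<in>D. \<theta> x \<in> L k) \<and>
     (\<forall>x\<in>D. \<forall>y\<in>D. lcong (Suc k) (\<theta> (x \<otimes> y)) (\<theta> x \<otimes> \<theta> y))"

lemma quasi_homD:
  assumes "quasi_hom k D \<theta>"
  shows "subgroup D G" "x \<in> D \<Longrightarrow> \<theta> x \<in> L k" "x \<in> D \<Longrightarrow> \<theta> x \<in> carrier G"
    "x \<in> D \<Longrightarrow> y \<in> D \<Longrightarrow> lcong (Suc k) (\<theta> (x \<otimes> y)) (\<theta> x \<otimes> \<theta> y)"
  using assms L_carrier by (auto simp: quasi_hom_def)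

lemma lcong_cancel_left:
  assumes "lcong k (a \<otimes> x) (a \<otimes> y)" "a \<in> carrier G" "x \<in> carrier G" "y \<in> carrier G"
  shows "lcong k x y"
  using lcong_mult[OF lcong_refl[of "inv a" k] assms(1)] assms by simp

lemma quasi_hom_one: assumes "quasi_hom k D \<theta>" shows "lcong (Suc k) (\<theta> \<one>) \<one>"
proof -
  note q = quasi_homD[OF assms]
  have one: "\<one> \<in> D" using q(1) by (rule subgroup.one_closed)
  have "lcong (Suc k) (\<theta> \<one> \<otimes> \<one>) (\<theta> \<one> \<otimes> \<theta> \<one>)" using q(4)[OF one one] q(3)[OF one] by simp
  then have "lcong (Suc k) \<one> (\<theta> \<one>)" by (rule lcong_cancel_left) (use q(3)[OF one] in auto)
  then show ?thesis by (rule lcong_sym)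
qed

lemma quasi_hom_inv: assumes "quasi_hom k D \<theta>" "x \<in> D" shows "lcong (Suc k) (\<theta> (inv x)) (inv (\<theta> x))"
proof -
  note q = quasi_homD[OF assms(1)]
  have i: "inv x \<in> D" using subgroup.m_inv_closed[OF q(1) assms(2)] .
  have xc: "x \<in> carrier G" using subgroup.mem_carrier[OF q(1) assms(2)] .
  have "lcong (Suc k) (\<theta> x \<otimes> \<theta> (inv x)) (\<theta> (x \<otimes> inv x))" using q(4)[OF assms(2) i] by (rule lcong_sym)
  also have "lcong (Suc k) \<dots> \<one>" using quasi_hom_one[OF assms(1)] xc by simp
  finally have "lcong (Suc k) (\<theta> x \<otimes> \<theta> (inv x)) (\<theta> x \<otimes> inv (\<theta> x))" using q(3)[OF assms(2)] by simp
  then show ?thesis by (rule lcong_cancel_left) (use q(3)[OF assms(2)] q(3)[OF i] in auto)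
qed

lemma quasi_hom_pow:
  assumes "quasi_hom k D \<theta>" "x \<in> D"
  shows "lcong (Suc k) (\<theta> (x [^] (n::nat))) (\<theta> x [^] n)"
proof (induction n)
  case 0 then show ?case using quasi_hom_one[OF assms(1)] by simp
next
  case (Suc n)
  note q = quasi_homD[OF assms(1)]
  have p: "x [^] n \<in> D" for n :: nat
    by (induction n) (auto intro: subgroup.one_closed[OF q(1)] subgroup.m_closed[OF q(1)] assms(2))
  have "lcong (Suc k) (\<theta> (x [^] n \<otimes> x)) (\<theta> (x [^] n) \<otimes> \<theta> x)" by (rule q(4)[OF p assms(2)])
  also have "lcong (Suc k) \<dots> (\<theta> x [^] n \<otimes> \<theta> x)"
    using Suc.IH q(3)[OF assms(2)] by (intro lcong_mult lcong_refl)
  finally show ?case by simp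
qed

lemma L_pow: "x \<in> L k \<Longrightarrow> x [^] (n::nat) \<in> L k"
  by (induction n) (auto intro: L_mult)

lemma lcong_pow_mult:
  assumes "u \<in> L k" "v \<in> L k"
  shows "lcong (Suc k) ((u \<otimes> v) [^] (n::nat)) (u [^] n \<otimes> v [^] n)"
proof (induction n)
  case (Suc n)
  have c: "u \<in> carrier G" "v \<in> carrier G" using assms L_carrier by auto
  have "lcong (Suc k) ((u \<otimes> v) [^] n \<otimes> (u \<otimes> v)) (u [^] n \<otimes> v [^] n \<otimes> (u \<otimes> v))"
    using Suc c by (intro lcong_mult lcong_refl) auto
  also have "u [^] n \<otimes> v [^] n \<otimes> (u \<otimes> v) = u [^] n \<otimes> ((v [^] n \<otimes> u) \<otimes> v)" using c by (simp add: m_assoc)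
  also have "lcong (Suc k) \<dots> (u [^] n \<otimes> ((u \<otimes> v [^] n) \<otimes> v))"
    using assms c by (intro lcong_mult lcong_refl lcong_commute L_pow) auto
  also have "u [^] n \<otimes> ((u \<otimes> v [^] n) \<otimes> v) = u [^] Suc n \<otimes> v [^] Suc n" using c by (simp add: m_assoc)
  finally show ?case by simp
qed (simp add: lcong_refl)

text \<open>Since the target is abelian modulo \<open>L (Suc k)\<close>, the powers of the images of
  the individual factors can be collected into one power of the image of \<open>P\<close>. The order
  of the factors is lost, the exponent \<open>n\<close> is not.\<close>

lemma quasi_hom_root_product:
  assumes q: "quasi_hom k D \<theta>" and W: "W \<subseteq> D" and r: "root_product G W n z P w"
  shows "z \<in> D \<and> P \<in> D \<and> w \<in> W \<and> lcong (Suc k) (\<theta> z) (\<theta> P [^] n \<otimes> \<theta> w)"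
  using r
proof (induction rule: root_product.induct)
  case (base w)
  note q' = quasi_homD[OF q]
  have c: "\<theta> w \<in> carrier G" "\<theta> \<one> \<in> carrier G" using base W q'(3) subgroup.one_closed[OF q'(1)] by auto
  have "lcong (Suc k) (\<theta> \<one> [^] n) (\<one> [^] n)" using quasi_hom_one[OF q] by (rule lcong_pow)
  then have "lcong (Suc k) (\<theta> \<one> [^] n \<otimes> \<theta> w) (\<one> \<otimes> \<theta> w)" using c by (intro lcong_mult lcong_refl) auto
  then have "lcong (Suc k) (\<theta> w) (\<theta> \<one> [^] n \<otimes> \<theta> w)" using c lcong_sym by auto
  then show ?case using base W subgroup.one_closed[OF q'(1)] by auto
next
  case (step z P w y)
  note q' = quasi_homD[OF q]
  have y: "y \<in> D" using step W by auto
  have yn: "y [^] n \<in> D"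
    by (induction n) (auto intro: subgroup.one_closed[OF q'(1)] subgroup.m_closed[OF q'(1)] y)
  have z: "z \<in> D" and P: "P \<in> D" and w: "w \<in> D" using step W by auto
  note c = q'(3)[OF y] q'(3)[OF z] q'(3)[OF P] q'(3)[OF w]
  have "lcong (Suc k) (\<theta> (y [^] n \<otimes> z)) (\<theta> (y [^] n) \<otimes> \<theta> z)" by (rule q'(4)[OF yn z])
  also have "lcong (Suc k) \<dots> (\<theta> y [^] n \<otimes> (\<theta> P [^] n \<otimes> \<theta> w))"
    using step by (intro lcong_mult quasi_hom_pow[OF q y]) auto
  also have "\<theta> y [^] n \<otimes> (\<theta> P [^] n \<otimes> \<theta> w) = (\<theta> y [^] n \<otimes> \<theta> P [^] n) \<otimes> \<theta> w" using c by (simp add: m_assoc)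
  also have "lcong (Suc k) \<dots> ((\<theta> y \<otimes> \<theta> P) [^] n \<otimes> \<theta> w)"
    using c lcong_sym[OF lcong_pow_mult[OF q'(2)[OF y] q'(2)[OF P]]] by (intro lcong_mult lcong_refl) auto
  also have "lcong (Suc k) \<dots> (\<theta> (y \<otimes> P) [^] n \<otimes> \<theta> w)"
    using c lcong_sym[OF q'(4)[OF y P]] by (intro lcong_mult lcong_refl lcong_pow) auto
  finally show ?case
    using step y yn z P subgroup.m_closed[OF q'(1)] by blast
qed

lemma quasi_hom_lc_head:
  assumes "set ys \<subseteq> carrier G"
  shows "quasi_hom (length ys) N (\<lambda>x. lc x ys)"
  using assms lc_in_L[of _ 0 ys] lc_mult_head L_subgroup[of 0] by (auto simp: quasi_hom_def)

lemma quasi_hom_lc_slot: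
  assumes "x \<in> N" "set ps \<subseteq> carrier G" "set qs \<subseteq> carrier G"
  shows "quasi_hom (Suc (length ps + length qs)) (carrier G) (\<lambda>y. lc x (ps @ y # qs))"
proof -
  have "lc x (ps @ y # qs) \<in> L (Suc (length ps + length qs))" if "y \<in> carrier G" for y
    using lc_in_L[of x 0 "ps @ y # qs"] assms that by simp
  then show ?thesis using assms lc_mult_slot[of x ps _ _ qs] subgroup_self by (simp add: quasi_hom_def)
qed

lemma quasi_hom_commutator:
  assumes "u \<in> L k"
  shows "quasi_hom (Suc k) (carrier G) (commutator G u)"
  using assms commutator_in_L commutator_lcong_mult_right subgroup_self by (simp add: quasi_hom_def)

lemma quasi_hom_subset: "quasi_hom k D \<theta> \<Longrightarrow> E \<subseteq> D \<Longrightarrow> subgroup E G \<Longrightarrow> quasi_hom k E \<theta>"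
  by (auto simp: quasi_hom_def)

end

text \<open>Of the Lie structure only the approximate divisibility expressed by \<open>roots\<close> is needed.\<close>

locale nil_action =
  transitive_action G \<tau> X act M x0 + filtered_group G N
  for G (structure) and \<tau> and X :: "'x topology" and act M x0 N +
  fixes b :: 'a and B :: "'a set" and s :: nat
  assumes b_carrier [simp]: "b \<in> carrier G"
    and generated: "subgroup S G \<Longrightarrow> N \<subseteq> S \<Longrightarrow> b \<in> S \<Longrightarrow> carrier G \<subseteq> S"
    and N_open: "openin \<tau> N"
    and B_subset: "B \<subseteq> N"
    and B_generates: "subgroup S G \<Longrightarrow> B \<subseteq> S \<Longrightarrow> N \<subseteq> S"
    and roots: "z \<in> B \<Longrightarrow> nbhd W \<Longrightarrow> \<exists>n0. \<forall>n\<ge>n0. \<exists>P w. root_product G W n z P w \<and> P \<in> W"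
    and nilpotent: "comm_series G N s = {\<one>}"
    and ergodic_b: "ergodic M (act b)"
begin

lemma nbhd_N: "nbhd N" using N_open L_one[of 0] by (simp add: nbhd_def)

lemma N_carrier: "x \<in> N \<Longrightarrow> x \<in> carrier G" using L_carrier[of x 0] by simp
lemma subgroup_N: "subgroup N G" using L_subgroup[of 0] by simp

section \<open>Asymptotic correlations and the subgroups \<open>R k\<close>\<close>

definition I :: "nat \<Rightarrow> ('x \<Rightarrow> real) \<Rightarrow> ('x \<Rightarrow> real) \<Rightarrow> real" where
  "I n f g = (\<integral>x. f (act (b [^] n) x) * g x \<partial>M)"

definition CI :: "nat \<Rightarrow> ('x \<Rightarrow> real) set" where
  "CI k = {g \<in> Cont. \<forall>z\<in>L k. \<forall>x\<in>topspace X. g (act z x) = g x}"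

text \<open>The test functions \<open>g\<close> are restricted to \<open>CI (Suc k)\<close>, so that
  membership depends only on the class modulo \<open>L (Suc k)\<close>. Computations with
  \<open>R k\<close> may therefore be done in an abelian quotient.\<close>

definition R :: "nat \<Rightarrow> 'a set" where
  "R k = {z \<in> L k. \<forall>f\<in>Cont. \<forall>g\<in>CI (Suc k). (\<lambda>n. I n f (\<lambda>x. g (act z x)) - I n f g) \<longlonglongrightarrow> 0}"

lemma CI_Cont: "g \<in> CI k \<Longrightarrow> g \<in> Cont" by (simp add: CI_def)

lemma CI_lcong:
  assumes "g \<in> CI k" "lcong k z z'" "x \<in> topspace X"
  shows "g (act z x) = g (act z' x)"
proof -
  have c: "z \<in> carrier G" "z' \<in> carrier G" "z \<otimes> inv z' \<in> L k" using assms by (auto simp: lcong_def)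
  have "act z x = act (z \<otimes> inv z') (act z' x)" using c assms by (simp add: m_assoc flip: act_mult)
  then show ?thesis using c assms by (simp add: CI_def)
qed

lemma CI_act:
  assumes "g \<in> CI k" "z \<in> carrier G"
  shows "(\<lambda>x. g (act z x)) \<in> CI k"
proof -
  have "g (act z (act l x)) = g (act z x)" if l: "l \<in> L k" and x: "x \<in> topspace X" for l x
  proof -
    have lc: "l \<in> carrier G" using l L_carrier by auto
    have "lcong k (z \<otimes> l) (z \<otimes> \<one>)" using l assms by (intro lcong_mult lcong_refl lcong_one) auto
    then show ?thesis using CI_lcong[OF assms(1) _ x, of "z \<otimes> l" z] lc assms x by (simp add: act_mult)
  qed
  then show ?thesis using assms Cont_act by (auto simp: CI_def)
qed

lemma I_cong: "(\<And>x. x \<in> topspace X \<Longrightarrow> g x = g' x) \<Longrightarrow> I n f g = I n f g'"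
  unfolding I_def by (intro Bochner_Integration.integral_cong) (auto simp: space_M)

lemma I_integrable: "f \<in> Cont \<Longrightarrow> g \<in> Cont \<Longrightarrow> integrable M (\<lambda>x. f (act (b [^] (n::nat)) x) * g x)"
  by (intro Cont_integrable Cont_intros Cont_act) auto

lemma I_diff: "f \<in> Cont \<Longrightarrow> g \<in> Cont \<Longrightarrow> h \<in> Cont \<Longrightarrow> I n f (\<lambda>x. g x - h x) = I n f g - I n f h"
  unfolding I_def using I_integrable[of f g n] I_integrable[of f h n] by (simp add: right_diff_distrib)

lemma I_add: "f \<in> Cont \<Longrightarrow> g \<in> Cont \<Longrightarrow> h \<in> Cont \<Longrightarrow> I n f (\<lambda>x. g x + h x) = I n f g + I n f h"
  unfolding I_def using I_integrable[of f g n] I_integrable[of f h n] by (simp add: distrib_left)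

lemma I_scale: "I n f (\<lambda>x. g x * c) = I n f g * c"
  unfolding I_def by (simp flip: mult.assoc)

lemma I_close:
  assumes "f \<in> Cont" "g \<in> Cont" "h \<in> Cont" "\<And>x. x \<in> topspace X \<Longrightarrow> \<bar>f x\<bar> \<le> C"
    "\<And>x. x \<in> topspace X \<Longrightarrow> \<bar>g x - h x\<bar> \<le> e"
  shows "\<bar>I n f g - I n f h\<bar> \<le> C * e"
proof -
  have "\<bar>I n f (\<lambda>x. g x - h x)\<bar> \<le> C * e" unfolding I_def
    using assms by (intro integral_Cont_bound Cont_act Cont_intros) auto
  then show ?thesis using assms by (simp add: I_diff)
qed

lemma R_L: "z \<in> R k \<Longrightarrow> z \<in> L k" by (simp add: R_def)
lemma R_carrier: "z \<in> R k \<Longrightarrow> z \<in> carrier G" using R_L L_carrier by blast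

lemma R_tendsto:
  "z \<in> R k \<Longrightarrow> f \<in> Cont \<Longrightarrow> g \<in> CI (Suc k) \<Longrightarrow> (\<lambda>n. I n f (\<lambda>x. g (act z x)) - I n f g) \<longlonglongrightarrow> 0"
  by (simp add: R_def)

text \<open>The terms of the series are normal, so a translate of a function in
  \<open>CI (Suc k)\<close> is again one. For inverses and products it is this translate to which
  the defining limit is applied.\<close>

lemma R_subgroup: "subgroup (R k) G"
proof (rule subgroupI)
  show "R k \<subseteq> carrier G" using R_carrier by auto
  have "I n f (\<lambda>x. g (act \<one> x)) = I n f g" for n f g by (rule I_cong) (simp add: act_one)
  then have "\<one> \<in> R k" by (simp add: R_def)
  then show "R k \<noteq> {}" by blast
next
  fix z assume z: "z \<in> R k"
  have zc: "z \<in> carrier G" using z R_carrier by blast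
  have "(\<lambda>n. I n f (\<lambda>x. g (act (inv z) x)) - I n f g) \<longlonglongrightarrow> 0"
    if f: "f \<in> Cont" and g: "g \<in> CI (Suc k)" for f g
  proof -
    have "(\<lambda>n. I n f (\<lambda>x. g (act (inv z) (act z x))) - I n f (\<lambda>x. g (act (inv z) x))) \<longlonglongrightarrow> 0"
      using R_tendsto[OF z f CI_act[OF g]] zc by simp
    moreover have "I n f (\<lambda>x. g (act (inv z) (act z x))) = I n f g" for n
      by (rule I_cong) (use zc in simp)
    ultimately have "(\<lambda>n. - (I n f g - I n f (\<lambda>x. g (act (inv z) x)))) \<longlonglongrightarrow> - 0" by (intro tendsto_minus) simp
    then show ?thesis by simp
  qed
  then show "inv z \<in> R k" using z L_inv by (simp add: R_def)
next
  fix z y assume z: "z \<in> R k" and y: "y \<in> R k"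
  have c: "z \<in> carrier G" "y \<in> carrier G" using z y R_carrier by auto
  have "(\<lambda>n. I n f (\<lambda>x. g (act (z \<otimes> y) x)) - I n f g) \<longlonglongrightarrow> 0"
    if f: "f \<in> Cont" and g: "g \<in> CI (Suc k)" for f g
  proof -
    have "(\<lambda>n. I n f (\<lambda>x. g (act z (act y x))) - I n f (\<lambda>x. g (act z x))) \<longlonglongrightarrow> 0"
      by (rule R_tendsto[OF y f CI_act[OF g c(1)]])
    from tendsto_add[OF this R_tendsto[OF z f g]]
    have "(\<lambda>n. I n f (\<lambda>x. g (act z (act y x))) - I n f g) \<longlonglongrightarrow> 0" by simp
    moreover have "I n f (\<lambda>x. g (act (z \<otimes> y) x)) = I n f (\<lambda>x. g (act z (act y x)))" for n
      by (rule I_cong) (use c in \<open>simp add: act_mult\<close>)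
    ultimately show ?thesis by simp
  qed
  then show "z \<otimes> y \<in> R k" using z y L_mult by (simp add: R_def)
qed

lemma L_Suc_R: "L (Suc k) \<subseteq> R k"
proof
  fix z assume z: "z \<in> L (Suc k)"
  have "I n f (\<lambda>x. g (act z x)) = I n f g" if "g \<in> CI (Suc k)" for n f g
    by (rule I_cong) (use z that in \<open>simp add: CI_def\<close>)
  then show "z \<in> R k" using z L_Suc_subset[of k] by (auto simp: R_def)
qed

lemma R_lcong: assumes "lcong (Suc k) z z'" "z' \<in> R k" shows "z \<in> R k"
proof -
  have "z \<otimes> inv z' \<otimes> z' \<in> R k"
    using assms L_Suc_R[of k] by (intro subgroup.m_closed[OF R_subgroup, of "z \<otimes> inv z'"]) (auto simp: lcong_def)
  then show ?thesis using assms by (simp add: lcong_def m_assoc)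
qed

text \<open>Turns a claim about the values of \<open>\<theta>\<close> into one about a subgroup of
  \<open>D\<close>, which then only has to be checked on generators.\<close>

lemma quasi_hom_preimage_R:
  assumes "quasi_hom k D \<theta>"
  shows "subgroup {x \<in> D. \<theta> x \<in> R k} G"
proof (rule subgroupI)
  note q = quasi_homD[OF assms]
  show "{x \<in> D. \<theta> x \<in> R k} \<subseteq> carrier G" using subgroup.subset[OF q(1)] by auto
  have "\<theta> \<one> \<in> R k" using R_lcong[OF quasi_hom_one[OF assms]] subgroup.one_closed[OF R_subgroup] .
  then show "{x \<in> D. \<theta> x \<in> R k} \<noteq> {}" using subgroup.one_closed[OF q(1)] by blast
next
  note q = quasi_homD[OF assms]
  fix a assume a: "a \<in> {x \<in> D. \<theta> x \<in> R k}"
  then show "inv a \<in> {x \<in> D. \<theta> x \<in> R k}"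
    using R_lcong[OF quasi_hom_inv[OF assms]] subgroup.m_inv_closed[OF q(1)] subgroup.m_inv_closed[OF R_subgroup]
    by simp
next
  note q = quasi_homD[OF assms]
  fix x y assume "x \<in> {x \<in> D. \<theta> x \<in> R k}" "y \<in> {x \<in> D. \<theta> x \<in> R k}"
  then show "x \<otimes> y \<in> {x \<in> D. \<theta> x \<in> R k}"
    using R_lcong[OF q(4)] subgroup.m_closed[OF q(1)] subgroup.m_closed[OF R_subgroup] by simp
qed

lemma R_test:
  assumes "z \<in> L k"
    and "\<And>f g e. f \<in> Cont \<Longrightarrow> g \<in> CI (Suc k) \<Longrightarrow> e > 0 \<Longrightarrow>
      \<exists>n0. \<forall>n\<ge>n0. \<bar>I n f (\<lambda>x. g (act z x)) - I n f g\<bar> < e"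
  shows "z \<in> R k"
proof -
  have "(\<lambda>n. I n f (\<lambda>x. g (act z x)) - I n f g) \<longlonglongrightarrow> 0"
    if "f \<in> Cont" "g \<in> CI (Suc k)" for f g
    using assms(2)[OF that] by (simp add: LIMSEQ_def dist_real_def)
  then show ?thesis using assms(1) by (simp add: R_def)
qed

text \<open>A factor \<open>v\<close> near the identity changes \<open>g\<close> uniformly little,
  and the resulting change of \<open>I n f g\<close> is small uniformly in \<open>n\<close>. Thus
  only the limit for the single element \<open>r\<close> enters.\<close>

lemma R_closed:
  assumes z: "z \<in> L k" and ex: "\<And>V. nbhd V \<Longrightarrow> \<exists>v\<in>V. \<exists>r\<in>R k. lcong (Suc k) z (v \<otimes> r)"
  shows "z \<in> R k"
proof (rule R_test[OF z])
  fix f g and e :: real assume f: "f \<in> Cont" and g: "g \<in> CI (Suc k)" and e: "e > 0"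
  obtain C where C: "C > 0" "\<And>x. x \<in> topspace X \<Longrightarrow> \<bar>f x\<bar> \<le> C" using Cont_bounded[OF f] by metis
  obtain V where V: "nbhd V" "\<And>w x. w \<in> V \<Longrightarrow> x \<in> topspace X \<Longrightarrow> \<bar>g (act w x) - g x\<bar> < e / (2 * C)"
    using uniform_continuity[OF CI_Cont[OF g], of "e / (2 * C)"] e C by auto
  obtain v r where vr: "v \<in> V" "r \<in> R k" "lcong (Suc k) z (v \<otimes> r)" using ex[OF V(1)] by auto
  have c: "v \<in> carrier G" "r \<in> carrier G" using vr V nbhd_carrier R_carrier by auto
  obtain n0 where n0: "\<forall>n\<ge>n0. \<bar>I n f (\<lambda>x. g (act r x)) - I n f g\<bar> < e / 2"
    using R_tendsto[OF vr(2) f g] e by (auto simp: LIMSEQ_def dist_real_def dest!: spec[of _ "e / 2"])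
  have "\<bar>I n f (\<lambda>x. g (act z x)) - I n f (\<lambda>x. g (act r x))\<bar> \<le> C * (e / (2 * C))" for n
  proof (rule I_close)
    fix x assume x: "x \<in> topspace X"
    have "g (act z x) = g (act v (act r x))" using CI_lcong[OF g vr(3) x] c x by (simp add: act_mult)
    then show "\<bar>g (act z x) - g (act r x)\<bar> \<le> e / (2 * C)" using V(2)[OF vr(1), of "act r x"] c x by simp
  qed (use f C CI_Cont[OF CI_act[OF g]] c L_carrier[OF z] in auto)
  then have "\<bar>I n f (\<lambda>x. g (act z x)) - I n f (\<lambda>x. g (act r x))\<bar> \<le> e / 2" for n using C by simp
  then show "\<exists>n0. \<forall>n\<ge>n0. \<bar>I n f (\<lambda>x. g (act z x)) - I n f g\<bar> < e"
    using n0 by (intro exI[of _ n0]) (smt (verit) field_sum_of_halves)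
qed

text \<open>Replacing \<open>f\<close> by its translate under \<open>h\<close> is nearly free. On
  the other hand \<open>h B' = B' d h\<close>, where \<open>d\<close> is a conjugate of the
  commutator \<open>c\<close>, so a change of variables moves \<open>h\<close> and \<open>d\<close>
  over to \<open>g\<close>. There \<open>h\<close> is again nearly free and \<open>d\<close> acts
  like \<open>c\<close>, since \<open>g\<close> is \<open>L (Suc (Suc j))\<close>-invariant. The
  point of the bound is that it does not depend on \<open>n\<close>.\<close>

lemma mautner_bound:
  assumes h: "h \<in> L j" and f: "f \<in> Cont" and g: "g \<in> CI (Suc (Suc j))"
    and C: "\<And>x. x \<in> topspace X \<Longrightarrow> \<bar>f x\<bar> \<le> C" "\<And>x. x \<in> topspace X \<Longrightarrow> \<bar>g x\<bar> \<le> C"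
    and e: "\<And>x. x \<in> topspace X \<Longrightarrow> \<bar>f (act h x) - f x\<bar> \<le> e" "\<And>x. x \<in> topspace X \<Longrightarrow> \<bar>g (act h x) - g x\<bar> \<le> e"
  shows "\<bar>I n f (\<lambda>x. g (act (inv (commutator G h (b [^] n))) x)) - I n f g\<bar> \<le> 2 * C * e"
proof -
  define B' where "B' = b [^] n"
  define c where "c = commutator G h B'"
  define d where "d = inv B' \<otimes> c \<otimes> B'"
  have hc: "h \<in> carrier G" and bc: "B' \<in> carrier G" using h L_carrier by (auto simp: B'_def)
  have cL: "c \<in> L (Suc j)" unfolding c_def using h bc by (rule commutator_in_L)
  have cc: "c \<in> carrier G" and dc: "d \<in> carrier G" using hc bc by (auto simp: c_def d_def)
  have hb: "h \<otimes> B' = B' \<otimes> (d \<otimes> h)" using hc bc by (simp add: c_def d_def commutator_def m_assoc)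
  have gC: "g \<in> Cont" using g CI_Cont by blast
  \<comment> \<open>The intermediate quantity, which is evaluated in two ways: against
    \<open>I n f g\<close> by near invariance of \<open>f\<close>, and exactly by the substitution
    \<open>y = d h x\<close>.\<close>
  let ?J = "\<integral>x. f (act h (act B' x)) * g x \<partial>M"
  have "\<bar>(\<integral>x. (f (act h (act B' x)) - f (act B' x)) * g x \<partial>M)\<bar> \<le> e * C"
    using f gC hc bc C e
    by (intro integral_Cont_bound Cont_intros(2) Cont_act[of "\<lambda>x. f (act h x)"] Cont_act) auto
  moreover have "(\<integral>x. (f (act h (act B' x)) - f (act B' x)) * g x \<partial>M) = ?J - I n f g"
  proof -
    have "integrable M (\<lambda>x. f (act h (act B' x)) * g x)" "integrable M (\<lambda>x. f (act B' x) * g x)"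
      using f gC hc bc
      by (auto intro!: Cont_integrable Cont_intros(3) Cont_act[of "\<lambda>x. f (act h x)"] intro: Cont_act)
    then show ?thesis by (simp add: I_def B'_def left_diff_distrib)
  qed
  ultimately have 1: "\<bar>?J - I n f g\<bar> \<le> e * C" by simp
  let ?F = "\<lambda>y. f (act B' y) * g (act (inv (d \<otimes> h)) y)"
  have F: "?F \<in> Cont" using f gC hc bc dc by (intro Cont_intros Cont_act) auto
  have "?J = (\<integral>x. ?F (act (d \<otimes> h) x) \<partial>M)"
  proof (rule Bochner_Integration.integral_cong[OF refl])
    fix x assume "x \<in> space M"
    then have x: "x \<in> topspace X" by (simp add: space_M)
    have "act h (act B' x) = act B' (act (d \<otimes> h) x)" using hb hc bc dc x by (metis act_mult m_closed)
    moreover have "act (inv (d \<otimes> h)) (act (d \<otimes> h) x) = x" using hc dc x by simp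
    ultimately show "f (act h (act B' x)) * g x = ?F (act (d \<otimes> h) x)" by simp
  qed
  also have "\<dots> = (\<integral>x. ?F x \<partial>M)"
    using hc dc F Cont_measurable by (intro integral_act) auto
  also have "\<dots> = I n f (\<lambda>y. g (act (inv (d \<otimes> h)) y))" by (simp add: I_def B'_def)
  finally have 2: "?J = I n f (\<lambda>y. g (act (inv (d \<otimes> h)) y))" .
  have dcong: "lcong (Suc (Suc j)) (inv d) (inv c)"
    using lcong_conj[OF cL, of "inv B'"] bc by (intro lcong_inv) (simp add: d_def)
  have 3: "\<bar>I n f (\<lambda>y. g (act (inv (d \<otimes> h)) y)) - I n f (\<lambda>y. g (act (inv c) y))\<bar> \<le> C * e"
  proof (rule I_close)
    fix x assume x: "x \<in> topspace X"
    \<comment> \<open>With this point the two arguments of \<open>g\<close> become \<open>y\<close>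
      and, up to an element of \<open>L (Suc (Suc j))\<close>, \<open>h y\<close>; their values
      differ by at most \<open>e\<close>.\<close>
    define y where "y = act (inv h) (act (inv d) x)"
    have y: "y \<in> topspace X" using hc dc x by (simp add: y_def)
    have "act (inv (d \<otimes> h)) x = y" using hc dc x by (simp add: y_def inv_mult_group act_mult)
    moreover have "g (act (inv c) x) = g (act h y)"
      using CI_lcong[OF g dcong x] hc dc x by (simp add: y_def)
    ultimately show "\<bar>g (act (inv (d \<otimes> h)) x) - g (act (inv c) x)\<bar> \<le> e"
      using e(2)[OF y] by (simp add: abs_minus_commute)
  qed (use f gC hc dc cc C in \<open>auto intro: Cont_act\<close>)
  have "\<bar>I n f (\<lambda>y. g (act (inv c) y)) - I n f g\<bar> \<le> 2 * (C * e)"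
    using 1 3 unfolding 2 mult.commute[of e] by linarith
  then show ?thesis by (simp add: c_def B'_def)
qed

section \<open>Commutators whose last entry is \<open>b\<close>\<close>

lemma continuous_map_lc:
  "continuous_map Z \<tau> f \<Longrightarrow> (\<And>f. f \<in> set fs \<Longrightarrow> continuous_map Z \<tau> f) \<Longrightarrow>
    continuous_map Z \<tau> (\<lambda>z. lc (f z) (map (\<lambda>f. f z) fs))"
proof (induction fs arbitrary: f)
  case (Cons h fs)
  have "continuous_map Z \<tau> (\<lambda>z. lc (commutator G (f z) (h z)) (map (\<lambda>f. f z) fs))"
    using Cons.prems by (intro Cons.IH[of "\<lambda>z. commutator G (f z) (h z)"] continuous_map_commutator) auto
  then show ?case by simp
qed simp

lemma continuous_lc_head:
  assumes "set ys \<subseteq> carrier G"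
  shows "continuous_map \<tau> \<tau> (\<lambda>x. lc x ys)"
proof -
  have "continuous_map \<tau> \<tau> (\<lambda>x. lc x (map (\<lambda>f. f x) (map (\<lambda>y x. y) ys)))"
    using assms by (intro continuous_map_lc) (auto intro!: continuous_map_group_const)
  then show ?thesis by (simp add: o_def)
qed

text \<open>For \<open>z\<close> in \<open>B\<close> and large \<open>n\<close> take a root product
  with small \<open>P\<close> and \<open>w\<close>. Then \<open>h = lc P ps\<close> is small and its
  commutator \<open>c\<close> with \<open>b [^] n\<close> is \<open>\<theta> P [^] n\<close> up to
  the next term, so \<open>\<theta> z\<close> is congruent to \<open>c\<close> times
  \<open>\<theta> w\<close>. The factor \<open>c\<close> is covered by \<open>mautner_bound\<close>,
  the factor \<open>\<theta> w\<close> by its smallness. Generation of \<open>N\<close> by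
  \<open>B\<close> gives the general case.\<close>

lemma lc_b_in_R:
  assumes x: "x \<in> N" and ps: "set ps \<subseteq> carrier G"
  shows "lc x (ps @ [b]) \<in> R (Suc (length ps))"
proof -
  define \<theta> where "\<theta> = (\<lambda>x. lc x (ps @ [b]))"
  let ?k = "Suc (length ps)"
  have q: "quasi_hom ?k N \<theta>" unfolding \<theta>_def using quasi_hom_lc_head[of "ps @ [b]"] ps by simp
  note q' = quasi_homD[OF q]
  have "\<theta> z \<in> R ?k" if z: "z \<in> B" for z
  proof -
    have zN: "z \<in> N" using z B_subset by auto
    have zL: "\<theta> z \<in> L ?k" using q' zN by auto
    \<comment> \<open>The estimate of \<open>mautner_bound\<close> concerns the inverse of a
      commutator. As \<open>R\<close> is a subgroup, the inverse of \<open>\<theta> z\<close> serves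
      as well.\<close>
    have "inv (\<theta> z) \<in> R ?k"
    proof (rule R_test)
      fix f g and e :: real assume f: "f \<in> Cont" and g: "g \<in> CI (Suc ?k)" and e: "e > 0"
      have gC: "g \<in> Cont" using g CI_Cont by blast
      obtain C1 C2 where "C1 > 0" "\<And>x. x \<in> topspace X \<Longrightarrow> \<bar>f x\<bar> \<le> C1" "\<And>x. x \<in> topspace X \<Longrightarrow> \<bar>g x\<bar> \<le> C2"
        using Cont_bounded[OF f] Cont_bounded[OF gC] by metis
      then obtain C where C: "C > 0" "\<And>x. x \<in> topspace X \<Longrightarrow> \<bar>f x\<bar> \<le> C" "\<And>x. x \<in> topspace X \<Longrightarrow> \<bar>g x\<bar> \<le> C"
        by (metis max.coboundedI1 max.coboundedI2 less_max_iff_disj)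
      \<comment> \<open>One error \<open>C * d\<close> comes from \<open>\<theta> w\<close> and two
        from \<open>mautner_bound\<close>; together they amount to three quarters of
        \<open>e\<close>.\<close>
      define d where "d = e / (4 * C)"
      have d: "d > 0" using e C by (simp add: d_def)
      obtain V1 where V1: "nbhd V1" "\<And>w x. w \<in> V1 \<Longrightarrow> x \<in> topspace X \<Longrightarrow> \<bar>f (act w x) - f x\<bar> < d"
        using uniform_continuity[OF f d] by metis
      obtain V2 where V2: "nbhd V2" "\<And>w x. w \<in> V2 \<Longrightarrow> x \<in> topspace X \<Longrightarrow> \<bar>g (act w x) - g x\<bar> < d"
        using uniform_continuity[OF gC d] by metis
      obtain W1 where W1: "nbhd W1" "\<And>w. w \<in> W1 \<Longrightarrow> lc w ps \<in> V1 \<inter> V2"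
        using nbhd_preimage[OF continuous_lc_head[OF ps] _ nbhd_Int[OF V1(1) V2(1)]] lc_one[OF ps] by metis
      have psb: "set (ps @ [b]) \<subseteq> carrier G" using ps by simp
      obtain W2 where W2: "nbhd W2" "\<And>w. w \<in> W2 \<Longrightarrow> \<theta> w \<in> V2"
        unfolding \<theta>_def using nbhd_preimage[OF continuous_lc_head[OF psb] _ V2(1)] lc_one[OF psb] by metis
      define W where "W = W1 \<inter> W2 \<inter> N"
      have W: "nbhd W" unfolding W_def using W1 W2 nbhd_N nbhd_Int by blast
      obtain n0 where n0: "\<forall>n\<ge>n0. \<exists>P w. root_product G W n z P w \<and> P \<in> W" using roots[OF z W] by auto
      have "\<bar>I n f (\<lambda>x. g (act (inv (\<theta> z)) x)) - I n f g\<bar> < e" if n: "n \<ge> n0" for n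
      proof -
        obtain P w where Pw: "root_product G W n z P w" "P \<in> W" using n0 n by blast
        have rp: "P \<in> N" "w \<in> W" "lcong (Suc ?k) (\<theta> z) (\<theta> P [^] n \<otimes> \<theta> w)"
          using quasi_hom_root_product[OF q _ Pw(1)] by (auto simp: W_def)
        define h where "h = lc P ps"
        have h: "h \<in> L (length ps)" unfolding h_def using lc_in_L[of P 0 ps] rp ps by simp
        define c where "c = commutator G h (b [^] n)"
        have hc: "h \<in> carrier G" using h L_carrier by auto
        have cc: "c \<in> carrier G" using hc by (simp add: c_def)
        have wc: "\<theta> w \<in> carrier G" using q' rp by (auto simp: W_def)
        \<comment> \<open>Additivity of the commutator in its second argument takes the exponent
          \<open>n\<close> from \<open>b\<close> to the value, and the commutator of
          \<open>h\<close> with \<open>b\<close> itself is \<open>\<theta> P\<close>.\<close>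
        have "lcong (Suc ?k) c (\<theta> P [^] n)"
          using quasi_hom_pow[OF quasi_hom_commutator[OF h] b_carrier] by (simp add: c_def \<theta>_def h_def)
        then have "lcong (Suc ?k) (\<theta> P [^] n \<otimes> \<theta> w) (c \<otimes> \<theta> w)"
          using wc by (intro lcong_mult lcong_refl lcong_sym[of _ c]) auto
        with rp(3) have "lcong (Suc ?k) (\<theta> z) (c \<otimes> \<theta> w)" by (rule lcong_trans)
        then have "lcong (Suc ?k) (inv (\<theta> z)) (inv (c \<otimes> \<theta> w))" by (rule lcong_inv)
        then have cong: "lcong (Suc ?k) (inv (\<theta> z)) (inv (\<theta> w) \<otimes> inv c)" using cc wc by (simp add: inv_mult_group)
        have "\<bar>I n f (\<lambda>x. g (act (inv (\<theta> z)) x)) - I n f (\<lambda>x. g (act (inv c) x))\<bar> \<le> C * d"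
        proof (rule I_close)
          fix x assume x: "x \<in> topspace X"
          define y where "y = act (inv (\<theta> w)) (act (inv c) x)"
          have y: "y \<in> topspace X" using x wc cc by (simp add: y_def)
          have "g (act (inv (\<theta> z)) x) = g y"
            using CI_lcong[OF g cong x] x wc cc by (simp add: y_def act_mult)
          moreover have "act (inv c) x = act (\<theta> w) y" using x wc cc by (simp add: y_def)
          moreover have "\<bar>g (act (\<theta> w) y) - g y\<bar> < d" using V2(2)[OF W2(2)] rp y by (auto simp: W_def)
          ultimately show "\<bar>g (act (inv (\<theta> z)) x) - g (act (inv c) x)\<bar> \<le> d" by (simp add: abs_minus_commute)
        qed (use f gC C cc L_carrier[OF zL] in \<open>auto intro: Cont_act\<close>)
        moreover have "\<bar>I n f (\<lambda>x. g (act (inv c) x)) - I n f g\<bar> \<le> 2 * C * d"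
          unfolding c_def
        proof (rule mautner_bound[OF h f g C(2,3)])
          have "h \<in> V1" "h \<in> V2" using W1(2) Pw(2) by (auto simp: W_def h_def)
          then show "\<bar>f (act h x) - f x\<bar> \<le> d" "\<bar>g (act h x) - g x\<bar> \<le> d" if "x \<in> topspace X" for x
            using V1(2) V2(2) that by (meson less_imp_le)+
        qed
        ultimately have "\<bar>I n f (\<lambda>x. g (act (inv (\<theta> z)) x)) - I n f g\<bar> \<le> 3 * (C * d)" by linarith
        also have "\<dots> < e" using C e by (simp add: d_def)
        finally show ?thesis .
      qed
      then show "\<exists>n0. \<forall>n\<ge>n0. \<bar>I n f (\<lambda>x. g (act (inv (\<theta> z)) x)) - I n f g\<bar> < e" by blast
    qed (use L_inv[OF zL] in auto)
    then have "inv (inv (\<theta> z)) \<in> R ?k" by (rule subgroup.m_inv_closed[OF R_subgroup])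
    then show ?thesis using L_carrier[OF zL] by simp
  qed
  then have "B \<subseteq> {x \<in> N. \<theta> x \<in> R ?k}" using B_subset by auto
  then have "N \<subseteq> {x \<in> N. \<theta> x \<in> R ?k}" by (rule B_generates[OF quasi_hom_preimage_R[OF q]])
  then show ?thesis using x by (auto simp: \<theta>_def)
qed

end

section \<open>Commutators with entries fixing the base point\<close>

context nil_action
begin

text \<open>An element of \<open>L k\<close> is central modulo \<open>L (Suc k)\<close>. Seen by
  \<open>L (Suc k)\<close>-invariant functions it therefore acts in the same way at all points, and
  trivially as soon as it fixes one. The correlations then agree exactly, for every
  \<open>n\<close>.\<close>

lemma stabilizer_in_R:
  assumes c: "c \<in> L k" and fix0: "act c x0 = x0"
  shows "c \<in> R k"
proof -
  have cc: "c \<in> carrier G" using c L_carrier by blast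
  have "I n f (\<lambda>x. g (act c x)) = I n f g" if g: "g \<in> CI (Suc k)" for n f g
  proof (rule I_cong)
    fix x assume "x \<in> topspace X"
    then obtain y where y: "y \<in> carrier G" "x = act y x0" using transitive by blast
    have "g (act (c \<otimes> y) x0) = g (act (y \<otimes> c) x0)"
      by (rule CI_lcong[OF g lcong_commute[OF c y(1)] x0])
    then show "g (act c x) = g x" using cc y x0 fix0 by (simp add: act_mult)
  qed
  then show ?thesis using c by (simp add: R_def)
qed

definition Stab :: "'a set" where "Stab = {g \<in> carrier G. act g x0 = x0}"

lemma Stab_subgroup: "subgroup Stab G"
proof (rule subgroupI)
  show "Stab \<noteq> {}" using act_one[OF x0] by (auto simp: Stab_def)
  fix a assume "a \<in> Stab"
  then show "inv a \<in> Stab" using act_inv(2)[of a x0] x0 by (auto simp: Stab_def)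
qed (use x0 in \<open>auto simp: Stab_def act_mult\<close>)

lemma same_orbit_point:
  assumes "g \<in> carrier G" "h \<in> carrier G" "act g x0 = act h x0"
  shows "inv g \<otimes> h \<in> Stab"
  using assms x0 by (simp add: Stab_def act_mult flip: assms(3))

lemma commutator_in_subgroup:
  "subgroup S G \<Longrightarrow> x \<in> S \<Longrightarrow> y \<in> S \<Longrightarrow> commutator G x y \<in> S"
  by (simp add: commutator_def subgroup.m_closed subgroup.m_inv_closed)

lemma lc_in_subgroup:
  "subgroup S G \<Longrightarrow> x \<in> S \<Longrightarrow> set ys \<subseteq> S \<Longrightarrow> lc x ys \<in> S"
  by (induction ys arbitrary: x) (auto intro: commutator_in_subgroup)

text \<open>The elements \<open>y\<close> with commutator of \<open>u\<close> and \<open>y\<close>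
  in \<open>R (Suc j)\<close> form a normal subgroup \<open>D\<close> that is closed and contains
  both \<open>b\<close> and the stabiliser. If \<open>D\<close> missed \<open>y1\<close>, thickened
  \<open>D\<close>-orbits of \<open>x0\<close> and of \<open>act y1 x0\<close> would be disjoint
  open sets, both invariant under \<open>b\<close> and hence of full measure.\<close>

lemma ergodic_step:
  assumes u: "u \<in> L j" "u \<in> Stab" and ub: "commutator G u b \<in> R (Suc j)" and y1: "y1 \<in> carrier G"
  shows "commutator G u y1 \<in> R (Suc j)"
proof (rule ccontr)
  assume contra: "commutator G u y1 \<notin> R (Suc j)"
  define \<theta> where "\<theta> = commutator G u"
  have q: "quasi_hom (Suc j) (carrier G) \<theta>" unfolding \<theta>_def by (rule quasi_hom_commutator[OF u(1)])
  note q' = quasi_homD[OF q]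
  have uc: "u \<in> carrier G" using u L_carrier by blast
  define D where "D = {y \<in> carrier G. \<theta> y \<in> R (Suc j)}"
  have D: "subgroup D G" unfolding D_def by (rule quasi_hom_preimage_R[OF q])
  have Dc: "d \<in> D \<Longrightarrow> d \<in> carrier G" for d by (simp add: D_def)
  have bD: "b \<in> D" using ub by (simp add: D_def \<theta>_def)
  have StabD: "Stab \<subseteq> D"
  proof
    fix g assume g: "g \<in> Stab"
    then have gc: "g \<in> carrier G" by (simp add: Stab_def)
    have "\<theta> g \<in> Stab" unfolding \<theta>_def by (rule commutator_in_subgroup[OF Stab_subgroup u(2) g])
    then show "g \<in> D" using stabilizer_in_R[OF q'(2)] gc by (simp add: D_def Stab_def)
  qed
  \<comment> \<open>\<open>\<theta>\<close> is a homomorphism into a group that is abelian modulo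
    \<open>L (Suc (Suc j))\<close>, so it takes congruent values on conjugate elements, and
    \<open>D\<close> is normal.\<close>
  have conjD: "inv y \<otimes> d \<otimes> y \<in> D" if d: "d \<in> D" and y: "y \<in> carrier G" for d y
  proof -
    have dc: "d \<in> carrier G" using d Dc by blast
    note c = q'(3)[OF dc] q'(3)[OF y]
    have "lcong (Suc (Suc j)) (\<theta> (inv y \<otimes> d \<otimes> y)) (\<theta> (inv y \<otimes> d) \<otimes> \<theta> y)"
      using q'(4)[of "inv y \<otimes> d" y] dc y by simp
    also have "lcong (Suc (Suc j)) \<dots> (\<theta> (inv y) \<otimes> \<theta> d \<otimes> \<theta> y)"
      using q'(4)[of "inv y" d] dc y c by (intro lcong_mult lcong_refl) auto
    also have "lcong (Suc (Suc j)) \<dots> (inv (\<theta> y) \<otimes> \<theta> d \<otimes> \<theta> y)"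
      using quasi_hom_inv[OF q y] c by (intro lcong_mult lcong_refl) auto
    also have "lcong (Suc (Suc j)) \<dots> (\<theta> d)"
      using lcong_conj[OF q'(2)[OF dc], of "inv (\<theta> y)"] c by simp
    finally show ?thesis using R_lcong d dc y by (simp add: D_def)
  qed
  \<comment> \<open>Otherwise \<open>y1\<close> would be a limit of elements of \<open>D\<close>,
    and continuity of \<open>\<theta>\<close> would bring \<open>\<theta> y1\<close> within reach of
    \<open>R_closed\<close>.\<close>
  have "\<exists>V0. nbhd V0 \<and> (\<forall>v\<in>V0. \<forall>d\<in>D. y1 \<noteq> v \<otimes> d)"
  proof (rule ccontr)
    assume "\<not> ?thesis"
    then have near: "\<And>V. nbhd V \<Longrightarrow> \<exists>v\<in>V. \<exists>d\<in>D. y1 = v \<otimes> d" by blast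
    have "\<theta> y1 \<in> R (Suc j)"
    proof (rule R_closed)
      fix V assume V: "nbhd V"
      have "continuous_map \<tau> \<tau> \<theta>" unfolding \<theta>_def
        using uc continuous_map_commutator[OF continuous_map_group_const continuous_map_id] by simp
      moreover have "\<theta> \<one> = \<one>" using uc by (simp add: \<theta>_def commutator_def)
      ultimately obtain W where W: "nbhd W" "\<And>w. w \<in> W \<Longrightarrow> \<theta> w \<in> V"
        using nbhd_preimage[OF _ _ V] by metis
      obtain v d where vd: "v \<in> W" "d \<in> D" "y1 = v \<otimes> d" using near[OF W(1)] by auto
      have "lcong (Suc (Suc j)) (\<theta> y1) (\<theta> v \<otimes> \<theta> d)"
        unfolding vd(3) using vd W nbhd_carrier Dc by (intro q'(4)) auto
      then show "\<exists>v\<in>V. \<exists>r\<in>R (Suc j). lcong (Suc (Suc j)) (\<theta> y1) (v \<otimes> r)"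
        using W(2)[OF vd(1)] vd(2) by (auto simp: D_def)
    qed (use q' y1 in auto)
    then show False using contra by (simp add: \<theta>_def)
  qed
  then obtain V0 where V0: "nbhd V0" "\<And>v d. v \<in> V0 \<Longrightarrow> d \<in> D \<Longrightarrow> y1 \<noteq> v \<otimes> d" by blast
  obtain V where V: "nbhd V" "\<And>v w. v \<in> V \<Longrightarrow> w \<in> V \<Longrightarrow> inv v \<otimes> w \<in> V0"
    using nbhd_quotient[OF V0(1)] by metis
  have Vc: "v \<in> V \<Longrightarrow> v \<in> carrier G" for v using V nbhd_carrier by blast
  \<comment> \<open>The orbit of \<open>V x\<close> under \<open>D\<close>. It is open and nonempty,
    and invariant under \<open>b\<close> because \<open>b\<close> belongs to \<open>D\<close>;
    ergodicity thus leaves only the measure 1.\<close>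
  define A where "A x = (\<Union>d\<in>D. act d ` (\<lambda>v. act v x) ` V)" for x
  have A_open: "openin X (A x)" if "x \<in> topspace X" for x
    unfolding A_def using that V Dc
    by (intro openin_Union ballI) (auto simp: nbhd_def intro!: openin_act_image open_orbit)
  have A1: "measure M (A x) = 1" if x: "x \<in> topspace X" for x
  proof -
    have Asub: "A x \<subseteq> topspace X" using A_open[OF x] openin_subset by blast
    have bA: "act b y \<in> A x \<longleftrightarrow> y \<in> A x" if y: "y \<in> topspace X" for y
    proof
      assume "y \<in> A x"
      then obtain d v where dv: "d \<in> D" "v \<in> V" "y = act d (act v x)" by (auto simp: A_def)
      have "act b y = act (b \<otimes> d) (act v x)" using dv Dc Vc x by (simp add: act_mult)
      moreover have "b \<otimes> d \<in> D" using subgroup.m_closed[OF D bD] dv by blast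
      ultimately show "act b y \<in> A x" using dv by (auto simp: A_def)
    next
      assume "act b y \<in> A x"
      then obtain d v where dv: "d \<in> D" "v \<in> V" "act b y = act d (act v x)" by (auto simp: A_def)
      have "y = act (inv b) (act b y)" using y by simp
      also have "\<dots> = act (inv b \<otimes> d) (act v x)" using dv Dc Vc x by (simp add: act_mult)
      finally have "y = act (inv b \<otimes> d) (act v x)" .
      moreover have "inv b \<otimes> d \<in> D"
        using subgroup.m_closed[OF D subgroup.m_inv_closed[OF D bD]] dv by blast
      ultimately show "y \<in> A x" using dv by (auto simp: A_def)
    qed
    have "act b -` A x \<inter> space M = A x" using bA Asub by (auto simp: space_M)
    then have "measure M (A x) = 0 \<or> measure M (A x) = 1"
      using ergodic_b open_sets[OF A_open[OF x]] by (auto simp: ergodic_def)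
    moreover have "act \<one> (act \<one> x) \<in> A x"
      using V subgroup.one_closed[OF D] by (auto simp: A_def nbhd_def)
    then have "A x \<noteq> {}" by blast
    then have "measure M (A x) > 0" by (rule open_positive[OF A_open[OF x]])
    ultimately show ?thesis by simp
  qed
  let ?x1 = "act y1 x0"
  have x1: "?x1 \<in> topspace X" using y1 x0 by simp
  have "A x0 \<inter> A ?x1 = {}"
  proof (rule ccontr)
    assume "A x0 \<inter> A ?x1 \<noteq> {}"
    then obtain d v d' v' where *: "d \<in> D" "v \<in> V" "d' \<in> D" "v' \<in> V"
      "act d (act v x0) = act d' (act v' ?x1)" by (auto simp: A_def)
    note c = Dc[OF *(1)] Vc[OF *(2)] Dc[OF *(3)] Vc[OF *(4)]
    define \<gamma> where "\<gamma> = inv (d \<otimes> v) \<otimes> (d' \<otimes> v' \<otimes> y1)"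
    have "\<gamma> \<in> Stab" unfolding \<gamma>_def
      using * c y1 x0 by (intro same_orbit_point) (auto simp: act_mult)
    then have \<gamma>: "\<gamma> \<in> D" using StabD by blast
    have "inv v \<otimes> (inv d' \<otimes> d) \<otimes> v \<in> D"
      using * c by (intro conjD subgroup.m_closed[OF D] subgroup.m_inv_closed[OF D]) auto
    then have "(inv v \<otimes> (inv d' \<otimes> d) \<otimes> v) \<otimes> \<gamma> \<in> D" using \<gamma> subgroup.m_closed[OF D] by blast
    \<comment> \<open>A common point of the two sets yields \<open>\<gamma>\<close> in the
      stabiliser. Regrouping with \<open>v\<close> inserted puts \<open>v'^-1 v\<close>, an element
      of \<open>V0\<close>, in front of a product of elements of \<open>D\<close>; the conjugation
      by \<open>v\<close> is absorbed by normality.\<close>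
    moreover have "y1 = (inv v' \<otimes> v) \<otimes> ((inv v \<otimes> (inv d' \<otimes> d) \<otimes> v) \<otimes> \<gamma>)"
      using c y1 by (simp add: \<gamma>_def m_assoc inv_mult_group)
    ultimately show False using V0(2) V(2)[OF *(4,2)] by blast
  qed
  then have "measure M (A x0 \<union> A ?x1) = measure M (A x0) + measure M (A ?x1)"
    using open_sets A_open x0 x1 by (intro finite_measure_Union) auto
  then have "measure M (A x0 \<union> A ?x1) = 2" using A1 x0 x1 by simp
  then show False using prob_le_1[of "A x0 \<union> A ?x1"] by simp
qed

text \<open>The complement of an orbit is a union of orbits of the same open subgroup, each of them
  open. The orbit is therefore closed in a compact space.\<close>

lemma open_subgroup_orbit_compact:
  assumes Q: "subgroup Q G" "openin \<tau> Q"
  shows "compactin X ((\<lambda>g. act g x0) ` Q)"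
proof -
  let ?O = "(\<lambda>g. act g x0) ` Q"
  have Qc: "q \<in> Q \<Longrightarrow> q \<in> carrier G" for q using subgroup.mem_carrier[OF Q(1)] .
  have "topspace X - ?O = (\<Union>x\<in>topspace X - ?O. (\<lambda>q. act q x) ` Q)"
  proof (rule equalityI; rule subsetI)
    fix x assume "x \<in> topspace X - ?O"
    moreover then have "x = act \<one> x" using act_one by auto
    ultimately show "x \<in> (\<Union>x\<in>topspace X - ?O. (\<lambda>q. act q x) ` Q)"
      using subgroup.one_closed[OF Q(1)] by blast
  next
    fix y assume "y \<in> (\<Union>x\<in>topspace X - ?O. (\<lambda>q. act q x) ` Q)"
    then obtain x q where xq: "x \<in> topspace X" "x \<notin> ?O" "q \<in> Q" "y = act q x" by auto
    have "y \<notin> ?O"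
    proof
      assume "y \<in> ?O"
      then obtain r where r: "r \<in> Q" "y = act r x0" by auto
      have "x = act (inv q) y" using xq Qc by simp
      also have "\<dots> = act (inv q \<otimes> r) x0" using r xq Qc x0 by (simp add: act_mult)
      finally have "x = act (inv q \<otimes> r) x0" .
      moreover have "inv q \<otimes> r \<in> Q"
        using xq r subgroup.m_closed[OF Q(1)] subgroup.m_inv_closed[OF Q(1)] by blast
      ultimately show False using xq by blast
    qed
    then show "y \<in> topspace X - ?O" using xq Qc by simp
  qed
  also have "openin X \<dots>" using open_orbit[OF Q(2)] by (intro openin_Union) auto
  finally have "closedin X ?O" using Qc x0 by (auto simp: closedin_def)
  then show ?thesis using compact by (rule closedin_compact_space[rotated])
qed

lemma nbhd_carrier_G: "nbhd (carrier G)"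
  using openin_topspace[of \<tau>] by (simp add: nbhd_def topspace_group)

text \<open>The intersection with \<open>carrier G\<close> takes care of the empty family.\<close>

lemma nbhd_finite_Inter: "finite F \<Longrightarrow> (\<And>A. A \<in> F \<Longrightarrow> nbhd (U A)) \<Longrightarrow> nbhd (carrier G \<inter> (\<Inter>A\<in>F. U A))"
proof (induction F rule: finite_induct)
  case (insert A F)
  have "nbhd (U A)" "nbhd (carrier G \<inter> (\<Inter>A\<in>F. U A))" using insert by auto
  then have "nbhd (U A \<inter> (carrier G \<inter> (\<Inter>A\<in>F. U A)))" by (rule nbhd_Int)
  then show ?case by (simp add: Int_ac)
qed (simp add: nbhd_carrier_G)

text \<open>
  If a biadditive map is trivial modulo \<open>R\<close> on the stabiliser in its second variable, then it is small
  modulo \<open>R\<close>, uniformly in the second variable, as soon as the first one is small; since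
  \<open>\<Phi> P y\<close> to the power \<open>n\<close> is \<open>\<Phi> P\<close> at \<open>y\<close> to the power \<open>n\<close>, taking roots in the first variable makes it trivial.
\<close>

lemma biadditive_in_R:
  assumes Q: "subgroup Q G" "openin \<tau> Q"
    and q1: "\<And>y. y \<in> Q \<Longrightarrow> quasi_hom k N (\<lambda>x. \<Phi> x y)"
    and q2: "\<And>x. x \<in> N \<Longrightarrow> quasi_hom k Q (\<Phi> x)"
    and cont: "continuous_map (prod_topology \<tau> \<tau>) \<tau> (\<lambda>p. \<Phi> (fst p) (snd p))"
    and one: "\<And>y. y \<in> Q \<Longrightarrow> \<Phi> \<one> y = \<one>"
    and stab: "\<And>x g. x \<in> N \<Longrightarrow> g \<in> Q \<Longrightarrow> g \<in> Stab \<Longrightarrow> \<Phi> x g \<in> R k"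
    and x: "x \<in> N" and y: "y \<in> Q"
  shows "\<Phi> x y \<in> R k"
proof -
  have Qc: "q \<in> Q \<Longrightarrow> q \<in> carrier G" for q using subgroup.mem_carrier[OF Q(1)] .
  have uniform: "\<exists>W. nbhd W \<and> (\<forall>x\<in>W \<inter> N. \<forall>y\<in>Q. \<exists>v\<in>V. \<exists>r\<in>R k. lcong (Suc k) (\<Phi> x y) (v \<otimes> r))"
    if V: "nbhd V" for V
  proof -
    define \<U> where "\<U> = {A. \<exists>U O'. nbhd U \<and> openin \<tau> O' \<and> O' \<subseteq> Q \<and> A = (\<lambda>g. act g x0) ` O' \<and>
       (\<forall>x\<in>U. \<forall>y\<in>O'. \<Phi> x y \<in> V)}"
    have "(\<lambda>g. act g x0) ` Q \<subseteq> \<Union>\<U>"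
    proof
      fix z assume "z \<in> (\<lambda>g. act g x0) ` Q"
      then obtain o' where o': "o' \<in> Q" "z = act o' x0" by auto
      have "openin (prod_topology \<tau> \<tau>) {p \<in> topspace (prod_topology \<tau> \<tau>). \<Phi> (fst p) (snd p) \<in> V}"
        using V openin_continuous_map_preimage[OF cont] by (simp add: nbhd_def)
      moreover have "(\<one>, o') \<in> {p \<in> topspace (prod_topology \<tau> \<tau>). \<Phi> (fst p) (snd p) \<in> V}"
        using o' one V Qc by (auto simp: nbhd_def topspace_group)
      ultimately obtain U O' where UO: "openin \<tau> U" "openin \<tau> O'" "\<one> \<in> U" "o' \<in> O'"
        "U \<times> O' \<subseteq> {p \<in> topspace (prod_topology \<tau> \<tau>). \<Phi> (fst p) (snd p) \<in> V}"
        unfolding openin_prod_topology_alt by meson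
      have "(\<lambda>g. act g x0) ` (O' \<inter> Q) \<in> \<U>"
        unfolding \<U>_def mem_Collect_eq
      proof (intro exI conjI)
        show "nbhd U" using UO by (simp add: nbhd_def)
        show "openin \<tau> (O' \<inter> Q)" using UO Q by blast
        show "\<forall>x\<in>U. \<forall>y\<in>O' \<inter> Q. \<Phi> x y \<in> V" using UO by fastforce
      qed auto
      then show "z \<in> \<Union>\<U>" using o' UO by blast
    qed
    moreover have "openin X A" if "A \<in> \<U>" for A using that orbit_open by (auto simp: \<U>_def)
    ultimately obtain F where F: "finite F" "F \<subseteq> \<U>" "(\<lambda>g. act g x0) ` Q \<subseteq> \<Union>F"
      using compactinD[OF open_subgroup_orbit_compact[OF Q], of \<U>] by auto
    have "\<forall>A\<in>F. \<exists>U O'. nbhd U \<and> openin \<tau> O' \<and> O' \<subseteq> Q \<and> A = (\<lambda>g. act g x0) ` O' \<and>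
       (\<forall>x\<in>U. \<forall>y\<in>O'. \<Phi> x y \<in> V)" using F(2) by (auto simp: \<U>_def)
    then obtain U O' where UO: "\<And>A. A \<in> F \<Longrightarrow> nbhd (U A) \<and> O' A \<subseteq> Q \<and> A = (\<lambda>g. act g x0) ` O' A \<and>
       (\<forall>x\<in>U A. \<forall>y\<in>O' A. \<Phi> x y \<in> V)" by metis
    show ?thesis
    proof (intro exI conjI ballI)
      show "nbhd (carrier G \<inter> (\<Inter>A\<in>F. U A))" using UO by (intro nbhd_finite_Inter F(1)) auto
      fix x y assume x: "x \<in> (carrier G \<inter> (\<Inter>A\<in>F. U A)) \<inter> N" and y: "y \<in> Q"
      obtain A where A: "A \<in> F" "act y x0 \<in> A" using F(3) y by blast
      then obtain o' where o': "o' \<in> O' A" "act y x0 = act o' x0" using UO by blast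
      have oQ: "o' \<in> Q" using UO A o' by blast
      \<comment> \<open>\<open>y\<close> and \<open>o'\<close> have the same orbit point, so they
        differ by an element of the stabiliser, on which \<open>\<Phi> x\<close> takes values in
        \<open>R k\<close>.\<close>
      define \<gamma> where "\<gamma> = inv o' \<otimes> y"
      have \<gamma>Q: "\<gamma> \<in> Q" unfolding \<gamma>_def
        using y oQ subgroup.m_closed[OF Q(1)] subgroup.m_inv_closed[OF Q(1)] by blast
      have \<gamma>S: "\<gamma> \<in> Stab" unfolding \<gamma>_def using o' Qc[OF oQ] Qc[OF y] by (intro same_orbit_point) auto
      have "y = o' \<otimes> \<gamma>" using Qc oQ y by (simp add: \<gamma>_def)
      then have "lcong (Suc k) (\<Phi> x y) (\<Phi> x o' \<otimes> \<Phi> x \<gamma>)"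
        using quasi_homD(4)[OF q2 oQ \<gamma>Q] x by auto
      moreover have "\<Phi> x o' \<in> V" using UO A o' x by blast
      ultimately show "\<exists>v\<in>V. \<exists>r\<in>R k. lcong (Suc k) (\<Phi> x y) (v \<otimes> r)"
        using stab[OF _ \<gamma>Q \<gamma>S] x by blast
    qed
  qed
  note qy = q1[OF y]
  have "\<Phi> z y \<in> R k" if z: "z \<in> B" for z
  proof (rule R_closed)
    have zN: "z \<in> N" using z B_subset by auto
    then show "\<Phi> z y \<in> L k" using quasi_homD(2)[OF qy] by auto
    fix V assume V: "nbhd V"
    \<comment> \<open>The final approximant is \<open>v\<close> times the small value
      \<open>\<Phi> w y\<close>. Writing the latter as the inverse of an inverse, \<open>V1\<close>
      and \<open>V2\<close> are chosen so that this product stays in \<open>V\<close>.\<close>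
    obtain V1 where V1: "nbhd V1" "\<And>v w. v \<in> V1 \<Longrightarrow> w \<in> V1 \<Longrightarrow> v \<otimes> inv w \<in> V"
      using nbhd_quotient[OF V] by metis
    obtain V2 where V2: "nbhd V2" "\<And>w. w \<in> V2 \<Longrightarrow> inv w \<in> V1"
      using nbhd_preimage[OF continuous_inv _ V1(1)] by auto
    obtain W1 where W1: "nbhd W1"
      "\<And>x y. x \<in> W1 \<Longrightarrow> x \<in> N \<Longrightarrow> y \<in> Q \<Longrightarrow> \<exists>v\<in>V1. \<exists>r\<in>R k. lcong (Suc k) (\<Phi> x y) (v \<otimes> r)"
      using uniform[OF V1(1)] by blast
    have "continuous_map \<tau> \<tau> (\<lambda>x. \<Phi> x y)"
      using continuous_map_compose[OF continuous_map_pairedI[OF continuous_map_id continuous_map_group_const] cont] Qc[OF y]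
      by (simp add: o_def)
    then obtain W2 where W2: "nbhd W2" "\<And>w. w \<in> W2 \<Longrightarrow> \<Phi> w y \<in> V2"
      using nbhd_preimage[OF _ _ V2(1)] one[OF y] by metis
    define W where "W = W1 \<inter> W2 \<inter> N"
    have W: "nbhd W" unfolding W_def using W1 W2 nbhd_N nbhd_Int by blast
    \<comment> \<open>A single exponent is enough: smallness of \<open>P\<close> controls its
      pairing with every element of \<open>Q\<close> at once, so no limit in \<open>n\<close> is
      taken.\<close>
    obtain n P w where Pw: "root_product G W n z P w" "P \<in> W" using roots[OF z W] by blast
    have rp: "P \<in> N" "w \<in> W" "lcong (Suc k) (\<Phi> z y) (\<Phi> P y [^] n \<otimes> \<Phi> w y)"
      using quasi_hom_root_product[OF qy _ Pw(1)] by (auto simp: W_def)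
    have yn: "y [^] n \<in> Q"
      by (induction n) (auto intro: subgroup.one_closed[OF Q(1)] subgroup.m_closed[OF Q(1)] y)
    obtain v r where vr: "v \<in> V1" "r \<in> R k" "lcong (Suc k) (\<Phi> P (y [^] n)) (v \<otimes> r)"
      using W1(2)[OF _ rp(1) yn] Pw(2) by (auto simp: W_def)
    have wN: "w \<in> N" using rp by (simp add: W_def)
    have c: "v \<in> carrier G" "r \<in> carrier G" "\<Phi> w y \<in> carrier G"
      using vr V1 nbhd_carrier R_carrier quasi_homD(3)[OF qy wN] by auto
    note rp(3)
    \<comment> \<open>The exponent passes to the second variable. The power of \<open>y\<close> may
      be far from the identity, which is why the smallness had to be uniform in that
      variable.\<close>
    also have "lcong (Suc k) (\<Phi> P y [^] n \<otimes> \<Phi> w y) (\<Phi> P (y [^] n) \<otimes> \<Phi> w y)"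
      using c lcong_sym[OF quasi_hom_pow[OF q2[OF rp(1)] y]] by (intro lcong_mult lcong_refl) auto
    also have "lcong (Suc k) \<dots> ((v \<otimes> r) \<otimes> \<Phi> w y)" using c vr by (intro lcong_mult lcong_refl) auto
    also have "(v \<otimes> r) \<otimes> \<Phi> w y = v \<otimes> (r \<otimes> \<Phi> w y)" using c by (simp add: m_assoc)
    also have "lcong (Suc k) \<dots> (v \<otimes> (\<Phi> w y \<otimes> r))"
      using c R_L[OF vr(2)] by (intro lcong_mult lcong_refl lcong_commute) auto
    also have "v \<otimes> (\<Phi> w y \<otimes> r) = (v \<otimes> inv (inv (\<Phi> w y))) \<otimes> r" using c by (simp add: m_assoc)
    finally have "lcong (Suc k) (\<Phi> z y) ((v \<otimes> inv (inv (\<Phi> w y))) \<otimes> r)" .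
    moreover have "v \<otimes> inv (inv (\<Phi> w y)) \<in> V"
      using V1(2)[OF vr(1) V2(2)[OF W2(2)]] rp by (simp add: W_def)
    ultimately show "\<exists>v\<in>V. \<exists>r\<in>R k. lcong (Suc k) (\<Phi> z y) (v \<otimes> r)" using vr(2) by blast
  qed
  then have "B \<subseteq> {x \<in> N. \<Phi> x y \<in> R k}" using B_subset by auto
  then have "N \<subseteq> {x \<in> N. \<Phi> x y \<in> R k}" by (rule B_generates[OF quasi_hom_preimage_R[OF qy]])
  then show ?thesis using x by auto
qed

lemma continuous_lc_slot:
  assumes "continuous_map Z \<tau> f" "continuous_map Z \<tau> g" "set ps \<subseteq> carrier G" "set qs \<subseteq> carrier G"
  shows "continuous_map Z \<tau> (\<lambda>z. lc (f z) (ps @ g z # qs))"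
proof -
  have "continuous_map Z \<tau> (\<lambda>z. lc (f z) (map (\<lambda>f. f z) (map (\<lambda>y x. y) ps @ g # map (\<lambda>y x. y) qs)))"
    using assms by (intro continuous_map_lc) (auto intro!: continuous_map_group_const)
  then show ?thesis by (simp add: o_def)
qed

text \<open>For \<open>y\<close> in \<open>N\<close> the variables exchange roles: roots are taken
  in the last entry \<open>y\<close>, and the first entry \<open>x\<close> is the one reduced to the
  stabiliser. Once all entries except the last fix the base point, so does their commutator, and
  \<open>ergodic_step\<close> applies. A general last entry is reached because \<open>N\<close> and
  \<open>b\<close> generate the group.\<close>

lemma lc_stab_in_R:
  assumes x: "x \<in> N" and qs: "set qs \<subseteq> Stab" and y: "y \<in> carrier G"
  shows "lc x (qs @ [y]) \<in> R (Suc (length qs))"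
proof -
  have qsc: "set qs \<subseteq> carrier G" using qs by (auto simp: Stab_def)
  have xc: "x \<in> carrier G" using x N_carrier by blast
  have q: "quasi_hom (Suc (length qs)) (carrier G) (\<lambda>y. lc x (qs @ [y]))" if "x \<in> N" for x
    using quasi_hom_lc_slot[OF that qsc, of "[]"] by simp
  have 1: "lc x (qs @ [y]) \<in> R (Suc (length qs))" if y: "y \<in> N" for y
  proof (rule biadditive_in_R[OF subgroup_N N_open, where \<Phi> = "\<lambda>y x. lc x (qs @ [y])" and x = y and y = x])
    fix x assume x: "x \<in> N"
    have xc: "x \<in> carrier G" using x N_carrier by blast
    show "quasi_hom (Suc (length qs)) N (\<lambda>y. lc x (qs @ [y]))"
      using q[OF x] by (rule quasi_hom_subset) (use N_carrier subgroup_N in auto)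
    show "lc x (qs @ [\<one>]) = \<one>" using lc_slot_one[OF xc qsc, of "[]"] by simp
  next
    fix y assume y: "y \<in> N"
    show "quasi_hom (Suc (length qs)) N (\<lambda>x. lc x (qs @ [y]))"
      using quasi_hom_lc_head[of "qs @ [y]"] qsc N_carrier[OF y] by simp
  next
    show "continuous_map (prod_topology \<tau> \<tau>) \<tau> (\<lambda>p. lc (snd p) (qs @ [fst p]))"
      by (rule continuous_lc_slot) (use qsc continuous_map_fst continuous_map_snd in auto)
  next
    fix y g assume y: "y \<in> N" and g: "g \<in> N" "g \<in> Stab"
    have "commutator G (lc g qs) y \<in> R (Suc (length qs))"
    proof (rule ergodic_step)
      show "lc g qs \<in> L (length qs)" using lc_in_L[of g 0 qs] g qsc by simp
      show "lc g qs \<in> Stab" by (rule lc_in_subgroup[OF Stab_subgroup g(2) qs])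
      show "commutator G (lc g qs) b \<in> R (Suc (length qs))" using lc_b_in_R[OF g(1) qsc] by simp
    qed (rule N_carrier[OF y])
    then show "lc g (qs @ [y]) \<in> R (Suc (length qs))" by simp
  qed (use x y in auto)
  have "carrier G \<subseteq> {y \<in> carrier G. lc x (qs @ [y]) \<in> R (Suc (length qs))}"
    using 1 N_carrier lc_b_in_R[OF x qsc] by (intro generated quasi_hom_preimage_R q x) auto
  then show ?thesis using y by auto
qed

text \<open>Induction on the number of unrestricted middle entries: \<open>biadditive_in_R\<close>
  reduces the rightmost of them to the stabiliser, where it joins the front of
  \<open>qs\<close>.\<close>

lemma lc_in_R:
  assumes "x \<in> N" "set ps \<subseteq> carrier G" "set qs \<subseteq> Stab" "y \<in> carrier G"
  shows "lc x (ps @ qs @ [y]) \<in> R (Suc (length ps + length qs))"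
  using assms
proof (induction ps arbitrary: x qs y rule: rev_induct)
  case Nil
  then show ?case using lc_stab_in_R[of x qs y] by simp
next
  case (snoc p ps)
  have ps: "set ps \<subseteq> carrier G" and p: "p \<in> carrier G" using snoc.prems by auto
  have qsc: "set (qs @ [y]) \<subseteq> carrier G" using snoc.prems by (auto simp: Stab_def)
  let ?k = "Suc (Suc (length ps + length qs))"
  have "lc x (ps @ p # (qs @ [y])) \<in> R ?k"
  proof (rule biadditive_in_R[OF subgroup_self, where \<Phi> = "\<lambda>x p. lc x (ps @ p # (qs @ [y]))"])
    show "openin \<tau> (carrier G)" using nbhd_carrier_G by (simp add: nbhd_def)
  next
    fix p assume p: "p \<in> carrier G"
    show "quasi_hom ?k N (\<lambda>x. lc x (ps @ p # (qs @ [y])))"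
      using quasi_hom_lc_head[of "ps @ p # (qs @ [y])"] ps p qsc by simp
    show "lc \<one> (ps @ p # (qs @ [y])) = \<one>" using ps p qsc by (intro lc_one) auto
  next
    fix x assume x: "x \<in> N"
    show "quasi_hom ?k (carrier G) (\<lambda>p. lc x (ps @ p # (qs @ [y])))"
      using quasi_hom_lc_slot[OF x ps qsc] by simp
    fix g assume "g \<in> Stab"
    then show "lc x (ps @ g # (qs @ [y])) \<in> R ?k"
      using snoc.IH[OF x ps, of "g # qs" y] snoc.prems by simp
  next
    show "continuous_map (prod_topology \<tau> \<tau>) \<tau> (\<lambda>q. lc (fst q) (ps @ snd q # (qs @ [y])))"
      by (rule continuous_lc_slot) (use ps qsc continuous_map_fst continuous_map_snd in auto)
  qed (use snoc.prems p in auto)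
  then show ?case by simp
qed

text \<open>The left-normed commutators generating \<open>L (Suc k)\<close> have at least one entry
  beyond the head. The last one plays the part of \<open>y\<close> in \<open>lc_in_R\<close>, with
  an empty list of stabiliser entries.\<close>

theorem L_subset_R: "L (Suc k) \<subseteq> R (Suc k)"
proof (rule L_subset_subgroup[OF R_subgroup L_Suc_R])
  fix x ys assume x: "x \<in> N" and ys: "set ys \<subseteq> carrier G" "length ys = Suc k"
  obtain ps y where "ys = ps @ [y]" using ys(2) by (cases ys rule: rev_cases) auto
  then show "lc x ys \<in> R (Suc k)" using lc_in_R[OF x, of ps "[]" y] ys by auto
qed

end

section \<open>Characteristic functions\<close>

context nil_action
begin

text \<open>Averages of translates with dyadic weights, a substitute for an integral over
  \<open>L k\<close>. Closure under midpoints is what the parallelogram identity asks for.\<close>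

inductive_set midhull :: "nat \<Rightarrow> ('x \<Rightarrow> real) \<Rightarrow> ('x \<Rightarrow> real) set" for k g where
  translate: "z \<in> L k \<Longrightarrow> (\<lambda>x. g (act z x)) \<in> midhull k g"
| mid: "\<phi> \<in> midhull k g \<Longrightarrow> \<psi> \<in> midhull k g \<Longrightarrow> (\<lambda>x. (\<phi> x + \<psi> x) * (1/2)) \<in> midhull k g"

lemma midhull_CI:
  assumes "\<phi> \<in> midhull k g" "g \<in> CI (Suc k)"
  shows "\<phi> \<in> CI (Suc k)"
  using assms
proof (induction rule: midhull.induct)
  case (translate z) then show ?case using CI_act L_carrier by blast
next
  case (mid \<phi> \<psi>)
  then have "\<phi> \<in> Cont" "\<psi> \<in> Cont" using CI_Cont by auto
  then have "(\<lambda>x. (\<phi> x + \<psi> x) * (1/2)) \<in> Cont" by (intro Cont_intros)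
  then show ?case using mid by (simp add: CI_def)
qed

text \<open>A translation by \<open>z\<close> in \<open>L k\<close> commutes with \<open>w\<close>
  up to \<open>L (Suc k)\<close>, which \<open>g\<close> does not see. All members of the hull
  therefore share the modulus of continuity of \<open>g\<close>.\<close>

lemma midhull_oscillation:
  assumes "\<phi> \<in> midhull k g" "g \<in> CI (Suc k)" "w \<in> carrier G"
    and osc: "\<And>x. x \<in> topspace X \<Longrightarrow> \<bar>g (act w x) - g x\<bar> \<le> e" and x: "x \<in> topspace X"
  shows "\<bar>\<phi> (act w x) - \<phi> x\<bar> \<le> e"
  using assms(1)
proof (induction rule: midhull.induct)
  case (translate z)
  have zc: "z \<in> carrier G" using translate L_carrier by blast
  have "g (act (z \<otimes> w) x) = g (act (w \<otimes> z) x)"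
    by (rule CI_lcong[OF assms(2) lcong_commute[OF translate assms(3)] x])
  then show ?case using osc[of "act z x"] zc assms(3) x by (simp add: act_mult)
next
  case (mid \<phi> \<psi>)
  have eq: "(\<phi> (act w x) + \<psi> (act w x)) * (1/2) - (\<phi> x + \<psi> x) * (1/2) =
      ((\<phi> (act w x) - \<phi> x) + (\<psi> (act w x) - \<psi> x)) / 2"
    by (simp add: field_simps)
  have "\<bar>(\<phi> (act w x) + \<psi> (act w x)) * (1/2) - (\<phi> x + \<psi> x) * (1/2)\<bar> \<le>
      (\<bar>\<phi> (act w x) - \<phi> x\<bar> + \<bar>\<psi> (act w x) - \<psi> x\<bar>) / 2"
    unfolding eq using abs_triangle_ineq[of "\<phi> (act w x) - \<phi> x" "\<psi> (act w x) - \<psi> x"] by simp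
  also have "\<dots> \<le> e" using mid.IH by simp
  finally show ?case .
qed

lemma midhull_I:
  assumes "\<phi> \<in> midhull (Suc k) g" "g \<in> CI (Suc (Suc k))" "f \<in> Cont"
  shows "(\<lambda>n. I n f \<phi> - I n f g) \<longlonglongrightarrow> 0"
  using assms(1)
proof (induction rule: midhull.induct)
  case (translate z)
  then have "z \<in> R (Suc k)" using L_subset_R by blast
  then show ?case by (rule R_tendsto[OF _ assms(3,2)])
next
  case (mid \<phi> \<psi>)
  have c: "\<phi> \<in> Cont" "\<psi> \<in> Cont" using mid midhull_CI assms(2) CI_Cont by blast+
  have eq: "I n f (\<lambda>x. (\<phi> x + \<psi> x) * (1/2)) - I n f g =
      ((I n f \<phi> - I n f g) + (I n f \<psi> - I n f g)) * (1/2)" for n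
    using I_scale[of n f "\<lambda>x. \<phi> x + \<psi> x" "1/2"] I_add[OF assms(3) c, of n] by (simp add: field_simps)
  show ?case unfolding eq by (rule tendsto_mult_left_zero[OF tendsto_add_zero[OF mid.IH]])
qed

lemma midhull_act:
  assumes "\<phi> \<in> midhull k g" "z \<in> L k"
  shows "\<exists>\<phi>'\<in>midhull k g. \<forall>x\<in>topspace X. \<phi>' x = \<phi> (act z x)"
  using assms(1)
proof (induction rule: midhull.induct)
  case (translate y)
  then show ?case using midhull.translate[OF L_mult[OF translate assms(2)], of g] L_carrier assms(2)
    by (intro bexI[of _ "\<lambda>x. g (act (y \<otimes> z) x)"]) (auto simp: act_mult)
next
  case (mid \<phi> \<psi>)
  then obtain \<phi>' \<psi>' where *: "\<phi>'\<in>midhull k g" "\<forall>x\<in>topspace X. \<phi>' x = \<phi> (act z x)"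
    "\<psi>'\<in>midhull k g" "\<forall>x\<in>topspace X. \<psi>' x = \<psi> (act z x)" by blast
  show ?case using * by (intro bexI[OF _ midhull.mid[OF *(1,3)]]) auto
qed

text \<open>
  The averages of least \<open>L\<^sup>2\<close> norm form a Cauchy sequence in \<open>L\<^sup>2\<close> by the parallelogram identity, and by
  equicontinuity they converge uniformly; the limit is invariant because the least norm is attained only once.
\<close>

theorem invariant_average:
  assumes g: "g \<in> CI (Suc (Suc k))"
  shows "\<exists>h\<in>CI (Suc k). \<forall>f\<in>Cont. (\<lambda>n. I n f g - I n f h) \<longlonglongrightarrow> 0"
proof -
  define K where "K = midhull (Suc k) g"
  have KC: "\<phi> \<in> K \<Longrightarrow> \<phi> \<in> Cont" for \<phi> using midhull_CI g CI_Cont unfolding K_def by blast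
  have gC: "g \<in> Cont" using g CI_Cont by blast
  define sq where "sq \<phi> = (\<integral>x. (\<phi> x)\<^sup>2 \<partial>M)" for \<phi> :: "'x \<Rightarrow> real"
  define d where "d = Inf (sq ` K)"
  have K_ne: "K \<noteq> {}" using midhull.translate[of \<one> "Suc k" g] by (auto simp: K_def)
  have bdd: "bdd_below (sq ` K)" by (intro bdd_belowI[of _ 0]) (auto simp: sq_def)
  have d_le: "d \<le> sq \<phi>" if "\<phi> \<in> K" for \<phi> unfolding d_def using bdd that by (intro cInf_lower) auto
  have parallelogram: "sq (\<lambda>x. \<phi> x - \<psi> x) \<le> 4 * e"
    if "\<phi> \<in> K" "\<psi> \<in> K" "sq \<phi> \<le> d + e" "sq \<psi> \<le> d + e" for \<phi> \<psi> e
  proof -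
    have c: "\<phi> \<in> Cont" "\<psi> \<in> Cont" using that KC by auto
    have i: "integrable M (\<lambda>x. (\<phi> x)\<^sup>2)" "integrable M (\<lambda>x. (\<psi> x)\<^sup>2)"
        "integrable M (\<lambda>x. ((\<phi> x + \<psi> x) * (1/2))\<^sup>2)"
      by (intro Cont_integrable Cont_intros c)+
    have "sq (\<lambda>x. \<phi> x - \<psi> x) = (\<integral>x. 2 * (\<phi> x)\<^sup>2 + 2 * (\<psi> x)\<^sup>2 - 4 * ((\<phi> x + \<psi> x) * (1/2))\<^sup>2 \<partial>M)"
      unfolding sq_def by (intro Bochner_Integration.integral_cong) (auto simp: power2_eq_square algebra_simps)
    also have "\<dots> = 2 * sq \<phi> + 2 * sq \<psi> - 4 * sq (\<lambda>x. (\<phi> x + \<psi> x) * (1/2))"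
      using i by (simp add: sq_def)
    also have "\<dots> \<le> 2 * (d + e) + 2 * (d + e) - 4 * d"
      using that d_le[of "\<lambda>x. (\<phi> x + \<psi> x) * (1/2)"] midhull.mid[of \<phi> "Suc k" g \<psi>] by (simp add: K_def)
    finally show ?thesis by simp
  qed
  have close: "\<exists>\<epsilon>>0. \<forall>\<phi>\<in>K. \<forall>\<psi>\<in>K. sq \<phi> \<le> d + \<epsilon> \<longrightarrow> sq \<psi> \<le> d + \<epsilon> \<longrightarrow> (\<forall>x\<in>topspace X. \<bar>\<phi> x - \<psi> x\<bar> \<le> e)"
    if e: "e > 0" for e
  proof -
    obtain W where W: "nbhd W" "\<And>w x. w \<in> W \<Longrightarrow> x \<in> topspace X \<Longrightarrow> \<bar>g (act w x) - g x\<bar> < e/4"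
      using uniform_continuity[OF gC, of "e/4"] e by auto
    obtain \<delta> where \<delta>: "\<delta> > 0"
      "\<And>\<psi> e x. \<psi> \<in> Cont \<Longrightarrow> (\<And>w x. w \<in> W \<Longrightarrow> x \<in> topspace X \<Longrightarrow> \<bar>\<psi> (act w x) - \<psi> x\<bar> \<le> e) \<Longrightarrow>
       (\<integral>x. (\<psi> x)\<^sup>2 \<partial>M) \<le> \<delta> * e\<^sup>2 \<Longrightarrow> x \<in> topspace X \<Longrightarrow> \<bar>\<psi> x\<bar> \<le> 2 * e"
      using equicontinuous_sup_bound[OF W(1)] by metis
    \<comment> \<open>The parallelogram bound \<open>4 * \<epsilon>\<close> then equals
      \<open>\<delta> * (e/2)\<^sup>2\<close>. A difference of two members of the hull oscillates by
      at most \<open>e/2\<close>, so \<open>\<delta>(2)\<close> bounds it by twice that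
      amount.\<close>
    define \<epsilon> where "\<epsilon> = \<delta> * (e/2)\<^sup>2 / 4"
    have \<epsilon>: "\<epsilon> > 0" using e \<delta> by (simp add: \<epsilon>_def)
    have "\<bar>\<phi> x - \<psi> x\<bar> \<le> e"
      if *: "\<phi> \<in> K" "\<psi> \<in> K" "sq \<phi> \<le> d + \<epsilon>" "sq \<psi> \<le> d + \<epsilon>" "x \<in> topspace X" for \<phi> \<psi> x
    proof -
      have osc: "\<bar>\<rho> (act w x) - \<rho> x\<bar> \<le> e/4" if "\<rho> \<in> K" "w \<in> W" "x \<in> topspace X" for \<rho> w x
        using that(1) unfolding K_def
        by (rule midhull_oscillation) (use g W that nbhd_carrier in \<open>auto intro: less_imp_le\<close>)
      have "\<bar>\<phi> x - \<psi> x\<bar> \<le> 2 * (e/2)"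
      proof (rule \<delta>(2)[of "\<lambda>x. \<phi> x - \<psi> x" "e/2"])
        show "(\<lambda>x. \<phi> x - \<psi> x) \<in> Cont" using * KC by (intro Cont_intros) auto
        fix w y assume "w \<in> W" "y \<in> topspace X"
        then show "\<bar>\<phi> (act w y) - \<psi> (act w y) - (\<phi> y - \<psi> y)\<bar> \<le> e/2"
          using osc[OF *(1), of w y] osc[OF *(2), of w y] by linarith
      next
        show "(\<integral>x. (\<phi> x - \<psi> x)\<^sup>2 \<partial>M) \<le> \<delta> * (e/2)\<^sup>2"
          using parallelogram[OF *(1-4)] by (simp add: sq_def \<epsilon>_def)
      qed (use * in auto)
      then show ?thesis by simp
    qed
    then show ?thesis using \<epsilon> by blast
  qed
  have "\<exists>\<phi>\<in>K. sq \<phi> \<le> d + 1 / Suc m" for m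
  proof -
    have "\<exists>v\<in>sq ` K. v < d + 1 / Suc m"
      unfolding d_def using K_ne bdd by (subst cInf_less_iff[symmetric]) auto
    then show ?thesis by (auto intro: less_imp_le)
  qed
  then obtain \<phi> where \<phi>: "\<And>m. \<phi> m \<in> K" "\<And>m. sq (\<phi> m) \<le> d + 1 / Suc m" by metis
  have small: "\<exists>m0. \<forall>m\<ge>m0. 1 / Suc m \<le> e" if e: "e > 0" for e :: real
  proof -
    obtain m0 where m0: "inverse (real (Suc m0)) < e" using reals_Archimedean[OF e] by auto
    have "1 / real (Suc m) \<le> e" if "m \<ge> m0" for m
    proof -
      have "1 / real (Suc m) \<le> 1 / real (Suc m0)" using that by (intro divide_left_mono) auto
      then show ?thesis using m0 by (simp add: inverse_eq_divide)
    qed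
    then show ?thesis by blast
  qed
  have "uniformly_Cauchy_on (topspace X) \<phi>"
    unfolding uniformly_Cauchy_on_def
  proof (intro allI impI)
    fix e :: real assume e: "e > 0"
    obtain \<epsilon> where \<epsilon>: "\<epsilon> > 0" "\<forall>\<phi>\<in>K. \<forall>\<psi>\<in>K. sq \<phi> \<le> d + \<epsilon> \<longrightarrow> sq \<psi> \<le> d + \<epsilon> \<longrightarrow> (\<forall>x\<in>topspace X. \<bar>\<phi> x - \<psi> x\<bar> \<le> e/2)"
      using close[of "e/2"] e by auto
    obtain m0 where m0: "\<forall>m\<ge>m0. 1 / Suc m \<le> \<epsilon>" using small[OF \<epsilon>(1)] by blast
    have le: "sq (\<phi> m) \<le> d + \<epsilon>" if "m \<ge> m0" for m using \<phi>(2)[of m] m0[rule_format, OF that] by linarith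
    have "dist (\<phi> m x) (\<phi> n x) < e" if "x \<in> topspace X" "m \<ge> m0" "n \<ge> m0" for x m n
      using \<epsilon>(2)[rule_format, OF \<phi>(1) \<phi>(1) le[OF that(2)] le[OF that(3)] that(1)] e by (simp add: dist_real_def)
    then show "\<exists>M. \<forall>x\<in>topspace X. \<forall>m\<ge>M. \<forall>n\<ge>M. dist (\<phi> m x) (\<phi> n x) < e" by blast
  qed
  then obtain h where h: "uniform_limit (topspace X) \<phi> h sequentially"
    using Cauchy_uniformly_convergent uniformly_convergent_on_def by blast
  have hlim: "\<exists>m0. \<forall>m\<ge>m0. \<forall>x\<in>topspace X. \<bar>\<phi> m x - h x\<bar> < e" if "e > 0" for e
    using h that by (simp add: uniform_limit_iff eventually_sequentially dist_real_def)
  have "continuous_map X Met_TC.mtopology h"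
  proof (rule Met_TC.continuous_map_uniform_limit[where f = \<phi> and F = sequentially])
    show "\<forall>\<^sub>F m in sequentially. continuous_map X Met_TC.mtopology (\<phi> m)"
      using KC[OF \<phi>(1)] by (simp add: Cont_def)
    show "\<forall>\<^sub>F m in sequentially. \<forall>x\<in>topspace X. h x \<in> UNIV \<and> dist (\<phi> m x) (h x) < e" if "0 < e" for e
      using h that by (simp add: uniform_limit_iff)
  qed simp
  then have hC: "h \<in> Cont" by (simp add: Cont_def)
  have "h (act z x) = h x" if z: "z \<in> L (Suc k)" and x: "x \<in> topspace X" for z x
  proof -
    have zc: "z \<in> carrier G" using z L_carrier by blast
    have "\<bar>h (act z x) - h x\<bar> \<le> e" if e: "e > 0" for e
    proof -
      obtain \<epsilon> where \<epsilon>: "\<epsilon> > 0" "\<forall>\<phi>\<in>K. \<forall>\<psi>\<in>K. sq \<phi> \<le> d + \<epsilon> \<longrightarrow> sq \<psi> \<le> d + \<epsilon> \<longrightarrow> (\<forall>x\<in>topspace X. \<bar>\<phi> x - \<psi> x\<bar> \<le> e/3)"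
      using close[of "e/3"] e by auto
      obtain m0 where m0: "\<forall>m\<ge>m0. 1 / Suc m \<le> \<epsilon>" using small[OF \<epsilon>(1)] by blast
      obtain m1 where m1: "\<forall>m\<ge>m1. \<forall>x\<in>topspace X. \<bar>\<phi> m x - h x\<bar> < e/3" using hlim[of "e/3"] e by auto
      define m where "m = max m0 m1"
      obtain \<psi> where \<psi>: "\<psi> \<in> K" "\<forall>x\<in>topspace X. \<psi> x = \<phi> m (act z x)"
        using midhull_act[OF _ z] \<phi>(1) unfolding K_def by blast
      have le: "sq (\<phi> m) \<le> d + \<epsilon>" using \<phi>(2)[of m] m0[rule_format, of m] by (simp add: m_def)
      \<comment> \<open>Invariance of the measure gives the translate the same norm, so it is as
        close to the minimum as \<open>\<phi> m\<close> and by \<open>close\<close> uniformly near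
        to it.\<close>
      have "sq \<psi> = (\<integral>x. (\<phi> m (act z x))\<^sup>2 \<partial>M)"
        unfolding sq_def by (intro Bochner_Integration.integral_cong) (use \<psi> in \<open>auto simp: space_M\<close>)
      also have "\<dots> = sq (\<phi> m)"
        unfolding sq_def using integral_act[of "\<lambda>x. (\<phi> m x)\<^sup>2" z] KC[OF \<phi>(1)] zc Cont_measurable[OF Cont_intros(5)]
        by blast
      finally have "\<bar>\<psi> x - \<phi> m x\<bar> \<le> e/3" using \<epsilon>(2)[rule_format, OF \<psi>(1) \<phi>(1) _ le x] le by simp
      moreover have "\<bar>\<phi> m x - h x\<bar> < e/3" "\<bar>\<phi> m (act z x) - h (act z x)\<bar> < e/3"
        using m1 x zc by (auto simp: m_def)
      moreover have "\<psi> x = \<phi> m (act z x)" using \<psi>(2) x by blast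
      ultimately show ?thesis by linarith
    qed
    then have "\<bar>h (act z x) - h x\<bar> \<le> 0" by (rule field_le_epsilon) simp
    then show ?thesis by simp
  qed
  then have hCI: "h \<in> CI (Suc k)" using hC by (simp add: CI_def)
  moreover have "(\<lambda>n. I n f g - I n f h) \<longlonglongrightarrow> 0" if f: "f \<in> Cont" for f
  proof -
    obtain C where C: "C > 0" "\<And>x. x \<in> topspace X \<Longrightarrow> \<bar>f x\<bar> \<le> C" using Cont_bounded[OF f] by metis
    have "\<exists>n0. \<forall>n\<ge>n0. norm (I n f g - I n f h - 0) < e" if e: "e > 0" for e
    proof -
      obtain m where m: "\<forall>x\<in>topspace X. \<bar>\<phi> m x - h x\<bar> < e / (2 * C)"
        using hlim[of "e / (2 * C)"] e C by auto
      have 1: "\<bar>I n f (\<phi> m) - I n f h\<bar> \<le> C * (e / (2 * C))" for n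
        using f KC[OF \<phi>(1)] hC C m by (intro I_close) (auto intro: less_imp_le)
      obtain n0 where "\<forall>n\<ge>n0. \<bar>I n f (\<phi> m) - I n f g\<bar> < e / 2"
        using midhull_I[OF _ g f, of "\<phi> m"] \<phi>(1)[of m] e
        by (auto simp: K_def LIMSEQ_def dist_real_def dest!: spec[of _ "e/2"])
      moreover have "C * (e / (2 * C)) = e / 2" using C by simp
      ultimately have "\<bar>I n f g - I n f h\<bar> < e" if "n \<ge> n0" for n using 1[of n] that by (smt (verit) field_sum_of_halves)
      then show ?thesis by auto
    qed
    then show ?thesis by (simp add: LIMSEQ_def dist_real_def)
  qed
  ultimately show ?thesis by blast
qed

theorem characteristic_functions:
  assumes "g \<in> Cont"
  shows "\<exists>h\<in>CI 1. \<forall>f\<in>Cont. (\<lambda>n. I n f g - I n f h) \<longlonglongrightarrow> 0"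
proof -
  have *: "\<exists>h\<in>CI (Suc 0). \<forall>f\<in>Cont. (\<lambda>n. I n f g - I n f h) \<longlonglongrightarrow> 0" if "g \<in> CI (Suc k)" for g k
    using that
  proof (induction k arbitrary: g)
    case 0 then show ?case by (intro bexI[of _ g]) auto
  next
    case (Suc k)
    obtain h where h: "h\<in>CI (Suc k)" "\<forall>f\<in>Cont. (\<lambda>n. I n f g - I n f h) \<longlonglongrightarrow> 0"
      using invariant_average[OF Suc.prems] by blast
    obtain h' where h': "h'\<in>CI (Suc 0)" "\<forall>f\<in>Cont. (\<lambda>n. I n f h - I n f h') \<longlonglongrightarrow> 0"
      using Suc.IH[OF h(1)] by blast
    have "(\<lambda>n. I n f g - I n f h') \<longlonglongrightarrow> 0" if "f \<in> Cont" for f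
      using tendsto_add[OF h(2)[rule_format, OF that] h'(2)[rule_format, OF that]] by simp
    then show ?case using h' by blast
  qed
  \<comment> \<open>The descent is indexed by \<open>Suc k\<close>; passing to one further, equally
    trivial term makes it applicable also for \<open>s = 0\<close>.\<close>
  have "L (Suc s) = {\<one>}" using L_Suc_subset[of s] L_one[of "Suc s"] nilpotent by blast
  then have "g \<in> CI (Suc s)" using assms act_one by (simp add: CI_def)
  then show ?thesis using *[of g s] by simp
qed

text \<open>Modulo \<open>L 1\<close> the subgroup \<open>N\<close> is central, by definition of the
  series. The group is generated by \<open>N\<close> and the single element \<open>b\<close>, and a
  group generated by central elements and one more element is abelian.\<close>

lemma quotient_abelian: "y \<in> carrier G \<Longrightarrow> z \<in> carrier G \<Longrightarrow> lcong 1 (y \<otimes> z) (z \<otimes> y)"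
proof -
  have cent: "subgroup {y \<in> carrier G. lcong 1 (y \<otimes> z) (z \<otimes> y)} G" if z: "z \<in> carrier G" for z
  proof (rule subgroupI)
    show "{y \<in> carrier G. lcong 1 (y \<otimes> z) (z \<otimes> y)} \<noteq> {}" using lcong_refl[OF z, of 1] z by (auto intro!: exI[of _ \<one>])
  next
    fix a assume a: "a \<in> {y \<in> carrier G. lcong 1 (y \<otimes> z) (z \<otimes> y)}"
    then have "lcong 1 (inv a \<otimes> (a \<otimes> z) \<otimes> inv a) (inv a \<otimes> (z \<otimes> a) \<otimes> inv a)"
      by (intro lcong_mult[of _ "inv a \<otimes> (a \<otimes> z)"] lcong_mult[of _ "inv a"] lcong_refl) auto
    then have "lcong 1 (z \<otimes> inv a) (inv a \<otimes> z)" using a z by (simp add: m_assoc)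
    then show "inv a \<in> {y \<in> carrier G. lcong 1 (y \<otimes> z) (z \<otimes> y)}" using a lcong_sym by auto
  next
    fix a c assume a: "a \<in> {y \<in> carrier G. lcong 1 (y \<otimes> z) (z \<otimes> y)}" and c: "c \<in> {y \<in> carrier G. lcong 1 (y \<otimes> z) (z \<otimes> y)}"
    then have "lcong 1 (a \<otimes> (c \<otimes> z)) (a \<otimes> (z \<otimes> c))" by (intro lcong_mult[of _ a] lcong_refl) auto
    also have "a \<otimes> (z \<otimes> c) = (a \<otimes> z) \<otimes> c" using a c z by (simp add: m_assoc)
    also have "lcong 1 \<dots> ((z \<otimes> a) \<otimes> c)" using a c by (intro lcong_mult[of _ "a \<otimes> z"] lcong_refl) auto
    finally show "a \<otimes> c \<in> {y \<in> carrier G. lcong 1 (y \<otimes> z) (z \<otimes> y)}" using a c z by (simp add: m_assoc)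
  qed auto
  have N: "lcong 1 (y \<otimes> z) (z \<otimes> y)" if "y \<in> N" "z \<in> carrier G" for y z
    using lcong_commute[of y 0 z] that by simp
  have b: "lcong 1 (y \<otimes> b) (b \<otimes> y)" if "y \<in> carrier G" for y
  proof -
    have "carrier G \<subseteq> {y \<in> carrier G. lcong 1 (y \<otimes> b) (b \<otimes> y)}"
      using N N_carrier by (intro generated cent) (auto intro: lcong_refl)
    then show ?thesis using that by auto
  qed
  assume z: "z \<in> carrier G" and y: "y \<in> carrier G"
  have "carrier G \<subseteq> {y \<in> carrier G. lcong 1 (y \<otimes> z) (z \<otimes> y)}"
    using N N_carrier lcong_sym[OF b[OF z]] z by (intro generated cent) auto
  then show ?thesis using y by auto
qed

text \<open>Finitely many orbits of \<open>W\<close> at points \<open>act h x0\<close> cover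
  \<open>X\<close>, so any \<open>g\<close> has the form \<open>w h \<gamma>\<close> with
  \<open>\<gamma>\<close> in the stabiliser. Since the quotient by \<open>L 1\<close> is abelian,
  \<open>\<gamma>\<close> leaves \<open>\<phi>\<close> unchanged at every point, and
  \<open>w\<close> changes it by less than \<open>e\<close>.\<close>

theorem CI_1_almost_periodic:
  assumes \<phi>: "\<phi> \<in> CI 1" and e: "e > 0"
  shows "\<exists>F. finite F \<and> F \<subseteq> carrier G \<and>
    (\<forall>g\<in>carrier G. \<exists>h\<in>F. \<forall>x\<in>topspace X. \<bar>\<phi> (act g x) - \<phi> (act h x)\<bar> < e)"
proof -
  obtain W where W: "nbhd W" "\<And>w x. w \<in> W \<Longrightarrow> x \<in> topspace X \<Longrightarrow> \<bar>\<phi> (act w x) - \<phi> x\<bar> < e"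
    using uniform_continuity[OF CI_Cont[OF \<phi>] e] by metis
  let ?O = "\<lambda>h. (\<lambda>w. act w (act h x0)) ` W"
  have "topspace X \<subseteq> \<Union>(?O ` carrier G)"
  proof
    fix x assume x: "x \<in> topspace X"
    then obtain h where h: "h \<in> carrier G" "x = act h x0" using transitive by blast
    then have "x \<in> ?O h" using W(1) act_one[OF x] by (auto simp: nbhd_def intro!: rev_image_eqI[of "\<one>"])
    then show "x \<in> \<Union>(?O ` carrier G)" using h by blast
  qed
  moreover have "openin X (?O h)" if "h \<in> carrier G" for h
    using W(1) that x0 by (intro open_orbit) (auto simp: nbhd_def)
  ultimately obtain \<F> where \<F>: "finite \<F>" "\<F> \<subseteq> ?O ` carrier G" "topspace X \<subseteq> \<Union>\<F>"
    using compactinD[OF compact[unfolded compact_space_def], of "?O ` carrier G"] by blast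
  then obtain F where F: "finite F" "F \<subseteq> carrier G" "\<F> = ?O ` F" by (metis finite_subset_image)
  have "\<exists>h\<in>F. \<forall>x\<in>topspace X. \<bar>\<phi> (act g x) - \<phi> (act h x)\<bar> < e" if g: "g \<in> carrier G" for g
  proof -
    have "act g x0 \<in> \<Union>(?O ` F)" using \<F>(3) F(3) act_in[OF g x0] by blast
    then obtain h w where hw: "h \<in> F" "w \<in> W" "act g x0 = act w (act h x0)" by blast
    have c: "h \<in> carrier G" "w \<in> carrier G" using hw F W(1) nbhd_carrier by auto
    define \<gamma> where "\<gamma> = inv (w \<otimes> h) \<otimes> g"
    have \<gamma>: "\<gamma> \<in> Stab" unfolding \<gamma>_def using hw c g x0 by (intro same_orbit_point) (auto simp: act_mult)
    then have \<gamma>c: "\<gamma> \<in> carrier G" by (simp add: Stab_def)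
    have fix\<gamma>: "\<phi> (act \<gamma> x) = \<phi> x" if "x \<in> topspace X" for x
    proof -
      obtain y where y: "y \<in> carrier G" "x = act y x0" using transitive \<open>x \<in> topspace X\<close> by blast
      have "\<phi> (act (\<gamma> \<otimes> y) x0) = \<phi> (act (y \<otimes> \<gamma>) x0)" by (rule CI_lcong[OF \<phi> quotient_abelian[OF \<gamma>c y(1)] x0])
      then show ?thesis using \<gamma> \<gamma>c y x0 by (simp add: act_mult Stab_def)
    qed
    have "\<bar>\<phi> (act g x) - \<phi> (act h x)\<bar> < e" if x: "x \<in> topspace X" for x
    proof -
      have "g = (w \<otimes> h) \<otimes> \<gamma>" using c g by (simp add: \<gamma>_def)
      then have "\<phi> (act g x) = \<phi> (act (\<gamma> \<otimes> (w \<otimes> h)) x)"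
        using CI_lcong[OF \<phi> quotient_abelian[of "w \<otimes> h" \<gamma>] x] c \<gamma>c by simp
      also have "\<dots> = \<phi> (act w (act h x))" using fix\<gamma>[of "act (w \<otimes> h) x"] c \<gamma>c x by (simp add: act_mult)
      finally show ?thesis using W(2)[OF hw(2), of "act h x"] c x by simp
    qed
    then show ?thesis using hw by blast
  qed
  then show ?thesis using F by blast
qed

end

section \<open>Averages and correlations\<close>

locale measure_preserving = prob_space M for M :: "'a measure" +
  fixes T :: "'a \<Rightarrow> 'a"
  assumes T_measurable [measurable]: "T \<in> measurable M M" and T_invariant: "distr M M T = M"
begin

lemma iter_measurable [measurable]: "(T ^^ n) \<in> measurable M M"
  by (induction n) (auto simp: T_measurable)

lemma iter_space: "x \<in> space M \<Longrightarrow> (T ^^ n) x \<in> space M"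
  using measurable_space[OF iter_measurable] by blast

lemma distr_iter: "distr M M (T ^^ n) = M"
proof (induction n)
  case (Suc n)
  have "distr (distr M M (T ^^ n)) M T = distr M M (T \<circ> (T ^^ n))"
    by (rule distr_distr) auto
  then show ?case unfolding Suc T_invariant by (simp only: funpow.simps)
qed (simp add: distr_id id_def)

lemma integral_iter:
  fixes \<phi> :: "'a \<Rightarrow> 'd :: {banach, second_countable_topology}"
  assumes "\<phi> \<in> borel_measurable M"
  shows "(\<integral>x. \<phi> ((T ^^ n) x) \<partial>M) = (\<integral>x. \<phi> x \<partial>M)"
  using integral_distr[of "T ^^ n" M M \<phi>] assms by (simp add: distr_iter)

lemma AE_iter: assumes "AE x in M. P x" shows "AE x in M. P ((T ^^ n) x)"
proof -
  have "AE x in distr M M (T ^^ n). P x" unfolding distr_iter by (rule assms)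
  then show ?thesis by (rule AE_distrD[OF iter_measurable])
qed

text \<open>The bound holds at every point and not only almost everywhere, so that it passes to
  iterates and pointwise averages without null sets.\<close>

definition bdd :: "real \<Rightarrow> ('a \<Rightarrow> complex) \<Rightarrow> bool" where
  "bdd C F \<longleftrightarrow> F \<in> borel_measurable M \<and> (\<forall>x\<in>space M. norm (F x) \<le> C)"

lemma bdd_measurable [measurable_dest]: "bdd C F \<Longrightarrow> F \<in> borel_measurable M" by (simp add: bdd_def)

lemma bdd_bound: "bdd C F \<Longrightarrow> x \<in> space M \<Longrightarrow> norm (F x) \<le> C" by (simp add: bdd_def)

lemma bdd_nonneg: "bdd C F \<Longrightarrow> 0 \<le> C"
proof -
  assume F: "bdd C F"
  obtain x where "x \<in> space M" using not_empty by blast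
  from bdd_bound[OF F this] show ?thesis using norm_ge_zero order_trans by blast
qed

lemma integrable_bounded:
  fixes F :: "'a \<Rightarrow> 'd :: {banach, second_countable_topology}"
  assumes "F \<in> borel_measurable M" "\<And>x. x \<in> space M \<Longrightarrow> norm (F x) \<le> C"
  shows "integrable M F"
  by (rule integrable_const_bound[where B = C]) (use assms in auto)

lemma bdd_integrable: "bdd C F \<Longrightarrow> integrable M F"
  by (rule integrable_bounded[of _ C]) (auto simp: bdd_def)

lemma bdd_iter: "bdd C F \<Longrightarrow> bdd C (\<lambda>x. F ((T ^^ n) x))"
  using iter_space by (auto simp: bdd_def)

lemma bdd_sq_integrable: assumes "bdd C F" shows "integrable M (\<lambda>x. (norm (F x))\<^sup>2)"
proof (rule integrable_bounded[of _ "C\<^sup>2"])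
  show "(\<lambda>x. (norm (F x))\<^sup>2) \<in> borel_measurable M" using assms by measurable
  show "norm ((norm (F x))\<^sup>2) \<le> C\<^sup>2" if "x \<in> space M" for x
    using bdd_bound[OF assms that] by (simp add: power_mono)
qed

lemma bdd_diff: "bdd C F \<Longrightarrow> bdd D H \<Longrightarrow> bdd (C + D) (\<lambda>x. F x - H x)"
  unfolding bdd_def by (auto intro!: order_trans[OF norm_triangle_ineq4 add_mono])

lemma bdd_const: "bdd (norm c) (\<lambda>x. c)" by (simp add: bdd_def)

lemma bdd_mult: "bdd C F \<Longrightarrow> bdd D H \<Longrightarrow> bdd (C * D) (\<lambda>x. F x * H x)"
  using bdd_nonneg[of C F] unfolding bdd_def by (auto simp: norm_mult intro!: mult_mono)

lemma bdd_cnj: "bdd C F \<Longrightarrow> bdd C (\<lambda>x. cnj (F x))"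
  using measurable_compose[OF _ borel_measurable_continuous_onI[of cnj]] continuous_on_cnj[OF continuous_on_id]
  by (auto simp: bdd_def)

section \<open>Ergodic averages and convex combinations of translates\<close>

definition avg :: "nat \<Rightarrow> ('a \<Rightarrow> complex) \<Rightarrow> 'a \<Rightarrow> complex" where
  "avg N F x = (\<Sum>h=1..N. F ((T ^^ h) x)) / of_nat N"

lemma avg_norm: "bdd C F \<Longrightarrow> x \<in> space M \<Longrightarrow> norm (avg N F x) \<le> C"
proof -
  assume F: "bdd C F" and x: "x \<in> space M"
  have "norm (\<Sum>h=1..N. F ((T ^^ h) x)) \<le> real (card {1..N}) * C"
    using bdd_bound[OF F] iter_space[OF x] by (intro sum_norm_bound) auto
  then show ?thesis using bdd_nonneg[OF F]
    by (cases "N = 0") (auto simp: avg_def norm_divide field_simps)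
qed

lemma bdd_avg: "bdd C F \<Longrightarrow> bdd C (avg N F)"
  using avg_norm unfolding bdd_def by (auto simp: avg_def[abs_def])

definition nrm2 :: "('a \<Rightarrow> complex) \<Rightarrow> real" where "nrm2 F = (\<integral>x. (norm (F x))\<^sup>2 \<partial>M)"

lemma nrm2_nonneg: "nrm2 F \<ge> 0" by (simp add: nrm2_def)

lemma sum_norm_square_le:
  fixes c :: "nat \<Rightarrow> complex"
  assumes "finite A"
  shows "(norm (sum c A))\<^sup>2 \<le> real (card A) * (\<Sum>i\<in>A. (norm (c i))\<^sup>2)"
proof -
  have "(norm (sum c A))\<^sup>2 \<le> (\<Sum>i\<in>A. norm (c i) * 1)\<^sup>2"
    using norm_sum[of c A] by (intro power_mono) auto
  also have "\<dots> \<le> (\<Sum>i\<in>A. (norm (c i))\<^sup>2) * (\<Sum>i\<in>A. 1\<^sup>2)" by (rule Cauchy_Schwarz_ineq_sum)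
  finally show ?thesis by (simp add: mult.commute)
qed

lemma nrm2_avg: assumes F: "bdd C F" shows "nrm2 (avg N F) \<le> nrm2 F"
proof (cases "N = 0")
  case True then show ?thesis by (simp add: nrm2_def avg_def)
next
  case False
  have i: "integrable M (\<lambda>x. (norm (F ((T ^^ h) x)))\<^sup>2)" for h using bdd_sq_integrable[OF bdd_iter[OF F]] .
  have "nrm2 (avg N F) \<le> (\<integral>x. (\<Sum>h=1..N. (norm (F ((T ^^ h) x)))\<^sup>2) / N \<partial>M)"
    unfolding nrm2_def
  proof (rule integral_mono)
    show "integrable M (\<lambda>x. (norm (avg N F x))\<^sup>2)" by (rule bdd_sq_integrable[OF bdd_avg[OF F]])
    show "integrable M (\<lambda>x. (\<Sum>h=1..N. (norm (F ((T ^^ h) x)))\<^sup>2) / N)" using i by simp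
    fix x
    have "(norm (\<Sum>h=1..N. F ((T ^^ h) x)))\<^sup>2 \<le> real N * (\<Sum>h=1..N. (norm (F ((T ^^ h) x)))\<^sup>2)"
      using sum_norm_square_le[of "{1..N}"] by simp
    then show "(norm (avg N F x))\<^sup>2 \<le> (\<Sum>h=1..N. (norm (F ((T ^^ h) x)))\<^sup>2) / N"
      using False by (simp add: avg_def norm_divide power_divide field_simps power2_eq_square)
  qed
  also have "\<dots> = (\<Sum>h=1..N. (\<integral>x. (norm (F ((T ^^ h) x)))\<^sup>2 \<partial>M)) / N" using i by simp
  also have "\<dots> = (\<Sum>h=1..N. nrm2 F) / N"
    using integral_iter[of "\<lambda>x. (norm (F x))\<^sup>2"] F by (simp add: nrm2_def)
  also have "\<dots> = nrm2 F" using False by simp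
  finally show ?thesis .
qed

inductive_set convhull :: "('a \<Rightarrow> complex) \<Rightarrow> ('a \<Rightarrow> complex) set" for F where
  shift: "(\<lambda>x. F ((T ^^ n) x)) \<in> convhull F"
| conv: "\<phi> \<in> convhull F \<Longrightarrow> \<psi> \<in> convhull F \<Longrightarrow> 0 \<le> t \<Longrightarrow> t \<le> 1 \<Longrightarrow>
    (\<lambda>x. of_real t * \<phi> x + of_real (1 - t) * \<psi> x) \<in> convhull F"

lemma convhull_bdd: "\<phi> \<in> convhull F \<Longrightarrow> bdd C F \<Longrightarrow> bdd C \<phi>"
proof (induction rule: convhull.induct)
  case (conv \<phi> \<psi> t)
  have "norm (of_real t * \<phi> x + of_real (1 - t) * \<psi> x) \<le> C" if "x \<in> space M" for x
  proof -
    have "norm (of_real t * \<phi> x + of_real (1 - t) * \<psi> x) \<le> t * norm (\<phi> x) + (1 - t) * norm (\<psi> x)"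
      using conv norm_triangle_ineq[of "of_real t * \<phi> x" "of_real (1 - t) * \<psi> x"]
      by (simp add: norm_mult del: of_real_diff)
    also have "\<dots> \<le> t * C + (1 - t) * C"
      using conv that by (intro add_mono mult_left_mono) (auto simp: bdd_def)
    finally show ?thesis by (simp add: algebra_simps)
  qed
  then show ?case using conv by (auto simp: bdd_def)
qed (rule bdd_iter)

text \<open>A shift by one telescopes: only the first and the last summand survive, which costs
  \<open>2 * C / N\<close>.\<close>

lemma avg_shift_bound:
  assumes F: "bdd C F" and x: "x \<in> space M"
  shows "norm (avg N F x - avg N (\<lambda>x. F ((T ^^ n) x)) x) \<le> 2 * C * n / N"
proof (induction n)
  case (Suc n)
  let ?G = "\<lambda>x. F ((T ^^ n) x)"
  have G: "bdd C ?G" by (rule bdd_iter[OF F])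
  have "(\<Sum>h=1..N. ?G ((T ^^ h) x)) - (\<Sum>h=1..N. ?G ((T ^^ Suc h) x)) = ?G ((T ^^ 1) x) - ?G ((T ^^ Suc N) x)"
    by (induction N) (auto simp: algebra_simps)
  then have "norm (avg N ?G x - avg N (\<lambda>x. F ((T ^^ Suc n) x)) x) = norm (?G ((T ^^ 1) x) - ?G ((T ^^ Suc N) x)) / N"
    by (simp add: avg_def funpow_swap1 norm_divide flip: diff_divide_distrib)
  also have "\<dots> \<le> (C + C) / N"
    by (intro divide_right_mono norm_triangle_le_diff add_mono bdd_bound[OF G] iter_space x) auto
  finally have "norm (avg N ?G x - avg N (\<lambda>x. F ((T ^^ Suc n) x)) x) \<le> (C + C) / N" .
  from norm_diff_triangle_le[OF Suc this]
  have "norm (avg N F x - avg N (\<lambda>x. F ((T ^^ Suc n) x)) x) \<le> 2 * C * n / N + (C + C) / N" .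
  also have "2 * C * n / N + (C + C) / N = 2 * C * Suc n / N"
    by (simp add: algebra_simps flip: add_divide_distrib)
  finally show ?case .
qed (simp)

lemma avg_conv:
  "avg N (\<lambda>x. a * \<phi> x + c * \<psi> x) x = a * avg N \<phi> x + c * avg N \<psi> x"
  by (simp add: avg_def sum.distrib add_divide_distrib flip: sum_distrib_left)

lemma convhull_avg:
  assumes "\<phi> \<in> convhull F" "bdd C F"
  shows "\<exists>c\<ge>0. \<forall>N. \<forall>x\<in>space M. norm (avg N F x - avg N \<phi> x) \<le> c / N"
  using assms(1)
proof (induction rule: convhull.induct)
  case (shift n)
  then show ?case using avg_shift_bound[OF assms(2), of _ _ n] bdd_nonneg[OF assms(2)]
    by (intro exI[of _ "2 * C * n"]) auto
next
  case (conv \<phi> \<psi> t)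
  then obtain c d where cd: "c \<ge> 0" "d \<ge> 0" "\<forall>N. \<forall>x\<in>space M. norm (avg N F x - avg N \<phi> x) \<le> c / N"
    "\<forall>N. \<forall>x\<in>space M. norm (avg N F x - avg N \<psi> x) \<le> d / N" by auto
  have "norm (avg N F x - avg N (\<lambda>x. of_real t * \<phi> x + of_real (1 - t) * \<psi> x) x) \<le> (c + d) / N"
    if x: "x \<in> space M" for N x
  proof -
    have "avg N F x - avg N (\<lambda>x. of_real t * \<phi> x + of_real (1 - t) * \<psi> x) x =
        of_real t * (avg N F x - avg N \<phi> x) + of_real (1 - t) * (avg N F x - avg N \<psi> x)"
      unfolding avg_conv by (simp add: algebra_simps)
    also have "norm \<dots> \<le> t * norm (avg N F x - avg N \<phi> x) + (1 - t) * norm (avg N F x - avg N \<psi> x)"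
      using conv norm_triangle_ineq[of "of_real t * (avg N F x - avg N \<phi> x)" "of_real (1 - t) * (avg N F x - avg N \<psi> x)"]
      by (simp add: norm_mult del: of_real_diff)
    also have "\<dots> \<le> 1 * norm (avg N F x - avg N \<phi> x) + 1 * norm (avg N F x - avg N \<psi> x)"
      using conv by (intro add_mono mult_right_mono) auto
    also have "\<dots> \<le> c / N + d / N" using cd x by (intro add_mono) auto
    finally show ?thesis by (simp add: add_divide_distrib)
  qed
  then show ?case using cd by (intro exI[of _ "c + d"]) auto
qed

text \<open>Each average is a convex combination, with weight \<open>N / (N + 1)\<close>, of its
  predecessor and one new translate. The case \<open>N = 0\<close> is excluded since
  \<open>avg 0 F\<close> is the zero function.\<close>

lemma avg_in_convhull: "N > 0 \<Longrightarrow> avg N F \<in> convhull F"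
proof (induction N rule: nat_induct_non_zero)
  case 1
  have "avg 1 F = (\<lambda>x. F ((T ^^ 1) x))" by (simp add: avg_def fun_eq_iff)
  then show ?case using convhull.shift[where n = 1] by metis
next
  case (Suc N)
  have "avg (Suc N) F = (\<lambda>x. of_real (real N / real (Suc N)) * avg N F x
      + of_real (1 - real N / real (Suc N)) * F ((T ^^ Suc N) x))"
  proof
    fix x
    have *: "(of_nat (Suc N) :: complex) \<noteq> 0" "(of_nat N :: complex) \<noteq> 0"
      using Suc by (simp_all add: of_nat_neq_0 del: of_nat_Suc)
    have "complex_of_real (1 - real N / real (Suc N)) = 1 / of_nat (Suc N)"
      using Suc by (simp add: field_simps)
    then show "avg (Suc N) F x = of_real (real N / real (Suc N)) * avg N F x
      + of_real (1 - real N / real (Suc N)) * F ((T ^^ Suc N) x)"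
      using * by (simp add: avg_def add_divide_distrib del: of_nat_Suc)
  qed
  then show ?case using convhull.conv[OF Suc.IH convhull.shift, of "real N / real (Suc N)" "Suc N"] by simp
qed

text \<open>Take a convex combination \<open>\<phi>\<close> of translates with nearly minimal norm.
  Its averages are asymptotically those of \<open>F\<close>, and averaging does not increase the
  norm, so the averages of \<open>F\<close> are nearly minimal too. The midpoint of two of them lies
  in the convex hull, and the parallelogram identity makes their difference small. Ergodicity plays
  no part, which permits the use on a product system.\<close>

theorem mean_ergodic_Cauchy:
  assumes F: "bdd C F" and e: "e > 0"
  shows "\<exists>N0. \<forall>m\<ge>N0. \<forall>n\<ge>N0. nrm2 (\<lambda>x. avg m F x - avg n F x) < e"
proof -
  define d where "d = Inf (nrm2 ` convhull F)"
  have bb: "bdd_below (nrm2 ` convhull F)" using nrm2_nonneg by (intro bdd_belowI[of _ 0]) auto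
  have ne: "convhull F \<noteq> {}" using convhull.shift by blast
  have d_le: "d \<le> nrm2 \<phi>" if "\<phi> \<in> convhull F" for \<phi>
    unfolding d_def using bb that by (intro cInf_lower) auto
  \<comment> \<open>Two averages of squared norm below \<open>d + 2 * \<epsilon>\<close> differ in
    squared norm by less than \<open>8 * \<epsilon>\<close>.\<close>
  define \<epsilon> where "\<epsilon> = e / 8"
  have \<epsilon>: "\<epsilon> > 0" using e by (simp add: \<epsilon>_def)
  have "\<exists>v\<in>nrm2 ` convhull F. v < d + \<epsilon>"
    unfolding d_def using ne bb \<epsilon> by (subst cInf_less_iff[symmetric]) auto
  then obtain \<phi> where \<phi>: "\<phi> \<in> convhull F" "nrm2 \<phi> < d + \<epsilon>" by auto
  have \<phi>b: "bdd C \<phi>" using convhull_bdd[OF \<phi>(1) F] .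
  have C: "C \<ge> 0" using bdd_nonneg[OF F] .
  obtain c where c: "c \<ge> 0" "\<And>N x. x \<in> space M \<Longrightarrow> norm (avg N F x - avg N \<phi> x) \<le> c / N"
    using convhull_avg[OF \<phi>(1) F] by blast
  have le: "nrm2 (avg N F) \<le> nrm2 \<phi> + 2 * C * c / N" for N
  proof -
    have "nrm2 (avg N F) \<le> (\<integral>x. (norm (avg N \<phi> x))\<^sup>2 + 2 * C * c / N \<partial>M)"
      unfolding nrm2_def
    proof (rule integral_mono)
      fix x assume x: "x \<in> space M"
      let ?a = "norm (avg N F x)" and ?b = "norm (avg N \<phi> x)"
      have "?a - ?b \<le> c / N" using c(2)[OF x] norm_triangle_ineq2 order_trans by blast
      moreover have "?a + ?b \<le> 2 * C" using avg_norm[OF F x, of N] avg_norm[OF \<phi>b x, of N] by simp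
      ultimately have "(?a - ?b) * (?a + ?b) \<le> (c / N) * (2 * C)"
        using c(1) by (intro mult_mono) auto
      then show "?a\<^sup>2 \<le> ?b\<^sup>2 + 2 * C * c / N" by (simp add: power2_eq_square algebra_simps)
    qed (use bdd_sq_integrable[OF bdd_avg[OF F]] bdd_sq_integrable[OF bdd_avg[OF \<phi>b]] in auto)
    also have "\<dots> = nrm2 (avg N \<phi>) + 2 * C * c / N"
      using bdd_sq_integrable[OF bdd_avg[OF \<phi>b]] by (simp add: nrm2_def prob_space)
    finally show ?thesis using nrm2_avg[OF \<phi>b, of N] by simp
  qed
  obtain N1 where N1: "2 * C * c / \<epsilon> < real N1" using reals_Archimedean2 by blast
  define N0 where "N0 = max 1 N1"
  have small: "nrm2 (avg N F) < d + 2 * \<epsilon>" if N: "N \<ge> N0" for N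
  proof -
    have "2 * C * c / \<epsilon> < real N" "real N > 0" using N1 N by (auto simp: N0_def)
    then have "2 * C * c / N < \<epsilon>" using \<epsilon> by (simp add: field_simps)
    then show ?thesis using le[of N] \<phi>(2) by simp
  qed
  have "nrm2 (\<lambda>x. avg m F x - avg n F x) < e" if mn: "m \<ge> N0" "n \<ge> N0" for m n
  proof -
    define t :: real where "t = 1/2"
    let ?h = "\<lambda>x. of_real t * avg m F x + of_real (1 - t) * avg n F x"
    have h: "?h \<in> convhull F" using mn by (intro convhull.conv avg_in_convhull) (auto simp: N0_def t_def)
    note i = bdd_sq_integrable[OF bdd_avg[OF F, of m]] bdd_sq_integrable[OF bdd_avg[OF F, of n]]
      bdd_sq_integrable[OF convhull_bdd[OF h F]]
    have "nrm2 (\<lambda>x. avg m F x - avg n F x) =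
        (\<integral>x. 2 * (norm (avg m F x))\<^sup>2 + 2 * (norm (avg n F x))\<^sup>2 - 4 * (norm (?h x))\<^sup>2 \<partial>M)"
      unfolding nrm2_def
    proof (rule Bochner_Integration.integral_cong[OF refl])
      fix x
      have "(norm (a - b))\<^sup>2 = 2 * (norm a)\<^sup>2 + 2 * (norm b)\<^sup>2 - 4 * (norm (of_real t * a + of_real (1 - t) * b))\<^sup>2"
        for a b :: complex unfolding cmod_power2 t_def by (simp add: power2_eq_square field_simps)
      then show "(norm (avg m F x - avg n F x))\<^sup>2 =
        2 * (norm (avg m F x))\<^sup>2 + 2 * (norm (avg n F x))\<^sup>2 - 4 * (norm (?h x))\<^sup>2" .
    qed
    also have "\<dots> = 2 * nrm2 (avg m F) + 2 * nrm2 (avg n F) - 4 * nrm2 ?h"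
      using i by (simp add: nrm2_def del: of_real_diff)
    also have "\<dots> < e" using small[OF mn(1)] small[OF mn(2)] d_le[OF h] by (simp add: \<epsilon>_def)
    finally show ?thesis .
  qed
  then show ?thesis by blast
qed

end

section \<open>Cesaro means\<close>

lemma cesaro_zero:
  fixes x :: "nat \<Rightarrow> real"
  assumes "x \<longlonglongrightarrow> 0"
  shows "(\<lambda>N. (\<Sum>n=1..N. x n) / N) \<longlonglongrightarrow> 0"
proof (rule LIMSEQ_I)
  fix e :: real assume e: "e > 0"
  obtain n0 where n0: "\<And>n. n \<ge> n0 \<Longrightarrow> \<bar>x n\<bar> < e/2"
    using LIMSEQ_D[OF assms, of "e/2"] e by auto
  define K where "K = (\<Sum>n\<le>n0. \<bar>x n\<bar>)"
  have bound: "(\<Sum>n=1..N. \<bar>x n\<bar>) \<le> K + real N * (e/2)" for N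
  proof -
    have "(\<Sum>n=1..N. \<bar>x n\<bar>) \<le> (\<Sum>n=1..N. (if n \<le> n0 then \<bar>x n\<bar> else 0) + e/2)"
    proof (rule sum_mono)
      fix n
      show "\<bar>x n\<bar> \<le> (if n \<le> n0 then \<bar>x n\<bar> else 0) + e/2" using n0[of n] e by auto
    qed
    also have "\<dots> = (\<Sum>n=1..N. if n \<le> n0 then \<bar>x n\<bar> else 0) + real N * (e/2)" by (simp add: sum.distrib)
    also have "(\<Sum>n=1..N. if n \<le> n0 then \<bar>x n\<bar> else 0) = (\<Sum>n\<in>{1..N} \<inter> {..n0}. \<bar>x n\<bar>)"
      by (subst sum.inter_restrict) auto
    also have "\<dots> \<le> K" unfolding K_def by (intro sum_mono2) auto
    finally show ?thesis by simp
  qed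
  obtain N1 where N1: "2 * K / e < real N1" using reals_Archimedean2 by blast
  have "norm ((\<Sum>n=1..N. x n) / N - 0) < e" if N: "N \<ge> max 1 N1" for N
  proof -
    have "2 * K / e < real N" "real N > 0" using N N1 by auto
    then have "K < real N * (e/2)" using e by (simp add: field_simps)
    then have "\<bar>\<Sum>n=1..N. x n\<bar> < real N * e" using bound[of N] sum_abs[of x "{1..N}"] by linarith
    then show ?thesis using \<open>real N > 0\<close> by (simp add: field_simps)
  qed
  then show "\<exists>no. \<forall>N\<ge>no. norm ((\<Sum>n=1..N. x n) / N - 0) < e" by blast
qed

lemma cesaro_complex:
  fixes x :: "nat \<Rightarrow> complex"
  assumes "x \<longlonglongrightarrow> l"
  shows "(\<lambda>N. (\<Sum>n=1..N. x n) / of_nat N) \<longlonglongrightarrow> l"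
proof -
  have "(\<lambda>N. (\<Sum>n=1..N. norm (x n - l)) / N) \<longlonglongrightarrow> 0"
    using assms by (intro cesaro_zero) (simp add: tendsto_norm_zero_iff LIM_zero_iff)
  then have "(\<lambda>N. (\<Sum>n=1..N. x n) / of_nat N - l) \<longlonglongrightarrow> 0"
  proof (rule Lim_null_comparison[rotated])
    show "\<forall>\<^sub>F N in sequentially. norm ((\<Sum>n=1..N. x n) / of_nat N - l) \<le> (\<Sum>n=1..N. norm (x n - l)) / N"
      using eventually_gt_at_top[of 0]
    proof eventually_elim
      case (elim N)
      have "(\<Sum>n=1..N. x n) / of_nat N - l = (\<Sum>n=1..N. x n - l) / of_nat N"
        using elim by (simp add: sum_subtractf field_simps)
      then show ?case using norm_sum[of "\<lambda>n. x n - l" "{1..N}"] by (simp add: norm_divide divide_right_mono)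
    qed
  qed
  then show ?thesis by (simp add: LIM_zero_iff)
qed

lemma eq_norm_of_real: "complex_of_real a = z \<Longrightarrow> 0 \<le> a \<Longrightarrow> a = norm z"
  by auto

section \<open>Correlations of a function with its translates\<close>

context measure_preserving
begin

text \<open>The difference of the two sides is the variance of \<open>norm (u x)\<close>.\<close>

lemma L1_sq_le_nrm2: assumes "bdd C u" shows "(\<integral>x. norm (u x) \<partial>M)\<^sup>2 \<le> nrm2 u"
proof -
  have "integrable M (\<lambda>x. norm (u x))" using bdd_integrable[OF assms] by simp
  then have "variance (\<lambda>x. norm (u x)) = nrm2 u - (\<integral>x. norm (u x) \<partial>M)\<^sup>2"
    unfolding nrm2_def using bdd_sq_integrable[OF assms] by (intro variance_eq) auto
  then show ?thesis using variance_positive[of "\<lambda>x. norm (u x)"] by simp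
qed

lemma integral_mult_bound:
  assumes F: "bdd C F" and u: "bdd D u"
  shows "norm (\<integral>x. F x * u x \<partial>M) \<le> C * sqrt (nrm2 u)"
proof -
  have "norm (\<integral>x. F x * u x \<partial>M) \<le> (\<integral>x. norm (F x * u x) \<partial>M)" by (rule integral_norm_bound)
  also have "\<dots> \<le> (\<integral>x. C * norm (u x) \<partial>M)"
  proof (rule integral_mono)
    show "integrable M (\<lambda>x. norm (F x * u x))" using bdd_integrable[OF bdd_mult[OF F u]] by simp
    show "integrable M (\<lambda>x. C * norm (u x))" using bdd_integrable[OF u] by simp
    show "norm (F x * u x) \<le> C * norm (u x)" if "x \<in> space M" for x
      using bdd_bound[OF F that] by (simp add: norm_mult mult_right_mono)
  qed
  also have "\<dots> = C * (\<integral>x. norm (u x) \<partial>M)" by simp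
  also have "\<dots> \<le> C * sqrt (nrm2 u)"
    using L1_sq_le_nrm2[OF u] bdd_nonneg[OF F] by (intro mult_left_mono real_le_rsqrt) auto
  finally show ?thesis .
qed

definition corr :: "('a \<Rightarrow> complex) \<Rightarrow> nat \<Rightarrow> complex" where
  "corr F h = (\<integral>x. F x * cnj (F ((T ^^ h) x)) \<partial>M)"

lemma corr_integrable: "bdd C F \<Longrightarrow> integrable M (\<lambda>x. F x * cnj (F ((T ^^ h) x)))"
  by (rule bdd_integrable[OF bdd_mult[OF _ bdd_cnj[OF bdd_iter]]])

lemma sum_corr:
  assumes "bdd C F"
  shows "(\<Sum>h=1..H. corr F h) / of_nat H = (\<integral>x. F x * cnj (avg H F x) \<partial>M)"
proof -
  have "(\<integral>x. F x * cnj (avg H F x) \<partial>M) = (\<integral>x. (\<Sum>h=1..H. F x * cnj (F ((T ^^ h) x))) / of_nat H \<partial>M)"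
    by (simp add: avg_def sum_distrib_left)
  also have "\<dots> = (\<Sum>h=1..H. corr F h) / of_nat H"
    using corr_integrable[OF assms] by (simp add: corr_def)
  finally show ?thesis by simp
qed

lemma corr_average_convergent:
  assumes F: "bdd C F"
  shows "convergent (\<lambda>H. (\<Sum>h=1..H. corr F h) / of_nat H)"
proof (rule Cauchy_convergent, rule metric_CauchyI)
  fix e :: real assume e: "e > 0"
  have C: "C \<ge> 0" by (rule bdd_nonneg[OF F])
  \<comment> \<open>After the Cauchy-Schwarz estimate the error is \<open>C * (e / (C + 1))\<close>;
    the summand 1 keeps this meaningful and strictly below \<open>e\<close> also when
    \<open>C = 0\<close>.\<close>
  define \<epsilon> where "\<epsilon> = (e / (C + 1))\<^sup>2"
  have "\<epsilon> > 0" using e C by (simp add: \<epsilon>_def)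
  then obtain N0 where N0: "\<And>m n. m \<ge> N0 \<Longrightarrow> n \<ge> N0 \<Longrightarrow> nrm2 (\<lambda>x. avg m F x - avg n F x) < \<epsilon>"
    using mean_ergodic_Cauchy[OF F] by blast
  have "dist ((\<Sum>h=1..m. corr F h) / of_nat m) ((\<Sum>h=1..n. corr F h) / of_nat n) < e"
    if mn: "m \<ge> N0" "n \<ge> N0" for m n
  proof -
    let ?u = "\<lambda>x. cnj (avg m F x - avg n F x)"
    have u: "bdd (C + C) ?u" by (intro bdd_cnj bdd_diff bdd_avg F)
    have i: "integrable M (\<lambda>x. F x * cnj (avg k F x))" for k
      by (intro bdd_integrable[OF bdd_mult[OF F bdd_cnj[OF bdd_avg[OF F]]]])
    have "(\<Sum>h=1..m. corr F h) / of_nat m - (\<Sum>h=1..n. corr F h) / of_nat n = (\<integral>x. F x * ?u x \<partial>M)"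
      unfolding sum_corr[OF F] using i by (simp add: right_diff_distrib)
    then have "dist ((\<Sum>h=1..m. corr F h) / of_nat m) ((\<Sum>h=1..n. corr F h) / of_nat n) \<le> C * sqrt (nrm2 ?u)"
      using integral_mult_bound[OF F u] by (simp add: dist_norm)
    also have "nrm2 ?u = nrm2 (\<lambda>x. avg m F x - avg n F x)"
      unfolding nrm2_def by (simp del: complex_cnj_diff)
    also have "C * sqrt \<dots> \<le> C * sqrt \<epsilon>"
      using N0[OF mn] C by (intro mult_left_mono real_sqrt_le_mono) auto
    also have "sqrt \<epsilon> = e / (C + 1)" using C e by (simp add: \<epsilon>_def real_sqrt_divide)
    also have "C * (e / (C + 1)) < e" using C e by (simp add: field_simps)
    finally show ?thesis .
  qed
  then show "\<exists>N0. \<forall>m\<ge>N0. \<forall>n\<ge>N0. dist ((\<Sum>h=1..m. corr F h) / of_nat m) ((\<Sum>h=1..n. corr F h) / of_nat n) < e"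
    by blast
qed

lemma measure_preserving_product: "measure_preserving (M \<Otimes>\<^sub>M M) (\<lambda>(x, y). (T x, T y))"
proof -
  interpret P: pair_prob_space M M by unfold_locales
  show ?thesis
  proof (unfold_locales)
    show "(\<lambda>(x, y). (T x, T y)) \<in> measurable (M \<Otimes>\<^sub>M M) (M \<Otimes>\<^sub>M M)" by measurable
    have "sigma_finite_measure (distr M M T)" by (simp add: T_invariant sigma_finite_measure_axioms)
    from pair_measure_distr[OF T_measurable T_measurable this]
    show "distr (M \<Otimes>\<^sub>M M) (M \<Otimes>\<^sub>M M) (\<lambda>(x, y). (T x, T y)) = M \<Otimes>\<^sub>M M" by (simp add: T_invariant)
  qed
qed

text \<open>By Fubini the squared modulus of a correlation of \<open>F\<close> is a correlation of
  \<open>F x * cnj (F y)\<close> on the product system. A product of ergodic systems may fail to be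
  ergodic, so only the convergence without ergodicity is available here. It shows that the limit
  defining the second seminorm exists.\<close>

lemma corr_sq_average_convergent:
  assumes F: "bdd C F"
  shows "convergent (\<lambda>H. (\<Sum>h=1..H. complex_of_real ((norm (corr F h))\<^sup>2)) / of_nat H)"
proof -
  interpret P: measure_preserving "M \<Otimes>\<^sub>M M" "\<lambda>(x, y). (T x, T y)" by (rule measure_preserving_product)
  interpret PP: pair_prob_space M M by unfold_locales
  define K where "K = (\<lambda>(x, y). F x * cnj (F y))"
  have K: "P.bdd (C * C) K"
    unfolding P.bdd_def
  proof
    show "K \<in> borel_measurable (M \<Otimes>\<^sub>M M)"
      unfolding K_def using bdd_measurable[OF F] bdd_measurable[OF bdd_cnj[OF F]] by measurable
    show "\<forall>x\<in>space (M \<Otimes>\<^sub>M M). norm (K x) \<le> C * C"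
      using bdd_bound[OF F] bdd_nonneg[OF F] by (auto simp: K_def space_pair_measure norm_mult intro!: mult_mono)
  qed
  have it: "((\<lambda>(x, y). (T x, T y)) ^^ h) (x, y) = ((T ^^ h) x, (T ^^ h) y)" for h x y
    by (induction h) auto
  have "P.corr K h = complex_of_real ((norm (corr F h))\<^sup>2)" for h
  proof -
    let ?u = "\<lambda>x. F x * cnj (F ((T ^^ h) x))"
    have i: "integrable (M \<Otimes>\<^sub>M M) (\<lambda>(x, y). ?u x * cnj (?u y))"
    proof -
      have "integrable (M \<Otimes>\<^sub>M M) (\<lambda>p. K p * cnj (K (((\<lambda>(x, y). (T x, T y)) ^^ h) p)))"
        by (rule P.corr_integrable[OF K])
      moreover have "K p * cnj (K (((\<lambda>(x, y). (T x, T y)) ^^ h) p)) = (case p of (x, y) \<Rightarrow> ?u x * cnj (?u y))" for p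
        by (cases p) (simp add: K_def it)
      ultimately show ?thesis by simp
    qed
    have "P.corr K h = (\<integral>p. (case p of (x, y) \<Rightarrow> ?u x * cnj (?u y)) \<partial>(M \<Otimes>\<^sub>M M))"
      unfolding P.corr_def by (intro Bochner_Integration.integral_cong) (auto simp: K_def it)
    also have "\<dots> = (\<integral>x. \<integral>y. ?u x * cnj (?u y) \<partial>M \<partial>M)"
      using PP.integral_fst'[OF i] by simp
    also have "\<dots> = corr F h * cnj (corr F h)"
    proof -
      have "(\<integral>y. cnj (?u y) \<partial>M) = cnj (corr F h)" unfolding corr_def by (rule Bochner_Integration.integral_cnj)
      then show ?thesis by (simp add: corr_def del: complex_cnj_mult complex_cnj_cnj)
    qed
    finally show ?thesis by (simp add: complex_norm_square del: of_real_power)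
  qed
  then show ?thesis using P.corr_average_convergent[OF K] by simp
qed

lemma corr_shift:
  assumes "bdd C F" "j \<le> k"
  shows "(\<integral>x. F ((T ^^ j) x) * cnj (F ((T ^^ k) x)) \<partial>M) = corr F (k - j)"
proof -
  have "(T ^^ (k - j)) ((T ^^ j) x) = (T ^^ k) x" for x
    using assms(2) by (metis comp_apply funpow_add le_add_diff_inverse2)
  then show ?thesis
    using integral_iter[OF bdd_measurable[OF bdd_mult[OF assms(1) bdd_cnj[OF bdd_iter[OF assms(1), of "k - j"]]]], of j]
    by (simp add: corr_def)
qed

text \<open>The conditional is the absolute difference of two natural numbers. Exchanging the two
  times conjugates the correlation, which the norm ignores.\<close>

lemma norm_corr_shift:
  assumes "bdd C F"
  shows "norm (\<integral>x. F ((T ^^ j) x) * cnj (F ((T ^^ k) x)) \<partial>M) = norm (corr F (if j \<le> k then k - j else j - k))"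
proof (cases "j \<le> k")
  case True then show ?thesis using corr_shift[OF assms] by simp
next
  case False
  have "(\<integral>x. F ((T ^^ j) x) * cnj (F ((T ^^ k) x)) \<partial>M) =
      (\<integral>x. cnj (F ((T ^^ k) x) * cnj (F ((T ^^ j) x))) \<partial>M)"
    by (simp add: mult.commute)
  also have "\<dots> = cnj (\<integral>x. F ((T ^^ k) x) * cnj (F ((T ^^ j) x)) \<partial>M)" by (rule Bochner_Integration.integral_cnj)
  finally show ?thesis using corr_shift[OF assms, of k j] False by simp
qed

text \<open>Expansion of the square. Weights and times are left general because it serves both the
  van der Corput estimate, with weights taken from the correlations and consecutive times, and
  averages along sparse sequences, with constant weights.\<close>

lemma nrm2_sum_le:
  assumes F: "bdd C F" and c: "\<And>j. j \<in> A \<Longrightarrow> norm (c j) \<le> D" and A: "finite A" and D: "D \<ge> 0"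
  shows "nrm2 (\<lambda>x. \<Sum>j\<in>A. c j * F ((T ^^ a j) x)) \<le>
    D\<^sup>2 * (\<Sum>j\<in>A. \<Sum>k\<in>A. norm (corr F (if a j \<le> a k then a k - a j else a j - a k)))"
proof -
  let ?S = "\<lambda>x. \<Sum>j\<in>A. c j * F ((T ^^ a j) x)"
  have i: "integrable M (\<lambda>x. F ((T ^^ a j) x) * cnj (F ((T ^^ a k) x)))" for j k
    by (rule bdd_integrable[OF bdd_mult[OF bdd_iter[OF F] bdd_cnj[OF bdd_iter[OF F]]]])
  have "complex_of_real (nrm2 ?S) = (\<integral>x. complex_of_real ((norm (?S x))\<^sup>2) \<partial>M)"
    by (simp add: nrm2_def del: of_real_power)
  also have "\<dots> = (\<integral>x. (\<Sum>j\<in>A. \<Sum>k\<in>A. (c j * cnj (c k)) * (F ((T ^^ a j) x) * cnj (F ((T ^^ a k) x)))) \<partial>M)"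
    by (intro Bochner_Integration.integral_cong refl)
      (simp add: complex_norm_square sum_product mult_ac del: of_real_power)
  also have "\<dots> = (\<Sum>j\<in>A. \<Sum>k\<in>A. (c j * cnj (c k)) * (\<integral>x. F ((T ^^ a j) x) * cnj (F ((T ^^ a k) x)) \<partial>M))"
    using i by simp
  finally have "nrm2 ?S = norm (\<Sum>j\<in>A. \<Sum>k\<in>A. (c j * cnj (c k)) * (\<integral>x. F ((T ^^ a j) x) * cnj (F ((T ^^ a k) x)) \<partial>M))"
    by (rule eq_norm_of_real[OF _ nrm2_nonneg])
  also have "\<dots> \<le> (\<Sum>j\<in>A. \<Sum>k\<in>A. norm ((c j * cnj (c k)) * (\<integral>x. F ((T ^^ a j) x) * cnj (F ((T ^^ a k) x)) \<partial>M)))"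
    by (intro order_trans[OF norm_sum] sum_mono norm_sum)
  also have "\<dots> \<le> (\<Sum>j\<in>A. \<Sum>k\<in>A. D\<^sup>2 * norm (corr F (if a j \<le> a k then a k - a j else a j - a k)))"
  proof (intro sum_mono)
    fix j k assume "j \<in> A" "k \<in> A"
    then have "norm (c j) * norm (c k) \<le> D * D" using c D by (intro mult_mono) auto
    then show "norm ((c j * cnj (c k)) * (\<integral>x. F ((T ^^ a j) x) * cnj (F ((T ^^ a k) x)) \<partial>M))
       \<le> D\<^sup>2 * norm (corr F (if a j \<le> a k then a k - a j else a j - a k))"
      unfolding norm_mult norm_corr_shift[OF F] by (intro mult_right_mono) (auto simp: power2_eq_square)
  qed
  also have "\<dots> = D\<^sup>2 * (\<Sum>j\<in>A. \<Sum>k\<in>A. norm (corr F (if a j \<le> a k then a k - a j else a j - a k)))"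
    by (simp add: sum_distrib_left)
  finally show ?thesis .
qed

lemma corr_bound: "bdd C F \<Longrightarrow> norm (corr F h) \<le> C * C"
proof -
  assume F: "bdd C F"
  have b: "bdd (C * C) (\<lambda>x. F x * cnj (F ((T ^^ h) x)))" by (intro bdd_mult bdd_cnj bdd_iter F)
  have "norm (corr F h) \<le> (\<integral>x. norm (F x * cnj (F ((T ^^ h) x))) \<partial>M)"
    unfolding corr_def by (rule integral_norm_bound)
  also have "\<dots> \<le> (\<integral>x. C * C \<partial>M)"
  proof (rule integral_mono)
    show "integrable M (\<lambda>x. norm (F x * cnj (F ((T ^^ h) x))))"
      using bdd_integrable[OF b] by (rule integrable_norm)
  qed (use bdd_bound[OF b] in auto)
  also have "\<dots> = C * C" by (simp add: prob_space)
  finally show ?thesis .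
qed

text \<open>Van der Corput: decay on average of the self-correlations bounds all the correlations on average.\<close>

lemma correlations_average_zero:
  assumes F: "bdd C F" and g: "bdd D g"
    and lim: "(\<lambda>H. (\<Sum>h=1..H. (norm (corr F h))\<^sup>2) / H) \<longlonglongrightarrow> 0"
  shows "(\<lambda>H. (\<Sum>h=1..H. (norm (\<integral>x. g x * F ((T ^^ h) x) \<partial>M))\<^sup>2) / H) \<longlonglongrightarrow> 0"
proof -
  define u where "u h = (\<integral>x. g x * F ((T ^^ h) x) \<partial>M)" for h
  define r where "r h = norm (corr F h)" for h
  have D: "D \<ge> 0" and C: "C \<ge> 0" using g F bdd_nonneg by auto
  have u_bound: "norm (u h) \<le> D * C" for h
  proof -
    have "norm (u h) \<le> (\<integral>x. norm (g x * F ((T ^^ h) x)) \<partial>M)" unfolding u_def by (rule integral_norm_bound)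
    also have "\<dots> \<le> (\<integral>x. D * C \<partial>M)"
      using bdd_mult[OF g bdd_iter[OF F]] by (intro integral_mono integrable_norm bdd_integrable) (auto simp: bdd_def)
    finally show ?thesis by (simp add: prob_space)
  qed
  \<comment> \<open>The first \<open>D\<^sup>2\<close> comes from the Cauchy-Schwarz estimate
    against \<open>g\<close>, \<open>(D * C)\<^sup>2\<close> bounds the squared weights, and 2
    counts how often a difference of times can occur for a fixed \<open>j\<close>.\<close>
  define E where "E = D\<^sup>2 * ((D * C)\<^sup>2 * 2)"
  have key: "((\<Sum>h=1..H. (norm (u h))\<^sup>2) / H)\<^sup>2 \<le> E * (r 0 / H + sqrt ((\<Sum>h=1..H. (r h)\<^sup>2) / H))"
    if H: "H > 0" for H
  proof -
    \<comment> \<open>The correlations themselves serve as weights, so that pairing \<open>S\<close>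
      with \<open>g\<close> produces the sum of their squared moduli.\<close>
    define S where "S x = (\<Sum>j\<in>{1..H}. cnj (u j) * F ((T ^^ j) x))" for x
    have Sb: "bdd (real H * (D * C * C)) S"
      unfolding bdd_def
    proof
      show "S \<in> borel_measurable M" unfolding S_def[abs_def] using bdd_measurable[OF F] by measurable
      have "norm (S x) \<le> real (card {1..H}) * (D * C * C)" if "x \<in> space M" for x
        unfolding S_def
        using u_bound bdd_bound[OF F iter_space[OF that]] D C by (intro sum_norm_bound) (auto simp: norm_mult intro!: mult_mono)
      then show "\<forall>x\<in>space M. norm (S x) \<le> real H * (D * C * C)" by simp
    qed
    have "complex_of_real (\<Sum>h=1..H. (norm (u h))\<^sup>2) = (\<Sum>h=1..H. cnj (u h) * u h)"
      by (simp add: complex_norm_square mult.commute del: of_real_power)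
    also have "\<dots> = (\<integral>x. (\<Sum>h=1..H. cnj (u h) * (g x * F ((T ^^ h) x))) \<partial>M)"
      using bdd_integrable[OF bdd_mult[OF g bdd_iter[OF F]]] by (simp add: u_def)
    also have "\<dots> = (\<integral>x. g x * S x \<partial>M)" by (simp add: S_def sum_distrib_left mult_ac)
    finally have "complex_of_real (\<Sum>h=1..H. (norm (u h))\<^sup>2) = (\<integral>x. g x * S x \<partial>M)" .
    moreover have "(\<Sum>h=1..H. (norm (u h))\<^sup>2) \<ge> 0" by (intro sum_nonneg) auto
    ultimately have "(\<Sum>h=1..H. (norm (u h))\<^sup>2) = norm (\<integral>x. g x * S x \<partial>M)" by (rule eq_norm_of_real)
    also have "\<dots> \<le> D * sqrt (nrm2 S)" by (rule integral_mult_bound[OF g Sb])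
    finally have "(\<Sum>h=1..H. (norm (u h))\<^sup>2)\<^sup>2 \<le> (D * sqrt (nrm2 S))\<^sup>2"
      by (intro power_mono sum_nonneg) auto
    also have "\<dots> = D\<^sup>2 * nrm2 S" using nrm2_nonneg by (simp add: power_mult_distrib)
    also have "nrm2 S \<le> (D * C)\<^sup>2 * (\<Sum>j=1..H. \<Sum>k=1..H. r (if j \<le> k then k - j else j - k))"
      unfolding S_def r_def using nrm2_sum_le[OF F, of "{1..H}" "\<lambda>j. cnj (u j)" "D * C" "\<lambda>j. j"] u_bound D C by simp
    \<comment> \<open>For fixed \<open>j\<close> each difference occurs at most once with
      \<open>k\<close> above and at most once with \<open>k\<close> below \<open>j\<close>.\<close>
    also have "(\<Sum>j=1..H. \<Sum>k=1..H. r (if j \<le> k then k - j else j - k)) \<le> (\<Sum>j=1..H. 2 * (\<Sum>d\<le>H. r d))"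
    proof (rule sum_mono)
      fix j assume j: "j \<in> {1..H}"
      have "(\<Sum>k=1..H. r (if j \<le> k then k - j else j - k)) \<le>
          (\<Sum>k=1..H. (if j \<le> k then r (k - j) else 0) + (if k \<le> j then r (j - k) else 0))"
        by (intro sum_mono) (auto simp: r_def)
      also have "\<dots> = (\<Sum>k\<in>{1..H} \<inter> {j..}. r (k - j)) + (\<Sum>k\<in>{1..H} \<inter> {..j}. r (j - k))"
        unfolding sum.distrib by (subst (1 2) sum.inter_restrict) auto
      also have "(\<Sum>k\<in>{1..H} \<inter> {j..}. r (k - j)) \<le> (\<Sum>d\<le>H. r d)"
      proof -
        have "(\<Sum>k\<in>{1..H} \<inter> {j..}. r (k - j)) = (\<Sum>d\<in>(\<lambda>k. k - j) ` ({1..H} \<inter> {j..}). r d)"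
          by (subst sum.reindex) (auto simp: inj_on_def)
        also have "\<dots> \<le> (\<Sum>d\<le>H. r d)" by (intro sum_mono2) (auto simp: r_def)
        finally show ?thesis .
      qed
      also have "(\<Sum>k\<in>{1..H} \<inter> {..j}. r (j - k)) \<le> (\<Sum>d\<le>H. r d)"
      proof -
        have "(\<Sum>k\<in>{1..H} \<inter> {..j}. r (j - k)) = (\<Sum>d\<in>(\<lambda>k. j - k) ` ({1..H} \<inter> {..j}). r d)"
          by (subst sum.reindex) (auto simp: inj_on_def)
        also have "\<dots> \<le> (\<Sum>d\<le>H. r d)" using j by (intro sum_mono2) (auto simp: r_def)
        finally show ?thesis .
      qed
      finally show "(\<Sum>k=1..H. r (if j \<le> k then k - j else j - k)) \<le> 2 * (\<Sum>d\<le>H. r d)" by simp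
    qed
    also have "\<dots> = 2 * H * (\<Sum>d\<le>H. r d)" by simp
    \<comment> \<open>The diagonal term is split off because the hypothesis averages only over
      positive times. Divided by \<open>H\<close> it vanishes in the limit.\<close>
    also have "(\<Sum>d\<le>H. r d) = r 0 + (\<Sum>d=1..H. r d)"
      by (induction H) auto
    also have "(\<Sum>d=1..H. r d) \<le> H * sqrt ((\<Sum>h=1..H. (r h)\<^sup>2) / H)"
    proof -
      have "(\<Sum>d=1..H. r d * 1)\<^sup>2 \<le> (\<Sum>d=1..H. (r d)\<^sup>2) * (\<Sum>d=1..H. 1\<^sup>2)" by (rule Cauchy_Schwarz_ineq_sum)
      then have "(\<Sum>d=1..H. r d)\<^sup>2 \<le> H\<^sup>2 * ((\<Sum>h=1..H. (r h)\<^sup>2) / H)"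
        using H by (simp add: power2_eq_square field_simps)
      then have "(\<Sum>d=1..H. r d) \<le> sqrt (H\<^sup>2 * ((\<Sum>h=1..H. (r h)\<^sup>2) / H))" by (rule real_le_rsqrt)
      then show ?thesis by (simp only: real_sqrt_mult) simp
    qed
    finally have "(\<Sum>h=1..H. (norm (u h))\<^sup>2)\<^sup>2 \<le>
        D\<^sup>2 * ((D * C)\<^sup>2 * (2 * H * (r 0 + H * sqrt ((\<Sum>h=1..H. (r h)\<^sup>2) / H))))"
      using D C by (simp add: mult_left_mono)
    also have "\<dots> = H\<^sup>2 * (E * (r 0 / H + sqrt ((\<Sum>h=1..H. (r h)\<^sup>2) / H)))"
      unfolding E_def using H by (simp add: field_simps power2_eq_square)
    finally show ?thesis using H by (simp add: power_divide divide_le_eq mult.commute)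
  qed
  have "(\<lambda>H. E * (r 0 / real H + sqrt ((\<Sum>h=1..H. (r h)\<^sup>2) / H))) \<longlonglongrightarrow> E * (0 + sqrt 0)"
    using lim unfolding r_def by (intro tendsto_intros tendsto_divide_0[OF tendsto_const] filterlim_real_sequentially[THEN filterlim_at_top_imp_at_infinity]) 
  then have lim0: "(\<lambda>H. E * (r 0 / real H + sqrt ((\<Sum>h=1..H. (r h)\<^sup>2) / H))) \<longlonglongrightarrow> 0" by simp
  have "(\<lambda>H. ((\<Sum>h=1..H. (norm (u h))\<^sup>2) / H)\<^sup>2) \<longlonglongrightarrow> 0"
  proof (rule tendsto_sandwich[OF _ _ tendsto_const lim0])
    show "\<forall>\<^sub>F H in sequentially. 0 \<le> ((\<Sum>h=1..H. (norm (u h))\<^sup>2) / H)\<^sup>2" by simp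
    show "\<forall>\<^sub>F H in sequentially. ((\<Sum>h=1..H. (norm (u h))\<^sup>2) / H)\<^sup>2
        \<le> E * (r 0 / H + sqrt ((\<Sum>h=1..H. (r h)\<^sup>2) / H))"
      by (rule eventually_mono[OF eventually_gt_at_top[of 0] key])
  qed
  from tendsto_real_sqrt[OF this]
  have "(\<lambda>H. \<bar>(\<Sum>h=1..H. (norm (u h))\<^sup>2) / H\<bar>) \<longlonglongrightarrow> 0" by (simp only: real_sqrt_abs real_sqrt_zero)
  then show ?thesis unfolding u_def[symmetric] by (rule tendsto_rabs_zero_cancel)
qed

end

section \<open>Seminorms of ergodic systems\<close>

context measure_preserving
begin

lemma Linfty_truncate:
  assumes "f \<in> Linfty M"
  obtains C f' where "bdd C f'" "AE x in M. f x = f' x"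
proof -
  obtain C where C: "AE x in M. norm (f x) \<le> C" and fm: "f \<in> borel_measurable M"
    using assms by (auto simp: Linfty_def)
  define f' where "f' x = (if norm (f x) \<le> C then f x else 0)" for x
  have "bdd (max C 0) f'" unfolding bdd_def
  proof
    show "f' \<in> borel_measurable M" unfolding f'_def[abs_def] using fm by measurable
  qed (auto simp: f'_def)
  moreover have "AE x in M. f x = f' x" using C by eventually_elim (simp add: f'_def)
  ultimately show thesis by (rule that)
qed

lemma bdd_Linfty: "bdd C f \<Longrightarrow> f \<in> Linfty M"
  by (auto simp: bdd_def Linfty_def intro!: exI[of _ C])

lemma corr_cong_AE:
  assumes "f \<in> borel_measurable M" "f' \<in> borel_measurable M" "AE x in M. f x = f' x"
  shows "corr f h = corr f' h"
proof -
  have cm: "cnj \<in> borel_measurable borel"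
    by (intro borel_measurable_continuous_onI continuous_on_cnj continuous_on_id)
  have m: "(\<lambda>x. cnj (u ((T ^^ h) x))) \<in> borel_measurable M" if "u \<in> borel_measurable M" for u :: "'a \<Rightarrow> complex"
    using measurable_compose[OF measurable_compose[OF iter_measurable that] cm] .
  show ?thesis unfolding corr_def
  proof (rule integral_cong_AE)
    show "AE x in M. f x * cnj (f ((T ^^ h) x)) = f' x * cnj (f' ((T ^^ h) x))"
      using assms(3) AE_iter[OF assms(3), of h] by eventually_elim simp
  qed (use assms m in \<open>auto intro!: borel_measurable_times\<close>)
qed

lemma integral_avg: "bdd C F \<Longrightarrow> N > 0 \<Longrightarrow> (\<integral>x. avg N F x \<partial>M) = (\<integral>x. F x \<partial>M)"
  using bdd_integrable[OF bdd_iter[of C F]] integral_iter[OF bdd_measurable[of C F]]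
  by (simp add: avg_def)

lemma nrm2_triangle:
  assumes "bdd C u" "bdd D v"
  shows "nrm2 (\<lambda>x. u x + v x) \<le> 2 * nrm2 u + 2 * nrm2 v"
proof -
  have b: "bdd (C + D) (\<lambda>x. u x + v x)" using assms by (auto simp: bdd_def intro!: norm_triangle_mono)
  have "nrm2 (\<lambda>x. u x + v x) \<le> (\<integral>x. 2 * (norm (u x))\<^sup>2 + 2 * (norm (v x))\<^sup>2 \<partial>M)"
    unfolding nrm2_def
  proof (rule integral_mono)
    fix x
    have "(norm (u x + v x))\<^sup>2 \<le> (norm (u x) + norm (v x))\<^sup>2" by (intro power_mono norm_triangle_ineq) auto
    also have "\<dots> \<le> 2 * (norm (u x))\<^sup>2 + 2 * (norm (v x))\<^sup>2"
      using sum_squares_bound[of "norm (u x)" "norm (v x)"] by (simp add: power2_sum)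
    finally show "(norm (u x + v x))\<^sup>2 \<le> 2 * (norm (u x))\<^sup>2 + 2 * (norm (v x))\<^sup>2" .
  qed (use bdd_sq_integrable[OF b] bdd_sq_integrable[OF assms(1)] bdd_sq_integrable[OF assms(2)] in auto)
  then show ?thesis using bdd_sq_integrable[OF assms(1)] bdd_sq_integrable[OF assms(2)] by (simp add: nrm2_def)
qed

lemma integral_product_cong_AE:
  assumes "f \<in> borel_measurable M" "f' \<in> borel_measurable M" "AE x in M. f x = f' x"
    "g \<in> borel_measurable M" "g' \<in> borel_measurable M" "AE x in M. g x = g' x"
  shows "(\<integral>x. g x * f ((T ^^ n) x) \<partial>M) = (\<integral>x. g' x * (f' ((T ^^ n) x) :: complex) \<partial>M)"
proof (rule integral_cong_AE)
  show "AE x in M. g x * f ((T ^^ n) x) = g' x * f' ((T ^^ n) x)"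
    using assms(6) AE_iter[OF assms(3), of n] by eventually_elim simp
qed (use assms measurable_compose[OF iter_measurable] in \<open>auto intro!: borel_measurable_times\<close>)

lemma L2norm_avg_cong_AE:
  assumes "f \<in> borel_measurable M" "f' \<in> borel_measurable M" "AE x in M. f x = f' x"
  shows "L2norm M (\<lambda>x. (\<Sum>n=1..N. f ((T ^^ a n) x)) / of_nat N) =
    sqrt (nrm2 (\<lambda>x. (\<Sum>n=1..N. f' ((T ^^ (a n :: nat)) x)) / of_nat N))"
proof -
  have "AE x in M. \<forall>n\<in>{1..N}. f ((T ^^ a n) x) = f' ((T ^^ a n) x)"
    using AE_iter[OF assms(3)] by (intro AE_finite_allI) auto
  then have "AE x in M. (norm ((\<Sum>n=1..N. f ((T ^^ a n) x)) / of_nat N))\<^sup>2 =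
      (norm ((\<Sum>n=1..N. f' ((T ^^ a n) x)) / of_nat N))\<^sup>2"
    by eventually_elim simp
  moreover have "(\<lambda>x. (norm ((\<Sum>n=1..N. u ((T ^^ a n) x)) / of_nat N))\<^sup>2) \<in> borel_measurable M"
    if "u \<in> borel_measurable M" for u :: "'a \<Rightarrow> complex"
    using measurable_compose[OF iter_measurable that] by measurable
  ultimately show ?thesis
    unfolding L2norm_def nrm2_def using assms by (intro arg_cong[of _ _ sqrt] integral_cong_AE) auto
qed

lemma correlation_bound:
  assumes "bdd D g" "bdd C F"
  shows "norm (\<integral>x. g x * F ((T ^^ n) x) \<partial>M) \<le> D * C"
proof -
  note b = bdd_mult[OF assms(1) bdd_iter[OF assms(2)], of n]
  have "norm (\<integral>x. g x * F ((T ^^ n) x) \<partial>M) \<le> (\<integral>x. norm (g x * F ((T ^^ n) x)) \<partial>M)"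
    by (rule integral_norm_bound)
  also have "\<dots> \<le> (\<integral>x. D * C \<partial>M)"
    using bdd_bound[OF b] integrable_norm[OF bdd_integrable[OF b]] by (intro integral_mono) auto
  finally show ?thesis by (simp add: prob_space)
qed

lemma weak_limit_iff_sparse_averages:
  assumes f: "f \<in> Linfty M"
  shows "(\<forall>a :: nat \<Rightarrow> nat. strict_mono a \<longrightarrow>
      (\<lambda>N. L2norm M (\<lambda>x. (\<Sum>n=1..N. f ((T ^^ a n) x)) / of_nat N)) \<longlonglongrightarrow> 0) \<longleftrightarrow>
    (\<forall>g\<in>Linfty M. (\<lambda>n. \<integral>x. g x * f ((T ^^ n) x) \<partial>M) \<longlonglongrightarrow> 0)" (is "?ii \<longleftrightarrow> ?iii")
proof -
  obtain C F where F: "bdd C F" "AE x in M. f x = F x" using Linfty_truncate[OF f] by blast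
  have fm: "f \<in> borel_measurable M" using f by (simp add: Linfty_def)
  have C: "C \<ge> 0" by (rule bdd_nonneg[OF F(1)])
  define A where "A a N x = (\<Sum>n=1..N. F ((T ^^ a n) x)) / of_nat N" for a :: "nat \<Rightarrow> nat" and N x
  have L2: "L2norm M (\<lambda>x. (\<Sum>n=1..N. f ((T ^^ a n) x)) / of_nat N) = sqrt (nrm2 (A a N))" for a N
    using L2norm_avg_cong_AE[OF fm bdd_measurable[OF F(1)] F(2)] by (simp add: A_def[abs_def])
  have Ab: "bdd C (A a N)" for a N
    unfolding bdd_def
  proof
    show "A a N \<in> borel_measurable M"
      unfolding A_def[abs_def] using measurable_compose[OF iter_measurable bdd_measurable[OF F(1)]] by measurable
    have "norm (\<Sum>n=1..N. F ((T ^^ a n) x)) \<le> real (card {1..N}) * C" if "x \<in> space M" for x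
      using bdd_bound[OF F(1)] iter_space[OF that] by (intro sum_norm_bound) auto
    then show "\<forall>x\<in>space M. norm (A a N x) \<le> C" using C
      by (cases "N = 0") (auto simp: A_def norm_divide field_simps)
  qed
  show ?thesis
  proof
    assume iii: ?iii
    have "(\<lambda>h. \<integral>x. cnj (F x) * f ((T ^^ h) x) \<partial>M) \<longlonglongrightarrow> 0"
      by (rule bspec[OF iii bdd_Linfty[OF bdd_cnj[OF F(1)]]])
    also have "(\<lambda>h. \<integral>x. cnj (F x) * f ((T ^^ h) x) \<partial>M) = (\<lambda>h. cnj (corr F h))"
    proof
      fix h
      have "(\<integral>x. cnj (F x) * f ((T ^^ h) x) \<partial>M) = (\<integral>x. cnj (F x) * F ((T ^^ h) x) \<partial>M)"
        using fm F bdd_measurable[OF F(1)] bdd_measurable[OF bdd_cnj[OF F(1)]]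
        by (intro integral_product_cong_AE) auto
      also have "\<dots> = (\<integral>x. cnj (F x * cnj (F ((T ^^ h) x))) \<partial>M)" by simp
      also have "\<dots> = cnj (corr F h)" unfolding corr_def by (rule Bochner_Integration.integral_cnj)
      finally show "(\<integral>x. cnj (F x) * f ((T ^^ h) x) \<partial>M) = cnj (corr F h)" .
    qed
    finally have c0: "(\<lambda>h. norm (corr F h)) \<longlonglongrightarrow> 0" using tendsto_norm_zero by fastforce
    show ?ii
    proof (intro allI impI)
      fix a :: "nat \<Rightarrow> nat" assume a: "strict_mono a"
      have "(\<lambda>N. nrm2 (A a N)) \<longlonglongrightarrow> 0"
      proof (rule LIMSEQ_I)
        fix e :: real assume e: "e > 0"
        obtain D where D: "\<And>h. h \<ge> D \<Longrightarrow> norm (corr F h) < e / 4"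
          using LIMSEQ_D[OF c0, of "e/4"] e by auto
        obtain N1 where N1: "4 * (C * C * (2 * D + 1)) / e < real N1" using reals_Archimedean2 by blast
        have "norm (nrm2 (A a N) - 0) < e" if N: "N \<ge> max 1 N1" for N
        proof -
          have Npos: "real N > 0" using N by simp
          let ?r = "\<lambda>j k. norm (corr F (if a j \<le> a k then a k - a j else a j - a k))"
          have "A a N = (\<lambda>x. \<Sum>n\<in>{1..N}. (1 / of_nat N) * F ((T ^^ a n) x))"
            by (simp add: A_def[abs_def] sum_divide_distrib)
          then have "nrm2 (A a N) \<le> (1/N)\<^sup>2 * (\<Sum>j=1..N. \<Sum>k=1..N. ?r j k)"
            using nrm2_sum_le[OF F(1), of "{1..N}" "\<lambda>_. 1 / of_nat N" "1/N" a] by (simp add: norm_divide)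
          also have "(\<Sum>j=1..N. \<Sum>k=1..N. ?r j k) \<le> (\<Sum>j=1..N. (2 * D + 1) * (C * C) + N * (e/4))"
          proof (rule sum_mono)
            fix j assume "j \<in> {1..N}"
            have "(\<Sum>k=1..N. ?r j k) \<le> (\<Sum>k=1..N. (if k \<in> {j - D..j + D} then C * C else 0) + e/4)"
            proof (rule sum_mono)
              fix k
              show "?r j k \<le> (if k \<in> {j - D..j + D} then C * C else 0) + e/4"
              proof (cases "k \<in> {j - D..j + D}")
                case True
                then show ?thesis using corr_bound[OF F(1), of "if a j \<le> a k then a k - a j else a j - a k"] e by simp
              next
                case False
                \<comment> \<open>A strictly increasing sequence of natural numbers never brings
                  indices closer together, so indices more than \<open>D\<close> apart have times at
                  least \<open>D\<close> apart.\<close>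
                have dist: "m - n \<le> a m - a n" if "n \<le> m" for m n
                  using that
                proof (induction m rule: dec_induct)
                  case (step m)
                  have "a m < a (Suc m)" "a n \<le> a m" using a step by (auto simp: strict_mono_Suc_iff strict_mono_leD)
                  then show ?case using step by linarith
                qed simp
                have "(if a j \<le> a k then a k - a j else a j - a k) \<ge> D"
                proof (cases "j \<le> k")
                  case True
                  then have "a j \<le> a k" using a by (simp add: strict_mono_leD)
                  then show ?thesis using dist[OF True] False True by auto
                next
                  case jk: False
                  then have "a k < a j" using a by (simp add: strict_mono_less)
                  then show ?thesis using dist[of k j] False jk by auto
                qed
                from D[OF this] have "?r j k < e/4" .
                then show ?thesis using if_not_P[OF False, of "C * C" 0] by linarith
              qed
            qed
            also have "\<dots> = (\<Sum>k\<in>{1..N} \<inter> {j - D..j + D}. C * C) + N * (e/4)"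
              unfolding sum.distrib by (subst sum.inter_restrict) auto
            also have "(\<Sum>k\<in>{1..N} \<inter> {j - D..j + D}. C * C) \<le> (\<Sum>k\<in>{j - D..j + D}. C * C)"
              using C by (intro sum_mono2) auto
            also have "\<dots> = real (card {j - D..j + D}) * (C * C)" by simp
            \<comment> \<open>The lower end \<open>j - D\<close> is a truncated difference, so the
              interval has at most \<open>2 * D + 1\<close> elements.\<close>
            also have "\<dots> \<le> (2 * D + 1) * (C * C)"
              using C by (intro mult_right_mono) (auto simp flip: of_nat_Suc of_nat_add of_nat_mult)
            finally show "(\<Sum>k=1..N. ?r j k) \<le> (2 * D + 1) * (C * C) + N * (e/4)" by simp
          qed
          finally have "nrm2 (A a N) \<le> (1/N)\<^sup>2 * (N * ((2 * D + 1) * (C * C) + N * (e/4)))"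
            by (simp add: mult_left_mono)
          also have "\<dots> = (2 * D + 1) * (C * C) / N + e/4"
            using Npos by (simp add: field_simps power2_eq_square)
          also have "(2 * D + 1) * (C * C) / N < e / 4"
          proof -
            have "4 * (C * C * (2 * D + 1)) / e < real N" using N1 N by simp
            then show ?thesis using e Npos by (simp add: field_simps)
          qed
          finally show ?thesis using nrm2_nonneg[of "A a N"] e by simp
        qed
        then show "\<exists>no. \<forall>N\<ge>no. norm (nrm2 (A a N) - 0) < e" by blast
      qed
      from tendsto_real_sqrt[OF this]
      show "(\<lambda>N. L2norm M (\<lambda>x. (\<Sum>n=1..N. f ((T ^^ a n) x)) / of_nat N)) \<longlonglongrightarrow> 0"
        by (simp only: L2 real_sqrt_zero)
    qed
  next
    assume ii: ?ii
    show ?iii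
    proof (rule ballI, rule ccontr)
      fix g assume g: "g \<in> Linfty M" and contra: "\<not> (\<lambda>n. \<integral>x. g x * f ((T ^^ n) x) \<partial>M) \<longlonglongrightarrow> 0"
      obtain D g' where g': "bdd D g'" "AE x in M. g x = g' x" using Linfty_truncate[OF g] by blast
      have gm: "g \<in> borel_measurable M" using g by (simp add: Linfty_def)
      define u where "u n = (\<integral>x. g' x * F ((T ^^ n) x) \<partial>M)" for n
      have "(\<integral>x. g x * f ((T ^^ n) x) \<partial>M) = u n" for n
        unfolding u_def using fm gm F g' bdd_measurable[OF F(1)] bdd_measurable[OF g'(1)]
        by (intro integral_product_cong_AE) auto
      then have "\<not> u \<longlonglongrightarrow> 0" using contra by simp
      then obtain e where e: "e > 0" "\<forall>N. \<exists>n\<ge>N. norm (u n) \<ge> e"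
        by (auto simp: LIMSEQ_iff not_less)
      have "infinite {n. norm (u n) \<ge> e}" using e(2) by (auto simp: infinite_nat_iff_unbounded_le)
      then obtain r :: "nat \<Rightarrow> nat" where r: "strict_mono r" "\<And>n. norm (u (r n)) \<ge> e"
        using infinite_enumerate by blast
      \<comment> \<open>Correlations bounded away from 0 could still cancel in the averages. On a
        further subsequence they converge to some \<open>l\<close> of modulus at least
        \<open>e\<close>, and then so do their Cesaro means.\<close>
      have "bounded (range (u \<circ> r))"
        unfolding bounded_iff u_def using correlation_bound[OF g'(1) F(1)] by (auto intro!: exI[of _ "D * C"])
      then obtain l r' where r': "strict_mono r'" "((u \<circ> r) \<circ> r') \<longlonglongrightarrow> l"
        using bounded_imp_convergent_subsequence by blast
      define a where "a = r \<circ> r'"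
      have a: "strict_mono a" unfolding a_def using r(1) r'(1) by (rule strict_mono_o)
      have ul: "(\<lambda>n. u (a n)) \<longlonglongrightarrow> l" using r'(2) by (simp add: a_def o_def)
      have "norm l \<ge> e"
        using r(2) by (intro LIMSEQ_le_const[OF tendsto_norm[OF ul]]) (auto simp: a_def)
      have ces: "(\<lambda>N. (\<Sum>n=1..N. u (a n)) / of_nat N) \<longlonglongrightarrow> l" by (rule cesaro_complex[OF ul])
      have eq: "(\<Sum>n=1..N. u (a n)) / of_nat N = (\<integral>x. g' x * A a N x \<partial>M)" for N
      proof -
        have "(\<integral>x. g' x * A a N x \<partial>M) = (\<integral>x. (\<Sum>n=1..N. g' x * F ((T ^^ a n) x)) / of_nat N \<partial>M)"
          by (simp add: A_def sum_distrib_left)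
        then show ?thesis using bdd_integrable[OF bdd_mult[OF g'(1) bdd_iter[OF F(1)]]] by (simp add: u_def)
      qed
      have "(\<lambda>N. sqrt (nrm2 (A a N))) \<longlonglongrightarrow> 0" using ii[rule_format, OF a] by (simp only: L2)
      then have "(\<lambda>N. D * sqrt (nrm2 (A a N))) \<longlonglongrightarrow> 0" by (rule tendsto_mult_right_zero)
      then have "(\<lambda>N. (\<Sum>n=1..N. u (a n)) / of_nat N) \<longlonglongrightarrow> 0"
        unfolding eq by (rule Lim_null_comparison[rotated]) (use integral_mult_bound[OF g'(1) Ab] in auto)
      then have "l = 0" using ces LIMSEQ_unique by blast
      then show False using \<open>norm l \<ge> e\<close> e(1) by simp
    qed
  qed
qed

text \<open>
  If the orbit of \<open>\<phi>\<close> is covered by finitely many small balls, then one of finitely many correlations of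
  \<open>F\<close> stays large at every time whenever the integral of \<open>\<phi> F\<close> does not vanish.
\<close>

lemma almost_periodic_orthogonal:
  assumes F: "bdd C F" and \<phi>: "bdd D \<phi>"
    and lim: "(\<lambda>H. (\<Sum>h=1..H. (norm (corr F h))\<^sup>2) / H) \<longlonglongrightarrow> 0"
    and ap: "\<And>e. e > 0 \<Longrightarrow> \<exists>\<Psi>. finite \<Psi> \<and> (\<forall>\<psi>\<in>\<Psi>. \<exists>D. bdd D \<psi>) \<and>
      (\<forall>h. \<exists>\<psi>\<in>\<Psi>. \<forall>x\<in>space M. norm (\<phi> ((T ^^ h) x) - \<psi> x) \<le> e)"
  shows "(\<integral>x. \<phi> x * F x \<partial>M) = 0"
proof (rule ccontr)
  define c where "c = norm (\<integral>x. \<phi> x * F x \<partial>M)"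
  assume "(\<integral>x. \<phi> x * F x \<partial>M) \<noteq> 0"
  then have c: "c > 0" by (simp add: c_def)
  have C: "C \<ge> 0" by (rule bdd_nonneg[OF F])
  \<comment> \<open>Replacing a translate of \<open>\<phi>\<close> by a member of the finite set
    costs at most \<open>e * C\<close>, which is at most half of \<open>c\<close>.\<close>
  define e where "e = c / (2 * (C + 1))"
  have e: "e > 0" using c C by (simp add: e_def)
  have eC: "e * C \<le> c / 2" using c C by (simp add: e_def field_simps)
  obtain \<Psi> where \<Psi>: "finite \<Psi>" "\<And>\<psi>. \<psi> \<in> \<Psi> \<Longrightarrow> \<exists>D. bdd D \<psi>"
    "\<And>h. \<exists>\<psi>\<in>\<Psi>. \<forall>x\<in>space M. norm (\<phi> ((T ^^ h) x) - \<psi> x) \<le> e" using ap[OF e] by blast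
  define u where "u \<psi> h = (\<integral>x. \<psi> x * F ((T ^^ h) x) \<partial>M)" for \<psi> h
  have large: "(c/2)\<^sup>2 \<le> (\<Sum>\<psi>\<in>\<Psi>. (norm (u \<psi> h))\<^sup>2)" for h
  proof -
    obtain \<psi> where \<psi>: "\<psi> \<in> \<Psi>" "\<And>x. x \<in> space M \<Longrightarrow> norm (\<phi> ((T ^^ h) x) - \<psi> x) \<le> e" using \<Psi>(3) by blast
    obtain D' where D': "bdd D' \<psi>" using \<Psi>(2)[OF \<psi>(1)] by blast
    have d: "bdd e (\<lambda>x. \<phi> ((T ^^ h) x) - \<psi> x)"
      using \<psi>(2) bdd_diff[OF bdd_iter[OF \<phi>] D', of h] by (auto simp: bdd_def)
    have "(\<integral>x. \<phi> x * F x \<partial>M) = (\<integral>x. \<phi> ((T ^^ h) x) * F ((T ^^ h) x) \<partial>M)"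
      by (rule integral_iter[symmetric]) (rule bdd_measurable[OF bdd_mult[OF \<phi> F]])
    also have "\<dots> = (\<integral>x. (\<phi> ((T ^^ h) x) - \<psi> x) * F ((T ^^ h) x) \<partial>M) + u \<psi> h"
      unfolding u_def using bdd_integrable[OF bdd_mult[OF d bdd_iter[OF F]]] bdd_integrable[OF bdd_mult[OF D' bdd_iter[OF F]]]
      by (subst Bochner_Integration.integral_add[symmetric]) (auto simp: algebra_simps)
    finally have "c \<le> e * C + norm (u \<psi> h)"
      unfolding c_def using correlation_bound[OF d F, of h] norm_triangle_le[of _ "u \<psi> h" "e * C + norm (u \<psi> h)"] by simp
    then have "c / 2 \<le> norm (u \<psi> h)" using eC by simp
    then have "(c/2)\<^sup>2 \<le> (norm (u \<psi> h))\<^sup>2" using c by (intro power_mono) auto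
    also have "\<dots> \<le> (\<Sum>\<psi>\<in>\<Psi>. (norm (u \<psi> h))\<^sup>2)" using \<psi>(1) \<Psi>(1) by (intro member_le_sum) auto
    finally show ?thesis .
  qed
  \<comment> \<open>The set is finite, so the averages of the summed squares tend to 0, although by
    \<open>large\<close> that sum is bounded below at every time.\<close>
  have "(\<lambda>H. \<Sum>\<psi>\<in>\<Psi>. (\<Sum>h=1..H. (norm (u \<psi> h))\<^sup>2) / H) \<longlonglongrightarrow> (\<Sum>\<psi>\<in>\<Psi>. 0)"
    unfolding u_def using \<Psi>(2) correlations_average_zero[OF F _ lim] by (intro tendsto_sum) blast
  then have "(\<lambda>H. \<Sum>\<psi>\<in>\<Psi>. (\<Sum>h=1..H. (norm (u \<psi> h))\<^sup>2) / H) \<longlonglongrightarrow> 0" by simp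
  moreover have "\<exists>N. \<forall>H\<ge>N. (c/2)\<^sup>2 \<le> (\<Sum>\<psi>\<in>\<Psi>. (\<Sum>h=1..H. (norm (u \<psi> h))\<^sup>2) / H)"
  proof (intro exI allI impI)
    fix H :: nat assume H: "H \<ge> 1"
    have "real H * (c/2)\<^sup>2 = (\<Sum>h=1..H. (c/2)\<^sup>2)" by simp
    also have "\<dots> \<le> (\<Sum>h=1..H. \<Sum>\<psi>\<in>\<Psi>. (norm (u \<psi> h))\<^sup>2)" by (intro sum_mono large)
    also have "\<dots> = (\<Sum>\<psi>\<in>\<Psi>. \<Sum>h=1..H. (norm (u \<psi> h))\<^sup>2)" by (rule sum.swap)
    finally show "(c/2)\<^sup>2 \<le> (\<Sum>\<psi>\<in>\<Psi>. (\<Sum>h=1..H. (norm (u \<psi> h))\<^sup>2) / H)"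
      using H by (simp add: field_simps flip: sum_divide_distrib)
  qed
  ultimately have "(c/2)\<^sup>2 \<le> 0" by (rule LIMSEQ_le_const)
  then show False using c by simp
qed

end

section \<open>Consequences of ergodicity\<close>

locale ergodic_system = measure_preserving +
  assumes erg: "ergodic M T"
begin

text \<open>The sublevel set at the mean is invariant, hence null or of full measure. Either way
  \<open>g\<close> minus its mean has constant sign almost everywhere, and its integral is
  0.\<close>

lemma invariant_constant:
  fixes g :: "'a \<Rightarrow> real"
  assumes g: "g \<in> borel_measurable M" and b: "\<And>x. x \<in> space M \<Longrightarrow> \<bar>g x\<bar> \<le> C"
    and inv: "\<And>x. x \<in> space M \<Longrightarrow> g (T x) = g x"
  shows "AE x in M. g x = (\<integral>x. g x \<partial>M)"
proof -
  define m where "m = (\<integral>x. g x \<partial>M)"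
  have i: "integrable M g" using g b by (intro integrable_bounded[of g C]) auto
  define A where "A = {x \<in> space M. g x \<le> m}"
  have A: "A \<in> sets M" unfolding A_def using g by measurable
  have "T -` A \<inter> space M = A"
    using measurable_space[OF T_measurable] inv by (auto simp: A_def)
  then consider "measure M A = 0" | "measure M A = 1" using erg A by (auto simp: ergodic_def)
  then have "AE x in M. g x = m"
  proof cases
    case 1
    then have "AE x in M. x \<notin> A" using A by (simp add: AE_iff_measurable emeasure_eq_measure prob_eq_0)
    then have ge: "AE x in M. 0 \<le> g x - m" using AE_space by eventually_elim (simp add: A_def)
    have "(\<integral>x. g x - m \<partial>M) = 0" using i by (simp add: m_def prob_space)
    then have "AE x in M. g x - m = 0" using integral_nonneg_eq_0_iff_AE[OF _ ge] i by simp
    then show ?thesis by simp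
  next
    case 2
    then have "AE x in M. x \<in> A" using A by (simp add: prob_eq_1)
    then have ge: "AE x in M. 0 \<le> m - g x" by eventually_elim (simp add: A_def)
    have "(\<integral>x. m - g x \<partial>M) = 0" using i by (simp add: m_def prob_space)
    then have "AE x in M. m - g x = 0" using integral_nonneg_eq_0_iff_AE[OF _ ge] i by simp
    then show ?thesis by eventually_elim simp
  qed
  then show ?thesis by (simp add: m_def)
qed

text \<open>A subsequence of the averages converges almost everywhere. Its limit is invariant
  because averages at \<open>x\<close> and \<open>T x\<close> differ by at most
  \<open>2 * C / N\<close>, so it is constant; and since averaging preserves integrals, the constant
  is the integral of \<open>F\<close>.\<close>

theorem mean_ergodic:
  assumes F: "bdd C F"
  shows "(\<lambda>N. nrm2 (\<lambda>x. avg N F x - (\<integral>x. F x \<partial>M))) \<longlonglongrightarrow> 0"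
proof -
  have Ab: "bdd C (avg n F)" for n by (rule bdd_avg[OF F])
  have C: "C \<ge> 0" by (rule bdd_nonneg[OF F])
  obtain r where r: "strict_mono r" "AE x in M. Cauchy (\<lambda>i. avg (r i) F x)"
  proof (rule cauchy_L1_AE_cauchy_subseq[of M "\<lambda>n. avg n F"])
    show "integrable M (avg n F)" for n by (rule bdd_integrable[OF Ab])
    fix e :: real assume e: "e > 0"
    then obtain N0 where N0: "\<forall>m\<ge>N0. \<forall>n\<ge>N0. nrm2 (\<lambda>x. avg m F x - avg n F x) < e\<^sup>2"
      using mean_ergodic_Cauchy[OF F, of "e\<^sup>2"] by auto
    have "(\<integral>x. norm (avg i F x - avg j F x) \<partial>M) < e" if "i \<ge> N0" "j \<ge> N0" for i j
    proof -
      have "(\<integral>x. norm (avg i F x - avg j F x) \<partial>M)\<^sup>2 < e\<^sup>2"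
        using L1_sq_le_nrm2[OF bdd_diff[OF Ab Ab], of i j] N0 that by fastforce
      then show ?thesis using e power2_less_imp_less by (meson less_imp_le)
    qed
    then show "\<exists>N. \<forall>i\<ge>N. \<forall>j\<ge>N. (\<integral>x. norm (avg i F x - avg j F x) \<partial>M) < e" by blast
  qed auto
  define Q where "Q x \<longleftrightarrow> Cauchy (\<lambda>i. avg (r i) F x)" for x
  \<comment> \<open>The Cauchy condition holds at \<open>T x\<close> exactly when it holds at
    \<open>x\<close>. With the value 0 elsewhere \<open>L\<close> is invariant at every point, as
    \<open>invariant_constant\<close> demands.\<close>
  define L where "L x = (if Q x then lim (\<lambda>i. avg (r i) F x) else 0)" for x
  have avm [measurable]: "avg n F \<in> borel_measurable M" for n by (rule bdd_measurable[OF Ab])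
  have Lm: "L \<in> borel_measurable M"
    unfolding L_def[abs_def]
  proof (rule measurable_If)
    show "(\<lambda>x. lim (\<lambda>i. avg (r i) F x)) \<in> borel_measurable M" by (rule borel_measurable_lim_metric) (rule avm)
    show "{x \<in> space M. Q x} \<in> sets M" unfolding Q_def by (rule sets_Collect_Cauchy) (rule avm)
  qed simp
  have L_lim: "(\<lambda>i. avg (r i) F x) \<longlonglongrightarrow> L x" if "Q x" for x
    using that by (simp add: L_def Q_def Cauchy_convergent_iff convergent_LIMSEQ_iff)
  have L_bound: "norm (L x) \<le> C" if "x \<in> space M" for x
  proof (cases "Q x")
    case True
    show ?thesis using avg_norm[OF F that] by (intro LIMSEQ_le_const2[OF tendsto_norm[OF L_lim[OF True]]]) auto
  qed (simp add: L_def C)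
  have r_top: "filterlim r at_top sequentially" using r(1) by (rule filterlim_subseq)
  have diff0: "(\<lambda>i. avg (r i) F (T x) - avg (r i) F x) \<longlonglongrightarrow> 0" if x: "x \<in> space M" for x
  proof -
    have "(\<lambda>N. avg N F (T x) - avg N F x) \<longlonglongrightarrow> 0"
    proof (rule Lim_null_comparison)
      have "norm (avg N F (T x) - avg N F x) \<le> 2 * C / N" for N
        using avg_shift_bound[OF F x, of N 1] by (simp add: avg_def funpow_swap1 norm_minus_commute)
      then show "\<forall>\<^sub>F N in sequentially. norm (avg N F (T x) - avg N F x) \<le> 2 * C / N" by simp
      show "(\<lambda>N. 2 * C / real N) \<longlonglongrightarrow> 0"
        by (intro tendsto_divide_0[OF tendsto_const] filterlim_real_sequentially[THEN filterlim_at_top_imp_at_infinity])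
    qed
    from filterlim_compose[OF this r_top] show ?thesis .
  qed
  have L_inv: "L (T x) = L x" if x: "x \<in> space M" for x
  proof -
    have iff: "(\<lambda>i. avg (r i) F (T x)) \<longlonglongrightarrow> l \<longleftrightarrow> (\<lambda>i. avg (r i) F x) \<longlonglongrightarrow> l" for l
      using Lim_transform[OF _ diff0[OF x]] Lim_transform2[OF _ diff0[OF x]] by blast
    then have "Q (T x) \<longleftrightarrow> Q x" by (simp add: Q_def Cauchy_convergent_iff convergent_def)
    then show ?thesis using iff by (simp add: L_def lim_def)
  qed
  define c where "c = Complex (\<integral>x. Re (L x) \<partial>M) (\<integral>x. Im (L x) \<partial>M)"
  have "AE x in M. Re (L x) = (\<integral>x. Re (L x) \<partial>M)"
    using Lm L_bound L_inv abs_Re_le_cmod order_trans by (intro invariant_constant[of _ C]) (auto, blast)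
  moreover have "AE x in M. Im (L x) = (\<integral>x. Im (L x) \<partial>M)"
    using Lm L_bound L_inv abs_Im_le_cmod order_trans by (intro invariant_constant[of _ C]) (auto, blast)
  ultimately have Lc: "AE x in M. L x = c" by eventually_elim (simp add: c_def complex_eq_iff)
  have conv: "AE x in M. (\<lambda>i. avg (r i) F x) \<longlonglongrightarrow> c"
    using Lc r(2) by eventually_elim (use L_lim Q_def in auto)
  have "(\<lambda>i. \<integral>x. avg (r i) F x \<partial>M) \<longlonglongrightarrow> (\<integral>x. c \<partial>M)"
    by (rule integral_dominated_convergence[where w = "\<lambda>_. C"])
      (use conv avm avg_norm[OF F] in \<open>auto intro!: AE_I2\<close>)
  moreover have "\<forall>\<^sub>F i in sequentially. (\<integral>x. avg (r i) F x \<partial>M) = (\<integral>x. F x \<partial>M)"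
    using eventually_gt_at_top[of 0]
  proof eventually_elim
    case (elim i)
    then have "r i > 0" using seq_suble[OF r(1), of i] by simp
    then show ?case by (rule integral_avg[OF F])
  qed
  ultimately have c: "(\<integral>x. F x \<partial>M) = c"
    by (simp add: prob_space tendsto_cong[of "\<lambda>i. \<integral>x. avg (r i) F x \<partial>M" "\<lambda>_. \<integral>x. F x \<partial>M"] LIMSEQ_const_iff)
  have sub: "(\<lambda>i. nrm2 (\<lambda>x. avg (r i) F x - c)) \<longlonglongrightarrow> (\<integral>x. 0 \<partial>M)"
    unfolding nrm2_def
  proof (rule integral_dominated_convergence[where w = "\<lambda>_. (C + norm c)\<^sup>2"])
    show "AE x in M. (\<lambda>i. (norm (avg (r i) F x - c))\<^sup>2) \<longlonglongrightarrow> 0"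
      using conv
    proof eventually_elim
      case (elim x)
      then have "(\<lambda>i. (norm (avg (r i) F x - c))\<^sup>2) \<longlonglongrightarrow> (norm (c - c))\<^sup>2" by (intro tendsto_intros)
      then show ?case by simp
    qed
    show "AE x in M. norm ((norm (avg (r i) F x - c))\<^sup>2) \<le> (C + norm c)\<^sup>2" for i
      using bdd_bound[OF bdd_diff[OF Ab bdd_const]] by (intro AE_I2) (simp add: power_mono)
  qed (use avm in auto)
  \<comment> \<open>Convergence is known along \<open>r\<close> only; the Cauchy property of the
    whole sequence carries it over.\<close>
  have "(\<lambda>N. nrm2 (\<lambda>x. avg N F x - c)) \<longlonglongrightarrow> 0"
  proof (rule LIMSEQ_I)
    fix e :: real assume e: "e > 0"
    obtain N0 where N0: "\<forall>m\<ge>N0. \<forall>n\<ge>N0. nrm2 (\<lambda>x. avg m F x - avg n F x) < e/4"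
      using mean_ergodic_Cauchy[OF F, of "e/4"] e by auto
    obtain i0 where i0: "\<And>i. i \<ge> i0 \<Longrightarrow> nrm2 (\<lambda>x. avg (r i) F x - c) < e/4"
      using LIMSEQ_D[OF sub, of "e/4"] e nrm2_nonneg by auto
    define i where "i = max i0 N0"
    have ri: "r i \<ge> N0" using seq_suble[OF r(1), of i] by (simp add: i_def)
    have "norm (nrm2 (\<lambda>x. avg N F x - c) - 0) < e" if "N \<ge> N0" for N
    proof -
      have "nrm2 (\<lambda>x. (avg N F x - avg (r i) F x) + (avg (r i) F x - c)) \<le>
          2 * nrm2 (\<lambda>x. avg N F x - avg (r i) F x) + 2 * nrm2 (\<lambda>x. avg (r i) F x - c)"
        by (rule nrm2_triangle[OF bdd_diff[OF Ab Ab] bdd_diff[OF Ab bdd_const]])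
      moreover have "nrm2 (\<lambda>x. avg N F x - avg (r i) F x) < e/4" using N0 that ri by blast
      moreover have "nrm2 (\<lambda>x. avg (r i) F x - c) < e/4" by (rule i0) (simp add: i_def)
      ultimately show ?thesis using nrm2_nonneg[of "\<lambda>x. avg N F x - c"] by simp
    qed
    then show "\<exists>no. \<forall>N\<ge>no. norm (nrm2 (\<lambda>x. avg N F x - c) - 0) < e" by blast
  qed
  then show ?thesis by (simp add: c)
qed

lemma corr_average:
  assumes F: "bdd C F"
  shows "(\<lambda>H. (\<Sum>h=1..H. corr F h) / of_nat H) \<longlonglongrightarrow> complex_of_real ((norm (\<integral>x. F x \<partial>M))\<^sup>2)"
proof -
  define c where "c = (\<integral>x. F x \<partial>M)"
  have "(\<lambda>H. (\<Sum>h=1..H. corr F h) / of_nat H - c * cnj c) \<longlonglongrightarrow> 0"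
  proof (rule Lim_null_comparison)
    have "norm ((\<Sum>h=1..H. corr F h) / of_nat H - c * cnj c) \<le> C * sqrt (nrm2 (\<lambda>x. avg H F x - c))" for H
    proof -
      let ?u = "\<lambda>x. cnj (avg H F x - c)"
      have u: "bdd (C + norm c) ?u" by (intro bdd_cnj bdd_diff bdd_avg F bdd_const)
      have "(\<Sum>h=1..H. corr F h) / of_nat H - c * cnj c = (\<integral>x. F x * ?u x \<partial>M)"
        unfolding sum_corr[OF F] c_def
        using bdd_integrable[OF F] bdd_integrable[OF bdd_mult[OF F bdd_cnj[OF bdd_avg[OF F]]]]
        by (simp add: right_diff_distrib)
      moreover have "nrm2 ?u = nrm2 (\<lambda>x. avg H F x - c)" unfolding nrm2_def by (simp del: complex_cnj_diff)
      ultimately show ?thesis using integral_mult_bound[OF F u] by simp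
    qed
    then show "\<forall>\<^sub>F H in sequentially. norm ((\<Sum>h=1..H. corr F h) / of_nat H - c * cnj c)
        \<le> C * sqrt (nrm2 (\<lambda>x. avg H F x - c))" by simp
    show "(\<lambda>H. C * sqrt (nrm2 (\<lambda>x. avg H F x - c))) \<longlonglongrightarrow> 0"
      using tendsto_real_sqrt[OF mean_ergodic[OF F]] by (intro tendsto_mult_right_zero) (simp add: c_def)
  qed
  then show ?thesis by (simp add: LIM_zero_iff c_def complex_norm_square del: of_real_power)
qed

text \<open>For an ergodic system the correlations converge on average to the squared modulus of the
  integral, and the square root in the definition undoes the square.\<close>

lemma ghk_seminorm_1:
  assumes "F \<in> Linfty M"
  shows "ghk_seminorm M T (Suc 0) F = complex_of_real (norm (\<integral>x. F x \<partial>M))"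
proof -
  obtain C F' where F': "bdd C F'" "AE x in M. F x = F' x" using Linfty_truncate[OF assms] by blast
  have Fm: "F \<in> borel_measurable M" using assms by (simp add: Linfty_def)
  have c: "corr F h = corr F' h" for h by (rule corr_cong_AE[OF Fm bdd_measurable[OF F'(1)] F'(2)])
  have i: "(\<integral>x. F x \<partial>M) = (\<integral>x. F' x \<partial>M)" by (rule integral_cong_AE[OF Fm bdd_measurable[OF F'(1)] F'(2)])
  have "lim (\<lambda>H. (\<Sum>h=1..H. corr F h) / of_nat H) = complex_of_real ((norm (\<integral>x. F x \<partial>M))\<^sup>2)"
    unfolding c i by (rule limI[OF corr_average[OF F'(1)]])
  then show ?thesis by (simp add: corr_def[abs_def] mult_diff_def flip: sqrt_def)
qed

lemma mult_diff_Linfty: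
  assumes "f \<in> Linfty M"
  shows "mult_diff T h f \<in> Linfty M"
proof -
  obtain C where C: "AE x in M. norm (f x) \<le> C" and fm: "f \<in> borel_measurable M"
    using assms by (auto simp: Linfty_def)
  have cm: "cnj \<in> borel_measurable borel"
    by (intro borel_measurable_continuous_onI continuous_on_cnj continuous_on_id)
  have "AE x in M. norm (mult_diff T h f x) \<le> \<bar>C\<bar> * \<bar>C\<bar>"
    using C AE_iter[OF C, of h]
  proof eventually_elim
    case (elim x)
    have "norm (f x) * norm (f ((T ^^ h) x)) \<le> \<bar>C\<bar> * \<bar>C\<bar>" using elim by (intro mult_mono) auto
    then show ?case by (simp add: mult_diff_def norm_mult)
  qed
  moreover have "mult_diff T h f \<in> borel_measurable M"
    unfolding mult_diff_def
    using fm measurable_compose[OF measurable_compose[OF iter_measurable fm] cm] by (intro borel_measurable_times) auto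
  ultimately show ?thesis by (auto simp: Linfty_def)
qed

text \<open>The squared first seminorm of a multiplicative derivative is the squared modulus of a
  correlation. Existence of the limit is essential: \<open>lim\<close> of a divergent sequence would
  carry no information.\<close>

theorem ghk_seminorm_2_eq_0_iff:
  assumes f: "f \<in> Linfty M"
  shows "ghk_seminorm M T 2 f = 0 \<longleftrightarrow> (\<lambda>H. (\<Sum>h=1..H. (norm (corr f h))\<^sup>2) / H) \<longlonglongrightarrow> 0"
proof -
  obtain C f' where f': "bdd C f'" "AE x in M. f x = f' x" using Linfty_truncate[OF f] by blast
  have fm: "f \<in> borel_measurable M" using f by (simp add: Linfty_def)
  have c: "corr f h = corr f' h" for h by (rule corr_cong_AE[OF fm bdd_measurable[OF f'(1)] f'(2)])
  define r where "r H = (\<Sum>h=1..H. (norm (corr f h))\<^sup>2) / H" for H :: nat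
  have rc: "complex_of_real (r H) = (\<Sum>h=1..H. complex_of_real ((norm (corr f h))\<^sup>2)) / of_nat H" for H
    by (simp add: r_def)
  have "convergent (\<lambda>H. complex_of_real (r H))" unfolding rc c by (rule corr_sq_average_convergent[OF f'(1)])
  then obtain l where l: "(\<lambda>H. complex_of_real (r H)) \<longlonglongrightarrow> l" by (auto simp: convergent_def)
  have rl: "r \<longlonglongrightarrow> Re l" using tendsto_Re[OF l] by simp
  have sq: "(ghk_seminorm M T (Suc 0) (mult_diff T h f)) ^ (2 ^ Suc 0) = complex_of_real ((norm (corr f h))\<^sup>2)" for h
    unfolding ghk_seminorm_1[OF mult_diff_Linfty[OF f]] by (simp add: corr_def mult_diff_def)
  have "ghk_seminorm M T 2 f = ghk_seminorm M T (Suc (Suc 0)) f" by (simp only: numeral_2_eq_2)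
  also have "\<dots> = complex_of_real (root (2 ^ Suc (Suc 0)) (Re (lim (\<lambda>H. complex_of_real (r H)))))"
    unfolding ghk_seminorm.simps(2)[of M T "Suc 0"] sq rc ..
  also have "lim (\<lambda>H. complex_of_real (r H)) = l" by (rule limI[OF l])
  finally have "ghk_seminorm M T 2 f = 0 \<longleftrightarrow> Re l = 0" by simp
  also have "\<dots> \<longleftrightarrow> r \<longlonglongrightarrow> 0" using rl LIMSEQ_unique by auto
  finally show ?thesis by (simp add: r_def[abs_def])
qed

end

section \<open>Approximate roots in Lie groups\<close>

text \<open>Coordinates centred at the identity, with size measured by the sum of absolute values.
  Multiplication is addition up to a quarter of the size of the second factor alone, which expresses
  that its derivative in the second variable is close to the identity matrix. Such an error adds up
  linearly when powers are formed.\<close>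

locale group_coordinates = topological_group G \<tau> for G (structure) and \<tau> +
  fixes U :: "'a set" and \<psi> :: "'a \<Rightarrow> nat \<Rightarrow> real" and d :: nat and r0 :: real
  assumes r0: "r0 > 0"
    and U_carrier: "U \<subseteq> carrier G" and one_U: "\<one> \<in> U"
    and coordinates_one: "i < d \<Longrightarrow> \<psi> \<one> i = 0"
    and coordinates_surj: "(\<Sum>i<d. \<bar>v i\<bar>) < r0 \<Longrightarrow> \<exists>x\<in>U. \<forall>i<d. \<psi> x i = v i"
    and coordinates_mult: "x \<in> U \<Longrightarrow> y \<in> U \<Longrightarrow> (\<Sum>i<d. \<bar>\<psi> x i\<bar>) < r0 \<Longrightarrow> (\<Sum>i<d. \<bar>\<psi> y i\<bar>) < r0 \<Longrightarrow>
      x \<otimes> y \<in> U \<and> (\<Sum>i<d. \<bar>\<psi> (x \<otimes> y) i - \<psi> x i - \<psi> y i\<bar>) \<le> (\<Sum>i<d. \<bar>\<psi> y i\<bar>) / 4"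
    and coordinates_nbhd: "r > 0 \<Longrightarrow> nbhd {x \<in> U. (\<Sum>i<d. \<bar>\<psi> x i\<bar>) < r}"
    and coordinates_basis: "nbhd W \<Longrightarrow> \<exists>r>0. {x \<in> U. (\<Sum>i<d. \<bar>\<psi> x i\<bar>) < r} \<subseteq> W"
begin

definition \<nu> :: "'a \<Rightarrow> real" where "\<nu> x = (\<Sum>i<d. \<bar>\<psi> x i\<bar>)"

lemma \<nu>_nbhd: "r > 0 \<Longrightarrow> nbhd {x \<in> U. \<nu> x < r}"
  unfolding \<nu>_def by (rule coordinates_nbhd)

lemma \<nu>_basis: "nbhd W \<Longrightarrow> \<exists>r>0. {x \<in> U. \<nu> x < r} \<subseteq> W"
  unfolding \<nu>_def by (rule coordinates_basis)

lemma \<nu>_nonneg: "\<nu> x \<ge> 0" by (simp add: \<nu>_def sum_nonneg)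

lemma \<nu>_one: "\<nu> \<one> = 0" by (simp add: \<nu>_def coordinates_one)

lemma \<nu>_mult:
  assumes "x \<in> U" "y \<in> U" "\<nu> x < r0" "\<nu> y < r0"
  shows "x \<otimes> y \<in> U" "(\<Sum>i<d. \<bar>\<psi> (x \<otimes> y) i - \<psi> x i - \<psi> y i\<bar>) \<le> \<nu> y / 4" "\<nu> (x \<otimes> y) \<le> \<nu> x + 5/4 * \<nu> y"
proof -
  show 1: "x \<otimes> y \<in> U" and 2: "(\<Sum>i<d. \<bar>\<psi> (x \<otimes> y) i - \<psi> x i - \<psi> y i\<bar>) \<le> \<nu> y / 4"
    using coordinates_mult[of x y] assms by (auto simp: \<nu>_def)
  have "\<nu> (x \<otimes> y) \<le> (\<Sum>i<d. \<bar>\<psi> (x \<otimes> y) i - \<psi> x i - \<psi> y i\<bar> + \<bar>\<psi> x i\<bar> + \<bar>\<psi> y i\<bar>)"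
    unfolding \<nu>_def by (intro sum_mono) linarith
  also have "\<dots> = (\<Sum>i<d. \<bar>\<psi> (x \<otimes> y) i - \<psi> x i - \<psi> y i\<bar>) + \<nu> x + \<nu> y" by (simp add: sum.distrib \<nu>_def)
  finally show "\<nu> (x \<otimes> y) \<le> \<nu> x + 5/4 * \<nu> y" using 2 by simp
qed

text \<open>Each multiplication by \<open>y\<close> contributes an error of at most a quarter of
  \<open>\<nu> y\<close>. The hypothesis \<open>small\<close> keeps all intermediate powers inside
  the range where the next multiplication can be estimated.\<close>

lemma power_coordinates:
  assumes y: "y \<in> U" and small: "5/4 * (real n * \<nu> y) < r0" and j: "j \<le> n"
  shows "y [^] j \<in> U" "(\<Sum>i<d. \<bar>\<psi> (y [^] j) i - real j * \<psi> y i\<bar>) \<le> real j / 4 * \<nu> y"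
    "\<nu> (y [^] j) \<le> 5/4 * (real j * \<nu> y)"
proof -
  have norm_le: "\<nu> x \<le> (\<Sum>i<d. \<bar>\<psi> x i - real j * \<psi> y i\<bar>) + real j * \<nu> y" for x and j :: nat
  proof -
    have "\<nu> x \<le> (\<Sum>i<d. \<bar>\<psi> x i - real j * \<psi> y i\<bar> + real j * \<bar>\<psi> y i\<bar>)"
      unfolding \<nu>_def
    proof (rule sum_mono)
      fix i
      have "\<bar>\<psi> x i\<bar> \<le> \<bar>\<psi> x i - real j * \<psi> y i\<bar> + \<bar>real j * \<psi> y i\<bar>" by linarith
      then show "\<bar>\<psi> x i\<bar> \<le> \<bar>\<psi> x i - real j * \<psi> y i\<bar> + real j * \<bar>\<psi> y i\<bar>" by (simp add: abs_mult)
    qed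
    then show ?thesis by (simp add: sum.distrib \<nu>_def sum_distrib_left)
  qed
  have *: "y [^] j \<in> U \<and> (\<Sum>i<d. \<bar>\<psi> (y [^] j) i - real j * \<psi> y i\<bar>) \<le> real j / 4 * \<nu> y"
    using j
  proof (induction j)
    case 0 then show ?case using one_U coordinates_one by simp
  next
    case (Suc j)
    then have IH: "y [^] j \<in> U" "(\<Sum>i<d. \<bar>\<psi> (y [^] j) i - real j * \<psi> y i\<bar>) \<le> real j / 4 * \<nu> y" by auto
    have "real (Suc j) * \<nu> y \<le> real n * \<nu> y" using Suc.prems \<nu>_nonneg by (intro mult_right_mono) auto
    then have jn: "real j * \<nu> y + \<nu> y \<le> real n * \<nu> y" by (simp add: distrib_right)
    have j0: "0 \<le> real j * \<nu> y" using \<nu>_nonneg[of y] by simp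
    have "\<nu> (y [^] j) \<le> 5/4 * (real j * \<nu> y)" using norm_le[of "y [^] j" j] IH by simp
    then have lt: "\<nu> (y [^] j) < r0" "\<nu> y < r0"
      using jn j0 small \<nu>_nonneg[of y] by linarith+
    note m = \<nu>_mult[OF IH(1) y lt]
    have "(\<Sum>i<d. \<bar>\<psi> (y [^] j \<otimes> y) i - real (Suc j) * \<psi> y i\<bar>) \<le>
        (\<Sum>i<d. \<bar>\<psi> (y [^] j \<otimes> y) i - \<psi> (y [^] j) i - \<psi> y i\<bar> + \<bar>\<psi> (y [^] j) i - real j * \<psi> y i\<bar>)"
      by (intro sum_mono) (simp add: algebra_simps)
    also have "\<dots> \<le> \<nu> y / 4 + real j / 4 * \<nu> y" using m(2) IH(2) by (simp add: sum.distrib)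
    finally show ?case using m(1) by (simp add: algebra_simps add_divide_distrib)
  qed
  then show "y [^] j \<in> U" "(\<Sum>i<d. \<bar>\<psi> (y [^] j) i - real j * \<psi> y i\<bar>) \<le> real j / 4 * \<nu> y" by auto
  then show "\<nu> (y [^] j) \<le> 5/4 * (real j * \<nu> y)" using norm_le[of "y [^] j" j] by simp
qed

text \<open>
  The \<open>n\<close>-th power of the point with coordinates \<open>\<psi> z / n\<close> is \<open>z\<close> up to an error of half the size.
  Iterating on the error exhausts \<open>z\<close>, and no exact \<open>n\<close>-th roots are needed.
\<close>

theorem approximate_roots:
  "\<exists>B. nbhd B \<and> (\<forall>z\<in>B. \<forall>W. nbhd W \<longrightarrow> (\<exists>n0. \<forall>n\<ge>n0. \<exists>P w. root_product G W n z P w \<and> P \<in> W))"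
proof -
  have Uc: "x \<in> U \<Longrightarrow> x \<in> carrier G" for x using U_carrier by auto
  \<comment> \<open>Guarantees that the error \<open>inv (y [^] n) \<otimes> z\<close> has
    coordinates at all, before anything is known about its size.\<close>
  obtain V where V: "nbhd V" "\<And>v w. v \<in> V \<Longrightarrow> w \<in> V \<Longrightarrow> inv v \<otimes> w \<in> {x \<in> U. \<nu> x < r0}"
    using nbhd_quotient[OF \<nu>_nbhd[OF r0]] by metis
  obtain \<rho>0 where \<rho>0: "\<rho>0 > 0" "{x \<in> U. \<nu> x < \<rho>0} \<subseteq> V"
    using \<nu>_basis[OF V(1)] by blast
  \<comment> \<open>The powers of the approximate root have size at most
    \<open>5/4 * \<rho>\<close>, so the factor 4 leaves ample room below both radii.\<close>
  define \<rho> where "\<rho> = min \<rho>0 r0 / 4"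
  have \<rho>: "\<rho> > 0" "4 * \<rho> \<le> r0" "4 * \<rho> \<le> \<rho>0" using \<rho>0 r0 by (auto simp: \<rho>_def)
  have root: "\<exists>y\<in>U. \<exists>w\<in>U. \<nu> y = \<nu> z / n \<and> \<nu> w \<le> \<nu> z / 2 \<and> z = y [^] n \<otimes> w"
    if z: "z \<in> U" "\<nu> z < \<rho>" and n: "n > 0" for z and n :: nat
  proof -
    have n1: "real n \<ge> 1" using n by simp
    have sum: "(\<Sum>i<d. \<bar>\<psi> z i / n\<bar>) = \<nu> z / n" using n by (simp add: \<nu>_def sum_divide_distrib)
    have "\<nu> z / n \<le> \<nu> z" using n1 \<nu>_nonneg[of z] by (simp add: divide_le_eq mult_le_cancel_left1)
    then have "(\<Sum>i<d. \<bar>\<psi> z i / n\<bar>) < r0" using z \<rho> sum by linarith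
    then obtain y where y: "y \<in> U" "\<forall>i<d. \<psi> y i = \<psi> z i / n" using coordinates_surj[of "\<lambda>i. \<psi> z i / n"] by blast
    have \<nu>y: "\<nu> y = \<nu> z / n" using y(2) sum by (simp add: \<nu>_def)
    have ny: "real n * \<nu> y = \<nu> z" using n by (simp add: \<nu>y)
    have "5/4 * (real n * \<nu> y) < r0" using z \<rho> ny \<nu>_nonneg[of z] by linarith
    note p = power_coordinates[OF y(1) this order_refl]
    define w where "w = inv (y [^] n) \<otimes> z"
    have yn: "y [^] n \<in> V" using p(1,3) ny z \<rho> \<nu>_nonneg[of z] by (intro subsetD[OF \<rho>0(2)]) auto
    have zV: "z \<in> V" using z \<rho> by (intro subsetD[OF \<rho>0(2)]) auto
    have w: "w \<in> U" "\<nu> w < r0" using V(2)[OF yn zV] by (auto simp: w_def)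
    have zw: "z = y [^] n \<otimes> w" using Uc y z by (simp add: w_def)
    have "\<nu> (y [^] n) < r0" using p(3) ny z \<rho> \<nu>_nonneg[of z] by linarith
    note m = \<nu>_mult(2)[OF p(1) w(1) this w(2)]
    \<comment> \<open>The first error is at most a quarter of \<open>\<nu> w\<close> itself and
      moves to the left; what remains gives \<open>3/4 * \<nu> w \<le> \<nu> z / 4\<close>.\<close>
    have "\<nu> w \<le> (\<Sum>i<d. \<bar>\<psi> z i - \<psi> (y [^] n) i - \<psi> w i\<bar> + \<bar>\<psi> (y [^] n) i - real n * \<psi> y i\<bar>)"
      unfolding \<nu>_def
    proof (rule sum_mono)
      fix i assume "i \<in> {..<d}"
      then have "real n * \<psi> y i = \<psi> z i" using y n by simp
      then show "\<bar>\<psi> w i\<bar> \<le> \<bar>\<psi> z i - \<psi> (y [^] n) i - \<psi> w i\<bar> + \<bar>\<psi> (y [^] n) i - real n * \<psi> y i\<bar>" by linarith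
    qed
    also have "\<dots> \<le> \<nu> w / 4 + \<nu> z / 4" using m p(2) ny by (simp add: sum.distrib flip: zw)
    finally have "\<nu> w \<le> \<nu> z / 2" using \<nu>_nonneg[of z] by linarith
    then show ?thesis using y w zw \<nu>y by blast
  qed
  \<comment> \<open>\<open>m\<close> is the number of halvings of the error still to be performed.
    The constant 3 closes the induction: the remainder has half the size, so its \<open>P\<close> is
    bounded by \<open>3/2 * (\<nu> z / n)\<close>, and multiplication by \<open>y\<close> gives a
    factor of at most \<open>1 + 5/4 * 3/2\<close>, which is below 3.\<close>
  have main: "\<exists>P w. root_product G W n z P w \<and> P \<in> U \<and> \<nu> P \<le> 3 * (\<nu> z / n)"
    if W: "{x \<in> U. \<nu> x < \<delta>} \<subseteq> W" and n: "n > 0"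
      and z: "z \<in> U" "\<nu> z < \<rho>" "\<nu> z / n < \<delta>" "\<nu> z / 2 ^ m < \<delta>" for W \<delta> z m and n :: nat
    using z
  proof (induction m arbitrary: z)
    case 0
    then have "z \<in> W" using W by auto
    then show ?case using root_product.base[of z W G n] one_U \<nu>_one \<nu>_nonneg[of z] by (intro exI[of _ \<one>] exI[of _ z]) auto
  next
    case (Suc m)
    obtain y w where yw: "y \<in> U" "w \<in> U" "\<nu> y = \<nu> z / n" "\<nu> w \<le> \<nu> z / 2" "z = y [^] n \<otimes> w"
      using root[OF Suc.prems(1,2) n] by blast
    have wn: "\<nu> w / n \<le> \<nu> z / 2 / n" using yw(4) by (intro divide_right_mono) auto
    have zn: "0 \<le> \<nu> z / n" "\<nu> z / 2 / n = \<nu> z / n / 2" using \<nu>_nonneg[of z] by auto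
    have "\<nu> w / 2 ^ m \<le> \<nu> z / 2 / 2 ^ m" using yw(4) by (intro divide_right_mono) auto
    then have "\<nu> w / 2 ^ m < \<delta>" using Suc.prems(4) by simp
    moreover have "\<nu> w / n < \<delta>" using wn zn Suc.prems(3) by linarith
    moreover have "\<nu> w < \<rho>" using yw(4) Suc.prems(2) \<nu>_nonneg[of z] by linarith
    ultimately obtain P w' where Pw: "root_product G W n w P w'" "P \<in> U" "\<nu> P \<le> 3 * (\<nu> w / n)"
      using Suc.IH[OF yw(2)] by blast
    have "y \<in> W" using W yw Suc.prems by auto
    then have "root_product G W n z (y \<otimes> P) w'" using root_product.step[OF Pw(1)] yw(5) by simp
    moreover have \<nu>P: "\<nu> P \<le> 3/2 * (\<nu> z / n)" using Pw(3) wn zn by simp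
    have "\<nu> z / n \<le> \<nu> z" using n \<nu>_nonneg[of z] by (simp add: divide_le_eq mult_le_cancel_left1)
    then have "\<nu> y < r0" "\<nu> P < r0" using \<nu>P yw(3) Suc.prems(2) \<rho> by linarith+
    note m = \<nu>_mult[OF yw(1) Pw(2) this]
    have "\<nu> (y \<otimes> P) \<le> 3 * (\<nu> z / n)" using m(3) \<nu>P yw(3) zn by linarith
    ultimately show ?case using m(1) by blast
  qed
  show ?thesis
  proof (rule exI, intro conjI ballI allI impI)
    show "nbhd {x \<in> U. \<nu> x < \<rho>}" by (rule \<nu>_nbhd[OF \<rho>(1)])
    fix z W assume z: "z \<in> {x \<in> U. \<nu> x < \<rho>}" and W: "nbhd W"
    obtain \<delta> where \<delta>: "\<delta> > 0" "{x \<in> U. \<nu> x < \<delta>} \<subseteq> W" using \<nu>_basis[OF W] by blast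
    \<comment> \<open>\<open>n1\<close> makes \<open>P\<close> and the roots small, while
      \<open>m\<close> makes the last remainder small; \<open>m\<close> depends on \<open>z\<close>
      and \<open>\<delta>\<close> but not on \<open>n\<close>.\<close>
    obtain n1 where n1: "3 * \<nu> z / \<delta> < real n1" using reals_Archimedean2 by blast
    obtain m where m: "\<nu> z / \<delta> < 2 ^ m" using real_arch_pow[of 2 "\<nu> z / \<delta>"] by auto
    have "\<exists>P w. root_product G W n z P w \<and> P \<in> W" if n: "n \<ge> max 1 n1" for n
    proof -
      have npos: "n > 0" "real n > 0" "3 * \<nu> z / \<delta> < real n" using n n1 by auto
      then have 3: "3 * (\<nu> z / n) < \<delta>" using \<delta> by (simp add: field_simps)
      then have "\<nu> z / n < \<delta>" using \<nu>_nonneg[of z] npos by (simp add: field_simps)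
      moreover have "\<nu> z / 2 ^ m < \<delta>" using m \<delta> by (simp add: field_simps)
      ultimately obtain P w where "root_product G W n z P w" "P \<in> U" "\<nu> P \<le> 3 * (\<nu> z / n)"
        using main[OF \<delta>(2) npos(1), of z m] z by blast
      then show ?thesis using \<delta>(2) 3 by force
    qed
    then show "\<exists>n0. \<forall>n\<ge>n0. \<exists>P w. root_product G W n z P w \<and> P \<in> W" by blast
  qed
qed

end

text \<open>A basic open set of the product topology restricts finitely many coordinates, and the
  sum of absolute values dominates each of them.\<close>

lemma Euclidean_space_ball:
  assumes S: "openin (Euclidean_space n) S" and e: "e \<in> S"
  shows "\<exists>r>0. \<forall>v\<in>topspace (Euclidean_space n). (\<Sum>i<n. \<bar>v i - e i\<bar>) < r \<longrightarrow> v \<in> S"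
proof -
  obtain V where V: "openin (powertop_real UNIV) V" "S = V \<inter> {x. \<forall>i\<ge>n. x i = 0}"
    using S by (auto simp: Euclidean_space_def openin_subtopology)
  have "e \<in> V" using e V(2) by blast
  with V(1) obtain U where U': "finite {i \<in> UNIV. U i \<noteq> topspace euclideanreal}" "\<forall>i\<in>UNIV. openin euclideanreal (U i)"
    "e \<in> Pi\<^sub>E UNIV U" "Pi\<^sub>E UNIV U \<subseteq> V"
    unfolding openin_product_topology_alt by blast
  have U: "finite {i. U i \<noteq> UNIV}" "\<And>i. open (U i)" "\<And>i. e i \<in> U i" "\<And>v. (\<forall>i. v i \<in> U i) \<Longrightarrow> v \<in> V"
    using U' by (auto simp: PiE_UNIV_domain)
  have "\<forall>i. \<exists>r>0. ball (e i) r \<subseteq> U i" using U(2,3) openE by blast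
  then obtain r where r: "\<And>i. r i > 0" "\<And>i. ball (e i) (r i) \<subseteq> U i" by metis
  \<comment> \<open>The element 1 keeps the set nonempty when no coordinate is restricted.\<close>
  define R where "R = Min (insert 1 (r ` {i. U i \<noteq> UNIV}))"
  have R: "R > 0" unfolding R_def using U(1) r(1) by (subst Min_gr_iff) auto
  have "v \<in> S" if v: "v \<in> topspace (Euclidean_space n)" and s: "(\<Sum>i<n. \<bar>v i - e i\<bar>) < R" for v
  proof -
    have v0: "\<forall>i\<ge>n. v i = 0" and e0: "\<forall>i\<ge>n. e i = 0" using v e V by (auto simp: topspace_Euclidean_space)
    have "v i \<in> U i" for i
    proof (cases "i < n \<and> U i \<noteq> UNIV")
      case True
      have "\<bar>v i - e i\<bar> \<le> (\<Sum>i<n. \<bar>v i - e i\<bar>)" using True by (intro member_le_sum) auto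
      also have "\<dots> < R" by (rule s)
      also have "R \<le> r i" unfolding R_def using U(1) True by (intro Min_le) auto
      finally show ?thesis using r(2)[of i] by (auto simp: dist_real_def abs_minus_commute)
    next
      case False
      then show ?thesis using v0 e0 U(3)[of i] by (cases "i < n") auto
    qed
    then show ?thesis using U(4) v0 V(2) by auto
  qed
  then show ?thesis using R by blast
qed

lemma finite_uniform_radius:
  fixes Q :: "'a \<Rightarrow> real \<Rightarrow> bool"
  assumes "finite S" "\<And>s. s \<in> S \<Longrightarrow> \<exists>r>0. Q s r" "\<And>s r r'. Q s r \<Longrightarrow> 0 < r' \<Longrightarrow> r' \<le> r \<Longrightarrow> Q s r'"
  shows "\<exists>r>0. \<forall>s\<in>S. Q s r"
  using assms(1,2)
proof (induction S rule: finite_induct)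
  case (insert a S)
  obtain r where r: "r > 0" "\<forall>s\<in>S. Q s r" using insert by auto
  obtain r' where r': "r' > 0" "Q a r'" using insert by auto
  show ?case using r r' assms(3) by (intro exI[of _ "min r r'"]) (auto intro: assms(3)[of _ r] assms(3)[of _ r'])
qed (auto intro: exI[of _ 1])

lemma lie_group_topological_group:
  assumes "lie_group G \<tau>"
  shows "topological_group G \<tau>"
proof -
  interpret group G using assms by (simp add: lie_group_def)
  show ?thesis
    using assms by unfold_locales (auto simp: lie_group_def smooth_map_def)
qed

text \<open>In a chart around the identity, multiplication by the identity on the left is the
  identity map, so the matrix of partial derivatives in the second variable is the unit matrix there
  and close to it nearby. The mean value theorem, applied to one coordinate of the second factor at
  a time, bounds the deviation from addition.\<close>

theorem lie_group_coordinates: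
  assumes "lie_group G \<tau>"
  shows "\<exists>U \<psi> d r0. group_coordinates G \<tau> U \<psi> d r0"
proof -
  interpret topological_group G \<tau> by (rule lie_group_topological_group[OF assms])
  obtain n A where atlas: "smooth_atlas n \<tau> A"
    and mult: "smooth_map (n + n) (prod_topology \<tau> \<tau>) (prod_atlas n A A) n \<tau> A (\<lambda>(x, y). x \<otimes>\<^bsub>G\<^esub> y)"
    using assms by (auto simp: lie_group_def)
  have "\<one>\<^bsub>G\<^esub> \<in> \<Union>(fst ` A)" using atlas by (simp add: smooth_atlas_def topspace_group)
  then obtain U \<phi> where U\<phi>: "(U, \<phi>) \<in> A" and oneU: "\<one>\<^bsub>G\<^esub> \<in> U" by auto
  have chart: "openin \<tau> U" "openin (Euclidean_space n) (\<phi> ` U)"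
    "homeomorphic_map (subtopology \<tau> U) (subtopology (Euclidean_space n) (\<phi> ` U)) \<phi>"
    using atlas U\<phi> by (auto simp: smooth_atlas_def is_chart_def)
  have Uc: "U \<subseteq> carrier G" using openin_subset[OF chart(1)] by (simp add: topspace_group)
  have inj: "inj_on \<phi> U"
    using homeomorphic_imp_injective_map[OF chart(3)] Uc by (simp add: topspace_group inf_absorb2)
  have \<phi>E: "\<phi> x \<in> topspace (Euclidean_space n)" if "x \<in> U" for x
    using openin_subset[OF chart(2)] that by blast
  have \<phi>0: "\<phi> x i = 0" if "x \<in> U" "i \<ge> n" for x i
    using \<phi>E[OF that(1)] that by (simp add: topspace_Euclidean_space)
  define E where "E = \<phi> \<one>\<^bsub>G\<^esub>"
  have E0: "E i = 0" if "i \<ge> n" for i using \<phi>0[OF oneU that] by (simp add: E_def)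
  define dist where "dist p = (\<Sum>i<n. \<bar>p i - E i\<bar>)" for p
  have ball_nbhd: "nbhd {x \<in> U. dist (\<phi> x) < r}" if r: "r > 0" for r
  proof -
    have 1: "continuous_map (subtopology \<tau> U) (Euclidean_space n) \<phi>"
      using homeomorphic_imp_continuous_map[OF chart(3)] continuous_map_in_subtopology by blast
    have 2: "continuous_map (Euclidean_space n) euclideanreal (\<lambda>v. v i)" for i
      unfolding Euclidean_space_def
      by (intro continuous_map_from_subtopology continuous_map_product_projection) auto
    have 3: "continuous_map (subtopology \<tau> U) euclideanreal (\<lambda>x. \<phi> x i)" for i
      using continuous_map_compose[OF 1 2] by (simp add: o_def)
    have "continuous_map (subtopology \<tau> U) euclideanreal (\<lambda>x. dist (\<phi> x))"
      unfolding dist_def by (intro continuous_map_sum continuous_map_real_abs continuous_map_diff 3) auto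
    then have "openin (subtopology \<tau> U) {x \<in> topspace (subtopology \<tau> U). dist (\<phi> x) \<in> {..<r}}"
      by (rule openin_continuous_map_preimage) auto
    also have "{x \<in> topspace (subtopology \<tau> U). dist (\<phi> x) \<in> {..<r}} = {x \<in> U. dist (\<phi> x) < r}"
      using Uc by (auto simp: topspace_group)
    finally show ?thesis using oneU r chart(1)
      by (auto simp: nbhd_def openin_open_subtopology dist_def E_def)
  qed
  have point: "\<exists>r>0. \<forall>v. dist v < r \<longrightarrow> (\<forall>i\<ge>n. v i = 0) \<longrightarrow> (\<exists>x\<in>U \<inter> W. \<phi> x = v)" if W: "nbhd W" for W
  proof -
    have "openin (subtopology \<tau> U) (U \<inter> W)"
      using W chart(1) by (auto simp: nbhd_def openin_open_subtopology)
    then have "openin (subtopology (Euclidean_space n) (\<phi> ` U)) (\<phi> ` (U \<inter> W))"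
      using homeomorphic_imp_open_map[OF chart(3)] by (simp add: open_map_def)
    then have o: "openin (Euclidean_space n) (\<phi> ` (U \<inter> W))" using chart(2) openin_open_subtopology by blast
    have "E \<in> \<phi> ` (U \<inter> W)" using oneU W by (auto simp: E_def nbhd_def)
    from Euclidean_space_ball[OF o this] obtain r where r: "r > 0"
      "\<And>v. v \<in> topspace (Euclidean_space n) \<Longrightarrow> dist v < r \<Longrightarrow> v \<in> \<phi> ` (U \<inter> W)" by (auto simp: dist_def)
    have "\<exists>x\<in>U \<inter> W. \<phi> x = v" if "dist v < r" "\<forall>i\<ge>n. v i = 0" for v
    proof -
      have "v \<in> \<phi> ` (U \<inter> W)" using that by (intro r(2)) (simp_all add: topspace_Euclidean_space)
      then show ?thesis by blast
    qed
    then show ?thesis using r(1) by blast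
  qed
  have basis: "\<exists>r>0. {x \<in> U. dist (\<phi> x) < r} \<subseteq> W" if W: "nbhd W" for W
  proof -
    obtain r where r: "r > 0" "\<And>v. dist v < r \<Longrightarrow> (\<forall>i\<ge>n. v i = 0) \<Longrightarrow> (\<exists>x\<in>U \<inter> W. \<phi> x = v)"
      using point[OF W] by blast
    have "x \<in> W" if x: "x \<in> U" "dist (\<phi> x) < r" for x
    proof -
      obtain x' where "x' \<in> U \<inter> W" "\<phi> x' = \<phi> x" using r(2)[OF x(2)] \<phi>0[OF x(1)] by blast
      then show ?thesis using inj_onD[OF inj, of x' x] x by auto
    qed
    then show ?thesis using r(1) by blast
  qed
  have "\<exists>V. nbhd V \<and> V \<subseteq> U \<and> (\<forall>x\<in>V. \<forall>y\<in>V. x \<otimes>\<^bsub>G\<^esub> y \<in> U)"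
  proof -
    have U: "nbhd U" using chart(1) oneU by (simp add: nbhd_def)
    obtain V1 where V1: "nbhd V1" "\<And>v w. v \<in> V1 \<Longrightarrow> w \<in> V1 \<Longrightarrow> v \<otimes>\<^bsub>G\<^esub> inv\<^bsub>G\<^esub> w \<in> U"
      using nbhd_quotient[OF U] by metis
    obtain V2 where V2: "nbhd V2" "\<And>w. w \<in> V2 \<Longrightarrow> inv\<^bsub>G\<^esub> w \<in> V1"
      using nbhd_preimage[OF continuous_inv _ V1(1)] by auto
    have "x \<otimes>\<^bsub>G\<^esub> y \<in> U" if "x \<in> V1" "y \<in> V2" for x y
      using V1(2)[OF that(1) V2(2)[OF that(2)]] nbhd_carrier[OF V2(1) that(2)] by simp
    then show ?thesis using nbhd_Int[OF nbhd_Int[OF V1(1) V2(1)] U] by blast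
  qed
  then obtain V where V: "nbhd V" "V \<subseteq> U" "\<And>x y. x \<in> V \<Longrightarrow> y \<in> V \<Longrightarrow> x \<otimes>\<^bsub>G\<^esub> y \<in> U" by blast
  obtain r1 where r1: "r1 > 0" "\<And>v. dist v < r1 \<Longrightarrow> (\<forall>i\<ge>n. v i = 0) \<Longrightarrow> (\<exists>x\<in>U \<inter> V. \<phi> x = v)"
    using point[OF V(1)] by blast
  \<comment> \<open>Matches the charts of \<open>prod_atlas\<close>: the second factor occupies the
    coordinates from index \<open>n\<close> on.\<close>
  define join where "join p q i = (if i < n then p i else q (i - n))" for p q :: "nat \<Rightarrow> real" and i
  define \<Phi> where "\<Phi> = (\<lambda>(x, y). join (\<phi> x) (\<phi> y))"
  have "(U \<times> U, \<Phi>) \<in> prod_atlas n A A"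
    unfolding prod_atlas_def by (rule image_eqI[of _ _ "((U, \<phi>), (U, \<phi>))"]) (auto simp: U\<phi> \<Phi>_def join_def fun_eq_iff)
  define D where "D = \<Phi> ` (U \<times> U \<inter> (\<lambda>(x, y). x \<otimes>\<^bsub>G\<^esub> y) -` U)"
  define F where "F j u = \<phi> ((\<lambda>(x, y). x \<otimes>\<^bsub>G\<^esub> y) (inv_into (U \<times> U) \<Phi> u)) j" for j u
  have smooth: "smooth_on (n + n) D (F j)" if "j < n" for j
    using mult \<open>(U \<times> U, \<Phi>) \<in> prod_atlas n A A\<close> U\<phi> that
    unfolding smooth_map_def smooth_in_charts_def D_def F_def[abs_def] by blast
  have \<Phi>_inj: "inj_on \<Phi> (U \<times> U)"
  proof (rule inj_onI, clarify)
    fix x y x' y' assume c: "x \<in> U" "y \<in> U" "x' \<in> U" "y' \<in> U" and eq: "\<Phi> (x, y) = \<Phi> (x', y')"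
    have "\<phi> x i = \<phi> x' i" for i
      using fun_cong[OF eq, of i] \<phi>0 c by (cases "i < n") (auto simp: \<Phi>_def join_def)
    moreover have "\<phi> y i = \<phi> y' i" for i
      using fun_cong[OF eq, of "n + i"] by (simp add: \<Phi>_def join_def)
    ultimately show "x = x' \<and> y = y'" using c inj by (auto simp: inj_on_def fun_eq_iff)
  qed
  have F\<Phi>: "F j (join (\<phi> x) (\<phi> y)) = \<phi> (x \<otimes>\<^bsub>G\<^esub> y) j" if "x \<in> U" "y \<in> U" for x y j
    using inv_into_f_f[OF \<Phi>_inj, of "(x, y)"] that by (simp add: F_def \<Phi>_def)
  have box: "\<exists>x\<in>V. \<exists>y\<in>V. \<phi> x = p \<and> \<phi> y = q \<and> join p q \<in> D"
    if pq: "dist p < r1" "dist q < r1" "\<And>i. i \<ge> n \<Longrightarrow> p i = 0" "\<And>i. i \<ge> n \<Longrightarrow> q i = 0" for p q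
  proof -
    obtain x y where xy: "x \<in> U \<inter> V" "\<phi> x = p" "y \<in> U \<inter> V" "\<phi> y = q" using r1(2)[OF pq(1)] r1(2)[OF pq(2)] pq(3,4) by blast
    then have "join p q \<in> D" using V(3)[of x y] by (auto simp: D_def \<Phi>_def intro!: image_eqI[of _ _ "(x, y)"])
    then show ?thesis using xy by blast
  qed
  have distE: "dist E = 0" by (simp add: dist_def)
  have join_upd: "(join p q)(n + i := t) = join p (q(i := t))" for p q i t
    by (auto simp: join_def fun_eq_iff)
  define P where "P j i u = deriv (\<lambda>t. F j (u(n + i := t))) (u (n + i))" for j i u
  have C1: "C_k_on 1 (n + n) D (F j)" if "j < n" for j using smooth[OF that] by (simp add: smooth_on_def)
  have diff: "(\<lambda>t. F j (u(n + i := t))) field_differentiable at (u (n + i))" if "j < n" "i < n" "u \<in> D" for j i u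
    using C1[OF that(1)] that by simp
  have contP: "continuous_map (subtopology (Euclidean_space (n + n)) D) euclideanreal (P j i)"
    if "j < n" "i < n" for j i
    using C1[OF that(1)] that unfolding P_def[abs_def] by simp
  \<comment> \<open>The error per component is \<open>\<epsilon>\<close> times the size of the
    second factor; summed over \<open>n\<close> components it stays below a quarter. The summand 1
    covers dimension 0.\<close>
  define \<epsilon> :: real where "\<epsilon> = 1 / (4 * (n + 1))"
  have \<epsilon>: "\<epsilon> > 0" by (simp add: \<epsilon>_def)
  define \<delta> :: "nat \<Rightarrow> nat \<Rightarrow> real" where "\<delta> j i = (if i = j then 1 else 0)" for j i
  have P_E: "P j i (join E E) = \<delta> j i" if ij: "j < n" "i < n" for j i
  proof -
    have "((\<lambda>t. (E(i := t)) j) has_field_derivative \<delta> j i) (at (E i))"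
      by (auto simp: \<delta>_def intro!: derivative_eq_intros)
    then have "((\<lambda>t. F j (join E (E(i := t)))) has_field_derivative \<delta> j i) (at (E i))"
    proof (rule has_field_derivative_transform_within_open)
      show "open (ball (E i) r1)" "E i \<in> ball (E i) r1" using r1(1) by auto
      fix t assume t: "t \<in> ball (E i) r1"
      have "dist (E(i := t)) = (\<Sum>k<n. if k = i then \<bar>t - E i\<bar> else 0)"
        unfolding dist_def by (intro sum.cong) auto
      also have "\<dots> = \<bar>t - E i\<bar>" using ij by simp
      also have "\<dots> < r1" using t by (simp add: dist_real_def abs_minus_commute)
      finally have "dist (E(i := t)) < r1" .
      then obtain y where y: "y \<in> V" "\<phi> y = E(i := t)"
        using box[of "E(i := t)" E] distE r1(1) E0 ij by auto
      then have "F j (join E (E(i := t))) = \<phi> (\<one>\<^bsub>G\<^esub> \<otimes>\<^bsub>G\<^esub> y) j"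
        using F\<Phi>[OF oneU, of y j] V(2) by (auto simp: E_def)
      then show "(E(i := t)) j = F j (join E (E(i := t)))" using y V(2) Uc by auto
    qed
    then show ?thesis unfolding P_def join_upd by (intro DERIV_imp_deriv) (simp add: join_def)
  qed
  have "\<exists>r>0. \<forall>s\<in>{..<n} \<times> {..<n}. \<forall>p q. dist p < min r r1 \<longrightarrow> dist q < min r r1 \<longrightarrow> (\<forall>i\<ge>n. p i = 0) \<longrightarrow> (\<forall>i\<ge>n. q i = 0) \<longrightarrow>
      \<bar>P (fst s) (snd s) (join p q) - \<delta> (fst s) (snd s)\<bar> < \<epsilon>"
  proof (rule finite_uniform_radius)
    fix s :: "nat \<times> nat" assume "s \<in> {..<n} \<times> {..<n}"
    then obtain j i where s: "s = (j, i)" "j < n" "i < n" by auto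
    let ?S = "{u \<in> topspace (subtopology (Euclidean_space (n + n)) D). P j i u \<in> {\<delta> j i - \<epsilon><..<\<delta> j i + \<epsilon>}}"
    have "openin (subtopology (Euclidean_space (n + n)) D) ?S"
      by (rule openin_continuous_map_preimage[OF contP[OF s(2,3)]]) auto
    then obtain O' where O': "openin (Euclidean_space (n + n)) O'" "?S = O' \<inter> D"
      by (auto simp: openin_subtopology)
    have top: "join p q \<in> topspace (Euclidean_space (n + n))" if "\<And>i. i \<ge> n \<Longrightarrow> q i = 0" for p q
      using that by (auto simp: topspace_Euclidean_space join_def)
    have JD: "join E E \<in> D" using box[of E E] distE r1(1) E0 by auto
    then have "join E E \<in> ?S" using P_E[OF s(2,3)] \<epsilon> top[of E E] E0 by simp
    then have "join E E \<in> O'" using O' by blast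
    from Euclidean_space_ball[OF O'(1) this] obtain r where r: "r > 0"
      "\<And>v. v \<in> topspace (Euclidean_space (n + n)) \<Longrightarrow> (\<Sum>i<n+n. \<bar>v i - join E E i\<bar>) < r \<Longrightarrow> v \<in> O'" by blast
    have sum: "(\<Sum>i<n+n. \<bar>join p q i - join E E i\<bar>) = dist p + dist q" for p q
    proof -
      have "(\<Sum>i<n+m. \<bar>join p q i - join E E i\<bar>) = dist p + (\<Sum>i<m. \<bar>q i - E i\<bar>)" for m
        by (induction m) (auto simp: dist_def join_def)
      then show ?thesis by (simp add: dist_def)
    qed
    show "\<exists>r>0. \<forall>p q. dist p < min r r1 \<longrightarrow> dist q < min r r1 \<longrightarrow> (\<forall>i\<ge>n. p i = 0) \<longrightarrow> (\<forall>i\<ge>n. q i = 0) \<longrightarrow>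
      \<bar>P (fst s) (snd s) (join p q) - \<delta> (fst s) (snd s)\<bar> < \<epsilon>"
    proof (intro exI[of _ "r/2"] conjI allI impI)
      fix p q assume *: "dist p < min (r/2) r1" "dist q < min (r/2) r1" "\<forall>i\<ge>n. p i = 0" "\<forall>i\<ge>n. q i = 0"
      have "join p q \<in> O'" using * sum[of p q] by (intro r(2) top) auto
      moreover have "join p q \<in> D" using box[of p q] * by auto
      ultimately have "join p q \<in> ?S" using O' by blast
      then show "\<bar>P (fst s) (snd s) (join p q) - \<delta> (fst s) (snd s)\<bar> < \<epsilon>" by (auto simp: s(1))
    qed (use r in auto)
  qed (auto simp: min_less_iff_conj)
  then obtain r where r: "r > 0" and P_near: "\<And>j i p q. j < n \<Longrightarrow> i < n \<Longrightarrow> dist p < min r r1 \<Longrightarrow> dist q < min r r1 \<Longrightarrow>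
      (\<forall>i\<ge>n. p i = 0) \<Longrightarrow> (\<forall>i\<ge>n. q i = 0) \<Longrightarrow> \<bar>P j i (join p q) - \<delta> j i\<bar> < \<epsilon>"
    by fastforce
  define r2 where "r2 = min r r1"
  have r2: "r2 > 0" "r2 \<le> r1" using r r1(1) by (auto simp: r2_def)
  have estimate: "\<bar>\<phi> (x \<otimes>\<^bsub>G\<^esub> y) j - \<phi> x j - (\<phi> y j - E j)\<bar> \<le> \<epsilon> * dist (\<phi> y)"
    if x: "x \<in> U" "dist (\<phi> x) < r2" and y: "y \<in> U" "dist (\<phi> y) < r2" and j: "j < n" for x y j
  proof -
    define p where "p = \<phi> x"
    \<comment> \<open>A path from the coordinates of the identity at \<open>q 0\<close> to those of
      \<open>y\<close> at \<open>q n\<close>, altering one coordinate per step.\<close>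
    define q where "q k i = (if i < k then \<phi> y i else E i)" for k i
    have p0: "\<forall>i\<ge>n. p i = 0" using \<phi>0[OF x(1)] by (simp add: p_def)
    have step: "\<bar>(F j (join p (q (Suc k))) - \<delta> j k * \<phi> y k) - (F j (join p (q k)) - \<delta> j k * E k)\<bar> \<le> \<epsilon> * \<bar>\<phi> y k - E k\<bar>"
      if k: "k < n" for k
    proof -
      define h where "h t = F j (join p ((q k)(k := t)))" for t
      \<comment> \<open>After subtraction of the linear function with slope
        \<open>\<delta> j k\<close> the derivative along the segment is bounded by
        \<open>\<epsilon>\<close>.\<close>
      have "norm ((h (\<phi> y k) - \<delta> j k * \<phi> y k) - (h (E k) - \<delta> j k * E k)) \<le> \<epsilon> * norm (\<phi> y k - E k)"
      proof (rule field_differentiable_bound[where S = "closed_segment (E k) (\<phi> y k)"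
            and f' = "\<lambda>t. P j k (join p ((q k)(k := t))) - \<delta> j k"])
        fix t assume t: "t \<in> closed_segment (E k) (\<phi> y k)"
        let ?q = "(q k)(k := t)"
        have tE: "\<bar>t - E k\<bar> \<le> \<bar>\<phi> y k - E k\<bar>" using t by (auto simp: closed_segment_eq_real_ivl split: if_splits)
        have "dist ?q \<le> dist (\<phi> y)" unfolding dist_def by (intro sum_mono) (use tE in \<open>auto simp: q_def\<close>)
        then have dq: "dist ?q < r2" using y by simp
        have q0: "\<forall>i\<ge>n. ?q i = 0" using E0 k \<phi>0[OF y(1)] by (auto simp: q_def)
        have D: "join p ?q \<in> D" using box[of p ?q] dq x r2 p0 q0 by (auto simp: p_def)
        have "(\<lambda>s. F j ((join p ?q)(n + k := s))) field_differentiable at ((join p ?q) (n + k))"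
          by (rule diff[OF j k D])
        then have "((\<lambda>s. F j ((join p ?q)(n + k := s))) has_field_derivative P j k (join p ?q)) (at ((join p ?q) (n + k)))"
          unfolding P_def by (simp add: field_differentiable_derivI)
        then have hd: "(h has_field_derivative P j k (join p ?q)) (at t)"
          unfolding join_upd by (simp add: h_def[abs_def] join_def[of _ _ "n + k"])
        show "((\<lambda>t. h t - \<delta> j k * t) has_field_derivative P j k (join p ?q) - \<delta> j k) (at t within closed_segment (E k) (\<phi> y k))"
          by (rule DERIV_diff[OF has_field_derivative_at_within[OF hd] DERIV_cmult_Id])
        show "norm (P j k (join p ?q) - \<delta> j k) \<le> \<epsilon>"
          using P_near[OF j k _ _ p0 q0] dq x(2) unfolding r2_def p_def real_norm_def by (meson less_imp_le)
      qed auto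
      moreover have "(q k)(k := \<phi> y k) = q (Suc k)" "(q k)(k := E k) = q k" by (auto simp: q_def fun_eq_iff less_Suc_eq)
      ultimately show ?thesis by (simp add: h_def)
    qed
    have total: "\<bar>F j (join p (q k)) - F j (join p (q 0)) - (\<Sum>i<k. \<delta> j i * (\<phi> y i - E i))\<bar> \<le> \<epsilon> * (\<Sum>i<k. \<bar>\<phi> y i - E i\<bar>)"
      if "k \<le> n" for k
      using that
    proof (induction k)
      case (Suc k)
      have "\<bar>F j (join p (q k)) - F j (join p (q 0)) - (\<Sum>i<k. \<delta> j i * (\<phi> y i - E i))\<bar> \<le> \<epsilon> * (\<Sum>i<k. \<bar>\<phi> y i - E i\<bar>)"
        using Suc by simp
      moreover have "\<delta> j k * (\<phi> y k - E k) = \<delta> j k * \<phi> y k - \<delta> j k * E k" by (rule right_diff_distrib)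
      moreover have "\<epsilon> * ((\<Sum>i<k. \<bar>\<phi> y i - E i\<bar>) + \<bar>\<phi> y k - E k\<bar>) =
          \<epsilon> * (\<Sum>i<k. \<bar>\<phi> y i - E i\<bar>) + \<epsilon> * \<bar>\<phi> y k - E k\<bar>" by (rule distrib_left)
      ultimately show ?case
        using step[of k] Suc.prems unfolding sum.lessThan_Suc by linarith
    qed simp
    have qn: "q n = \<phi> y" using E0 \<phi>0[OF y(1)] by (auto simp: q_def fun_eq_iff)
    have q0: "q 0 = \<phi> \<one>\<^bsub>G\<^esub>" by (auto simp: q_def E_def)
    have "(\<Sum>i<n. \<delta> j i * (\<phi> y i - E i)) = (\<Sum>i<n. if i = j then \<phi> y j - E j else 0)"
      by (intro sum.cong) (auto simp: \<delta>_def)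
    also have "\<dots> = \<phi> y j - E j" using j by simp
    finally have "(\<Sum>i<n. \<delta> j i * (\<phi> y i - E i)) = \<phi> y j - E j" .
    moreover have "F j (join p (q n)) = \<phi> (x \<otimes>\<^bsub>G\<^esub> y) j" unfolding p_def qn by (rule F\<Phi>[OF x(1) y(1)])
    moreover have "F j (join p (q 0)) = \<phi> x j" unfolding p_def q0 using F\<Phi>[OF x(1) oneU] x Uc by auto
    ultimately show ?thesis using total[OF order_refl] by (simp add: dist_def)
  qed
  define \<psi> where "\<psi> x i = \<phi> x i - E i" for x i
  have dist\<psi>: "(\<Sum>i<n. \<bar>\<psi> x i\<bar>) = dist (\<phi> x)" for x by (simp add: \<psi>_def dist_def)
  have "group_coordinates G \<tau> U \<psi> n r2"
  proof unfold_locales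
    show "\<exists>x\<in>U. \<forall>i<n. \<psi> x i = v i" if v: "(\<Sum>i<n. \<bar>v i\<bar>) < r2" for v
    proof -
      define w where "w i = (if i < n then E i + v i else 0)" for i
      have "dist w = (\<Sum>i<n. \<bar>v i\<bar>)" unfolding dist_def by (intro sum.cong) (auto simp: w_def)
      then obtain x where "x \<in> U \<inter> V" "\<phi> x = w" using r1(2)[of w] v r2 by (auto simp: w_def)
      then show ?thesis by (intro bexI[of _ x]) (auto simp: \<psi>_def w_def)
    qed
    show "x \<otimes>\<^bsub>G\<^esub> y \<in> U \<and> (\<Sum>i<n. \<bar>\<psi> (x \<otimes>\<^bsub>G\<^esub> y) i - \<psi> x i - \<psi> y i\<bar>) \<le> (\<Sum>i<n. \<bar>\<psi> y i\<bar>) / 4"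
      if xy: "x \<in> U" "y \<in> U" "(\<Sum>i<n. \<bar>\<psi> x i\<bar>) < r2" "(\<Sum>i<n. \<bar>\<psi> y i\<bar>) < r2" for x y
    proof
      have d: "dist (\<phi> x) < r2" "dist (\<phi> y) < r2" using xy dist\<psi> by auto
      obtain x' y' where "x' \<in> V" "y' \<in> V" "\<phi> x' = \<phi> x" "\<phi> y' = \<phi> y"
        using box[of "\<phi> x" "\<phi> y"] d r2 \<phi>0 xy by auto
      then show "x \<otimes>\<^bsub>G\<^esub> y \<in> U" using V(2,3) xy inj by (metis inj_onD subsetD)
      have "(\<Sum>i<n. \<bar>\<psi> (x \<otimes>\<^bsub>G\<^esub> y) i - \<psi> x i - \<psi> y i\<bar>) \<le> (\<Sum>i<n. \<epsilon> * dist (\<phi> y))"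
      proof (rule sum_mono)
        fix i assume "i \<in> {..<n}"
        then show "\<bar>\<psi> (x \<otimes>\<^bsub>G\<^esub> y) i - \<psi> x i - \<psi> y i\<bar> \<le> \<epsilon> * dist (\<phi> y)"
          using estimate[OF xy(1) d(1) xy(2) d(2), of i] by (simp add: \<psi>_def algebra_simps)
      qed
      also have "\<dots> = (n * \<epsilon>) * dist (\<phi> y)" by simp
      also have "\<dots> \<le> 1/4 * dist (\<phi> y)"
        by (intro mult_right_mono) (auto simp: \<epsilon>_def field_simps dist_def sum_nonneg)
      finally show "(\<Sum>i<n. \<bar>\<psi> (x \<otimes>\<^bsub>G\<^esub> y) i - \<psi> x i - \<psi> y i\<bar>) \<le> (\<Sum>i<n. \<bar>\<psi> y i\<bar>) / 4"
        by (simp add: dist\<psi>)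
    qed
  qed (use r2 Uc oneU ball_nbhd basis in \<open>auto simp: dist\<psi> \<psi>_def[of "\<one>\<^bsub>G\<^esub>"] E_def\<close>)
  then show ?thesis by blast
qed

section \<open>Haar measure on coset spaces\<close>

lemma space_borel_of: "space (borel_of X) = topspace X"
  by (simp add: borel_of_def space_measure_of_conv)

lemma openin_borel_of: "openin X U \<Longrightarrow> U \<in> sets (borel_of X)"
  unfolding borel_of_def using openin_subset by (subst sets_measure_of) auto

lemma continuous_map_borel_measurable:
  assumes "continuous_map X Y f"
  shows "f \<in> measurable (borel_of X) (borel_of Y)"
proof -
  have "f \<in> measurable (borel_of X) (sigma (topspace Y) {U. openin Y U})"
  proof (rule measurable_measure_of)
    show "{U. openin Y U} \<subseteq> Pow (topspace Y)" using openin_subset by auto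
    show "f \<in> space (borel_of X) \<rightarrow> topspace Y"
      using continuous_map_image_subset_topspace[OF assms] by (auto simp: space_borel_of)
    fix U assume "U \<in> {U. openin Y U}"
    then have "openin X {x \<in> topspace X. f x \<in> U}" using assms openin_continuous_map_preimage by fastforce
    then show "f -` U \<inter> space (borel_of X) \<in> sets (borel_of X)" using openin_borel_of
      by (simp add: space_borel_of vimage_def Collect_conj_eq Int_commute)
  qed
  then show ?thesis by (simp add: borel_of_def)
qed

locale coset_space = topological_group G \<tau> for G (structure) and \<tau> +
  fixes \<Gamma> :: "'a set"
  assumes \<Gamma>_subgroup: "subgroup \<Gamma> G"
begin

abbreviation X :: "'a set topology" where "X \<equiv> coset_topology G \<tau> \<Gamma>"

definition \<pi> :: "'a \<Rightarrow> 'a set" where "\<pi> g = g <# \<Gamma>"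

lemma \<Gamma>_carrier: "\<Gamma> \<subseteq> carrier G" using \<Gamma>_subgroup by (rule subgroup.subset)

lemma topspace_X: "topspace X = \<pi> ` carrier G"
  using topspace_coset_topology[OF topspace_group] by (auto simp: LCOSETS_def \<pi>_def)

lemma \<pi>_eq_iff:
  assumes "g \<in> carrier G" "h \<in> carrier G"
  shows "\<pi> g = \<pi> h \<longleftrightarrow> inv g \<otimes> h \<in> \<Gamma>"
proof
  assume "\<pi> g = \<pi> h"
  moreover have "h \<in> \<pi> h"
    using subgroup.one_closed[OF \<Gamma>_subgroup] assms by (force simp: \<pi>_def l_coset_def)
  ultimately obtain c where "c \<in> \<Gamma>" "h = g \<otimes> c" by (auto simp: \<pi>_def l_coset_def)
  then show "inv g \<otimes> h \<in> \<Gamma>" using assms \<Gamma>_carrier by auto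
next
  assume c: "inv g \<otimes> h \<in> \<Gamma>"
  have "\<pi> h = g <# ((inv g \<otimes> h) <# \<Gamma>)"
    using assms \<Gamma>_carrier by (simp add: \<pi>_def lcos_m_assoc)
  also have "(inv g \<otimes> h) <# \<Gamma> = \<Gamma>"
    using subgroup.lcos_module_imp[OF \<Gamma>_subgroup is_group] c \<Gamma>_subgroup coset_join3 assms by blast
  finally show "\<pi> g = \<pi> h" by (simp add: \<pi>_def)
qed

lemma act_\<pi>: "g \<in> carrier G \<Longrightarrow> h \<in> carrier G \<Longrightarrow> g <# \<pi> h = \<pi> (g \<otimes> h)"
  using lcos_m_assoc[OF \<Gamma>_carrier] by (simp add: \<pi>_def)

lemma openin_X_iff: "openin X U \<longleftrightarrow> U \<subseteq> \<pi> ` carrier G \<and> openin \<tau> {g \<in> carrier G. \<pi> g \<in> U}"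
  unfolding openin_coset_topology by (auto simp: LCOSETS_def \<pi>_def topspace_group)

lemma continuous_\<pi>: "continuous_map \<tau> X \<pi>"
  unfolding continuous_map_def topspace_X by (auto simp: openin_X_iff topspace_group)

lemma open_\<pi>:
  assumes "openin \<tau> U"
  shows "openin X (\<pi> ` U)"
proof -
  have U: "U \<subseteq> carrier G" using openin_subset[OF assms] by (simp add: topspace_group)
  have "{g \<in> carrier G. \<pi> g \<in> \<pi> ` U} = (\<Union>c\<in>\<Gamma>. (\<lambda>u. u \<otimes> c) ` U)"
  proof (rule equalityI; rule subsetI)
    fix g assume "g \<in> {g \<in> carrier G. \<pi> g \<in> \<pi> ` U}"
    then obtain u where u: "g \<in> carrier G" "u \<in> U" "\<pi> u = \<pi> g" by auto
    then have "inv u \<otimes> g \<in> \<Gamma>" "g = u \<otimes> (inv u \<otimes> g)" using \<pi>_eq_iff[of u g] U by auto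
    then show "g \<in> (\<Union>c\<in>\<Gamma>. (\<lambda>u. u \<otimes> c) ` U)" using u by blast
  next
    fix g assume "g \<in> (\<Union>c\<in>\<Gamma>. (\<lambda>u. u \<otimes> c) ` U)"
    then obtain u c where uc: "u \<in> U" "c \<in> \<Gamma>" "g = u \<otimes> c" by auto
    then have c: "u \<in> carrier G" "c \<in> carrier G" using U \<Gamma>_carrier by auto
    have "\<pi> u = \<pi> g" using \<pi>_eq_iff[of u g] c uc by simp
    then show "g \<in> {g \<in> carrier G. \<pi> g \<in> \<pi> ` U}" using uc c by auto
  qed
  also have "openin \<tau> \<dots>"
    using assms \<Gamma>_carrier by (intro openin_Union) (auto intro: openin_right_translate)
  finally show ?thesis using U by (auto simp: openin_X_iff)
qed

text \<open>Because \<open>\<pi>\<close> is open, a product neighbourhood found in the group at a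
  representative of \<open>x\<close> projects to one in \<open>X\<close>.\<close>

lemma continuous_action: "continuous_map (prod_topology \<tau> X) X (\<lambda>(g, x). g <# x)"
  unfolding continuous_map_def
proof (intro conjI allI impI)
  show "(\<lambda>(g, x). g <# x) \<in> topspace (prod_topology \<tau> X) \<rightarrow> topspace X"
    by (auto simp: topspace_X topspace_group act_\<pi>)
  fix U assume U: "openin X U"
  show "openin (prod_topology \<tau> X) {p \<in> topspace (prod_topology \<tau> X). (case p of (g, x) \<Rightarrow> g <# x) \<in> U}"
    unfolding openin_prod_topology_alt
  proof (intro allI impI)
    fix g x assume "(g, x) \<in> {p \<in> topspace (prod_topology \<tau> X). (case p of (g, x) \<Rightarrow> g <# x) \<in> U}"
    then obtain h where h: "g \<in> carrier G" "h \<in> carrier G" "x = \<pi> h" "\<pi> (g \<otimes> h) \<in> U"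
      by (auto simp: topspace_X topspace_group act_\<pi>)
    have "openin (prod_topology \<tau> \<tau>) {p \<in> topspace (prod_topology \<tau> \<tau>). (\<pi> \<circ> (\<lambda>(x, y). x \<otimes> y)) p \<in> U}"
      by (rule openin_continuous_map_preimage[OF continuous_map_compose[OF continuous_mult continuous_\<pi>] U])
    moreover have "(g, h) \<in> {p \<in> topspace (prod_topology \<tau> \<tau>). (\<pi> \<circ> (\<lambda>(x, y). x \<otimes> y)) p \<in> U}"
      using h by (simp add: topspace_group)
    ultimately obtain A C where AC: "openin \<tau> A" "openin \<tau> C" "g \<in> A" "h \<in> C"
      "A \<times> C \<subseteq> {p \<in> topspace (prod_topology \<tau> \<tau>). (\<pi> \<circ> (\<lambda>(x, y). x \<otimes> y)) p \<in> U}"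
      unfolding openin_prod_topology_alt by meson
    have "A \<times> \<pi> ` C \<subseteq> {p \<in> topspace (prod_topology \<tau> X). (case p of (g, x) \<Rightarrow> g <# x) \<in> U}"
      using AC(5) by (auto simp: topspace_group topspace_X act_\<pi>)
    then show "\<exists>A C. openin \<tau> A \<and> openin X C \<and> g \<in> A \<and> x \<in> C \<and>
        A \<times> C \<subseteq> {p \<in> topspace (prod_topology \<tau> X). (case p of (g, x) \<Rightarrow> g <# x) \<in> U}"
      using AC open_\<pi> h by blast
  qed
qed

lemma second_countable_X: "second_countable \<tau> \<Longrightarrow> second_countable X"
  by (rule second_countable_open_map_image[OF continuous_\<pi>])
    (use open_\<pi> in \<open>auto simp: open_map_def topspace_X topspace_group\<close>)

end

locale discrete_coset_space = coset_space +
  assumes hausdorff: "Hausdorff_space \<tau>" and second_countable: "second_countable \<tau>"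
    and discrete: "subtopology \<tau> \<Gamma> = discrete_topology \<Gamma>"
begin

text \<open>Discreteness isolates the identity in \<open>\<Gamma>\<close>. The resulting
  \<open>V\<close> is one on which \<open>\<pi>\<close> is injective, and the same holds for its
  left translates.\<close>

lemma separating_nbhd: "\<exists>V. nbhd V \<and> (\<forall>v\<in>V. \<forall>w\<in>V. inv v \<otimes> w \<in> \<Gamma> \<longrightarrow> v = w)"
proof -
  have one: "\<one> \<in> \<Gamma>" using subgroup.one_closed[OF \<Gamma>_subgroup] .
  have "openin (subtopology \<tau> \<Gamma>) {\<one>}" using one by (simp add: discrete)
  then obtain U where U: "openin \<tau> U" "{\<one>} = U \<inter> \<Gamma>" by (auto simp: openin_subtopology)
  then have "nbhd U" by (auto simp: nbhd_def)
  then obtain V where V: "nbhd V" "\<And>v w. v \<in> V \<Longrightarrow> w \<in> V \<Longrightarrow> inv v \<otimes> w \<in> U"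
    using nbhd_quotient by metis
  have "v = w" if "v \<in> V" "w \<in> V" "inv v \<otimes> w \<in> \<Gamma>" for v w
  proof -
    have c: "v \<in> carrier G" "w \<in> carrier G" using that V nbhd_carrier by auto
    have "inv v \<otimes> w = \<one>" using V(2)[OF that(1,2)] that(3) U by blast
    then have "v \<otimes> (inv v \<otimes> w) = v" using c by simp
    then show ?thesis using c by simp
  qed
  then show ?thesis using V(1) by blast
qed

text \<open>A discrete subgroup is closed: a translate of the separating neighbourhood meets
  \<open>\<Gamma>\<close> in at most one point, since two would differ by some
  \<open>inv v \<otimes> w\<close> in \<open>\<Gamma>\<close>. That point is closed and can be
  removed.\<close>

lemma \<Gamma>_complement_open: "openin \<tau> (carrier G - \<Gamma>)"
proof (subst openin_subopen, rule ballI)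
  fix t assume t: "t \<in> carrier G - \<Gamma>"
  obtain V where V: "nbhd V" "\<And>v w. v \<in> V \<Longrightarrow> w \<in> V \<Longrightarrow> inv v \<otimes> w \<in> \<Gamma> \<Longrightarrow> v = w"
    using separating_nbhd by blast
  let ?W = "(\<lambda>v. t \<otimes> v) ` V"
  have W: "openin \<tau> ?W" using V(1) t by (intro openin_left_translate) (auto simp: nbhd_def)
  have tW: "t \<in> ?W" using V(1) t by (auto simp: nbhd_def intro!: rev_image_eqI[of \<one>])
  have uniq: "c = c'" if "c \<in> ?W \<inter> \<Gamma>" "c' \<in> ?W \<inter> \<Gamma>" for c c'
  proof -
    from that obtain v w where vw: "v \<in> V" "w \<in> V" "c = t \<otimes> v" "c' = t \<otimes> w" by auto
    have car: "v \<in> carrier G" "w \<in> carrier G" using vw V nbhd_carrier by auto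
    have "inv c \<otimes> c' \<in> \<Gamma>"
      using that subgroup.m_closed[OF \<Gamma>_subgroup] subgroup.m_inv_closed[OF \<Gamma>_subgroup] by blast
    moreover have "inv c \<otimes> c' = inv v \<otimes> w" using vw car t by (simp add: inv_mult_group m_assoc)
    ultimately show ?thesis using V(2)[OF vw(1,2)] vw by simp
  qed
  have "closedin \<tau> (?W \<inter> \<Gamma>)"
  proof (cases "?W \<inter> \<Gamma> = {}")
    case False
    then obtain c where c: "?W \<inter> \<Gamma> = {c}" using uniq by blast
    then have "c \<in> topspace \<tau>" using \<Gamma>_carrier by (auto simp: topspace_group)
    then show ?thesis using hausdorff c by (simp add: closedin_Hausdorff_singleton)
  qed simp
  then have "openin \<tau> (?W - (?W \<inter> \<Gamma>))" using W by (rule openin_diff[rotated])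
  moreover have "t \<in> ?W - (?W \<inter> \<Gamma>)" using tW t by blast
  moreover have "?W - (?W \<inter> \<Gamma>) \<subseteq> carrier G - \<Gamma>" using openin_subset[OF W] by (auto simp: topspace_group)
  ultimately show "\<exists>T. openin \<tau> T \<and> t \<in> T \<and> T \<subseteq> carrier G - \<Gamma>" by blast
qed

lemma Hausdorff_X: "Hausdorff_space X"
  unfolding Hausdorff_space_def
proof (intro allI impI)
  fix x y assume xy: "x \<in> topspace X \<and> y \<in> topspace X \<and> x \<noteq> y"
  then obtain g h where gh: "g \<in> carrier G" "h \<in> carrier G" "x = \<pi> g" "y = \<pi> h" by (auto simp: topspace_X)
  let ?f = "\<lambda>p. inv (fst p) \<otimes> snd p"
  have "openin (prod_topology \<tau> \<tau>) {p \<in> topspace (prod_topology \<tau> \<tau>). ?f p \<in> carrier G - \<Gamma>}"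
    by (rule openin_continuous_map_preimage[OF continuous_map_group_mult[OF
          continuous_map_group_inv[OF continuous_map_fst] continuous_map_snd] \<Gamma>_complement_open])
  moreover have "(g, h) \<in> {p \<in> topspace (prod_topology \<tau> \<tau>). ?f p \<in> carrier G - \<Gamma>}"
    using gh xy \<pi>_eq_iff[of g h] by (simp add: topspace_group)
  ultimately obtain A C where AC: "openin \<tau> A" "openin \<tau> C" "g \<in> A" "h \<in> C"
    "A \<times> C \<subseteq> {p \<in> topspace (prod_topology \<tau> \<tau>). ?f p \<in> carrier G - \<Gamma>}"
    unfolding openin_prod_topology_alt by meson
  have "disjnt (\<pi> ` A) (\<pi> ` C)"
    unfolding disjnt_iff
  proof (intro allI notI, elim conjE imageE)
    fix z a c assume "z = \<pi> a" "a \<in> A" "z = \<pi> c" "c \<in> C"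
    then have "(a, c) \<in> A \<times> C" "\<pi> a = \<pi> c" by auto
    then show False using AC(5) \<pi>_eq_iff[of a c] by (auto simp: topspace_group)
  qed
  then show "\<exists>U V. openin X U \<and> openin X V \<and> x \<in> U \<and> y \<in> V \<and> disjnt U V"
    using AC gh open_\<pi> by blast
qed

text \<open>\<open>haar_projection\<close> speaks about all fundamental domains, so one must be
  exhibited before the measure can be computed. Countably many open sets on which
  \<open>\<pi>\<close> is injective cover the group; from each of them the cosets met earlier are
  deleted.\<close>

lemma fundamental_domain_exists: "\<exists>F. fundamental_domain G \<tau> \<Gamma> F"
proof -
  obtain V where V: "nbhd V" "\<And>v w. v \<in> V \<Longrightarrow> w \<in> V \<Longrightarrow> inv v \<otimes> w \<in> \<Gamma> \<Longrightarrow> v = w"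
    using separating_nbhd by blast
  have Vc: "v \<in> V \<Longrightarrow> v \<in> carrier G" for v using V(1) nbhd_carrier by blast
  let ?t = "\<lambda>g. (\<lambda>v. g \<otimes> v) ` V"
  have t_open: "openin \<tau> (?t g)" if "g \<in> carrier G" for g
    using V(1) that by (intro openin_left_translate) (auto simp: nbhd_def)
  have "g \<in> ?t g" if "g \<in> carrier G" for g
    using V(1) that by (auto simp: nbhd_def intro!: rev_image_eqI[of \<one>])
  then have "\<Union>(?t ` carrier G) = topspace \<tau>"
    using t_open openin_subset topspace_group by fastforce
  then obtain \<V> where \<V>: "countable \<V>" "\<V> \<subseteq> ?t ` carrier G" "\<Union>\<V> = topspace \<tau>"
    using Lindelof_spaceD[OF second_countable_imp_Lindelof_space[OF second_countable], of "?t ` carrier G"] t_open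
    by blast
  have "\<V> \<noteq> {}" using \<V>(3) one_closed by (auto simp: topspace_group)
  define A where "A = from_nat_into \<V>"
  have A: "range A = \<V>" unfolding A_def using \<V>(1) \<open>\<V> \<noteq> {}\<close> by (simp add: range_from_nat_into)
  have A_cases: "\<exists>g\<in>carrier G. A n = ?t g" for n
  proof -
    have "A n \<in> ?t ` carrier G" using A \<V>(2) rangeI[of A n] by (simp only: subset_iff)
    then show ?thesis by (simp only: image_iff)
  qed
  have A_open: "openin \<tau> (A n)" for n using A_cases[of n] t_open by metis
  have A_car: "a \<in> A n \<Longrightarrow> a \<in> carrier G" for a n
    using subsetD[OF openin_subset[OF A_open[of n]], of a] by (simp add: topspace_group)
  have A_inj: "a = c" if ac: "a \<in> A n" "c \<in> A n" "\<pi> a = \<pi> c" for a c n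
  proof -
    obtain g where g: "g \<in> carrier G" "A n = ?t g" using A_cases[of n] by blast
    then obtain v w where vw: "v \<in> V" "w \<in> V" "a = g \<otimes> v" "c = g \<otimes> w" using ac by auto
    have "inv a \<otimes> c \<in> \<Gamma>" using \<pi>_eq_iff[of a c] ac A_car by blast
    moreover have "inv a \<otimes> c = inv v \<otimes> w" using vw Vc g by (simp add: inv_mult_group m_assoc)
    ultimately show ?thesis using V(2)[OF vw(1,2)] vw by simp
  qed
  define S where "S n = {g \<in> carrier G. \<pi> g \<in> \<pi> ` A n}" for n
  have S_open: "openin \<tau> (S n)" for n using open_\<pi>[OF A_open[of n]] by (simp add: openin_X_iff S_def)
  define F where "F = (\<Union>n. A n - (\<Union>m<n. S m))"
  have "F \<in> sets (borel_of \<tau>)"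
    unfolding F_def using openin_borel_of[OF A_open] openin_borel_of[OF S_open] by auto
  moreover have "bij_betw (\<lambda>g. g <# \<Gamma>) F (lcosets \<Gamma>)"
    unfolding bij_betw_def
  proof
    have less: False if "x \<in> A n - (\<Union>m<n. S m)" "y \<in> A m" "m < n" "\<pi> x = \<pi> y" for x y m n
      using that A_car[of x n] by (auto simp: S_def)
    show "inj_on (\<lambda>g. g <# \<Gamma>) F"
    proof (rule inj_onI)
      fix x y assume "x \<in> F" "y \<in> F" and "x <# \<Gamma> = y <# \<Gamma>"
      then obtain n m where nm: "x \<in> A n - (\<Union>m<n. S m)" "y \<in> A m - (\<Union>n<m. S n)" and eq: "\<pi> x = \<pi> y"
        by (auto simp: F_def \<pi>_def)
      have "n = m" using less[OF nm(1), of y m] less[OF nm(2), of x n] nm eq by (metis DiffD1 linorder_neqE_nat)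
      then show "x = y" using A_inj[of x n y] nm eq by blast
    qed
    show "(\<lambda>g. g <# \<Gamma>) ` F = lcosets \<Gamma>"
    proof
      show "(\<lambda>g. g <# \<Gamma>) ` F \<subseteq> lcosets \<Gamma>" using A_car by (auto simp: F_def LCOSETS_def)
      show "lcosets \<Gamma> \<subseteq> (\<lambda>g. g <# \<Gamma>) ` F"
      proof
        fix x assume "x \<in> lcosets \<Gamma>"
        then obtain g where g: "g \<in> carrier G" "x = \<pi> g" by (auto simp: LCOSETS_def \<pi>_def)
        have "\<exists>n. g \<in> A n" using \<V>(3) A g by (auto simp: topspace_group)
        then have ex: "\<exists>n. g \<in> S n" using g by (auto simp: S_def)
        define n where "n = (LEAST n. g \<in> S n)"
        have gn: "g \<in> S n" unfolding n_def using ex by (rule LeastI_ex)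
        have lt: "g \<notin> S m" if "m < n" for m using that unfolding n_def by (rule not_less_Least)
        obtain a where a: "a \<in> A n" "\<pi> g = \<pi> a" using gn by (auto simp: S_def)
        have "a \<notin> S m" if "m < n" for m using lt[OF that] a g by (auto simp: S_def)
        then have "a \<in> F" using a by (auto simp: F_def)
        then show "x \<in> (\<lambda>g. g <# \<Gamma>) ` F" using a g by (auto simp: \<pi>_def)
      qed
    qed
  qed
  ultimately show ?thesis unfolding fundamental_domain_def by blast
qed

text \<open>A translate of a fundamental domain is again one, and the measure does not depend on the domain.\<close>

theorem haar_projection_invariant:
  assumes M: "haar_projection G \<tau> \<Gamma> M" and g: "g \<in> carrier G"
  shows "distr M M (\<lambda>x. g <# x) = M"
proof -
  have sM: "sets M = sets (borel_of X)" using M by (simp add: haar_projection_def)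
  obtain m where m: "haar_measure G \<tau> m"
    and dom: "\<And>F. fundamental_domain G \<tau> \<Gamma> F \<Longrightarrow> M = distr (restrict_space m F) (borel_of X) (\<lambda>g. g <# \<Gamma>)"
    using M by (auto simp: haar_projection_def)
  have sm: "sets m = sets (borel_of \<tau>)" using m by (simp add: haar_measure_def)
  have spm: "space m = carrier G" using sets_eq_imp_space_eq[OF sm] by (simp add: space_borel_of topspace_group)
  have spM: "space M = \<pi> ` carrier G" using sets_eq_imp_space_eq[OF sM] by (simp add: space_borel_of topspace_X)
  have \<pi>m: "\<pi> \<in> measurable m (borel_of X)"
    using continuous_map_borel_measurable[OF continuous_\<pi>] measurable_cong_sets[OF sm refl] by blast
  have lm: "(\<lambda>x. h \<otimes> x) \<in> measurable m m" if "h \<in> carrier G" for h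
    using continuous_map_borel_measurable[OF continuous_map_group_mult[OF continuous_map_group_const[OF that] continuous_map_id]]
      measurable_cong_sets[OF sm sm] by simp
  have M_eq: "emeasure M A = emeasure m {x \<in> F. \<pi> x \<in> A}"
    if F: "fundamental_domain G \<tau> \<Gamma> F" and A: "A \<in> sets M" for F A
  proof -
    have FS: "F \<in> sets m" using F sm by (simp add: fundamental_domain_def)
    have "emeasure M A = emeasure (distr (restrict_space m F) (borel_of X) \<pi>) A"
      using dom[OF F] by (simp add: \<pi>_def[abs_def])
    also have "\<dots> = emeasure (restrict_space m F) (\<pi> -` A \<inter> space (restrict_space m F))"
      using A sM \<pi>m by (intro emeasure_distr measurable_restrict_space1) auto
    also have "\<pi> -` A \<inter> space (restrict_space m F) = {x \<in> F. \<pi> x \<in> A}"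
      using sets.sets_into_space[OF FS] by (auto simp: space_restrict_space)
    also have "emeasure (restrict_space m F) \<dots> = emeasure m \<dots>"
      using FS sets.sets_into_space[OF FS] by (intro emeasure_restrict_space) (auto simp: Int_absorb2)
    finally show ?thesis .
  qed
  obtain F where F: "fundamental_domain G \<tau> \<Gamma> F" using fundamental_domain_exists by blast
  have FS: "F \<in> sets m" using F sm by (simp add: fundamental_domain_def)
  have Fc: "x \<in> F \<Longrightarrow> x \<in> carrier G" for x using sets.sets_into_space[OF FS] spm by auto
  have gF: "fundamental_domain G \<tau> \<Gamma> (g <# F)"
    unfolding fundamental_domain_def
  proof
    have "g <# F = (\<lambda>x. inv g \<otimes> x) -` F \<inter> space m"
    proof (rule equalityI; rule subsetI)
      fix x assume "x \<in> (\<lambda>x. inv g \<otimes> x) -` F \<inter> space m"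
      then have "inv g \<otimes> x \<in> F" "x = g \<otimes> (inv g \<otimes> x)" using g spm by auto
      then show "x \<in> g <# F" by (auto simp: l_coset_def)
    qed (use g Fc spm in \<open>auto simp: l_coset_def\<close>)
    then have "g <# F \<in> sets m" using measurable_sets[OF lm FS, of "inv g"] g by simp
    then show "g <# F \<in> sets (borel_of \<tau>)" using sm by simp
    have bij: "bij_betw \<pi> F (lcosets \<Gamma>)" using F by (simp add: fundamental_domain_def \<pi>_def[abs_def])
    show "bij_betw (\<lambda>g. g <# \<Gamma>) (g <# F) (lcosets \<Gamma>)"
      unfolding \<pi>_def[symmetric] bij_betw_def
    proof
      show "inj_on \<pi> (g <# F)"
      proof (rule inj_onI)
        fix x y assume "x \<in> g <# F" "y \<in> g <# F" and eq: "\<pi> x = \<pi> y"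
        then obtain a c where ac: "a \<in> F" "c \<in> F" "x = g \<otimes> a" "y = g \<otimes> c" by (auto simp: l_coset_def)
        have "inv g <# \<pi> (g \<otimes> a) = inv g <# \<pi> (g \<otimes> c)" using eq ac by simp
        then have "\<pi> a = \<pi> c" using g Fc[OF ac(1)] Fc[OF ac(2)] by (simp add: act_\<pi>)
        then show "x = y" using bij ac by (auto simp: bij_betw_def inj_on_def)
      qed
      show "\<pi> ` (g <# F) = lcosets \<Gamma>"
      proof
        show "\<pi> ` (g <# F) \<subseteq> lcosets \<Gamma>" using g Fc by (auto simp: l_coset_def[of _ _ F] LCOSETS_def \<pi>_def)
        show "lcosets \<Gamma> \<subseteq> \<pi> ` (g <# F)"
        proof
          fix x assume "x \<in> lcosets \<Gamma>"
          then obtain h where h: "h \<in> carrier G" "x = \<pi> h" by (auto simp: LCOSETS_def \<pi>_def)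
          have "\<pi> (inv g \<otimes> h) \<in> lcosets \<Gamma>" using g h by (auto simp: LCOSETS_def \<pi>_def)
          then obtain a where a: "a \<in> F" "\<pi> (inv g \<otimes> h) = \<pi> a" using bij by (auto simp: bij_betw_def)
          have "\<pi> (g \<otimes> a) = g <# \<pi> (inv g \<otimes> h)" using a g Fc by (simp add: act_\<pi>)
          also have "\<dots> = x" using g h by (simp add: act_\<pi>)
          finally show "x \<in> \<pi> ` (g <# F)" using a by (auto simp: l_coset_def)
        qed
      qed
    qed
  qed
  have actm: "(\<lambda>x. g <# x) \<in> measurable M M"
  proof -
    have "continuous_map X X (\<lambda>x. g <# x)"
      using continuous_map_compose[OF continuous_map_pairedI[OF continuous_map_group_const[OF g] continuous_map_id] continuous_action]
      by (simp add: o_def)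
    then show ?thesis using continuous_map_borel_measurable measurable_cong_sets[OF sM sM] by blast
  qed
  show ?thesis
  proof (rule measure_eqI)
    fix A assume "A \<in> sets (distr M M (\<lambda>x. g <# x))"
    then have A: "A \<in> sets M" by simp
    let ?A = "(\<lambda>x. g <# x) -` A \<inter> space M"
    have A': "?A \<in> sets M" using measurable_sets[OF actm A] .
    have "emeasure (distr M M (\<lambda>x. g <# x)) A = emeasure M ?A" by (rule emeasure_distr[OF actm A])
    also have "\<dots> = emeasure m {x \<in> F. \<pi> x \<in> ?A}" by (rule M_eq[OF F A'])
    \<comment> \<open>Left invariance of the Haar measure moves a piece of \<open>F\<close> to a
      piece of the translated domain, where the formula for \<open>M\<close> is used a second
      time.\<close>
    also have "\<dots> = emeasure m (g <# {x \<in> F. \<pi> x \<in> ?A})"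
    proof -
      have "{x \<in> F. \<pi> x \<in> ?A} = F \<inter> (\<pi> -` ?A \<inter> space m)" using Fc spm by auto
      also have "\<dots> \<in> sets m" using FS measurable_sets[OF \<pi>m, of ?A] A' sM by auto
      finally show ?thesis using m g by (simp add: haar_measure_def)
    qed
    also have "{x \<in> F. \<pi> x \<in> ?A} = {x \<in> F. \<pi> (g \<otimes> x) \<in> A}"
      using g Fc spM by (auto simp: act_\<pi>)
    also have "g <# \<dots> = {x \<in> g <# F. \<pi> x \<in> A}"
      by (auto simp: l_coset_def)
    also have "emeasure m \<dots> = emeasure M A" by (rule M_eq[OF gF A, symmetric])
    finally show "emeasure (distr M M (\<lambda>x. g <# x)) A = emeasure M A" .
  qed simp
qed

end

section \<open>Density of continuous functions\<close>

text \<open>The closed sets are the closures, as far as contained in \<open>U\<close>, of members of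
  a countable base; regularity shows that they reach every point of \<open>U\<close>. The empty set
  is inserted so that they can be enumerated.\<close>

lemma open_fsigma:
  assumes reg: "regular_space X" and sc: "second_countable X" and U: "openin X U"
  shows "\<exists>C :: nat \<Rightarrow> 'a set. (\<forall>n. closedin X (C n)) \<and> U = (\<Union>n. C n)"
proof -
  from sc[unfolded second_countable_def] obtain \<B> where \<B>': "countable \<B>" "\<forall>V\<in>\<B>. openin X V"
    "\<forall>U x. openin X U \<and> x \<in> U \<longrightarrow> (\<exists>V\<in>\<B>. x \<in> V \<and> V \<subseteq> U)"
    by (elim exE conjE) (rule that; assumption)
  have \<B>: "countable \<B>" "\<And>V. V \<in> \<B> \<Longrightarrow> openin X V"
    "\<And>U x. openin X U \<Longrightarrow> x \<in> U \<Longrightarrow> \<exists>V\<in>\<B>. x \<in> V \<and> V \<subseteq> U"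
    using \<B>' by simp_all
  define \<C> where "\<C> = insert {} ((\<lambda>B. X closure_of B) ` {B \<in> \<B>. X closure_of B \<subseteq> U})"
  have cnt: "countable \<C>" using \<B>(1) by (simp add: \<C>_def)
  have closed: "closedin X S" if "S \<in> \<C>" for S using that by (auto simp: \<C>_def)
  have "U = \<Union>\<C>"
  proof
    show "U \<subseteq> \<Union>\<C>"
    proof
      fix x assume x: "x \<in> U"
      have "neighbourhood_base_of (closedin X) X" using reg by (simp add: neighbourhood_base_of_closedin)
      then obtain V C where VC: "openin X V" "closedin X C" "x \<in> V" "V \<subseteq> C" "C \<subseteq> U"
        using U x unfolding neighbourhood_base_of by meson
      obtain B where B: "B \<in> \<B>" "x \<in> B" "B \<subseteq> V" using \<B>(3)[OF VC(1,3)] by blast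
      have "X closure_of B \<subseteq> C" using B VC by (intro closure_of_minimal) auto
      moreover have "x \<in> X closure_of B"
        using closure_of_subset[of B X] openin_subset[OF \<B>(2)[OF B(1)]] B(2) by blast
      moreover have "X closure_of B \<in> \<C>"
        unfolding \<C>_def using B(1) VC(5) calculation(1) by (intro insertI2 imageI) auto
      ultimately show "x \<in> \<Union>\<C>" by blast
    qed
  qed (auto simp: \<C>_def)
  moreover have "range (from_nat_into \<C>) = \<C>" using cnt by (intro range_from_nat_into) (auto simp: \<C>_def)
  ultimately have "U = (\<Union>n. from_nat_into \<C> n)" by simp
  moreover have "closedin X (from_nat_into \<C> n)" for n
    by (intro closed from_nat_into) (auto simp: \<C>_def)
  ultimately show ?thesis by blast
qed

context transitive_action
begin

text \<open>A Urysohn function equal to 1 on a large closed part of \<open>U\<close> and to 0 off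
  \<open>U\<close> differs from the indicator only on the small rest.\<close>

lemma open_approximation:
  assumes X: "Hausdorff_space X" "second_countable X" and U: "openin X U" and e: "e > 0"
  shows "\<exists>\<phi>\<in>Cont. (\<forall>x\<in>topspace X. 0 \<le> \<phi> x \<and> \<phi> x \<le> 1) \<and> (\<integral>x. \<bar>indicator U x - \<phi> x\<bar> \<partial>M) < e"
proof -
  have reg: "regular_space X" using compact X(1) compact_Hausdorff_imp_regular_space by blast
  have normal: "normal_space X" using compact X(1) compact_Hausdorff_or_regular_imp_normal_space by blast
  obtain C :: "nat \<Rightarrow> 'x set" where C: "\<And>n. closedin X (C n)" "U = (\<Union>n. C n)"
    using open_fsigma[OF reg X(2) U] by blast
  have Cm: "C n \<in> sets M" for n
  proof -
    have "openin X (topspace X - C n)" using C(1)[of n] by (simp add: closedin_def)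
    then have "topspace X - (topspace X - C n) \<in> sets M"
      by (rule sets.Diff[OF open_sets[OF openin_topspace] open_sets])
    moreover have "topspace X - (topspace X - C n) = C n" using closedin_subset[OF C(1)[of n]] by auto
    ultimately show ?thesis by simp
  qed
  have Um: "U \<in> sets M" by (rule open_sets[OF U])
  define D where "D n = (\<Union>i\<le>n. C i)" for n
  have Dm: "D n \<in> sets M" for n using Cm by (auto simp: D_def)
  have "incseq D" by (force simp: D_def incseq_def)
  then have "(\<lambda>n. measure M (D n)) \<longlonglongrightarrow> measure M (\<Union>n. D n)" using Dm by (intro finite_Lim_measure_incseq) auto
  moreover have "(\<Union>n. D n) = U" by (auto simp: D_def C(2))
  ultimately obtain n where n: "\<bar>measure M (D n) - measure M U\<bar> < e"
    using LIMSEQ_D[of "\<lambda>n. measure M (D n)" "measure M U" e] e by fastforce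
  have DU: "D n \<subseteq> U" by (auto simp: D_def C(2))
  have "closedin X (D n)" unfolding D_def using C(1) by (intro closedin_Union) auto
  moreover have "closedin X (topspace X - U)" using U by blast
  moreover have "disjnt (topspace X - U) (D n)" using DU by (auto simp: disjnt_def)
  ultimately obtain \<phi> where \<phi>: "continuous_map X (top_of_set {0..1::real}) \<phi>" "\<phi> ` (topspace X - U) \<subseteq> {0}" "\<phi> ` D n \<subseteq> {1}"
    using Urysohn_lemma[OF normal, of "topspace X - U" "D n" 0 1] by auto
  have cont: "\<phi> \<in> Cont" using \<phi>(1) by (simp add: Cont_def continuous_map_in_subtopology)
  have rng: "0 \<le> \<phi> x \<and> \<phi> x \<le> 1" if "x \<in> topspace X" for x
    using continuous_map_image_subset_topspace[OF \<phi>(1)] that by fastforce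
  have "(\<integral>x. \<bar>indicator U x - \<phi> x\<bar> \<partial>M) \<le> (\<integral>x. indicator (U - D n) x \<partial>M)"
  proof (rule integral_mono)
    show "integrable M (\<lambda>x. \<bar>indicator U x - \<phi> x\<bar>)"
      using Cont_integrable[OF cont] Um by (intro integrable_abs Bochner_Integration.integrable_diff) (auto simp: less_top[symmetric])
    show "integrable M (indicator (U - D n) :: 'x \<Rightarrow> real)" using Um Dm by (auto simp: less_top[symmetric])
    fix x assume "x \<in> space M"
    then have x: "x \<in> topspace X" by (simp add: space_M)
    consider "x \<in> D n" | "x \<in> U - D n" | "x \<in> topspace X - U" using x by blast
    then show "\<bar>indicator U x - \<phi> x\<bar> \<le> indicator (U - D n) x"
      using rng[OF x] \<phi>(2,3) DU by cases (auto simp: indicator_def image_subset_iff)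
  qed
  also have "\<dots> = measure M U - measure M (D n)" using Um Dm DU by (simp add: finite_measure_Diff)
  also have "\<dots> < e" using n by simp
  finally show ?thesis using cont rng by blast
qed

text \<open>Induction along the generation of the Borel sets: complements correspond to
  \<open>1 - \<phi>\<close>, finite unions to maxima, and countable unions reduce to finite ones by
  continuity of the measure.\<close>

lemma indicator_approximation:
  assumes X: "Hausdorff_space X" "second_countable X" and A: "A \<in> sets M"
  shows "\<forall>e>0. \<exists>\<phi>\<in>Cont. (\<forall>x\<in>topspace X. 0 \<le> \<phi> x \<and> \<phi> x \<le> 1) \<and> (\<integral>x. \<bar>indicator A x - \<phi> x\<bar> \<partial>M) < e"
proof -
  have sM: "sets M = sigma_sets (topspace X) {U. openin X U}"
    unfolding sets_M borel_of_def using openin_subset by (subst sets_measure_of) auto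
  have "A \<in> sigma_sets (topspace X) {U. openin X U}" using A sM by simp
  then show ?thesis
  proof (induction rule: sigma_sets.induct)
    case (Basic U) then show ?case using open_approximation[OF X] by auto
  next
    case Empty then show ?case by (auto intro!: bexI[of _ "\<lambda>_. 0"] Cont_intros)
  next
    case (Compl A)
    show ?case
    proof (intro allI impI)
      fix e :: real assume "e > 0"
      then obtain \<phi> where \<phi>: "\<phi> \<in> Cont" "\<And>x. x\<in>topspace X \<Longrightarrow> 0 \<le> \<phi> x \<and> \<phi> x \<le> 1" "(\<integral>x. \<bar>indicator A x - \<phi> x\<bar> \<partial>M) < e"
        using Compl.IH by blast
      have "(\<integral>x. \<bar>indicator (topspace X - A) x - (1 - \<phi> x)\<bar> \<partial>M) = (\<integral>x. \<bar>indicator A x - \<phi> x\<bar> \<partial>M)"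
        by (intro Bochner_Integration.integral_cong) (auto simp: space_M indicator_def)
      then show "\<exists>\<phi>\<in>Cont. (\<forall>x\<in>topspace X. 0 \<le> \<phi> x \<and> \<phi> x \<le> 1) \<and> (\<integral>x. \<bar>indicator (topspace X - A) x - \<phi> x\<bar> \<partial>M) < e"
        using \<phi> by (intro bexI[of _ "\<lambda>x. 1 - \<phi> x"] Cont_intros) auto
    qed
  next
    case (Union a)
    have am: "a i \<in> sets M" for i using Union.hyps sM by simp
    show ?case
    proof (intro allI impI)
      fix e :: real assume e: "e > 0"
      define D where "D n = (\<Union>i\<le>n. a i)" for n
      have Dm: "D n \<in> sets M" for n using am by (auto simp: D_def)
      have Um: "(\<Union>i. a i) \<in> sets M" using am by auto
      have "incseq D" by (force simp: D_def incseq_def)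
      then have "(\<lambda>n. measure M (D n)) \<longlonglongrightarrow> measure M (\<Union>n. D n)" using Dm by (intro finite_Lim_measure_incseq) auto
      moreover have "(\<Union>n. D n) = (\<Union>i. a i)" by (auto simp: D_def)
      ultimately obtain n where n: "\<bar>measure M (D n) - measure M (\<Union>i. a i)\<bar> < e / 2"
        using LIMSEQ_D[of "\<lambda>n. measure M (D n)" "measure M (\<Union>i. a i)" "e/2"] e by fastforce
      have DU: "D n \<subseteq> (\<Union>i. a i)" by (auto simp: D_def)
      have "\<exists>\<phi>\<in>Cont. (\<forall>x\<in>topspace X. 0 \<le> \<phi> x \<and> \<phi> x \<le> 1) \<and> (\<integral>x. \<bar>indicator (D m) x - \<phi> x\<bar> \<partial>M) < \<epsilon>"
        if "\<epsilon> > 0" for m \<epsilon> using that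
      proof (induction m arbitrary: \<epsilon>)
        case 0 then show ?case using Union.IH[of 0] by (simp add: D_def)
      next
        case (Suc m)
        have h: "\<epsilon> / 2 > 0" using Suc.prems by simp
        obtain \<phi> where \<phi>: "\<phi> \<in> Cont" "\<And>x. x\<in>topspace X \<Longrightarrow> 0 \<le> \<phi> x \<and> \<phi> x \<le> 1" "(\<integral>x. \<bar>indicator (D m) x - \<phi> x\<bar> \<partial>M) < \<epsilon> / 2"
          using Suc.IH[OF h] by blast
        obtain \<psi> where \<psi>: "\<psi> \<in> Cont" "\<And>x. x\<in>topspace X \<Longrightarrow> 0 \<le> \<psi> x \<and> \<psi> x \<le> 1" "(\<integral>x. \<bar>indicator (a (Suc m)) x - \<psi> x\<bar> \<partial>M) < \<epsilon> / 2"
          using Union.IH[of "Suc m"] h by blast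
        have i: "integrable M (\<lambda>x. \<bar>indicator A x - \<chi>' x\<bar>)" if "A \<in> sets M" "\<chi>' \<in> Cont" for A \<chi>'
          using Cont_integrable[OF that(2)] that(1) by (intro integrable_abs Bochner_Integration.integrable_diff) (auto simp: less_top[symmetric])
        have mx: "(\<lambda>x. max (\<phi> x) (\<psi> x)) \<in> Cont" using \<phi>(1) \<psi>(1) by (rule Cont_intros)
        have DS: "D (Suc m) = D m \<union> a (Suc m)" by (auto simp: D_def atMost_Suc)
        have "(\<integral>x. \<bar>indicator (D (Suc m)) x - max (\<phi> x) (\<psi> x)\<bar> \<partial>M) \<le>
            (\<integral>x. \<bar>indicator (D m) x - \<phi> x\<bar> + \<bar>indicator (a (Suc m)) x - \<psi> x\<bar> \<partial>M)"
        proof (rule integral_mono)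
          show "integrable M (\<lambda>x. \<bar>indicator (D (Suc m)) x - max (\<phi> x) (\<psi> x)\<bar>)" by (rule i[OF Dm mx])
          show "integrable M (\<lambda>x. \<bar>indicator (D m) x - \<phi> x\<bar> + \<bar>indicator (a (Suc m)) x - \<psi> x\<bar>)"
            using i[OF Dm \<phi>(1)] i[OF am \<psi>(1)] by simp
          fix x assume "x \<in> space M"
          then have x: "x \<in> topspace X" by (simp add: space_M)
          show "\<bar>indicator (D (Suc m)) x - max (\<phi> x) (\<psi> x)\<bar> \<le> \<bar>indicator (D m) x - \<phi> x\<bar> + \<bar>indicator (a (Suc m)) x - \<psi> x\<bar>"
            unfolding DS using \<phi>(2)[OF x] \<psi>(2)[OF x] by (auto simp: indicator_def)
        qed
        also have "\<dots> < \<epsilon>" using i[OF Dm \<phi>(1)] i[OF am \<psi>(1)] \<phi>(3) \<psi>(3) by simp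
        finally show ?case using mx \<phi>(2) \<psi>(2) by (intro bexI[OF _ mx]) (auto simp: le_max_iff_disj)
      qed
      then obtain \<phi> where \<phi>: "\<phi> \<in> Cont" "\<And>x. x\<in>topspace X \<Longrightarrow> 0 \<le> \<phi> x \<and> \<phi> x \<le> 1" "(\<integral>x. \<bar>indicator (D n) x - \<phi> x\<bar> \<partial>M) < e / 2"
        using e by (meson half_gt_zero)
      have i: "integrable M (\<lambda>x. \<bar>indicator A x - \<phi> x\<bar>)" if "A \<in> sets M" for A
        using Cont_integrable[OF \<phi>(1)] that(1) by (intro integrable_abs Bochner_Integration.integrable_diff) (auto simp: less_top[symmetric])
      have j: "integrable M (indicator ((\<Union>i. a i) - D n) :: 'x \<Rightarrow> real)" using Um Dm by (auto simp: less_top[symmetric])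
      have "(\<integral>x. \<bar>indicator (\<Union>i. a i) x - \<phi> x\<bar> \<partial>M) \<le> (\<integral>x. \<bar>indicator (D n) x - \<phi> x\<bar> + indicator ((\<Union>i. a i) - D n) x \<partial>M)"
      proof (rule integral_mono)
        show "integrable M (\<lambda>x. \<bar>indicator (\<Union>i. a i) x - \<phi> x\<bar>)" by (rule i[OF Um])
        show "integrable M (\<lambda>x. \<bar>indicator (D n) x - \<phi> x\<bar> + indicator ((\<Union>i. a i) - D n) x)"
          using i[OF Dm, of n] j by (rule Bochner_Integration.integrable_add)
        show "\<bar>indicator (\<Union>i. a i) x - \<phi> x\<bar> \<le> \<bar>indicator (D n) x - \<phi> x\<bar> + indicator ((\<Union>i. a i) - D n) x" for x
          using DU by (auto simp: indicator_def)
      qed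
      also have "\<dots> = (\<integral>x. \<bar>indicator (D n) x - \<phi> x\<bar> \<partial>M) + (measure M (\<Union>i. a i) - measure M (D n))"
        using i[OF Dm, of n] j Um Dm DU by (simp add: finite_measure_Diff)
      also have "\<dots> < e" using \<phi>(3) n by linarith
      finally show "\<exists>\<phi>\<in>Cont. (\<forall>x\<in>topspace X. 0 \<le> \<phi> x \<and> \<phi> x \<le> 1) \<and> (\<integral>x. \<bar>indicator (\<Union>i. a i) x - \<phi> x\<bar> \<partial>M) < e"
        using \<phi> by blast
    qed
  qed
qed

theorem Cont_dense_L1:
  fixes f :: "'x \<Rightarrow> real"
  assumes X: "Hausdorff_space X" "second_countable X" and f: "integrable M f"
  shows "\<forall>e>0. \<exists>\<phi>\<in>Cont. (\<integral>x. \<bar>f x - \<phi> x\<bar> \<partial>M) < e"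
  using f
proof (induction rule: integrable_induct)
  case (base A c)
  show ?case
  proof (intro allI impI)
    fix e :: real assume e: "e > 0"
    then obtain \<phi> where \<phi>: "\<phi> \<in> Cont" "(\<integral>x. \<bar>indicator A x - \<phi> x\<bar> \<partial>M) < e / (\<bar>c\<bar> + 1)"
      using indicator_approximation[OF X base(1)] by (metis abs_ge_zero add_nonneg_pos divide_pos_pos zero_less_one)
    have "(\<integral>x. \<bar>indicator A x *\<^sub>R c - \<phi> x * c\<bar> \<partial>M) = (\<integral>x. \<bar>indicator A x - \<phi> x\<bar> * \<bar>c\<bar> \<partial>M)"
      by (intro Bochner_Integration.integral_cong) (auto simp flip: abs_mult left_diff_distrib)
    also have "\<dots> = (\<integral>x. \<bar>indicator A x - \<phi> x\<bar> \<partial>M) * \<bar>c\<bar>" by simp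
    also have "\<dots> \<le> e / (\<bar>c\<bar> + 1) * \<bar>c\<bar>" using \<phi>(2) by (intro mult_right_mono) auto
    also have "\<dots> < e" using e by (simp add: field_simps)
    finally show "\<exists>\<phi>\<in>Cont. (\<integral>x. \<bar>indicator A x *\<^sub>R c - \<phi> x\<bar> \<partial>M) < e"
      using \<phi>(1) by (intro bexI[of _ "\<lambda>x. \<phi> x * c"] Cont_intros) auto
  qed
next
  case (add f g)
  show ?case
  proof (intro allI impI)
    fix e :: real assume e: "e > 0"
    then have "e/2 > 0" by simp
    then obtain \<phi> \<psi> where *: "\<phi> \<in> Cont" "(\<integral>x. \<bar>f x - \<phi> x\<bar> \<partial>M) < e/2" "\<psi> \<in> Cont" "(\<integral>x. \<bar>g x - \<psi> x\<bar> \<partial>M) < e/2"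
      using add.IH by meson
    have i: "integrable M (\<lambda>x. \<bar>f x - \<phi> x\<bar>)" "integrable M (\<lambda>x. \<bar>g x - \<psi> x\<bar>)"
      "integrable M (\<lambda>x. \<bar>(f x + g x) - (\<phi> x + \<psi> x)\<bar>)"
      using add.hyps *(1,3) Cont_integrable by auto
    have "(\<integral>x. \<bar>(f x + g x) - (\<phi> x + \<psi> x)\<bar> \<partial>M) \<le> (\<integral>x. \<bar>f x - \<phi> x\<bar> + \<bar>g x - \<psi> x\<bar> \<partial>M)"
      using i by (intro integral_mono) auto
    also have "\<dots> < e" using i *(2,4) by simp
    finally show "\<exists>\<phi>\<in>Cont. (\<integral>x. \<bar>(f x + g x) - \<phi> x\<bar> \<partial>M) < e"
      using *(1,3) by (intro bexI[of _ "\<lambda>x. \<phi> x + \<psi> x"] Cont_intros) auto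
  qed
next
  case (lim f s)
  show ?case
  proof (intro allI impI)
    fix e :: real assume e: "e > 0"
    have fm: "f \<in> borel_measurable M" and sm: "\<And>i. s i \<in> borel_measurable M" using lim.hyps by auto
    have "(\<lambda>i. \<integral>x. \<bar>f x - s i x\<bar> \<partial>M) \<longlonglongrightarrow> (\<integral>x. 0 \<partial>M)"
    proof (rule integral_dominated_convergence[where w = "\<lambda>x. 3 * \<bar>f x\<bar>"])
      show "AE x in M. (\<lambda>i. \<bar>f x - s i x\<bar>) \<longlonglongrightarrow> 0"
      proof (rule AE_I2)
        fix x assume "x \<in> space M"
        then have "(\<lambda>i. \<bar>f x - s i x\<bar>) \<longlonglongrightarrow> \<bar>f x - f x\<bar>" using lim.hyps by (intro tendsto_intros) auto
        then show "(\<lambda>i. \<bar>f x - s i x\<bar>) \<longlonglongrightarrow> 0" by simp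
      qed
      show "AE x in M. norm \<bar>f x - s i x\<bar> \<le> 3 * \<bar>f x\<bar>" for i
      proof (rule AE_I2)
        fix x assume "x \<in> space M"
        then have "norm (s i x) \<le> 2 * norm (f x)" using lim.hyps by auto
        then show "norm \<bar>f x - s i x\<bar> \<le> 3 * \<bar>f x\<bar>" by simp
      qed
      show "integrable M (\<lambda>x. 3 * \<bar>f x\<bar>)" using lim.hyps by auto
    qed (use fm sm in auto)
    then obtain i where i: "\<bar>\<integral>x. \<bar>f x - s i x\<bar> \<partial>M\<bar> < e/2"
      using LIMSEQ_D[of _ 0 "e/2"] e by fastforce
    obtain \<phi> where \<phi>: "\<phi> \<in> Cont" "(\<integral>x. \<bar>s i x - \<phi> x\<bar> \<partial>M) < e/2" using lim.IH[of i] e by (meson half_gt_zero)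
    have ii: "integrable M (\<lambda>x. \<bar>f x - s i x\<bar>)" "integrable M (\<lambda>x. \<bar>s i x - \<phi> x\<bar>)" "integrable M (\<lambda>x. \<bar>f x - \<phi> x\<bar>)"
      using lim.hyps Cont_integrable[OF \<phi>(1)] by auto
    have "(\<integral>x. \<bar>f x - \<phi> x\<bar> \<partial>M) \<le> (\<integral>x. \<bar>f x - s i x\<bar> + \<bar>s i x - \<phi> x\<bar> \<partial>M)"
      using ii by (intro integral_mono) auto
    also have "\<dots> < e" using ii i \<phi>(2) by simp
    finally show "\<exists>\<phi>\<in>Cont. (\<integral>x. \<bar>f x - \<phi> x\<bar> \<partial>M) < e" using \<phi>(1) by blast
  qed
qed

end

section \<open>Reduction to a small open subgroup\<close>

context group
begin

lemma root_product_in_subgroup: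
  assumes "subgroup S G" "W \<subseteq> S" "root_product G W n z P w"
  shows "z \<in> S \<and> P \<in> S"
  using assms(3)
proof (induction rule: root_product.induct)
  case (base w)
  then show ?case using assms subgroup.one_closed by blast
next
  case (step z P w y)
  have y: "y \<in> S" using step assms(2) by auto
  have "y [^] n \<in> S" by (induction n) (auto intro: subgroup.one_closed[OF assms(1)] subgroup.m_closed[OF assms(1)] y)
  then show ?case using step y subgroup.m_closed[OF assms(1)] by blast
qed

lemma root_product_subgroup_group:
  "root_product G W n z P w \<Longrightarrow> root_product (G\<lparr>carrier := H\<rparr>) W n z P w"
proof (induction rule: root_product.induct)
  case (base w)
  then show ?case using root_product.base[of w W "G\<lparr>carrier := H\<rparr>" n] by simp
next
  case (step z P w y)
  have "y [^]\<^bsub>G\<lparr>carrier := H\<rparr>\<^esub> n = y [^] n" by (simp add: nat_pow_def)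
  then show ?case using root_product.step[OF step.IH step.hyps(2)] by simp
qed

end

text \<open>Inverses, commutators and generated subgroups are the same in \<open>H\<close> and in
  \<open>G\<close>, so the series of \<open>H\<close> inherits its termination from nilpotency of
  \<open>G\<close>.\<close>

lemma (in group) comm_series_subgroup_group:
  assumes H: "subgroup H G" and N: "filtered_group (G\<lparr>carrier := H\<rparr>) N"
  shows "comm_series (G\<lparr>carrier := H\<rparr>) N k \<subseteq> lower_central G k"
proof (induction k)
  interpret F: filtered_group "G\<lparr>carrier := H\<rparr>" N by (rule N)
  case 0
  then show ?case using F.L_carrier[of _ 0] subgroup.subset[OF H] by auto
next
  interpret F: filtered_group "G\<lparr>carrier := H\<rparr>" N by (rule N)
  case (Suc k)
  let ?H = "G\<lparr>carrier := H\<rparr>"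
  let ?S = "{commutator ?H x y | x y. x \<in> comm_series ?H N k \<and> y \<in> carrier ?H}"
  have c: "x \<in> H" if "x \<in> comm_series ?H N k" for x using F.L_carrier[OF that] by simp
  have comm: "commutator ?H x y = x \<otimes> y \<otimes> inv x \<otimes> inv y" if "x \<in> H" "y \<in> H" for x y
    using that m_inv_consistent[OF H] by (simp add: commutator_def)
  have sub: "?S \<subseteq> {x \<otimes> y \<otimes> inv x \<otimes> inv y | x y. x \<in> lower_central G k \<and> y \<in> carrier G}"
  proof
    fix z assume "z \<in> ?S"
    then obtain x y where xy: "z = commutator ?H x y" "x \<in> comm_series ?H N k" "y \<in> H" by auto
    then have "z = x \<otimes> y \<otimes> inv x \<otimes> inv y" using comm c by simp
    moreover have "x \<in> lower_central G k" "y \<in> carrier G" using xy Suc subgroup.mem_carrier[OF H] by auto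
    ultimately show "z \<in> {x \<otimes> y \<otimes> inv x \<otimes> inv y | x y. x \<in> lower_central G k \<and> y \<in> carrier G}" by blast
  qed
  have SH: "?S \<subseteq> H"
  proof
    fix z assume "z \<in> ?S"
    then obtain x y where xy: "z = commutator ?H x y" "x \<in> H" "y \<in> H" using c by auto
    then show "z \<in> H" using F.commutator_closed[of x y] by simp
  qed
  have "comm_series ?H N (Suc k) = generate G ?S"
    unfolding comm_series.simps(2) by (rule generate_consistent[OF SH H])
  also have "\<dots> \<subseteq> lower_central G (Suc k)"
    unfolding lower_central.simps(2) by (rule mono_generate[OF sub])
  finally show ?case .
qed

context discrete_coset_space
begin

lemma transitive_action_cosets:
  assumes M: "haar_projection G \<tau> \<Gamma> M" and compact: "compact_space X"
  shows "transitive_action G \<tau> X (\<lambda>g x. g <#\<^bsub>G\<^esub> x) M \<Gamma>"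
proof -
  have x0: "\<Gamma> = \<pi> \<one>" using lcos_mult_one[OF \<Gamma>_carrier] by (simp add: \<pi>_def)
  have act0: "g <# \<Gamma> = \<pi> g" for g by (simp add: \<pi>_def)
  show ?thesis
  proof (intro transitive_action.intro topological_group_axioms transitive_action_axioms.intro)
    show "\<one> <# x = x" if "x \<in> topspace X" for x using that by (auto simp: topspace_X act_\<pi>)
    show "(g \<otimes> h) <# x = g <# (h <# x)" if "g \<in> carrier G" "h \<in> carrier G" "x \<in> topspace X" for g h x
      using that by (auto simp: topspace_X act_\<pi> m_assoc)
    show "\<Gamma> \<in> topspace X" using x0 by (auto simp: topspace_X)
    show "\<exists>g\<in>carrier G. x = g <# \<Gamma>" if "x \<in> topspace X" for x using that by (auto simp: topspace_X act0)
    show "openin X ((\<lambda>g. g <# \<Gamma>) ` U)" if "openin \<tau> U" for U using open_\<pi>[OF that] by (simp add: act0)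
    show "distr M M (\<lambda>x. g <#\<^bsub>G\<^esub> x) = M" if "g \<in> carrier G" for g
      using haar_projection_invariant[OF M that] .
    show "sets M = sets (borel_of X)" "prob_space M" using M by (simp_all add: haar_projection_def)
  qed (rule compact continuous_action)+
qed

text \<open>
  Only the subgroup \<open>H\<close> generated by \<open>b\<close> and by a small ball around the identity matters: its orbits are
  open and invariant under \<open>b\<close>, so it acts transitively by ergodicity.
\<close>

theorem nil_action_exists:
  assumes M: "haar_projection G \<tau> \<Gamma> M" and compact: "compact_space X"
    and coords: "group_coordinates G \<tau> U \<psi> d r0"
    and nil: "lower_central G s = {\<one>}" and b: "b \<in> carrier G"
    and erg: "ergodic M (\<lambda>x. b <#\<^bsub>G\<^esub> x)"
  shows "\<exists>H N B. nil_action (G\<lparr>carrier := H\<rparr>) (subtopology \<tau> H) X (\<lambda>g x. g <#\<^bsub>G\<^esub> x) M \<Gamma> N b B s"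
proof -
  interpret W: transitive_action G \<tau> X "\<lambda>g x. g <#\<^bsub>G\<^esub> x" M \<Gamma> by (rule transitive_action_cosets[OF M compact])
  obtain B where B: "nbhd B" "\<And>z W. z \<in> B \<Longrightarrow> nbhd W \<Longrightarrow> \<exists>n0. \<forall>n\<ge>n0. \<exists>P w. root_product G W n z P w \<and> P \<in> W"
    using group_coordinates.approximate_roots[OF coords] by blast
  have Bc: "B \<subseteq> carrier G" using nbhd_carrier[OF B(1)] by blast
  define N where "N = generate G B"
  define H where "H = generate G (insert b N)"
  have N_sub: "subgroup N G" unfolding N_def using Bc by (rule generate_is_subgroup)
  have Nc: "N \<subseteq> carrier G" using N_sub by (rule subgroup.subset)
  have H_sub: "subgroup H G" unfolding H_def using Nc b by (intro generate_is_subgroup) auto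
  have Hc: "H \<subseteq> carrier G" using H_sub by (rule subgroup.subset)
  have BN: "B \<subseteq> N" and NH: "N \<subseteq> H" and bH: "b \<in> H" by (auto simp: N_def H_def intro: generate.incl)
  have B_min: "N \<subseteq> S" if "subgroup S G" "B \<subseteq> S" for S
    unfolding N_def by (rule generate_subgroup_incl[OF that(2,1)])
  have H_min: "H \<subseteq> S" if "subgroup S G" "N \<subseteq> S" "b \<in> S" for S
    unfolding H_def using that by (intro generate_subgroup_incl) auto
  have translate_open: "openin \<tau> S" if S: "subgroup S G" "B \<subseteq> S" for S
  proof (subst openin_subopen, rule ballI)
    fix g assume g: "g \<in> S"
    have gc: "g \<in> carrier G" using g S(1) subgroup.mem_carrier by metis
    have "openin \<tau> ((\<lambda>v. g \<otimes> v) ` B)" using B(1) gc by (intro openin_left_translate) (auto simp: nbhd_def)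
    moreover have "g \<in> (\<lambda>v. g \<otimes> v) ` B" using B(1) gc by (auto simp: nbhd_def intro!: rev_image_eqI[of \<one>])
    moreover have "(\<lambda>v. g \<otimes> v) ` B \<subseteq> S" using g S subgroup.m_closed[OF S(1)] by blast
    ultimately show "\<exists>T. openin \<tau> T \<and> g \<in> T \<and> T \<subseteq> S" by blast
  qed
  have N_open: "openin \<tau> N" and H_open: "openin \<tau> H"
    using translate_open[OF N_sub BN] translate_open[OF H_sub] BN NH by auto
  \<comment> \<open>With the open subgroup itself as the neighbourhood for the roots, every element
    of \<open>B\<close> is a product of members of that subgroup. This does the work of
    connectedness of \<open>B\<close>.\<close>
  have open_contains: "B \<subseteq> S" if S: "subgroup S G" "openin \<tau> S" for S
  proof
    fix z assume z: "z \<in> B"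
    have "nbhd S" using S subgroup.one_closed[OF S(1)] by (simp add: nbhd_def)
    then obtain n P w where "root_product G S n z P w" using B(2)[OF z] by blast
    then show "z \<in> S" using root_product_in_subgroup[OF S(1) order_refl] by blast
  qed
  \<comment> \<open>The elements with conjugate in \<open>N\<close> form an open subgroup, which by
    \<open>open_contains\<close> includes \<open>B\<close> and hence \<open>N\<close>, although
    \<open>B\<close> itself need not be invariant under conjugation.\<close>
  have N_conj: "g \<otimes> x \<otimes> inv g \<in> N" if g: "g \<in> carrier G" and x: "x \<in> N" for g x
  proof -
    define S where "S = {x \<in> carrier G. g \<otimes> x \<otimes> inv g \<in> N}"
    have "subgroup S G"
    proof (rule subgroupI)
      show "S \<noteq> {}" using g subgroup.one_closed[OF N_sub] by (auto simp: S_def intro!: exI[of _ \<one>])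
    next
      fix a assume a: "a \<in> S"
      then have "inv (g \<otimes> a \<otimes> inv g) \<in> N" using subgroup.m_inv_closed[OF N_sub] by (simp add: S_def)
      then show "inv a \<in> S" using a g by (simp add: S_def inv_mult_group m_assoc)
    next
      fix a c assume ac: "a \<in> S" "c \<in> S"
      then have "(g \<otimes> a \<otimes> inv g) \<otimes> (g \<otimes> c \<otimes> inv g) \<in> N" using subgroup.m_closed[OF N_sub] by (simp add: S_def)
      then show "a \<otimes> c \<in> S" using ac g by (simp add: S_def m_assoc)
    qed (auto simp: S_def)
    moreover have "openin \<tau> S"
    proof -
      have "continuous_map \<tau> \<tau> (\<lambda>x. g \<otimes> x \<otimes> inv g)"
        using g continuous_map_id by (intro group_continuous_intros) auto
      from openin_continuous_map_preimage[OF this N_open] show ?thesis by (simp add: S_def topspace_group)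
    qed
    ultimately have "N \<subseteq> S" using open_contains B_min by blast
    then show ?thesis using x by (auto simp: S_def)
  qed
  have H_transitive: "\<exists>h\<in>H. x = h <# \<Gamma>" if x: "x \<in> topspace X" for x
  proof (rule ccontr)
    assume contra: "\<not> (\<exists>h\<in>H. x = h <# \<Gamma>)"
    define A where "A y = (\<lambda>h. h <# y) ` H" for y
    have A_open: "openin X (A y)" if "y \<in> topspace X" for y
      unfolding A_def by (rule W.open_orbit[OF H_open that])
    have A1: "measure M (A y) = 1" if y: "y \<in> topspace X" for y
    proof -
      have Asub: "A y \<subseteq> topspace X" using openin_subset[OF A_open[OF y]] .
      have inv_iff: "b <# z \<in> A y \<longleftrightarrow> z \<in> A y" if z: "z \<in> topspace X" for z
      proof
        assume "z \<in> A y"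
        then obtain h where h: "h \<in> H" "z = h <# y" by (auto simp: A_def)
        then have "b <# z = (b \<otimes> h) <# y" using W.act_mult[of b h y] b Hc y by auto
        then show "b <# z \<in> A y" using subgroup.m_closed[OF H_sub bH h(1)] by (auto simp: A_def)
      next
        assume "b <# z \<in> A y"
        then obtain h where h: "h \<in> H" "b <# z = h <# y" by (auto simp: A_def)
        have "z = inv b <# (b <# z)" using W.act_inv(2)[OF b z] by simp
        also have "\<dots> = (inv b \<otimes> h) <# y" using W.act_mult[of "inv b" h y] h b Hc y by auto
        finally show "z \<in> A y"
          using subgroup.m_closed[OF H_sub subgroup.m_inv_closed[OF H_sub bH] h(1)] by (auto simp: A_def)
      qed
      have "(\<lambda>x. b <# x) -` A y \<inter> space M = A y" using inv_iff Asub by (auto simp: W.space_M)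
      then have "measure M (A y) = 0 \<or> measure M (A y) = 1"
        using erg W.open_sets[OF A_open[OF y]] by (auto simp: ergodic_def)
      moreover have "y \<in> A y"
        using W.act_one[OF y] subgroup.one_closed[OF H_sub] by (auto simp: A_def intro!: rev_image_eqI[of \<one>])
      then have "measure M (A y) > 0" using W.open_positive[OF A_open[OF y]] by blast
      ultimately show ?thesis by simp
    qed
    have "A x \<inter> A \<Gamma> = {}"
    proof (rule ccontr)
      assume "A x \<inter> A \<Gamma> \<noteq> {}"
      then obtain h k where hk: "h \<in> H" "k \<in> H" "h <# x = k <# \<Gamma>" by (auto simp: A_def)
      have "x = inv h <# (k <# \<Gamma>)" using W.act_inv(2)[of h x] hk Hc x by auto
      also have "\<dots> = (inv h \<otimes> k) <# \<Gamma>" using W.act_mult[of "inv h" k \<Gamma>] hk Hc W.x0 by auto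
      finally show False
        using contra subgroup.m_closed[OF H_sub subgroup.m_inv_closed[OF H_sub hk(1)] hk(2)] by blast
    qed
    then have "measure M (A x \<union> A \<Gamma>) = measure M (A x) + measure M (A \<Gamma>)"
      using W.open_sets A_open x W.x0 by (intro W.finite_measure_Union) auto
    then have "measure M (A x \<union> A \<Gamma>) = 2" using A1[OF x] A1[OF W.x0] by simp
    then show False using W.prob_le_1[of "A x \<union> A \<Gamma>"] by simp
  qed
  let ?G = "G\<lparr>carrier := H\<rparr>" and ?\<tau> = "subtopology \<tau> H"
  have grp: "group ?G" by (rule subgroup_imp_group[OF H_sub])
  have tsH: "topspace ?\<tau> = H" using Hc by (auto simp: topspace_group)
  have openH: "openin \<tau> U" if "openin ?\<tau> U" for U
    using that H_open by (simp add: openin_open_subtopology)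
  have S_sub: "subgroup S G" if "subgroup S ?G" for S by (rule incl_subgroup[OF H_sub that])
  interpret HG: topological_group ?G ?\<tau>
  proof (intro topological_group.intro grp topological_group_axioms.intro)
    show "topspace ?\<tau> = carrier ?G" using tsH by simp
    have "continuous_map (prod_topology ?\<tau> ?\<tau>) \<tau> (\<lambda>p. fst p \<otimes> snd p)"
      using continuous_map_into_fulltopology[OF continuous_map_fst] continuous_map_into_fulltopology[OF continuous_map_snd]
      by (intro continuous_map_group_mult)
    moreover have "(\<lambda>p. fst p \<otimes> snd p) \<in> topspace (prod_topology ?\<tau> ?\<tau>) \<rightarrow> H"
      using subgroup.m_closed[OF H_sub] by (auto simp: tsH)
    ultimately show "continuous_map (prod_topology ?\<tau> ?\<tau>) ?\<tau> (\<lambda>(x, y). x \<otimes>\<^bsub>?G\<^esub> y)"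
      by (simp add: continuous_map_in_subtopology case_prod_unfold image_subset_iff Pi_iff)
    have "continuous_map ?\<tau> \<tau> (\<lambda>x. inv x)" using continuous_inv by (rule continuous_map_from_subtopology)
    then have "continuous_map ?\<tau> ?\<tau> (\<lambda>x. inv x)"
      using subgroup.m_inv_closed[OF H_sub] by (auto simp: continuous_map_in_subtopology tsH)
    then show "continuous_map ?\<tau> ?\<tau> (\<lambda>x. inv\<^bsub>?G\<^esub> x)"
      by (rule continuous_map_eq) (simp add: tsH m_inv_consistent[OF H_sub])
  qed
  have normal: "N \<lhd> ?G"
    unfolding group.normal_inv_iff[OF grp]
  proof
    show "subgroup N ?G" using N_sub NH H_sub subgroup_incl by blast
    show "\<forall>x\<in>carrier ?G. \<forall>h\<in>N. x \<otimes>\<^bsub>?G\<^esub> h \<otimes>\<^bsub>?G\<^esub> inv\<^bsub>?G\<^esub> x \<in> N"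
      using N_conj Hc m_inv_consistent[OF H_sub] by auto
  qed
  interpret FG: filtered_group ?G N
    by (intro filtered_group.intro grp filtered_group_axioms.intro normal)
  have nbhdH: "nbhd W" if "HG.nbhd W" for W using that openH by (simp add: HG.nbhd_def nbhd_def)
  have "transitive_action ?G ?\<tau> X (\<lambda>g x. g <#\<^bsub>G\<^esub> x) M \<Gamma>"
  proof (intro transitive_action.intro HG.topological_group_axioms transitive_action_axioms.intro)
    have "continuous_map (prod_topology ?\<tau> X) X (\<lambda>p. fst p <# snd p)"
      by (intro W.continuous_map_act continuous_map_into_fulltopology[OF continuous_map_fst] continuous_map_snd)
    then show "continuous_map (prod_topology ?\<tau> X) X (\<lambda>(g, x). g <#\<^bsub>G\<^esub> x)" by (simp add: case_prod_unfold)
    show "\<one>\<^bsub>?G\<^esub> <# x = x" if "x \<in> topspace X" for x using W.act_one[OF that] by simp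
    show "(g \<otimes>\<^bsub>?G\<^esub> h) <# x = g <# (h <# x)" if "g \<in> carrier ?G" "h \<in> carrier ?G" "x \<in> topspace X" for g h x
      using W.act_mult[of g h x] that Hc by auto
    show "\<Gamma> \<in> topspace X" by (rule W.x0)
    show "\<exists>g\<in>carrier ?G. x = g <# \<Gamma>" if "x \<in> topspace X" for x using H_transitive[OF that] by simp
    show "openin X ((\<lambda>g. g <# \<Gamma>) ` U)" if "openin ?\<tau> U" for U by (rule W.orbit_open[OF openH[OF that]])
    show "distr M M (\<lambda>x. g <#\<^bsub>G\<^esub> x) = M" if "g \<in> carrier ?G" for g using W.invariant[of g] that Hc by auto
  qed (rule compact W.sets_M W.prob)+
  moreover have "nil_action_axioms ?G ?\<tau> (\<lambda>g x. g <#\<^bsub>G\<^esub> x) M N b B s"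
  proof (intro nil_action_axioms.intro)
    show "carrier ?G \<subseteq> S" if "subgroup S ?G" "N \<subseteq> S" "b \<in> S" for S
      using H_min[OF S_sub[OF that(1)] that(2,3)] by simp
    show "openin ?\<tau> N" using N_open H_open NH by (simp add: openin_open_subtopology)
    show "N \<subseteq> S" if "subgroup S ?G" "B \<subseteq> S" for S using B_min[OF S_sub[OF that(1)] that(2)] .
    show "\<exists>n0. \<forall>n\<ge>n0. \<exists>P w. root_product ?G W n z P w \<and> P \<in> W" if "z \<in> B" "HG.nbhd W" for z W
      using B(2)[OF that(1) nbhdH[OF that(2)]] root_product_subgroup_group[of W _ z _ _ H] by blast
    have "comm_series ?G N s \<subseteq> {\<one>}" using comm_series_subgroup_group[OF H_sub FG.filtered_group_axioms] nil by metis
    then show "comm_series ?G N s = {\<one>\<^bsub>?G\<^esub>}" using FG.L_one[of s] by auto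
    show "b \<in> carrier ?G" using bH by simp
  qed (rule BN erg)+
  ultimately have "nil_action ?G ?\<tau> X (\<lambda>g x. g <#\<^bsub>G\<^esub> x) M \<Gamma> N b B s"
    by (rule nil_action.intro[OF _ FG.filtered_group_axioms])
  then show ?thesis by (intro exI)
qed

end

section \<open>The Kronecker factor\<close>

context nil_action
begin

lemma CI_compose:
  assumes "\<phi> \<in> CI k" "continuous_on UNIV F"
  shows "(\<lambda>x. F (\<phi> x)) \<in> CI k"
proof -
  have "continuous_map X euclideanreal (F \<circ> \<phi>)"
    using assms by (intro continuous_map_compose[of X euclideanreal]) (auto simp: CI_def Cont_def)
  then show ?thesis using assms(1) by (auto simp: CI_def Cont_def o_def)
qed

lemma CI_mult: "\<phi> \<in> CI k \<Longrightarrow> \<psi> \<in> CI k \<Longrightarrow> (\<lambda>x. \<phi> x * \<psi> x) \<in> CI k"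
  by (auto simp: CI_def intro: Cont_intros)

lemma pow_act: "x \<in> topspace X \<Longrightarrow> (act b ^^ n) x = act (b [^] n) x"
proof (induction n)
  case (Suc n)
  then have "(act b ^^ Suc n) x = act (b \<otimes> b [^] n) x" by (simp add: act_mult)
  also have "b \<otimes> b [^] n = b [^] Suc n" using nat_pow_Suc2[OF b_carrier] by simp
  finally show ?case .
qed (simp add: act_one)

end

locale ergodic_nil_action = nil_action G \<tau> X act M x0 N b B s
  for G (structure) and \<tau> and X :: "'x topology" and act M x0 N b B s +
  assumes Hausdorff: "Hausdorff_space X" and countable: "second_countable X"
begin

sublocale ergodic_system M "act b"
  by unfold_locales (auto intro: invariant ergodic_b act_measurable)

lemma Cont_bdd: "\<phi> \<in> Cont \<Longrightarrow> \<exists>C. bdd C (\<lambda>x. complex_of_real (\<phi> x))"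
proof -
  assume \<phi>: "\<phi> \<in> Cont"
  obtain C where "\<And>x. x \<in> topspace X \<Longrightarrow> \<bar>\<phi> x\<bar> \<le> C" using Cont_bounded[OF \<phi>] by metis
  then have "bdd C (\<lambda>x. complex_of_real (\<phi> x))"
    using measurable_compose[OF Cont_measurable[OF \<phi>] borel_measurable_of_real] by (simp add: bdd_def space_M)
  then show ?thesis by blast
qed

definition orth :: "('x \<Rightarrow> complex) \<Rightarrow> bool" where
  "orth f \<longleftrightarrow> (\<forall>\<phi>\<in>CI 1. (\<integral>x. complex_of_real (\<phi> x) * f x \<partial>M) = 0)"

text \<open>\<open>characteristic_functions\<close> compares correlations of continuous functions
  only, so \<open>u\<close> is approximated in mean by a continuous \<open>\<phi>\<close>. The
  correlations of \<open>u\<close> with \<open>h\<close> vanish for every \<open>n\<close>, because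
  translates of \<open>h\<close> are again in \<open>CI 1\<close>.\<close>

lemma orth_weak_limit_Cont:
  assumes u: "u \<in> borel_measurable M" "\<And>x. x \<in> space M \<Longrightarrow> \<bar>u x\<bar> \<le> C"
    and orth: "\<And>\<phi>. \<phi> \<in> CI 1 \<Longrightarrow> (\<integral>x. \<phi> x * u x \<partial>M) = 0" and g: "g \<in> Cont"
  shows "(\<lambda>n. \<integral>x. g x * u (act (b [^] (n::nat)) x) \<partial>M) \<longlonglongrightarrow> (0 :: real)"
proof -
  obtain h where h: "h \<in> CI 1" "\<And>f. f \<in> Cont \<Longrightarrow> (\<lambda>n. I n f g - I n f h) \<longlonglongrightarrow> 0"
    using characteristic_functions[OF g] by blast
  have hC: "h \<in> Cont" by (rule CI_Cont[OF h(1)])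
  obtain D where D: "D > 0" "\<And>x. x \<in> topspace X \<Longrightarrow> \<bar>g x - h x\<bar> \<le> D"
    using Cont_bounded[OF Cont_intros(2)[OF g hC]] by metis
  have ui: "integrable M u" by (rule integrable_bounded[of u C]) (use u in auto)
  have bn: "b [^] n \<in> carrier G" for n :: nat by simp
  have um: "(\<lambda>x. u (act (b [^] n) x)) \<in> borel_measurable M" for n :: nat
    using measurable_compose[OF act_measurable[OF bn] u(1)] .
  have ub: "\<bar>u (act (b [^] n) x)\<bar> \<le> C" if "x \<in> space M" for n :: nat and x
    using u(2)[of "act (b [^] n) x"] that by (simp add: space_M)
  have prod: "integrable M (\<lambda>x. \<phi> x * u (act (b [^] n) x))" if \<phi>: "\<phi> \<in> Cont" for \<phi> and n :: nat
  proof -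
    obtain K where K: "K > 0" "\<And>x. x \<in> topspace X \<Longrightarrow> \<bar>\<phi> x\<bar> \<le> K" using Cont_bounded[OF \<phi>] by metis
    show ?thesis
    proof (rule integrable_bounded[of _ "K * C"])
      show "(\<lambda>x. \<phi> x * u (act (b [^] n) x)) \<in> borel_measurable M"
        using Cont_measurable[OF \<phi>] um by (rule borel_measurable_times)
      show "norm (\<phi> x * u (act (b [^] n) x)) \<le> K * C" if "x \<in> space M" for x
        using K(1) K(2)[of x] ub[OF that, of n] that unfolding real_norm_def abs_mult
        by (intro mult_mono) (auto simp: space_M)
    qed
  qed
  have hz: "(\<integral>x. h x * u (act (b [^] n) x) \<partial>M) = 0" for n :: nat
  proof -
    let ?c = "inv (b [^] n)"
    have "(\<integral>x. h x * u (act (b [^] n) x) \<partial>M) = (\<integral>x. h (act ?c (act (b [^] n) x)) * u (act (b [^] n) x) \<partial>M)"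
      by (intro Bochner_Integration.integral_cong refl) (simp add: space_M act_inv)
    also have "\<dots> = (\<integral>x. h (act ?c x) * u x \<partial>M)"
    proof (rule integral_act)
      show "(\<lambda>x. h (act ?c x) * u x) \<in> borel_measurable M"
        using Cont_measurable[OF Cont_act[OF hC, of ?c]] u(1) by (intro borel_measurable_times) auto
    qed simp
    also have "\<dots> = 0" by (rule orth[OF CI_act[OF h(1)]]) simp
    finally show ?thesis .
  qed
  show ?thesis
  proof (rule LIMSEQ_I)
    fix e :: real assume e: "e > 0"
    obtain \<phi> where \<phi>: "\<phi> \<in> Cont" "(\<integral>x. \<bar>u x - \<phi> x\<bar> \<partial>M) < e / (2 * D)"
      using Cont_dense_L1[OF Hausdorff countable ui] e D(1) by (metis divide_pos_pos mult_pos_pos zero_less_numeral)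
    obtain n0 where n0: "\<And>n. n \<ge> n0 \<Longrightarrow> \<bar>I n \<phi> g - I n \<phi> h\<bar> < e / 2"
      using LIMSEQ_D[OF h(2)[OF \<phi>(1)], of "e / 2"] e by auto
    have i: "integrable M (\<lambda>x. \<bar>u x - \<phi> x\<bar>)" using ui Cont_integrable[OF \<phi>(1)] by simp
    have "\<bar>\<integral>x. g x * u (act (b [^] n) x) \<partial>M\<bar> < e" if n: "n \<ge> n0" for n
    proof -
      let ?v = "\<lambda>x. u (act (b [^] n) x) - \<phi> (act (b [^] n) x)"
      note pu = prod[OF g, of n] prod[OF hC, of n]
      note p\<phi> = I_integrable[OF \<phi>(1) g, of n] I_integrable[OF \<phi>(1) hC, of n]
      have vi: "integrable M (\<lambda>x. \<bar>?v x\<bar>)"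
        using prod[OF Cont_intros(8)[of 1], of n] Cont_integrable[OF Cont_act[OF \<phi>(1) bn], of n] by simp
      \<comment> \<open>Subtracting \<open>h\<close> from \<open>g\<close> costs nothing by
        \<open>hz\<close>. The first term is small because \<open>u\<close> is close to
        \<open>\<phi>\<close>, uniformly in \<open>n\<close>; the second is the asymptotic equality
        for continuous functions.\<close>
      have "(\<integral>x. g x * u (act (b [^] n) x) \<partial>M) = (\<integral>x. (g x - h x) * ?v x \<partial>M) + (I n \<phi> g - I n \<phi> h)"
        using pu p\<phi> hz[of n] by (simp add: I_def left_diff_distrib right_diff_distrib mult.commute)
      moreover have "\<bar>\<integral>x. (g x - h x) * ?v x \<partial>M\<bar> \<le> D * (\<integral>x. \<bar>u x - \<phi> x\<bar> \<partial>M)"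
      proof -
        have "\<bar>\<integral>x. (g x - h x) * ?v x \<partial>M\<bar> \<le> (\<integral>x. \<bar>(g x - h x) * ?v x\<bar> \<partial>M)" by (rule integral_abs_bound)
        also have "\<dots> \<le> (\<integral>x. D * \<bar>?v x\<bar> \<partial>M)"
        proof (rule integral_mono)
          show "integrable M (\<lambda>x. \<bar>(g x - h x) * ?v x\<bar>)"
            using pu p\<phi> by (simp add: left_diff_distrib right_diff_distrib mult.commute)
          show "integrable M (\<lambda>x. D * \<bar>?v x\<bar>)" using vi by simp
          show "\<bar>(g x - h x) * ?v x\<bar> \<le> D * \<bar>?v x\<bar>" if "x \<in> space M" for x
            using D(2)[of x] that by (simp add: space_M abs_mult mult_right_mono)
        qed
        also have "\<dots> = D * (\<integral>x. \<bar>?v x\<bar> \<partial>M)" by simp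
        also have "(\<integral>x. \<bar>?v x\<bar> \<partial>M) = (\<integral>x. \<bar>u x - \<phi> x\<bar> \<partial>M)"
          by (rule integral_act[OF _ bn]) (use u(1) Cont_measurable[OF \<phi>(1)] in measurable)
        finally show ?thesis .
      qed
      moreover have "D * (\<integral>x. \<bar>u x - \<phi> x\<bar> \<partial>M) < e / 2" using \<phi>(2) D(1) by (simp add: field_simps)
      ultimately show ?thesis using n0[OF n] by linarith
    qed
    then show "\<exists>no. \<forall>n::nat\<ge>no. norm ((\<integral>x. g x * u (act (b [^] n) x) \<partial>M) - 0) < e" by (intro exI[of _ n0]) auto
  qed
qed

text \<open>The iterates of \<open>u\<close> are uniformly bounded, so approximating the fixed
  factor \<open>v\<close> in mean by a continuous function gives an error independent of
  \<open>n\<close>.\<close>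

lemma orth_weak_limit_real:
  assumes u: "u \<in> borel_measurable M" "\<And>x. x \<in> space M \<Longrightarrow> \<bar>u x\<bar> \<le> C"
    and orth: "\<And>\<phi>. \<phi> \<in> CI 1 \<Longrightarrow> (\<integral>x. \<phi> x * u x \<partial>M) = 0"
    and v: "v \<in> borel_measurable M" "\<And>x. x \<in> space M \<Longrightarrow> \<bar>v x\<bar> \<le> D"
  shows "(\<lambda>n. \<integral>x. v x * u ((act b ^^ n) x) \<partial>M) \<longlonglongrightarrow> (0 :: real)"
proof (rule LIMSEQ_I)
  fix e :: real assume e: "e > 0"
  have um: "(\<lambda>x. u ((act b ^^ n) x)) \<in> borel_measurable M" for n
    using measurable_compose[OF iter_measurable u(1)] .
  have ub: "\<bar>u ((act b ^^ n) x)\<bar> \<le> C" if "x \<in> space M" for n x using u(2)[OF iter_space[OF that]] .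
  have C: "C \<ge> 0" using u(2) not_empty by fastforce
  have vi: "integrable M v" by (rule integrable_bounded[of v D]) (use v in auto)
  have "\<exists>g\<in>Cont. (\<integral>x. \<bar>v x - g x\<bar> \<partial>M) < e / (2 * (C + 1))"
    using Cont_dense_L1[OF Hausdorff countable vi] e C by simp
  then obtain g where g: "g \<in> Cont" "(\<integral>x. \<bar>v x - g x\<bar> \<partial>M) < e / (2 * (C + 1))" by blast
  have di: "integrable M (\<lambda>x. \<bar>v x - g x\<bar>)" using vi Cont_integrable[OF g(1)] by simp
  have mult_int: "integrable M (\<lambda>x. w x * u ((act b ^^ n) x))" if w: "integrable M w" for w n
  proof (rule Bochner_Integration.integrable_bound)
    show "integrable M (\<lambda>x. C * w x)" using w by simp
    show "(\<lambda>x. w x * u ((act b ^^ n) x)) \<in> borel_measurable M"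
      using borel_measurable_integrable[OF w] um by (rule borel_measurable_times)
    show "AE x in M. norm (w x * u ((act b ^^ n) x)) \<le> norm (C * w x)"
    proof (rule AE_I2)
      fix x assume "x \<in> space M"
      then have "\<bar>u ((act b ^^ n) x)\<bar> * \<bar>w x\<bar> \<le> C * \<bar>w x\<bar>" using ub by (intro mult_right_mono) auto
      then show "norm (w x * u ((act b ^^ n) x)) \<le> norm (C * w x)" using C by (simp add: abs_mult mult.commute)
    qed
  qed
  have "(\<lambda>n. \<integral>x. g x * u ((act b ^^ n) x) \<partial>M) \<longlonglongrightarrow> 0"
  proof -
    have "(\<integral>x. g x * u ((act b ^^ n) x) \<partial>M) = (\<integral>x. g x * u (act (b [^] n) x) \<partial>M)" for n
      by (intro Bochner_Integration.integral_cong) (auto simp: space_M pow_act)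
    then show ?thesis using orth_weak_limit_Cont[OF u orth g(1)] by simp
  qed
  then obtain n0 where n0: "\<And>n. n \<ge> n0 \<Longrightarrow> \<bar>\<integral>x. g x * u ((act b ^^ n) x) \<partial>M\<bar> < e / 2"
    using LIMSEQ_D[of _ 0 "e / 2"] e by fastforce
  have "\<bar>\<integral>x. v x * u ((act b ^^ n) x) \<partial>M\<bar> < e" if n: "n \<ge> n0" for n
  proof -
    have d: "integrable M (\<lambda>x. v x - g x)" using vi Cont_integrable[OF g(1)] by simp
    have "(\<integral>x. v x * u ((act b ^^ n) x) \<partial>M) =
      (\<integral>x. (v x - g x) * u ((act b ^^ n) x) \<partial>M) + (\<integral>x. g x * u ((act b ^^ n) x) \<partial>M)"
      using mult_int[OF vi, of n] mult_int[OF Cont_integrable[OF g(1)], of n] by (simp add: left_diff_distrib)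
    moreover have "\<bar>\<integral>x. (v x - g x) * u ((act b ^^ n) x) \<partial>M\<bar> \<le> C * (\<integral>x. \<bar>v x - g x\<bar> \<partial>M)"
    proof -
      have "\<bar>\<integral>x. (v x - g x) * u ((act b ^^ n) x) \<partial>M\<bar> \<le> (\<integral>x. \<bar>(v x - g x) * u ((act b ^^ n) x)\<bar> \<partial>M)"
        by (rule integral_abs_bound)
      also have "\<dots> \<le> (\<integral>x. C * \<bar>v x - g x\<bar> \<partial>M)"
      proof (rule integral_mono)
        show "integrable M (\<lambda>x. \<bar>(v x - g x) * u ((act b ^^ n) x)\<bar>)" using mult_int[OF d] by (rule integrable_abs)
        show "integrable M (\<lambda>x. C * \<bar>v x - g x\<bar>)" using di by simp
        fix x assume "x \<in> space M"
        then have "\<bar>u ((act b ^^ n) x)\<bar> * \<bar>v x - g x\<bar> \<le> C * \<bar>v x - g x\<bar>" using ub by (intro mult_right_mono) auto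
        then show "\<bar>(v x - g x) * u ((act b ^^ n) x)\<bar> \<le> C * \<bar>v x - g x\<bar>" by (simp add: abs_mult mult.commute)
      qed
      finally show ?thesis by simp
    qed
    moreover have "C * (\<integral>x. \<bar>v x - g x\<bar> \<partial>M) \<le> (C + 1) * (\<integral>x. \<bar>v x - g x\<bar> \<partial>M)"
      by (intro mult_right_mono Bochner_Integration.integral_nonneg) auto
    moreover have "(C + 1) * (\<integral>x. \<bar>v x - g x\<bar> \<partial>M) < e / 2" using g(2) C by (simp add: field_simps)
    ultimately show ?thesis using n0[OF n] by linarith
  qed
  then show "\<exists>no. \<forall>n\<ge>no. norm ((\<integral>x. v x * u ((act b ^^ n) x) \<partial>M) - 0) < e" by (intro exI[of _ n0]) auto
qed

lemma integrable_Re_Im: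
  assumes "integrable M (\<lambda>x. f x :: complex)"
  shows "(\<integral>x. f x \<partial>M) = Complex (\<integral>x. Re (f x) \<partial>M) (\<integral>x. Im (f x) \<partial>M)"
  using integral_bounded_linear[OF bounded_linear_Re assms] integral_bounded_linear[OF bounded_linear_Im assms]
  by (simp add: complex_eq_iff)

lemma orth_Re_Im:
  assumes f: "bdd C f"
  shows "orth f \<longleftrightarrow> (\<forall>\<phi>\<in>CI 1. (\<integral>x. \<phi> x * Re (f x) \<partial>M) = 0 \<and> (\<integral>x. \<phi> x * Im (f x) \<partial>M) = 0)"
proof -
  have "integrable M (\<lambda>x. complex_of_real (\<phi> x) * f x)" if "\<phi> \<in> CI 1" for \<phi>
    using Cont_bdd[OF CI_Cont[OF that]] bdd_integrable[OF bdd_mult[OF _ f]] by blast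
  then show ?thesis by (auto simp: orth_def integrable_Re_Im complex_eq_iff)
qed

lemma bdd_Re_Im:
  assumes "bdd C f"
  shows "(\<lambda>x. Re (f x)) \<in> borel_measurable M" "(\<lambda>x. Im (f x)) \<in> borel_measurable M"
    "x \<in> space M \<Longrightarrow> \<bar>Re (f x)\<bar> \<le> C" "x \<in> space M \<Longrightarrow> \<bar>Im (f x)\<bar> \<le> C"
proof -
  have "f \<in> borel_measurable M" by (rule bdd_measurable[OF assms])
  then show "(\<lambda>x. Re (f x)) \<in> borel_measurable M" "(\<lambda>x. Im (f x)) \<in> borel_measurable M" by measurable
  show "\<bar>Re (f x)\<bar> \<le> C" "\<bar>Im (f x)\<bar> \<le> C" if "x \<in> space M"
    using bdd_bound[OF assms that] abs_Re_le_cmod[of "f x"] abs_Im_le_cmod[of "f x"] by linarith+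
qed

lemma orth_weak_limit:
  assumes f: "bdd C f" "orth f" and g: "bdd D g"
  shows "(\<lambda>n. \<integral>x. g x * f ((act b ^^ n) x) \<partial>M) \<longlonglongrightarrow> 0"
proof -
  note R = bdd_Re_Im[OF f(1)] and S = bdd_Re_Im[OF g]
  have o: "(\<integral>x. \<phi> x * Re (f x) \<partial>M) = 0" "(\<integral>x. \<phi> x * Im (f x) \<partial>M) = 0" if "\<phi> \<in> CI 1" for \<phi>
    using f orth_Re_Im[OF f(1)] that by auto
  note lim = orth_weak_limit_real[OF R(1,3) o(1) S(1,3)] orth_weak_limit_real[OF R(1,3) o(1) S(2,4)]
    orth_weak_limit_real[OF R(2,4) o(2) S(1,3)] orth_weak_limit_real[OF R(2,4) o(2) S(2,4)]
  have int: "integrable M (\<lambda>x. v (g x) * u (f ((act b ^^ n) x)))" if "u \<in> {Re, Im}" "v \<in> {Re, Im}" for u v n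
  proof (rule integrable_bounded[of _ "D * C"])
    note R' = bdd_Re_Im[OF bdd_iter[OF f(1), of n]]
    show "(\<lambda>x. v (g x) * u (f ((act b ^^ n) x))) \<in> borel_measurable M"
      using that S(1,2) R'(1,2) by (auto intro: borel_measurable_times)
    show "norm (v (g x) * u (f ((act b ^^ n) x))) \<le> D * C" if x: "x \<in> space M" for x
      using \<open>u \<in> {Re, Im}\<close> \<open>v \<in> {Re, Im}\<close> S(3,4)[OF x] R'(3,4)[OF x]
      by (auto simp: abs_mult intro!: mult_mono bdd_nonneg[OF g])
  qed
  have eq: "(\<integral>x. g x * f ((act b ^^ n) x) \<partial>M) = Complex
      ((\<integral>x. Re (g x) * Re (f ((act b ^^ n) x)) \<partial>M) - (\<integral>x. Im (g x) * Im (f ((act b ^^ n) x)) \<partial>M))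
      ((\<integral>x. Re (g x) * Im (f ((act b ^^ n) x)) \<partial>M) + (\<integral>x. Im (g x) * Re (f ((act b ^^ n) x)) \<partial>M))" for n
    using integrable_Re_Im[OF bdd_integrable[OF bdd_mult[OF g bdd_iter[OF f(1), of n]]]]
      int[of Re Re n] int[of Im Im n] int[of Re Im n] int[of Im Re n] by simp
  have "(\<lambda>n. \<integral>x. g x * f ((act b ^^ n) x) \<partial>M) \<longlonglongrightarrow> Complex (0 - 0) (0 + 0)"
    unfolding eq by (intro tendsto_Complex tendsto_diff tendsto_add lim) auto
  then show ?thesis by (simp add: zero_complex.code)
qed

lemma seminorm_zero_imp_orth:
  assumes f: "bdd C f" and lim: "(\<lambda>H. (\<Sum>h=1..H. (norm (corr f h))\<^sup>2) / H) \<longlonglongrightarrow> 0"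
  shows "orth f"
  unfolding orth_def
proof
  fix \<phi> assume \<phi>: "\<phi> \<in> CI 1"
  have \<phi>C: "\<phi> \<in> Cont" by (rule CI_Cont[OF \<phi>])
  obtain D where D: "bdd D (\<lambda>x. complex_of_real (\<phi> x))" using Cont_bdd[OF \<phi>C] by blast
  show "(\<integral>x. complex_of_real (\<phi> x) * f x \<partial>M) = 0"
  proof (rule almost_periodic_orthogonal[OF f D lim])
    fix e :: real assume "e > 0"
    from CI_1_almost_periodic[OF \<phi> this] obtain F where F: "finite F" "F \<subseteq> carrier G"
      "\<And>g. g \<in> carrier G \<Longrightarrow> \<exists>h\<in>F. \<forall>x\<in>topspace X. \<bar>\<phi> (act g x) - \<phi> (act h x)\<bar> < e" by blast
    let ?\<Psi> = "(\<lambda>g x. complex_of_real (\<phi> (act g x))) ` F"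
    have "\<exists>D. bdd D \<psi>" if "\<psi> \<in> ?\<Psi>" for \<psi> using that F(2) Cont_bdd[OF Cont_act[OF \<phi>C]] by auto
    moreover have "\<exists>\<psi>\<in>?\<Psi>. \<forall>x\<in>space M. norm (complex_of_real (\<phi> ((act b ^^ h) x)) - \<psi> x) \<le> e" for h
    proof -
      obtain k where k: "k \<in> F" "\<And>x. x \<in> topspace X \<Longrightarrow> \<bar>\<phi> (act (b [^] h) x) - \<phi> (act k x)\<bar> < e"
        using F(3)[of "b [^] h"] by auto
      have "norm (complex_of_real (\<phi> ((act b ^^ h) x)) - complex_of_real (\<phi> (act k x))) \<le> e" if "x \<in> space M" for x
      proof -
        have "norm (complex_of_real (\<phi> ((act b ^^ h) x)) - complex_of_real (\<phi> (act k x))) = \<bar>\<phi> (act (b [^] h) x) - \<phi> (act k x)\<bar>"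
          using that unfolding of_real_diff[symmetric] norm_of_real by (simp add: space_M pow_act)
        then show ?thesis using k(2)[of x] that by (simp add: space_M)
      qed
      then show ?thesis using k(1) by (intro bexI[OF _ imageI]) auto
    qed
    ultimately show "\<exists>\<Psi>. finite \<Psi> \<and> (\<forall>\<psi>\<in>\<Psi>. \<exists>D. bdd D \<psi>) \<and>
      (\<forall>h. \<exists>\<psi>\<in>\<Psi>. \<forall>x\<in>space M. norm (complex_of_real (\<phi> ((act b ^^ h) x)) - \<psi> x) \<le> e)"
      using F(1) by (intro exI[of _ ?\<Psi>]) auto
  qed
qed

text \<open>Up to conjugation a self-correlation is a correlation of \<open>f\<close> with the fixed
  function \<open>cnj (f x)\<close>.\<close>

lemma weak_limit_imp_seminorm_zero:
  assumes f: "bdd C f" and lim: "\<And>g. bdd C g \<Longrightarrow> (\<lambda>n. \<integral>x. g x * f ((act b ^^ n) x) \<partial>M) \<longlonglongrightarrow> 0"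
  shows "(\<lambda>H. (\<Sum>h=1..H. (norm (corr f h))\<^sup>2) / H) \<longlonglongrightarrow> 0"
proof -
  have "corr f h = cnj (\<integral>x. cnj (f x) * f ((act b ^^ h) x) \<partial>M)" for h
    unfolding corr_def by (subst Bochner_Integration.integral_cnj[symmetric]) simp
  then have "(norm (corr f h))\<^sup>2 = (norm (\<integral>x. cnj (f x) * f ((act b ^^ h) x) \<partial>M))\<^sup>2" for h by simp
  moreover have "(\<lambda>h. (norm (\<integral>x. cnj (f x) * f ((act b ^^ h) x) \<partial>M))\<^sup>2) \<longlonglongrightarrow> 0\<^sup>2"
    using lim[OF bdd_cnj[OF f]] by (intro tendsto_power tendsto_norm_zero)
  ultimately have "(\<lambda>h. (norm (corr f h))\<^sup>2) \<longlonglongrightarrow> 0" by simp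
  then show ?thesis by (rule cesaro_zero)
qed

end

section \<open>The Kronecker factor as a sigma-algebra\<close>

context ergodic_nil_action
begin

text \<open>For an ergodic system this realises the Kronecker factor.\<close>

definition kronecker :: "'x measure" where
  "kronecker = sigma (topspace X) ((\<lambda>\<phi>. {x \<in> topspace X. \<phi> x > 0}) ` CI 1)"

lemma space_kronecker: "space kronecker = topspace X"
  by (simp add: kronecker_def space_measure_of_conv)

lemma sets_kronecker:
  "sets kronecker = sigma_sets (topspace X) ((\<lambda>\<phi>. {x \<in> topspace X. \<phi> x > 0}) ` CI 1)"
  unfolding kronecker_def by (rule sets_measure_of) auto

lemma positive_in_kronecker: "\<phi> \<in> CI 1 \<Longrightarrow> {x \<in> topspace X. \<phi> x > 0} \<in> sets kronecker"
  by (auto simp: sets_kronecker intro!: sigma_sets.Basic)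

lemma CI_kronecker_measurable:
  assumes "\<phi> \<in> CI 1"
  shows "\<phi> \<in> borel_measurable kronecker"
proof (rule borel_measurable_iff_greater[THEN iffD2], rule allI)
  fix a
  have "(\<lambda>x. \<phi> x - a) \<in> CI 1" by (rule CI_compose[OF assms]) (intro continuous_intros)
  from positive_in_kronecker[OF this] show "{w \<in> space kronecker. a < \<phi> w} \<in> sets kronecker"
    by (simp add: space_kronecker)
qed

lemma subalgebra_kronecker: "subalgebra M kronecker"
  unfolding subalgebra_def
proof
  show "space kronecker = space M" by (simp add: space_kronecker space_M)
  have "{x \<in> topspace X. \<phi> x > 0} \<in> sets M" if "\<phi> \<in> CI 1" for \<phi>
    using borel_measurable_iff_greater[THEN iffD1, OF Cont_measurable[OF CI_Cont[OF that]]] by (simp add: space_M)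
  then have "(\<lambda>\<phi>. {x \<in> topspace X. \<phi> x > 0}) ` CI 1 \<subseteq> sets M" by auto
  from sets.sigma_sets_subset[OF this] show "sets kronecker \<subseteq> sets M"
    by (simp only: sets_kronecker space_M)
qed

sublocale K: finite_measure_subalgebra M kronecker
  by unfold_locales (rule subalgebra_kronecker)

lemma act_kronecker_measurable:
  assumes g: "g \<in> carrier G"
  shows "act g \<in> measurable kronecker kronecker"
proof -
  have "act g \<in> measurable kronecker (sigma (topspace X) ((\<lambda>\<phi>. {x \<in> topspace X. \<phi> x > 0}) ` CI 1))"
  proof (rule measurable_measure_of)
    show "(\<lambda>\<phi>. {x \<in> topspace X. \<phi> x > 0}) ` CI 1 \<subseteq> Pow (topspace X)" by auto
    show "act g \<in> space kronecker \<rightarrow> topspace X" using g by (auto simp: space_kronecker)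
    fix A assume "A \<in> (\<lambda>\<phi>. {x \<in> topspace X. \<phi> x > 0}) ` CI 1"
    then obtain \<phi> where \<phi>: "\<phi> \<in> CI 1" "A = {x \<in> topspace X. \<phi> x > 0}" by auto
    have "act g -` A \<inter> space kronecker = {x \<in> topspace X. \<phi> (act g x) > 0}"
      using g by (auto simp: \<phi>(2) space_kronecker)
    then show "act g -` A \<inter> space kronecker \<in> sets kronecker"
      using positive_in_kronecker[OF CI_act[OF \<phi>(1) g]] by simp
  qed
  then show ?thesis by (simp add: kronecker_def)
qed

lemma kronecker_invariant: "{act b -` A \<inter> space M | A. A \<in> sets kronecker} = sets kronecker"
proof (intro equalityI subsetI)
  fix S assume "S \<in> {act b -` A \<inter> space M | A. A \<in> sets kronecker}"
  then show "S \<in> sets kronecker"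
    using measurable_sets[OF act_kronecker_measurable[OF b_carrier]] by (auto simp: space_M space_kronecker)
next
  fix A assume A: "A \<in> sets kronecker"
  let ?A = "act (inv b) -` A \<inter> space kronecker"
  have "A \<subseteq> topspace X" using sets.sets_into_space[OF A] by (simp add: space_kronecker)
  then have "A = act b -` ?A \<inter> space M"
    by (auto simp: space_M space_kronecker)
  moreover have "?A \<in> sets kronecker" by (rule measurable_sets[OF act_kronecker_measurable A]) simp
  ultimately show "A \<in> {act b -` A \<inter> space M | A. A \<in> sets kronecker}" by blast
qed

text \<open>The product of the positive parts is positive exactly on the intersection. Stability
  under intersections prepares the Dynkin argument for integrals over sets of the factor.\<close>

lemma positive_Int_stable: "Int_stable ((\<lambda>\<phi>. {x \<in> topspace X. \<phi> x > (0 :: real)}) ` CI 1)"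
proof (rule Int_stableI)
  fix A B assume "A \<in> (\<lambda>\<phi>. {x \<in> topspace X. \<phi> x > 0}) ` CI 1" "B \<in> (\<lambda>\<phi>. {x \<in> topspace X. \<phi> x > 0}) ` CI 1"
  then obtain \<phi> \<psi> where *: "\<phi> \<in> CI 1" "A = {x \<in> topspace X. \<phi> x > 0}" "\<psi> \<in> CI 1" "B = {x \<in> topspace X. \<psi> x > 0}"
    by auto
  let ?\<theta> = "\<lambda>x. max 0 (\<phi> x) * max 0 (\<psi> x)"
  have "?\<theta> \<in> CI 1"
    by (intro CI_mult CI_compose[OF *(1), of "\<lambda>t. max 0 t"] CI_compose[OF *(3), of "\<lambda>t. max 0 t"] continuous_intros)
  moreover have "A \<inter> B = {x \<in> topspace X. ?\<theta> x > 0}"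
    by (auto simp: *(2,4) zero_less_mult_iff max_def)
  ultimately show "A \<inter> B \<in> (\<lambda>\<phi>. {x \<in> topspace X. \<phi> x > 0}) ` CI 1" by (intro image_eqI[of _ _ ?\<theta>])
qed

text \<open>The indicator is the pointwise limit of the functions
  \<open>min 1 (n * max 0 \<phi>)\<close>, which are continuous in \<open>\<phi>\<close> and so stay
  in \<open>CI 1\<close>.\<close>

lemma orth_positive:
  assumes u: "u \<in> borel_measurable M" "\<And>x. x \<in> space M \<Longrightarrow> \<bar>u x\<bar> \<le> C"
    and orth: "\<And>\<phi>. \<phi> \<in> CI 1 \<Longrightarrow> (\<integral>x. \<phi> x * u x \<partial>M) = 0" and \<phi>: "\<phi> \<in> CI 1"
  shows "(\<integral>x. indicator {x \<in> topspace X. \<phi> x > 0} x * u x \<partial>M) = (0 :: real)"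
proof -
  let ?F = "\<lambda>n t. min 1 (real n * max 0 t)"
  have F: "(\<lambda>x. ?F n (\<phi> x)) \<in> CI 1" for n
    by (rule CI_compose[OF \<phi>, of "?F n"]) (intro continuous_intros)
  have "(\<lambda>n. \<integral>x. ?F n (\<phi> x) * u x \<partial>M) \<longlonglongrightarrow> (\<integral>x. indicator {x \<in> topspace X. \<phi> x > 0} x * u x \<partial>M)"
  proof (rule integral_dominated_convergence[where w = "\<lambda>x. C"])
    show "(\<lambda>x. indicator {x \<in> topspace X. 0 < \<phi> x} x * u x) \<in> borel_measurable M"
      using positive_in_kronecker[OF \<phi>] subalgebra_kronecker u(1)
      by (intro borel_measurable_times borel_measurable_indicator) (auto simp: subalgebra_def)
    show "(\<lambda>x. ?F n (\<phi> x) * u x) \<in> borel_measurable M" for n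
      using Cont_measurable[OF CI_Cont[OF F]] u(1) by (rule borel_measurable_times)
    show "AE x in M. (\<lambda>n. ?F n (\<phi> x) * u x) \<longlonglongrightarrow> indicator {x \<in> topspace X. 0 < \<phi> x} x * u x"
    proof (rule AE_I2, rule tendsto_mult_right)
      fix x assume x: "x \<in> space M"
      show "(\<lambda>n. ?F n (\<phi> x)) \<longlonglongrightarrow> indicator {x \<in> topspace X. 0 < \<phi> x} x"
      proof (cases "\<phi> x > 0")
        case True
        obtain n0 :: nat where n0: "1 / \<phi> x < n0" using reals_Archimedean2 by blast
        have "?F n (\<phi> x) = 1" if "n \<ge> n0" for n
        proof -
          have "1 < n0 * \<phi> x" using n0 True by (simp add: field_simps)
          also have "\<dots> \<le> n * \<phi> x" using that True by (intro mult_right_mono) auto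
          finally show ?thesis using True by simp
        qed
        then have "eventually (\<lambda>n. ?F n (\<phi> x) = 1) sequentially" by (rule eventually_sequentiallyI)
        then show ?thesis using True x by (simp add: space_M tendsto_eventually)
      qed simp
    qed
    show "AE x in M. norm (?F n (\<phi> x) * u x) \<le> C" for n
    proof (rule AE_I2)
      fix x assume x: "x \<in> space M"
      have "\<bar>?F n (\<phi> x)\<bar> * \<bar>u x\<bar> \<le> 1 * C" using u(2)[OF x] by (intro mult_mono) auto
      then show "norm (?F n (\<phi> x) * u x) \<le> C" by (simp add: abs_mult)
    qed
  qed simp
  moreover have "(\<integral>x. ?F n (\<phi> x) * u x \<partial>M) = 0" for n by (rule orth[OF F])
  ultimately show ?thesis by (simp add: LIMSEQ_const_iff)
qed

text \<open>The sets over which \<open>u\<close> integrates to 0 form a Dynkin system containing the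
  generators, which yields all sets of the factor and thus a vanishing conditional expectation.
  Conversely a function in \<open>CI 1\<close> is measurable for the factor, so it may be integrated
  against the conditional expectation instead of \<open>u\<close>.\<close>

lemma orth_iff_cond_exp_real:
  assumes u: "u \<in> borel_measurable M" "\<And>x. x \<in> space M \<Longrightarrow> \<bar>u x\<bar> \<le> C"
  shows "(\<forall>\<phi>\<in>CI 1. (\<integral>x. \<phi> x * u x \<partial>M) = 0) \<longleftrightarrow> (AE x in M. real_cond_exp M kronecker u x = 0)"
proof
  assume orth: "\<forall>\<phi>\<in>CI 1. (\<integral>x. \<phi> x * u x \<partial>M) = 0"
  let ?E = "(\<lambda>\<phi>. {x \<in> topspace X. \<phi> x > (0 :: real)}) ` CI 1"
  have ui: "integrable M u" by (rule integrable_bounded[of u C]) (use u in auto)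
  have iu: "integrable M (\<lambda>x. indicator A x * u x)" if "A \<in> sets M" for A
    using integrable_mult_indicator[OF that ui] by simp
  have KM: "A \<in> sets kronecker \<Longrightarrow> A \<in> sets M" for A using subalgebra_kronecker by (auto simp: subalgebra_def)
  have E: "?E \<subseteq> Pow (topspace X)" by auto
  have one: "(\<integral>x. indicator (topspace X) x * u x \<partial>M) = 0"
  proof -
    have "(\<lambda>x. 1) \<in> CI 1" by (auto simp: CI_def intro: Cont_intros)
    from orth[rule_format, OF this] have "(\<integral>x. u x \<partial>M) = 0" by simp
    moreover have "(\<integral>x. indicator (topspace X) x * u x \<partial>M) = (\<integral>x. u x \<partial>M)"
      by (intro Bochner_Integration.integral_cong) (auto simp: space_M)
    ultimately show ?thesis by simp
  qed
  have "(\<integral>x. indicator A x * u x \<partial>M) = 0" if "A \<in> sigma_sets (topspace X) ?E" for A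
    using positive_Int_stable E that
  proof (induction rule: sigma_sets_induct_disjoint)
    case (basic A)
    then show ?case using orth_positive[OF u] orth by auto
  next
    case empty
    then show ?case by simp
  next
    case (compl A)
    have A: "A \<in> sets M" "A \<subseteq> topspace X"
      using compl(1) KM sets.sets_into_space[of A kronecker] by (auto simp: sets_kronecker space_kronecker)
    have "indicator (topspace X - A) x * u x = indicator (topspace X) x * u x - indicator A x * u x" for x
      using A(2) by (auto simp: indicator_def)
    then show ?case using compl(2) one iu[OF A(1)] iu[of "topspace X"] sets.top[of M] by (simp add: space_M)
  next
    case (union A)
    have A: "A i \<in> sets M" for i using union(2) KM by (auto simp: sets_kronecker)
    have "(\<lambda>n. \<integral>x. indicator (\<Union>i<n. A i) x * u x \<partial>M) \<longlonglongrightarrow> (\<integral>x. indicator (\<Union>i. A i) x * u x \<partial>M)"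
    proof (rule integral_dominated_convergence[where w = "\<lambda>x. C"])
      show "AE x in M. (\<lambda>n. indicator (\<Union>i<n. A i) x * u x) \<longlonglongrightarrow> indicator (\<Union>i. A i) x * u x"
      proof (rule AE_I2, rule tendsto_mult_right)
        fix x show "(\<lambda>n. indicator (\<Union>i<n. A i) x) \<longlonglongrightarrow> (indicator (\<Union>i. A i) x :: real)"
          by (rule LIMSEQ_indicator_UN)
      qed
      show "AE x in M. norm (indicator (\<Union>i<n. A i) x * u x) \<le> C" for n
        using u(2) by (intro AE_I2) (auto simp: indicator_def intro: order_trans[OF abs_ge_zero])
    qed (use A u(1) in \<open>auto intro!: borel_measurable_times\<close>)
    moreover have "(\<integral>x. indicator (\<Union>i<n. A i) x * u x \<partial>M) = 0" for n
    proof -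
      have "indicator (\<Union>i<n. A i) x = (\<Sum>i<n. indicator (A i) x :: real)" for x
        using union(1) by (intro indicator_UN_disjoint) (auto simp: disjoint_family_on_def)
      then have "(\<integral>x. indicator (\<Union>i<n. A i) x * u x \<partial>M) = (\<integral>x. (\<Sum>i<n. indicator (A i) x * u x) \<partial>M)"
        by (simp add: sum_distrib_right)
      also have "\<dots> = (\<Sum>i<n. \<integral>x. indicator (A i) x * u x \<partial>M)"
        using iu[OF A] by (intro Bochner_Integration.integral_sum) auto
      also have "\<dots> = 0" using union(3) by simp
      finally show ?thesis .
    qed
    ultimately show ?case by (simp add: LIMSEQ_const_iff)
  qed
  then show "AE x in M. real_cond_exp M kronecker u x = 0"
    by (intro K.real_cond_exp_charact[OF _ ui]) (auto simp: sets_kronecker set_lebesgue_integral_def)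
next
  assume ae: "AE x in M. real_cond_exp M kronecker u x = 0"
  show "\<forall>\<phi>\<in>CI 1. (\<integral>x. \<phi> x * u x \<partial>M) = 0"
  proof
    fix \<phi> assume \<phi>: "\<phi> \<in> CI 1"
    have ui: "integrable M u" by (rule integrable_bounded[of u C]) (use u in auto)
    obtain D where D: "\<And>x. x \<in> topspace X \<Longrightarrow> \<bar>\<phi> x\<bar> \<le> D" using Cont_bounded[OF CI_Cont[OF \<phi>]] by metis
    have i: "integrable M (\<lambda>x. \<phi> x * u x)"
    proof (rule integrable_bounded[of _ "D * C"])
      show "(\<lambda>x. \<phi> x * u x) \<in> borel_measurable M"
        using Cont_measurable[OF CI_Cont[OF \<phi>]] u(1) by (rule borel_measurable_times)
      show "norm (\<phi> x * u x) \<le> D * C" if "x \<in> space M" for x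
        unfolding real_norm_def abs_mult
        using D[of x] u(2)[OF that] that by (intro mult_mono) (auto simp: space_M)
    qed
    have "(\<integral>x. \<phi> x * u x \<partial>M) = (\<integral>x. \<phi> x * real_cond_exp M kronecker u x \<partial>M)"
      by (rule K.real_cond_exp_intg(2)[OF i CI_kronecker_measurable[OF \<phi>] u(1), symmetric])
    also have "\<dots> = (\<integral>x. 0 \<partial>M)"
    proof (rule integral_cong_AE)
      show "AE x in M. \<phi> x * real_cond_exp M kronecker u x = 0" using ae by eventually_elim simp
    qed (use Cont_measurable[OF CI_Cont[OF \<phi>]] in auto)
    finally show "(\<integral>x. \<phi> x * u x \<partial>M) = 0" by simp
  qed
qed

end

section \<open>Equivalences for essentially bounded functions\<close>

context ergodic_nil_action
begin

text \<open>Three implications in a cycle: a vanishing seminorm gives orthogonality by almost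
  periodicity, orthogonality gives weak convergence through the characteristic functions, and weak
  convergence gives back the seminorm by Cesaro summation.\<close>

lemma seminorm_zero_iff_orth:
  assumes f: "bdd C f"
  shows "ghk_seminorm M (act b) 2 f = 0 \<longleftrightarrow> orth f"
    and "(\<forall>g\<in>Linfty M. (\<lambda>n. \<integral>x. g x * f ((act b ^^ n) x) \<partial>M) \<longlonglongrightarrow> 0) \<longleftrightarrow> orth f"
proof -
  let ?i = "ghk_seminorm M (act b) 2 f = 0"
  let ?iii = "\<forall>g\<in>Linfty M. (\<lambda>n. \<integral>x. g x * f ((act b ^^ n) x) \<partial>M) \<longlonglongrightarrow> 0"
  note seminorm = ghk_seminorm_2_eq_0_iff[OF bdd_Linfty[OF f]]
  have 1: "orth f" if ?i using seminorm that seminorm_zero_imp_orth[OF f] by blast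
  have 2: "(\<lambda>n. \<integral>x. g x * f ((act b ^^ n) x) \<partial>M) \<longlonglongrightarrow> 0" if o: "orth f" and g: "g \<in> Linfty M" for g
  proof -
    obtain D g' where g': "bdd D g'" "AE x in M. g x = g' x" using Linfty_truncate[OF g] by blast
    have "g \<in> borel_measurable M" using g by (simp add: Linfty_def)
    then have "(\<integral>x. g x * f ((act b ^^ n) x) \<partial>M) = (\<integral>x. g' x * f ((act b ^^ n) x) \<partial>M)" for n
      by (intro integral_product_cong_AE bdd_measurable[OF f] bdd_measurable[OF g'(1)] g'(2)) auto
    then show ?thesis using orth_weak_limit[OF f o g'(1)] by simp
  qed
  have 3: "?i" if ?iii using seminorm weak_limit_imp_seminorm_zero[OF f] that bdd_Linfty by blast
  show "?i \<longleftrightarrow> orth f" using 1 2 3 by blast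
  show "?iii \<longleftrightarrow> orth f" using 1 2 3 by blast
qed

lemma Linfty_bdd_cases:
  assumes f: "f \<in> Linfty M"
  obtains C F where "bdd C F" "AE x in M. f x = F x"
    "ghk_seminorm M (act b) 2 f = 0 \<longleftrightarrow> ghk_seminorm M (act b) 2 F = 0"
proof -
  obtain C F where F: "bdd C F" "AE x in M. f x = F x" using Linfty_truncate[OF f] by blast
  have fm: "f \<in> borel_measurable M" using f by (simp add: Linfty_def)
  have "corr f h = corr F h" for h by (rule corr_cong_AE[OF fm bdd_measurable[OF F(1)] F(2)])
  then have "ghk_seminorm M (act b) 2 f = 0 \<longleftrightarrow> ghk_seminorm M (act b) 2 F = 0"
    using ghk_seminorm_2_eq_0_iff[OF f] ghk_seminorm_2_eq_0_iff[OF bdd_Linfty[OF F(1)]] by simp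
  then show ?thesis by (rule that[OF F])
qed

theorem seminorm_zero_iff_weak_limit:
  assumes f: "f \<in> Linfty M"
  shows "ghk_seminorm M (act b) 2 f = 0 \<longleftrightarrow>
    (\<forall>g\<in>Linfty M. (\<lambda>n. \<integral>x. g x * f ((act b ^^ n) x) \<partial>M) \<longlonglongrightarrow> 0)"
proof -
  obtain C F where F: "bdd C F" "AE x in M. f x = F x"
    "ghk_seminorm M (act b) 2 f = 0 \<longleftrightarrow> ghk_seminorm M (act b) 2 F = 0"
    using Linfty_bdd_cases[OF f] by metis
  have fm: "f \<in> borel_measurable M" using f by (simp add: Linfty_def)
  have "(\<integral>x. g x * f ((act b ^^ n) x) \<partial>M) = (\<integral>x. g x * F ((act b ^^ n) x) \<partial>M)" if "g \<in> Linfty M" for g n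
    using that by (intro integral_product_cong_AE fm bdd_measurable[OF F(1)] F(2)) (auto simp: Linfty_def)
  then show ?thesis using F(3) seminorm_zero_iff_orth[OF F(1)] by simp
qed

theorem seminorm_zero_iff_cond_exp:
  assumes f: "f \<in> Linfty M"
  shows "ghk_seminorm M (act b) 2 f = 0 \<longleftrightarrow> (AE x in M. complex_cond_exp M kronecker f x = 0)"
proof -
  obtain C F where F: "bdd C F" "AE x in M. f x = F x"
    "ghk_seminorm M (act b) 2 f = 0 \<longleftrightarrow> ghk_seminorm M (act b) 2 F = 0"
    using Linfty_bdd_cases[OF f] by metis
  have fm: "f \<in> borel_measurable M" using f by (simp add: Linfty_def)
  have fR: "(\<lambda>x. Re (f x)) \<in> borel_measurable M" "(\<lambda>x. Im (f x)) \<in> borel_measurable M" using fm by measurable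
  note R = bdd_Re_Im[OF F(1)]
  have "AE x in M. Re (f x) = Re (F x)" "AE x in M. Im (f x) = Im (F x)" using F(2) by auto
  from K.real_cond_exp_cong[OF this(1) fR(1) R(1)] K.real_cond_exp_cong[OF this(2) fR(2) R(2)]
  have "AE x in M. complex_cond_exp M kronecker f x = complex_cond_exp M kronecker F x"
    by eventually_elim (simp add: complex_cond_exp_def)
  then have "(AE x in M. complex_cond_exp M kronecker f x = 0) \<longleftrightarrow>
      (AE x in M. real_cond_exp M kronecker (\<lambda>x. Re (F x)) x = 0 \<and> real_cond_exp M kronecker (\<lambda>x. Im (F x)) x = 0)"
    by (intro eventually_subst, eventually_elim) (simp add: complex_cond_exp_def complex_eq_iff)
  also have "\<dots> \<longleftrightarrow> orth F"
    unfolding AE_conj_iff orth_Re_Im[OF F(1)]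
    using orth_iff_cond_exp_real[OF R(1,3)] orth_iff_cond_exp_real[OF R(2,4)] by blast
  finally show ?thesis using F(3) seminorm_zero_iff_orth(1)[OF F(1)] by simp
qed

lemma hk_factor_kronecker: "is_hk_factor_1 M (act b) kronecker"
  unfolding is_hk_factor_1_def using subalgebra_kronecker kronecker_invariant seminorm_zero_iff_cond_exp by blast

text \<open>\<open>kronecker\<close> witnesses that a factor with the characterising property
  exists. The one picked by the choice operator then has this property as well, and the property
  contains the equivalence.\<close>

theorem seminorm_zero_iff_hk_factor:
  assumes "f \<in> Linfty M"
  shows "ghk_seminorm M (act b) 2 f = 0 \<longleftrightarrow> (AE x in M. complex_cond_exp M (hk_factor_1 M (act b)) f x = 0)"
proof -
  have "is_hk_factor_1 M (act b) (hk_factor_1 M (act b))"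
    unfolding hk_factor_1_def by (rule someI) (rule hk_factor_kronecker)
  then show ?thesis using assms by (simp add: is_hk_factor_1_def)
qed

end

lemma nilsystem_ergodic_nil_action:
  assumes "nilsystem s G \<tau> \<Gamma> b M T" "ergodic M T"
  obtains H N B where "ergodic_nil_action (G\<lparr>carrier := H\<rparr>) (subtopology \<tau> H) (coset_topology G \<tau> \<Gamma>)
    (\<lambda>g x. g <#\<^bsub>G\<^esub> x) M \<Gamma> N b B s"
proof -
  have nil: "lie_group G \<tau>" "lower_central G s = {\<one>\<^bsub>G\<^esub>}" "subgroup \<Gamma> G"
    "subtopology \<tau> \<Gamma> = discrete_topology \<Gamma>" "compact_space (coset_topology G \<tau> \<Gamma>)"
    "haar_projection G \<tau> \<Gamma> M" "b \<in> carrier G" "T = (\<lambda>x. b <#\<^bsub>G\<^esub> x)"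
    using assms(1) by (auto simp: nilsystem_def nilmanifold_def nilpotent_group_def)
  interpret topological_group G \<tau> by (rule lie_group_topological_group[OF nil(1)])
  interpret discrete_coset_space G \<tau> \<Gamma>
    using nil topological_group_axioms unfolding lie_group_def
    by (intro discrete_coset_space.intro coset_space.intro coset_space_axioms.intro discrete_coset_space_axioms.intro) auto
  obtain U \<psi> d r0 where "group_coordinates G \<tau> U \<psi> d r0" using lie_group_coordinates[OF nil(1)] by blast
  from nil_action_exists[OF nil(6,5) this nil(2,7)] assms(2)
  obtain H N B where "nil_action (G\<lparr>carrier := H\<rparr>) (subtopology \<tau> H) X (\<lambda>g x. g <#\<^bsub>G\<^esub> x) M \<Gamma> N b B s"
    unfolding nil(8) by blast
  then show ?thesis
    using that by (simp add: ergodic_nil_action_def ergodic_nil_action_axioms_def Hausdorff_X second_countable_X[OF second_countable])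
qed

theorem theorem3p7:
  fixes G :: "('g, 'r) monoid_scheme" and \<tau> :: "'g topology" and \<Gamma> :: "'g set" and b :: 'g
    and s :: nat and M :: "'g set measure" and T :: "'g set \<Rightarrow> 'g set"
    and f :: "'g set \<Rightarrow> complex"
  assumes "s \<ge> 1"
    and "nilsystem s G \<tau> \<Gamma> b M T"
    and "ergodic M T"
    and "f \<in> Linfty M"
  shows
    "let i = (ghk_seminorm M T 2 f = 0);
         i' = (AE x in M. complex_cond_exp M (hk_factor_1 M T) f x = 0);
         ii = (\<forall>a :: nat \<Rightarrow> nat. strict_mono a \<longrightarrow>
           (\<lambda>N. L2norm M (\<lambda>x. (\<Sum>n=1..N. f ((T ^^ a n) x)) / of_nat N)) \<longlonglongrightarrow> 0);
         iii = (\<forall>g\<in>Linfty M. (\<lambda>n. \<integral>x. g x * f ((T ^^ n) x) \<partial>M) \<longlonglongrightarrow> 0)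
     in (i \<longleftrightarrow> i') \<and> (i \<longleftrightarrow> ii) \<and> (ii \<longleftrightarrow> iii)"
proof -
  obtain H N B where "ergodic_nil_action (G\<lparr>carrier := H\<rparr>) (subtopology \<tau> H) (coset_topology G \<tau> \<Gamma>)
    (\<lambda>g x. g <#\<^bsub>G\<^esub> x) M \<Gamma> N b B s"
    by (rule nilsystem_ergodic_nil_action[OF assms(2,3)])
  then interpret ergodic_nil_action "G\<lparr>carrier := H\<rparr>" "subtopology \<tau> H" "coset_topology G \<tau> \<Gamma>"
    "\<lambda>g x. g <#\<^bsub>G\<^esub> x" M \<Gamma> N b B s .
  have T: "T = (\<lambda>x. b <#\<^bsub>G\<^esub> x)" using assms(2) by (simp add: nilsystem_def)
  show ?thesis
    unfolding Let_def T
    using seminorm_zero_iff_hk_factor[OF assms(4)] seminorm_zero_iff_weak_limit[OF assms(4)]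
      weak_limit_iff_sparse_averages[OF assms(4)] by blast
qed

end
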